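(* Let $k$ be a field and $n$ a positive integer. Let $\underline{Pent}_n$ be the set of all invertible elements $R\in \mathcal{M}_n(k)\otimes \mathcal{M}_n(k)$ that are solutions of the pentagon equation $R^{12}R^{13}R^{23}=R^{23}R^{12}$ in $\mathcal{M}_n(k)^{\otimes 3}$ and have length $l(R)=n$. Then there exists a one to one correspondence between the set of types (isomorphism classes) of $n$-dimensional Hopf algebras over $k$ and the set of orbits of the action $$GL_n(k)\times \underline{Pent}_n\to \underline{Pent}_n,\qquad (u,R)\mapsto (u\otimes u)R(u\otimes u)^{-1}.$$
   Context: All algebras (associative, unital), Hopf algebras and tensor products are over $k$. $\mathcal{M}_n(k)$ is the algebra of $n\times n$ matrices, $GL_n(k)$ its group of invertible elements. For an algebra $A$ and $R=\sum R^1\otimes R^2\in A\otimes A$, $R^{12}=\sum R^1\otimes R^2\otimes 1_A$, $R^{13}=\sum R^1\otimes 1_A\otimes R^2$, $R^{23}=\sum 1_A\otimes R^1\otimes R^2$. The length $l(R)$ of $R\neq0$ is the smallest $m$ such that $R=\sum_{i=1}^m a_i\otimes b_i$ for some $a_i,b_i\in A$. *)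

theory Defs
  imports
    "Jordan_Normal_Form.VS_Connect"
    "HOL-Library.Poly_Mapping"
    "HOL-Algebra.Group_Action"
begin

section \<open>Algebras over a field\<close>

text \<open>
  The ground field is the type \<open>'k\<close>. The locale \<open>algebra\<close> of HOL-Algebra is restricted to
  commutative algebras, so associative unital algebras get a locale of their own.
\<close>

locale k_algebra =
  fixes A :: "('k::field, 'a, 'm) module_scheme" (structure)
  assumes ring: "ring A"
    and vectorspace: "vectorspace class_ring A"
    and smult_mult_left: "\<lbrakk>x \<in> carrier A; y \<in> carrier A\<rbrakk> \<Longrightarrow> (c \<odot> x) \<otimes> y = c \<odot> (x \<otimes> y)"
    and smult_mult_right: "\<lbrakk>x \<in> carrier A; y \<in> carrier A\<rbrakk> \<Longrightarrow> x \<otimes> (c \<odot> y) = c \<odot> (x \<otimes> y)"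

definition base_alg :: "('k::field, 'k) module" where
  "base_alg = \<lparr>carrier = UNIV, mult = (*), one = 1, zero = 0, add = (+), smult = (*)\<rparr>"

definition alg_hom ::
  "('k::field, 'a, 'm) module_scheme \<Rightarrow> ('k, 'b, 'n) module_scheme \<Rightarrow> ('a \<Rightarrow> 'b) set" where
  "alg_hom A B = Ring.ring_hom A B \<inter> LinearCombinations.module_hom class_ring A B"

section \<open>Tensor products\<close>

text \<open>
  The tensor product of \<open>A\<close> and \<open>B\<close> is the quotient of the free vector space on
  \<open>carrier A \<times> carrier B\<close> (finitely supported functions) by the subspace spanned by the
  bilinearity relations. Its elements are the cosets of that subspace.
\<close>

type_synonym ('a, 'b, 'k) tens = "(('a \<times> 'b) \<Rightarrow>\<^sub>0 'k) set"

definition tensor_relators ::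
  "('k::field, 'a, 'm) module_scheme \<Rightarrow> ('k, 'b, 'n) module_scheme \<Rightarrow> (('a \<times> 'b) \<Rightarrow>\<^sub>0 'k) set"
  where
  "tensor_relators A B =
     {Poly_Mapping.single (a \<oplus>\<^bsub>A\<^esub> a', b) 1 - Poly_Mapping.single (a, b) 1
        - Poly_Mapping.single (a', b) 1 | a a' b. a \<in> carrier A \<and> a' \<in> carrier A \<and> b \<in> carrier B}
   \<union> {Poly_Mapping.single (a, b \<oplus>\<^bsub>B\<^esub> b') 1 - Poly_Mapping.single (a, b) 1
        - Poly_Mapping.single (a, b') 1 | a b b'. a \<in> carrier A \<and> b \<in> carrier B \<and> b' \<in> carrier B}
   \<union> {Poly_Mapping.single (c \<odot>\<^bsub>A\<^esub> a, b) 1 - Poly_Mapping.single (a, b) c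
        | c a b. a \<in> carrier A \<and> b \<in> carrier B}
   \<union> {Poly_Mapping.single (a, c \<odot>\<^bsub>B\<^esub> b) 1 - Poly_Mapping.single (a, b) c
        | c a b. a \<in> carrier A \<and> b \<in> carrier B}"

definition tensor_class ::
  "('k::field, 'a, 'm) module_scheme \<Rightarrow> ('k, 'b, 'n) module_scheme \<Rightarrow> (('a \<times> 'b) \<Rightarrow>\<^sub>0 'k)
     \<Rightarrow> ('a, 'b, 'k) tens" where
  "tensor_class A B p =
     {q. q - p \<in> Modules.module.span (\<lambda>c. Poly_Mapping.map ((*) c)) (tensor_relators A B)}"

definition tensor_rep :: "('a, 'b, 'k::zero) tens \<Rightarrow> ('a \<times> 'b) \<Rightarrow>\<^sub>0 'k" where
  "tensor_rep S = (SOME p. p \<in> S)"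

definition pure_tensor ::
  "('k::field, 'a, 'm) module_scheme \<Rightarrow> ('k, 'b, 'n) module_scheme \<Rightarrow> 'a \<Rightarrow> 'b \<Rightarrow> ('a, 'b, 'k) tens"
  where
  "pure_tensor A B a b = tensor_class A B (Poly_Mapping.single (a, b) 1)"

text \<open>
  For algebras \<open>A\<close> and \<open>B\<close> the product is the one with
  \<open>(a \<otimes> b) (a' \<otimes> b') = a a' \<otimes> b b'\<close>. For mere vector spaces \<open>mult\<close> and \<open>one\<close> carry no meaning.
\<close>

definition tensor ::
  "('k::field, 'a, 'm) module_scheme \<Rightarrow> ('k, 'b, 'n) module_scheme
     \<Rightarrow> ('k, ('a, 'b, 'k) tens) module" where
  "tensor A B = \<lparr>
     carrier = tensor_class A B ` {p. Poly_Mapping.keys p \<subseteq> carrier A \<times> carrier B},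
     mult = (\<lambda>S T. tensor_class A B
       (\<Sum>(a, b) \<in> Poly_Mapping.keys (tensor_rep S). \<Sum>(a', b') \<in> Poly_Mapping.keys (tensor_rep T).
          Poly_Mapping.single (a \<otimes>\<^bsub>A\<^esub> a', b \<otimes>\<^bsub>B\<^esub> b')
            (Poly_Mapping.lookup (tensor_rep S) (a, b) * Poly_Mapping.lookup (tensor_rep T) (a', b')))),
     one = pure_tensor A B \<one>\<^bsub>A\<^esub> \<one>\<^bsub>B\<^esub>,
     zero = tensor_class A B 0,
     add = (\<lambda>S T. tensor_class A B (tensor_rep S + tensor_rep T)),
     smult = (\<lambda>c S. tensor_class A B (Poly_Mapping.map ((*) c) (tensor_rep S)))\<rparr>"

text \<open>
  The linear map out of a tensor product induced by a bilinear map \<open>f\<close> into \<open>C\<close>, that is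
  \<open>\<Sum> a \<otimes> b \<mapsto> \<Sum> f a b\<close>.
\<close>

definition tensor_lift ::
  "('k::field, 'c, 'm) module_scheme \<Rightarrow> ('a \<Rightarrow> 'b \<Rightarrow> 'c) \<Rightarrow> ('a, 'b, 'k) tens \<Rightarrow> 'c" where
  "tensor_lift C f S = (\<Oplus>\<^bsub>C\<^esub>x \<in> Poly_Mapping.keys (tensor_rep S).
     Poly_Mapping.lookup (tensor_rep S) x \<odot>\<^bsub>C\<^esub> f (fst x) (snd x))"

definition tensor_map ::
  "('k::field, 'a', 'm) module_scheme \<Rightarrow> ('k, 'b', 'n) module_scheme \<Rightarrow> ('a \<Rightarrow> 'a') \<Rightarrow> ('b \<Rightarrow> 'b')
     \<Rightarrow> ('a, 'b, 'k) tens \<Rightarrow> ('a', 'b', 'k) tens" where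
  "tensor_map A' B' f g = tensor_lift (tensor A' B') (\<lambda>a b. pure_tensor A' B' (f a) (g b))"

text \<open>Triple tensor products are bracketed to the left: \<open>(A \<otimes> B) \<otimes> C\<close>.\<close>

definition pure_tensor3 ::
  "('k::field, 'a, 'm) module_scheme \<Rightarrow> ('k, 'b, 'n) module_scheme \<Rightarrow> ('k, 'c, 'l) module_scheme
     \<Rightarrow> 'a \<Rightarrow> 'b \<Rightarrow> 'c \<Rightarrow> (('a, 'b, 'k) tens, 'c, 'k) tens" where
  "pure_tensor3 A B C a b c = pure_tensor (tensor A B) C (pure_tensor A B a b) c"

text \<open>The associator \<open>A \<otimes> (B \<otimes> C) \<rightarrow> (A \<otimes> B) \<otimes> C\<close>.\<close>

definition tensor_assoc ::
  "('k::field, 'a, 'm) module_scheme \<Rightarrow> ('k, 'b, 'n) module_scheme \<Rightarrow> ('k, 'c, 'l) module_scheme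
     \<Rightarrow> ('a, ('b, 'c, 'k) tens, 'k) tens \<Rightarrow> (('a, 'b, 'k) tens, 'c, 'k) tens" where
  "tensor_assoc A B C = tensor_lift (tensor (tensor A B) C)
     (\<lambda>a. tensor_lift (tensor (tensor A B) C) (\<lambda>b c. pure_tensor3 A B C a b c))"

section \<open>Hopf algebras\<close>

record (overloaded) ('k, 'h) hopf = "('k, 'h) module" +
  comult :: "'h \<Rightarrow> ('h, 'h, 'k) tens"
  counit :: "'h \<Rightarrow> 'k"

locale bialgebra =
  fixes H :: "('k::field, 'h) hopf" (structure)
  assumes k_algebra: "k_algebra H"
    and comult_hom: "comult H \<in> alg_hom H (tensor H H)"
    and counit_hom: "counit H \<in> alg_hom H base_alg"
    and coassoc: "h \<in> carrier H \<Longrightarrow>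
      tensor_map (tensor H H) H (comult H) id (comult H h)
      = tensor_assoc H H H (tensor_map H (tensor H H) id (comult H) (comult H h))"
    and counit_left: "h \<in> carrier H \<Longrightarrow> tensor_lift H (\<lambda>a b. counit H a \<odot> b) (comult H h) = h"
    and counit_right: "h \<in> carrier H \<Longrightarrow> tensor_lift H (\<lambda>a b. counit H b \<odot> a) (comult H h) = h"

text \<open>
  An antipode is unique if it exists and is preserved by bialgebra morphisms, so it is not part
  of the record.
\<close>

definition is_antipode :: "('k::field, 'h) hopf \<Rightarrow> ('h \<Rightarrow> 'h) \<Rightarrow> bool" where
  "is_antipode H S \<longleftrightarrow> S \<in> LinearCombinations.module_hom class_ring H H \<and>
     (\<forall>h \<in> carrier H.
        tensor_lift H (\<lambda>a b. S a \<otimes>\<^bsub>H\<^esub> b) (comult H h) = counit H h \<odot>\<^bsub>H\<^esub> \<one>\<^bsub>H\<^esub> \<and>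
        tensor_lift H (\<lambda>a b. a \<otimes>\<^bsub>H\<^esub> S b) (comult H h) = counit H h \<odot>\<^bsub>H\<^esub> \<one>\<^bsub>H\<^esub>)"

locale hopf_algebra = bialgebra +
  assumes antipode: "\<exists>S. is_antipode H S"

definition hopf_iso :: "('k::field, 'h) hopf \<Rightarrow> ('k, 'l) hopf \<Rightarrow> ('h \<Rightarrow> 'l) set" where
  "hopf_iso H L = {f. f \<in> alg_hom H L \<and> bij_betw f (carrier H) (carrier L) \<and>
     (\<forall>h \<in> carrier H. comult L (f h) = tensor_map L L f f (comult H h) \<and>
                       counit L (f h) = counit H h)}"

text \<open>
  HOL has no set of all Hopf algebras, so these are the Hopf algebras whose carrier is a subset of
  the type \<open>'h\<close>. As soon as \<open>k\<^sup>n\<close> injects into \<open>'h\<close>, every isomorphism class of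
  \<open>n\<close>-dimensional Hopf algebras has a representative there.
\<close>

definition hopf_algs :: "nat \<Rightarrow> ('k::field, 'h) hopf set" where
  "hopf_algs n = {H. hopf_algebra H \<and>
     vectorspace.fin_dim class_ring H \<and> vectorspace.dim class_ring H = n}"

definition hopf_types :: "nat \<Rightarrow> ('k::field, 'h) hopf set set" where
  "hopf_types n =
     hopf_algs n // {(H, L). H \<in> hopf_algs n \<and> L \<in> hopf_algs n \<and> hopf_iso H L \<noteq> {}}"

section \<open>The pentagon equation\<close>

definition leg12 :: "('k::field, 'a, 'm) module_scheme \<Rightarrow> ('a, 'a, 'k) tens
    \<Rightarrow> (('a, 'a, 'k) tens, 'a, 'k) tens" where
  "leg12 A = tensor_lift (tensor (tensor A A) A) (\<lambda>x y. pure_tensor3 A A A x y \<one>\<^bsub>A\<^esub>)"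

definition leg13 :: "('k::field, 'a, 'm) module_scheme \<Rightarrow> ('a, 'a, 'k) tens
    \<Rightarrow> (('a, 'a, 'k) tens, 'a, 'k) tens" where
  "leg13 A = tensor_lift (tensor (tensor A A) A) (\<lambda>x y. pure_tensor3 A A A x \<one>\<^bsub>A\<^esub> y)"

definition leg23 :: "('k::field, 'a, 'm) module_scheme \<Rightarrow> ('a, 'a, 'k) tens
    \<Rightarrow> (('a, 'a, 'k) tens, 'a, 'k) tens" where
  "leg23 A = tensor_lift (tensor (tensor A A) A) (\<lambda>x y. pure_tensor3 A A A \<one>\<^bsub>A\<^esub> x y)"

definition pentagon :: "('k::field, 'a, 'm) module_scheme \<Rightarrow> ('a, 'a, 'k) tens \<Rightarrow> bool" where
  "pentagon A R \<longleftrightarrow>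
     leg12 A R \<otimes>\<^bsub>tensor (tensor A A) A\<^esub> leg13 A R \<otimes>\<^bsub>tensor (tensor A A) A\<^esub> leg23 A R
     = leg23 A R \<otimes>\<^bsub>tensor (tensor A A) A\<^esub> leg12 A R"

definition tensor_length :: "('k::field, 'a, 'm) module_scheme \<Rightarrow> ('a, 'a, 'k) tens \<Rightarrow> nat" where
  "tensor_length A R = (LEAST m. \<exists>a b. (\<forall>i<m. a i \<in> carrier A \<and> b i \<in> carrier A) \<and>
     R = (\<Oplus>\<^bsub>tensor A A\<^esub>i \<in> {..<m}. pure_tensor A A (a i) (b i)))"

abbreviation mat_alg :: "nat \<Rightarrow> ('k::field, 'k mat) module" where
  "mat_alg n \<equiv> module_mat TYPE('k) n n"

abbreviation GL :: "nat \<Rightarrow> 'k::field mat monoid" where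
  "GL n \<equiv> units_of (mat_alg n)"

definition Pent :: "nat \<Rightarrow> ('k::field mat, 'k mat, 'k) tens set" where
  "Pent n = {R \<in> Units (tensor (mat_alg n) (mat_alg n)).
     pentagon (mat_alg n) R \<and> tensor_length (mat_alg n) R = n}"

text \<open>
  Actions in HOL-Algebra are homomorphisms into \<open>BijGroup\<close>, whose elements are extensional
  functions; hence the restriction to \<open>Pent n\<close>.
\<close>

definition conj_action ::
  "nat \<Rightarrow> 'k::field mat \<Rightarrow> ('k mat, 'k mat, 'k) tens \<Rightarrow> ('k mat, 'k mat, 'k) tens" where
  "conj_action n u = (\<lambda>R \<in> Pent n.
     (let T = tensor (mat_alg n) (mat_alg n); uu = pure_tensor (mat_alg n) (mat_alg n) u u
      in uu \<otimes>\<^bsub>T\<^esub> R \<otimes>\<^bsub>T\<^esub> inv\<^bsub>T\<^esub> uu))"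

end

theory Submission
  imports Defs "HOL-Library.Function_Algebras"
begin

text \<open>
Everything rests on a dictionary between bases of a Hopf algebra \<open>H\<close> of dimension \<open>n\<close> and
expressions of a solution \<open>R\<close> as a sum of \<open>n\<close> pure tensors. A basis \<open>e\<close> gives structure constants
\<open>e\<^sub>i e\<^sub>j = \<Sum> m\<^sub>i\<^sub>j\<^sub>k e\<^sub>k\<close> and \<open>\<Delta> e\<^sub>k = \<Sum> d\<^sub>k\<^sub>i\<^sub>j e\<^sub>i \<otimes> e\<^sub>j\<close>. A solution \<open>R\<close> is said to realize constants
\<open>m, d\<close> if \<open>R = \<Sum> a\<^sub>i \<otimes> b\<^sub>i\<close> with two independent families such that the \<open>b\<^sub>i\<close> multiply by \<open>m\<close>, like the
basis of \<open>H\<close>, and the \<open>a\<^sub>i\<close> multiply by \<open>d\<close>, like the dual basis of \<open>H\<^sup>*\<close>.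

From \<open>H\<close> to \<open>R\<close>: let \<open>b\<^sub>i\<close> be left multiplication by \<open>e\<^sub>i\<close> on \<open>H\<close> and \<open>a\<^sub>i\<close> the operator
\<open>h \<mapsto> \<Sum> h\<^sub>1 \<langle>e\<^sub>i\<^sup>*, h\<^sub>2\<rangle>\<close>. Then \<open>R\<close> is \<open>x \<otimes> y \<mapsto> \<Sum> x\<^sub>1 \<otimes> x\<^sub>2 y\<close>; the pentagon equation says that
\<open>R (h \<otimes> 1) = \<Delta>(h) R\<close>, and the antipode supplies the inverse (\<open>regular_realization\<close>).

From \<open>R\<close> to \<open>H\<close>: length \<open>n\<close> means that both families of legs are independent. The pentagon equation
reads \<open>R\<^sup>1\<^sup>2 R\<^sup>1\<^sup>3 = R\<^sup>2\<^sup>3 R\<^sup>1\<^sup>2 (R\<^sup>2\<^sup>3)\<^sup>-\<^sup>1\<close> and also \<open>R\<^sup>1\<^sup>3 R\<^sup>2\<^sup>3 = (R\<^sup>1\<^sup>2)\<^sup>-\<^sup>1 R\<^sup>2\<^sup>3 R\<^sup>1\<^sup>2\<close>. Comparing matrix entries in one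
leg shows that the span of the \<open>a\<^sub>i\<close> and the span of the \<open>b\<^sub>i\<close> are closed under multiplication, and that
\<open>b \<mapsto> R (b \<otimes> 1) R\<^sup>-\<^sup>1\<close> is a comultiplication with the constants \<open>d\<close> (\<open>realizes_exists\<close>, \<open>comult_b\<close>). Since
the inverse of a matrix is a polynomial in it, the span of the \<open>a\<^sub>i \<otimes> b\<^sub>j\<close> contains \<open>1\<close> and \<open>R\<^sup>-\<^sup>1\<close>
(\<open>inverse_in_subalgebra\<close>); this yields unit, counit and antipode (\<open>hopf_constants_exist\<close>).

The crux is that a solution that realizes \<open>m, d\<close> is conjugate to the one built from \<open>m, d\<close>
(\<open>conjugate_to_regular\<close>). Through the \<open>b\<^sub>i\<close> and the \<open>a\<^sub>i\<close> the space \<open>k\<^sup>n\<close> is a Hopf module over \<open>H\<close>, and by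
the fundamental theorem of Hopf modules it is \<open>H\<close> tensored with its coinvariants, which then form a line.
A nonzero coinvariant vector \<open>v\<close> gives the matrix \<open>u\<close> with columns \<open>b\<^sub>k v\<close> that conjugates one solution
into the other.

A change of basis of \<open>H\<close> corresponds to a change of the families \<open>a, b\<close> that leaves \<open>R\<close> fixed
(\<open>basechange_realization\<close>, \<open>two_realizations\<close>). So call \<open>R\<close> an encoding of \<open>H\<close> if it realizes the
constants of \<open>H\<close> for some basis. Two algebras with a common encoding are isomorphic and two encodings of
one algebra are conjugate, which is exactly what \<open>quotient_correspondence\<close> turns into a bijection between
classes and orbits.

Tensor products are handled through coordinates: bases of the factors give a basis of the product, and
elements of \<open>M\<^sub>n(k) \<otimes> M\<^sub>n(k)\<close> become matrices with rows and columns indexed by pairs.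
\<close>

section \<open>Vector spaces with coordinates\<close>

text \<open>
The assumptions are about the operations alone, so that they can be verified for a tensor product
before it is known to be a vector space; that it is one follows.
\<close>

locale coordinates =
  fixes A :: "('k::field, 'a, 'm) module_scheme" (structure)
    and I :: "'i set" and e :: "'i \<Rightarrow> 'a" and \<kappa> :: "'a \<Rightarrow> 'i \<Rightarrow> 'k"
  assumes finite_index: "finite I"
    and zero_in: "\<zero> \<in> carrier A"
    and add_in: "\<lbrakk>x \<in> carrier A; y \<in> carrier A\<rbrakk> \<Longrightarrow> x \<oplus> y \<in> carrier A"
    and smult_in: "x \<in> carrier A \<Longrightarrow> c \<odot> x \<in> carrier A"
    and basis_in: "i \<in> I \<Longrightarrow> e i \<in> carrier A"
    and coord_zero: "i \<in> I \<Longrightarrow> \<kappa> \<zero> i = 0"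
    and coord_add: "\<lbrakk>x \<in> carrier A; y \<in> carrier A; i \<in> I\<rbrakk> \<Longrightarrow> \<kappa> (x \<oplus> y) i = \<kappa> x i + \<kappa> y i"
    and coord_smult: "\<lbrakk>x \<in> carrier A; i \<in> I\<rbrakk> \<Longrightarrow> \<kappa> (c \<odot> x) i = c * \<kappa> x i"
    and coord_basis: "\<lbrakk>i \<in> I; j \<in> I\<rbrakk> \<Longrightarrow> \<kappa> (e i) j = (if i = j then 1 else 0)"
    and coord_eqI: "\<lbrakk>x \<in> carrier A; y \<in> carrier A; \<And>i. i \<in> I \<Longrightarrow> \<kappa> x i = \<kappa> y i\<rbrakk> \<Longrightarrow> x = y"
begin

lemma abelian_group: "abelian_group A"
proof (rule abelian_groupI)
  fix x assume x: "x \<in> carrier A"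
  show "\<exists>y\<in>carrier A. y \<oplus> x = \<zero>"
  proof (rule bexI)
    show "(- 1) \<odot> x \<oplus> x = \<zero>"
      by (rule coord_eqI) (use x in \<open>auto simp: coord_add coord_smult coord_zero zero_in add_in smult_in\<close>)
  qed (use x in \<open>auto simp: smult_in\<close>)
qed (auto intro!: coord_eqI simp: coord_add coord_zero zero_in add_in algebra_simps)

lemma vectorspace: "vectorspace class_ring A"
proof -
  interpret abelian_group A by (rule abelian_group)
  have "field (class_ring :: 'k ring)" by (rule class_field)
  then interpret K: field "class_ring :: 'k ring" .
  show ?thesis
    by unfold_locales
      (auto intro!: coord_eqI simp: class_ring_simps coord_add coord_smult smult_in add_in algebra_simps)
qed

lemma coord_finsum:
  assumes "finite F" "\<And>x. x \<in> F \<Longrightarrow> f x \<in> carrier A" "i \<in> I"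
  shows "\<kappa> (\<Oplus>x\<in>F. f x) i = (\<Sum>x\<in>F. \<kappa> (f x) i)"
proof -
  interpret abelian_group A by (rule abelian_group)
  show ?thesis using assms
    by (induction F rule: finite_induct) (auto simp: coord_zero coord_add Pi_def)
qed

lemma finsum_in: "(\<And>x. x \<in> F \<Longrightarrow> f x \<in> carrier A) \<Longrightarrow> (\<Oplus>x\<in>F. f x) \<in> carrier A"
proof -
  interpret abelian_group A by (rule abelian_group)
  show "(\<And>x. x \<in> F \<Longrightarrow> f x \<in> carrier A) \<Longrightarrow> ?thesis" by (auto intro: finsum_closed)
qed

lemma expansion:
  assumes "x \<in> carrier A"
  shows "x = (\<Oplus>i\<in>I. \<kappa> x i \<odot> e i)"
  by (rule coord_eqI)
    (use assms in \<open>auto simp: coord_finsum finite_index smult_in basis_in coord_smult coord_basis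
       finsum_in if_distrib cong: if_cong\<close>)

lemma exists_coords: "\<exists>x\<in>carrier A. \<forall>i\<in>I. \<kappa> x i = c i"
  by (rule bexI[of _ "\<Oplus>i\<in>I. c i \<odot> e i"])
     (auto simp: coord_finsum finite_index smult_in basis_in coord_smult coord_basis
       finsum_in if_distrib cong: if_cong)

lemma sum_coord_add:
  "\<lbrakk>x \<in> carrier A; y \<in> carrier A\<rbrakk> \<Longrightarrow>
    (\<Sum>i\<in>I. \<kappa> (x \<oplus> y) i * h i) = (\<Sum>i\<in>I. \<kappa> x i * h i) + (\<Sum>i\<in>I. \<kappa> y i * h i)"
  unfolding sum.distrib[symmetric] by (rule sum.cong) (auto simp: coord_add distrib_right)

lemma sum_coord_smult:
  "x \<in> carrier A \<Longrightarrow> (\<Sum>i\<in>I. \<kappa> (c \<odot> x) i * h i) = c * (\<Sum>i\<in>I. \<kappa> x i * h i)"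
  unfolding sum_distrib_left by (rule sum.cong) (auto simp: coord_smult mult.assoc)

end

section \<open>Coordinates on tensor products\<close>

lemma lookup_scale [simp]:
  "Poly_Mapping.lookup (Poly_Mapping.map ((*) (c::'k::field)) p) x = c * Poly_Mapping.lookup p x"
  by (simp add: map.rep_eq when_def)

interpretation poly_mapping_module:
  Modules.module "\<lambda>c p. Poly_Mapping.map ((*) (c::'k::field)) (p :: 'x \<Rightarrow>\<^sub>0 'k)"
  by unfold_locales
    (auto intro!: poly_mapping_eqI simp: lookup_add algebra_simps)

definition bilinear_into ::
  "('k::field, 'a, 'm) module_scheme \<Rightarrow> ('k, 'b, 'n) module_scheme \<Rightarrow> ('k, 'c, 'l) module_scheme
     \<Rightarrow> ('a \<Rightarrow> 'b \<Rightarrow> 'c) \<Rightarrow> bool" where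
  "bilinear_into A B C f \<longleftrightarrow>
     (\<forall>a\<in>carrier A. \<forall>b\<in>carrier B. f a b \<in> carrier C) \<and>
     (\<forall>a\<in>carrier A. \<forall>a'\<in>carrier A. \<forall>b\<in>carrier B. f (a \<oplus>\<^bsub>A\<^esub> a') b = f a b \<oplus>\<^bsub>C\<^esub> f a' b) \<and>
     (\<forall>a\<in>carrier A. \<forall>b\<in>carrier B. \<forall>b'\<in>carrier B. f a (b \<oplus>\<^bsub>B\<^esub> b') = f a b \<oplus>\<^bsub>C\<^esub> f a b') \<and>
     (\<forall>c. \<forall>a\<in>carrier A. \<forall>b\<in>carrier B. f (c \<odot>\<^bsub>A\<^esub> a) b = c \<odot>\<^bsub>C\<^esub> f a b) \<and>
     (\<forall>c. \<forall>a\<in>carrier A. \<forall>b\<in>carrier B. f a (c \<odot>\<^bsub>B\<^esub> b) = c \<odot>\<^bsub>C\<^esub> f a b)"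

lemma bilinear_intoD:
  assumes "bilinear_into A B C f"
  shows "\<And>a b. \<lbrakk>a \<in> carrier A; b \<in> carrier B\<rbrakk> \<Longrightarrow> f a b \<in> carrier C"
    "\<And>a a' b. \<lbrakk>a \<in> carrier A; a' \<in> carrier A; b \<in> carrier B\<rbrakk> \<Longrightarrow> f (a \<oplus>\<^bsub>A\<^esub> a') b = f a b \<oplus>\<^bsub>C\<^esub> f a' b"
    "\<And>a b b'. \<lbrakk>a \<in> carrier A; b \<in> carrier B; b' \<in> carrier B\<rbrakk> \<Longrightarrow> f a (b \<oplus>\<^bsub>B\<^esub> b') = f a b \<oplus>\<^bsub>C\<^esub> f a b'"
    "\<And>c a b. \<lbrakk>a \<in> carrier A; b \<in> carrier B\<rbrakk> \<Longrightarrow> f (c \<odot>\<^bsub>A\<^esub> a) b = c \<odot>\<^bsub>C\<^esub> f a b"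
    "\<And>c a b. \<lbrakk>a \<in> carrier A; b \<in> carrier B\<rbrakk> \<Longrightarrow> f a (c \<odot>\<^bsub>B\<^esub> b) = c \<odot>\<^bsub>C\<^esub> f a b"
  using assms unfolding bilinear_into_def by blast+

abbreviation bilinear_form where "bilinear_form A B g \<equiv> bilinear_into A B base_alg g"

text \<open>
A bilinear form on the factors is the same as a linear form on formal sums that kills the relators.
Coordinates of a tensor are obtained by evaluating such forms on a representative.
\<close>

definition extend_linearly :: "('x \<Rightarrow> 'k::field) \<Rightarrow> ('x \<Rightarrow>\<^sub>0 'k) \<Rightarrow> 'k" where
  "extend_linearly g p = (\<Sum>x\<in>Poly_Mapping.keys p. Poly_Mapping.lookup p x * g x)"

lemma extend_linearly_superset:
  "finite F \<Longrightarrow> Poly_Mapping.keys p \<subseteq> F \<Longrightarrow> extend_linearly g p = (\<Sum>x\<in>F. Poly_Mapping.lookup p x * g x)"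
  unfolding extend_linearly_def
  by (rule sum.mono_neutral_left) (auto simp: in_keys_iff)

lemma extend_linearly_add:
  "extend_linearly g (p + q) = extend_linearly g p + extend_linearly g q"
proof -
  let ?F = "Poly_Mapping.keys p \<union> Poly_Mapping.keys q"
  have "Poly_Mapping.keys (p + q) \<subseteq> ?F" by (rule keys_add)
  then show ?thesis
    by (simp add: extend_linearly_superset[of ?F] lookup_add algebra_simps sum.distrib)
qed

lemma keys_minus_subset:
  "Poly_Mapping.keys (p - q) \<subseteq> Poly_Mapping.keys p \<union> Poly_Mapping.keys (q :: _ \<Rightarrow>\<^sub>0 'k::field)"
  by (auto simp: in_keys_iff lookup_minus)

lemma extend_linearly_diff:
  "extend_linearly g (p - q) = extend_linearly g p - extend_linearly g q"
  using extend_linearly_add[of g "p - q" q] by simp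

lemma extend_linearly_scale:
  "extend_linearly g (Poly_Mapping.map ((*) c) p) = c * extend_linearly g p"
proof -
  have "Poly_Mapping.keys (Poly_Mapping.map ((*) c) p) \<subseteq> Poly_Mapping.keys p"
    by (auto simp: in_keys_iff)
  then show ?thesis
    by (simp add: extend_linearly_superset[of "Poly_Mapping.keys p"] sum_distrib_left mult.assoc)
qed

lemma extend_linearly_zero [simp]: "extend_linearly g 0 = 0"
  by (simp add: extend_linearly_def)

lemma extend_linearly_single [simp]: "extend_linearly g (Poly_Mapping.single x c) = c * g x"
  by (cases "c = 0") (simp_all add: extend_linearly_def)

lemma extend_linearly_sum:
  "extend_linearly g (\<Sum>i\<in>F. p i) = (\<Sum>i\<in>F. extend_linearly g (p i))"
  by (induction F rule: infinite_finite_induct) (simp_all add: extend_linearly_add)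

abbreviation relator_span ::
  "('k::field, 'a, 'm) module_scheme \<Rightarrow> ('k, 'b, 'n) module_scheme \<Rightarrow> (('a \<times> 'b) \<Rightarrow>\<^sub>0 'k) set" where
  "relator_span A B \<equiv>
     Modules.module.span (\<lambda>c. Poly_Mapping.map ((*) c)) (tensor_relators A B)"

lemma bilinear_form_kills_relators:
  assumes "bilinear_form A B g" "r \<in> relator_span A B"
  shows "extend_linearly (\<lambda>(a, b). g a b) r = 0"
  using assms(2)
proof (induction rule: poly_mapping_module.span_induct_alt)
  case base show ?case by simp
next
  case (step c x y)
  have "extend_linearly (\<lambda>(a, b). g a b) x = 0"
    using step(1) assms(1)
    by (auto simp: tensor_relators_def bilinear_into_def base_alg_def extend_linearly_diff)
  then show ?case using step by (simp add: extend_linearly_add extend_linearly_scale)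
qed

lemma mem_tensor_class: "p \<in> tensor_class A B p"
  by (simp add: tensor_class_def poly_mapping_module.span_zero)

lemma tensor_class_eq_iff: "tensor_class A B p = tensor_class A B q \<longleftrightarrow> p - q \<in> relator_span A B"
proof
  assume "tensor_class A B p = tensor_class A B q"
  then have "p \<in> tensor_class A B q" using mem_tensor_class by blast
  then show "p - q \<in> relator_span A B" by (simp add: tensor_class_def)
next
  assume *: "p - q \<in> relator_span A B"
  have "r - q \<in> relator_span A B \<longleftrightarrow> r - p \<in> relator_span A B" for r
  proof -
    have "(r - q) - (p - q) = r - p" "(r - p) + (p - q) = r - q" by simp_all
    then show ?thesis
      using poly_mapping_module.span_diff[OF _ *, of "r - q"]
        poly_mapping_module.span_add[OF _ *, of "r - p"] by metis
  qed
  then show "tensor_class A B p = tensor_class A B q" by (simp add: tensor_class_def)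
qed

locale two_coordinates = A: coordinates A I e \<kappa> + B: coordinates B J f \<mu>
  for A :: "('k::field, 'a, 'm) module_scheme" and I :: "'i set" and e \<kappa>
    and B :: "('k, 'b, 'n) module_scheme" and J :: "'j set" and f \<mu>
begin

abbreviation "formal \<equiv> {p :: ('a \<times> 'b) \<Rightarrow>\<^sub>0 'k. Poly_Mapping.keys p \<subseteq> carrier A \<times> carrier B}"

abbreviation T where "T \<equiv> tensor A B"

definition tcoord :: "('a, 'b, 'k) tens \<Rightarrow> 'i \<times> 'j \<Rightarrow> 'k" where
  "tcoord S ij = extend_linearly (\<lambda>(a, b). \<kappa> a (fst ij) * \<mu> b (snd ij)) (tensor_rep S)"

definition tbasis :: "'i \<times> 'j \<Rightarrow> ('a, 'b, 'k) tens" where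
  "tbasis ij = pure_tensor A B (e (fst ij)) (f (snd ij))"

lemma coord_product_bilinear:
  "i \<in> I \<Longrightarrow> j \<in> J \<Longrightarrow> bilinear_form A B (\<lambda>a b. \<kappa> a i * \<mu> b j)"
  by (auto simp: bilinear_into_def base_alg_def A.coord_add B.coord_add A.coord_smult B.coord_smult
      algebra_simps)

lemma relator_span_formal: "r \<in> relator_span A B \<Longrightarrow> r \<in> formal"
proof (induction rule: poly_mapping_module.span_induct_alt)
  case base show ?case by simp
next
  case (step c x y)
  have x: "x \<in> formal"
    using step(1) unfolding tensor_relators_def
    by (auto dest!: subsetD[OF keys_minus_subset] split: if_splits
        simp: A.add_in B.add_in A.smult_in B.smult_in)
  have "Poly_Mapping.keys (Poly_Mapping.map ((*) c) x) \<subseteq> Poly_Mapping.keys x"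
    by (auto simp: in_keys_iff)
  then show ?case using x step(2) keys_add[of "Poly_Mapping.map ((*) c) x" y] by blast
qed

lemma single_add_left:
  "\<lbrakk>a \<in> carrier A; a' \<in> carrier A; b \<in> carrier B\<rbrakk> \<Longrightarrow>
    Poly_Mapping.single (a \<oplus>\<^bsub>A\<^esub> a', b) 1 - (Poly_Mapping.single (a, b) 1 + Poly_Mapping.single (a', b) 1)
    \<in> relator_span A B"
  by (subst diff_diff_eq[symmetric], rule poly_mapping_module.span_base)
    (unfold tensor_relators_def, blast)

lemma single_add_right:
  "\<lbrakk>a \<in> carrier A; b \<in> carrier B; b' \<in> carrier B\<rbrakk> \<Longrightarrow>
    Poly_Mapping.single (a, b \<oplus>\<^bsub>B\<^esub> b') 1 - (Poly_Mapping.single (a, b) 1 + Poly_Mapping.single (a, b') 1)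
    \<in> relator_span A B"
  by (subst diff_diff_eq[symmetric], rule poly_mapping_module.span_base)
    (unfold tensor_relators_def, blast)

lemma single_smult_left:
  "\<lbrakk>a \<in> carrier A; b \<in> carrier B\<rbrakk> \<Longrightarrow>
    Poly_Mapping.single (c \<odot>\<^bsub>A\<^esub> a, b) 1 - Poly_Mapping.single (a, b) c \<in> relator_span A B"
  by (rule poly_mapping_module.span_base) (unfold tensor_relators_def, blast)

lemma single_smult_right:
  "\<lbrakk>a \<in> carrier A; b \<in> carrier B\<rbrakk> \<Longrightarrow>
    Poly_Mapping.single (a, c \<odot>\<^bsub>B\<^esub> b) 1 - Poly_Mapping.single (a, b) c \<in> relator_span A B"
  by (rule poly_mapping_module.span_base) (unfold tensor_relators_def, blast)

lemma single_zero_left: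
  assumes "b \<in> carrier B"
  shows "Poly_Mapping.single (\<zero>\<^bsub>A\<^esub>, b) 1 \<in> relator_span A B"
proof -
  interpret vectorspace class_ring A by (rule A.vectorspace)
  have "0 \<odot>\<^bsub>A\<^esub> \<zero>\<^bsub>A\<^esub> = \<zero>\<^bsub>A\<^esub>"
    by (rule A.coord_eqI) (auto simp: A.zero_in A.smult_in A.coord_zero A.coord_smult)
  then show ?thesis using single_smult_left[OF A.zero_in assms, of 0] by simp
qed

lemma single_zero_right:
  assumes "a \<in> carrier A"
  shows "Poly_Mapping.single (a, \<zero>\<^bsub>B\<^esub>) 1 \<in> relator_span A B"
proof -
  have "0 \<odot>\<^bsub>B\<^esub> \<zero>\<^bsub>B\<^esub> = \<zero>\<^bsub>B\<^esub>"
    by (rule B.coord_eqI) (auto simp: B.zero_in B.smult_in B.coord_zero B.coord_smult)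
  then show ?thesis using single_smult_right[OF assms B.zero_in, of 0] by simp
qed

lemma span_trans_diff:
  "\<lbrakk>p - q \<in> relator_span A B; q - r \<in> relator_span A B\<rbrakk> \<Longrightarrow> p - r \<in> relator_span A B"
  using poly_mapping_module.span_add[of "p - q" _ "q - r"] by simp

lemma span_add_diff:
  "\<lbrakk>p - q \<in> relator_span A B; p' - q' \<in> relator_span A B\<rbrakk> \<Longrightarrow>
    (p + p') - (q + q') \<in> relator_span A B"
  using poly_mapping_module.span_add[of "p - q" _ "p' - q'"] by (simp add: algebra_simps)

lemma expand_left:
  assumes "finite F" "F \<subseteq> I" "b \<in> carrier B"
  shows "Poly_Mapping.single (\<Oplus>\<^bsub>A\<^esub>i\<in>F. c i \<odot>\<^bsub>A\<^esub> e i, b) 1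
    - (\<Sum>i\<in>F. Poly_Mapping.single (e i, b) (c i)) \<in> relator_span A B"
proof -
  interpret abelian_group A by (rule A.abelian_group)
  from assms show ?thesis
  proof (induction F rule: finite_induct)
    case empty then show ?case using single_zero_left by simp
  next
    case (insert i F)
    have *: "c i \<odot>\<^bsub>A\<^esub> e i \<in> carrier A" "(\<Oplus>\<^bsub>A\<^esub>i\<in>F. c i \<odot>\<^bsub>A\<^esub> e i) \<in> carrier A"
      using insert by (auto intro!: A.smult_in A.basis_in finsum_closed)
    have **: "(\<Oplus>\<^bsub>A\<^esub>i\<in>insert i F. c i \<odot>\<^bsub>A\<^esub> e i) = c i \<odot>\<^bsub>A\<^esub> e i \<oplus>\<^bsub>A\<^esub> (\<Oplus>\<^bsub>A\<^esub>i\<in>F. c i \<odot>\<^bsub>A\<^esub> e i)"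
      using insert by (intro finsum_insert) (auto intro!: A.smult_in A.basis_in)
    have ***: "Poly_Mapping.single (c i \<odot>\<^bsub>A\<^esub> e i, b) 1 - Poly_Mapping.single (e i, b) (c i)
      \<in> relator_span A B"
      using insert by (intro single_smult_left A.basis_in) auto
    have "(\<Sum>i\<in>insert i F. Poly_Mapping.single (e i, b) (c i))
       = Poly_Mapping.single (e i, b) (c i) + (\<Sum>i\<in>F. Poly_Mapping.single (e i, b) (c i))"
      using insert by simp
    then show ?case unfolding **
      using span_trans_diff[OF single_add_left[OF * insert(5)] span_add_diff[OF *** insert(3)]] insert
      by simp
  qed
qed

lemma expand_right:
  assumes "finite F" "F \<subseteq> J" "a \<in> carrier A"
  shows "Poly_Mapping.single (a, \<Oplus>\<^bsub>B\<^esub>i\<in>F. c i \<odot>\<^bsub>B\<^esub> f i) 1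
    - (\<Sum>i\<in>F. Poly_Mapping.single (a, f i) (c i)) \<in> relator_span A B"
proof -
  interpret abelian_group B by (rule B.abelian_group)
  from assms show ?thesis
  proof (induction F rule: finite_induct)
    case empty then show ?case using single_zero_right by simp
  next
    case (insert i F)
    have *: "c i \<odot>\<^bsub>B\<^esub> f i \<in> carrier B" "(\<Oplus>\<^bsub>B\<^esub>i\<in>F. c i \<odot>\<^bsub>B\<^esub> f i) \<in> carrier B"
      using insert by (auto intro!: B.smult_in B.basis_in finsum_closed)
    have **: "(\<Oplus>\<^bsub>B\<^esub>i\<in>insert i F. c i \<odot>\<^bsub>B\<^esub> f i) = c i \<odot>\<^bsub>B\<^esub> f i \<oplus>\<^bsub>B\<^esub> (\<Oplus>\<^bsub>B\<^esub>i\<in>F. c i \<odot>\<^bsub>B\<^esub> f i)"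
      using insert by (intro finsum_insert) (auto intro!: B.smult_in B.basis_in)
    have ***: "Poly_Mapping.single (a, c i \<odot>\<^bsub>B\<^esub> f i) 1 - Poly_Mapping.single (a, f i) (c i)
      \<in> relator_span A B"
      using insert by (intro single_smult_right B.basis_in) auto
    have "(\<Sum>i\<in>insert i F. Poly_Mapping.single (a, f i) (c i))
       = Poly_Mapping.single (a, f i) (c i) + (\<Sum>i\<in>F. Poly_Mapping.single (a, f i) (c i))"
      using insert by simp
    then show ?case unfolding **
      using span_trans_diff[OF single_add_right[OF insert(5) *] span_add_diff[OF *** insert(3)]] insert
      by simp
  qed
qed

lemma span_scale_single:
  "Poly_Mapping.single x 1 - p \<in> relator_span A B \<Longrightarrow>
    Poly_Mapping.single x c - Poly_Mapping.map ((*) c) p \<in> relator_span A B"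
  using poly_mapping_module.span_scale[of "Poly_Mapping.single x 1 - p" _ c]
  by (simp add: poly_mapping_module.scale_right_diff_distrib)

lemma span_sum_diff:
  "\<lbrakk>\<And>x. x \<in> F \<Longrightarrow> p x - q x \<in> relator_span A B\<rbrakk> \<Longrightarrow>
    (\<Sum>x\<in>F. p x) - (\<Sum>x\<in>F. q x) \<in> relator_span A B"
  using poly_mapping_module.span_sum[of F "\<lambda>x. p x - q x"] by (simp add: sum_subtractf)

lemma single_normal_form:
  assumes a: "a \<in> carrier A" and b: "b \<in> carrier B"
  shows "Poly_Mapping.single (a, b) 1
    - (\<Sum>(i,j)\<in>I\<times>J. Poly_Mapping.single (e i, f j) (\<kappa> a i * \<mu> b j)) \<in> relator_span A B"
proof -
  have 1: "Poly_Mapping.single (a, b) 1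
    - (\<Sum>i\<in>I. Poly_Mapping.single (e i, b) (\<kappa> a i)) \<in> relator_span A B"
    using expand_left[OF A.finite_index subset_refl b, of "\<kappa> a"] A.expansion[OF a] by simp
  have "Poly_Mapping.single (e i, b) (\<kappa> a i)
      - (\<Sum>j\<in>J. Poly_Mapping.single (e i, f j) (\<kappa> a i * \<mu> b j)) \<in> relator_span A B" if i: "i \<in> I" for i
    using span_scale_single[OF expand_right[OF B.finite_index subset_refl A.basis_in[OF i], of "\<mu> b"],
      of "\<kappa> a i"] B.expansion[OF b]
    by (simp add: poly_mapping_module.scale_sum_right)
  then have 2: "(\<Sum>i\<in>I. Poly_Mapping.single (e i, b) (\<kappa> a i))
    - (\<Sum>i\<in>I. \<Sum>j\<in>J. Poly_Mapping.single (e i, f j) (\<kappa> a i * \<mu> b j)) \<in> relator_span A B"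
    by (rule span_sum_diff)
  show ?thesis using span_trans_diff[OF 1 2] by (simp add: sum.cartesian_product)
qed

lemma poly_mapping_sum_single:
  "(\<Sum>x\<in>Poly_Mapping.keys p. Poly_Mapping.single x (Poly_Mapping.lookup p x)) = p"
  by (rule poly_mapping_eqI) (auto simp: lookup_sum lookup_single when_def in_keys_iff)

lemma single_sum: "Poly_Mapping.single x (\<Sum>i\<in>F. c i) = (\<Sum>i\<in>F. Poly_Mapping.single x (c i))"
  by (induction F rule: infinite_finite_induct) (simp_all add: single_add)

text \<open>
Modulo the relators every formal sum is a combination of the pairs of basis vectors, so that a tensor
is determined by its coordinates.
\<close>

lemma normal_form:
  assumes p: "p \<in> formal"
  shows "p - (\<Sum>(i,j)\<in>I\<times>J. Poly_Mapping.single (e i, f j)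
      (extend_linearly (\<lambda>(a, b). \<kappa> a i * \<mu> b j) p)) \<in> relator_span A B"
proof -
  have "(\<Sum>x\<in>Poly_Mapping.keys p. Poly_Mapping.single x (Poly_Mapping.lookup p x))
    - (\<Sum>x\<in>Poly_Mapping.keys p. \<Sum>(i,j)\<in>I\<times>J.
        Poly_Mapping.single (e i, f j) (Poly_Mapping.lookup p x * (\<kappa> (fst x) i * \<mu> (snd x) j))) \<in> relator_span A B"
  proof (rule span_sum_diff)
    fix x assume "x \<in> Poly_Mapping.keys p"
    then have "fst x \<in> carrier A" "snd x \<in> carrier B" using p by auto
    from span_scale_single[OF single_normal_form[OF this], of "Poly_Mapping.lookup p x"]
    show "Poly_Mapping.single x (Poly_Mapping.lookup p x) - (\<Sum>(i,j)\<in>I\<times>J.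
        Poly_Mapping.single (e i, f j) (Poly_Mapping.lookup p x * (\<kappa> (fst x) i * \<mu> (snd x) j))) \<in> relator_span A B"
      by (simp add: poly_mapping_module.scale_sum_right case_prod_beta)
  qed
  moreover have "(\<Sum>x\<in>Poly_Mapping.keys p. \<Sum>(i,j)\<in>I\<times>J.
        Poly_Mapping.single (e i, f j) (Poly_Mapping.lookup p x * (\<kappa> (fst x) i * \<mu> (snd x) j)))
     = (\<Sum>(i,j)\<in>I\<times>J. Poly_Mapping.single (e i, f j)
      (extend_linearly (\<lambda>(a, b). \<kappa> a i * \<mu> b j) p))"
    unfolding extend_linearly_def
    by (subst sum.swap) (auto simp: single_sum case_prod_beta intro!: sum.cong)
  ultimately show ?thesis by (simp add: poly_mapping_sum_single)
qed

lemma tensor_class_eq_coord: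
  assumes "p \<in> formal" "q \<in> formal"
    and "\<And>i j. i \<in> I \<Longrightarrow> j \<in> J \<Longrightarrow> extend_linearly (\<lambda>(a, b). \<kappa> a i * \<mu> b j) p
       = extend_linearly (\<lambda>(a, b). \<kappa> a i * \<mu> b j) q"
  shows "tensor_class A B p = tensor_class A B q"
proof -
  let ?s = "\<lambda>p. \<Sum>(i,j)\<in>I\<times>J. Poly_Mapping.single (e i, f j)
      (extend_linearly (\<lambda>(a, b). \<kappa> a i * \<mu> b j) p)"
  have "?s p = ?s q" using assms(3) by (auto intro!: sum.cong)
  moreover have "?s q - q \<in> relator_span A B"
    using poly_mapping_module.span_neg[OF normal_form[OF assms(2)]] by simp
  ultimately show ?thesis
    using span_trans_diff[OF normal_form[OF assms(1)]] by (simp add: tensor_class_eq_iff)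
qed

text \<open>
Both sides agree on the normal form, and a bilinear form does not see the difference.
\<close>

lemma bilinear_form_expand:
  assumes g: "bilinear_form A B g" and p: "p \<in> formal"
  shows "extend_linearly (\<lambda>(a, b). g a b) p = (\<Sum>(i,j)\<in>I\<times>J.
     extend_linearly (\<lambda>(a, b). \<kappa> a i * \<mu> b j) p * g (e i) (f j))"
proof -
  have "extend_linearly (\<lambda>(a, b). g a b) (p - (\<Sum>(i,j)\<in>I\<times>J. Poly_Mapping.single (e i, f j)
      (extend_linearly (\<lambda>(a, b). \<kappa> a i * \<mu> b j) p))) = 0"
    by (rule bilinear_form_kills_relators[OF g normal_form[OF p]])
  then show ?thesis
    by (simp add: extend_linearly_diff extend_linearly_sum case_prod_beta)
qed

lemma bilinear_form_apply:
  assumes "bilinear_form A B g" "a \<in> carrier A" "b \<in> carrier B"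
  shows "g a b = (\<Sum>i\<in>I. \<Sum>j\<in>J. \<kappa> a i * \<mu> b j * g (e i) (f j))"
  using bilinear_form_expand[OF assms(1), of "Poly_Mapping.single (a, b) 1"] assms
  by (simp add: sum.cartesian_product)

lemma tensor_rep_facts:
  assumes "S \<in> carrier T"
  shows "tensor_rep S \<in> formal" "tensor_class A B (tensor_rep S) = S"
proof -
  obtain p where p: "p \<in> formal" "S = tensor_class A B p"
    using assms by (auto simp: tensor_def)
  have "tensor_rep S \<in> S" unfolding tensor_rep_def
    by (rule someI[of _ p]) (simp add: p mem_tensor_class)
  then have *: "tensor_rep S - p \<in> relator_span A B" by (simp add: p tensor_class_def)
  then show "tensor_class A B (tensor_rep S) = S" by (simp add: p tensor_class_eq_iff)
  show "tensor_rep S \<in> formal"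
    using relator_span_formal[OF *] keys_add[of "tensor_rep S - p" p] p(1) by auto
qed

lemma tensor_class_in: "p \<in> formal \<Longrightarrow> tensor_class A B p \<in> carrier T"
  by (auto simp: tensor_def)

lemma rep_class_form:
  assumes "p \<in> formal" "bilinear_form A B g"
  shows "extend_linearly (\<lambda>(a, b). g a b) (tensor_rep (tensor_class A B p))
     = extend_linearly (\<lambda>(a, b). g a b) p"
proof -
  have "tensor_rep (tensor_class A B p) - p \<in> relator_span A B"
    using tensor_rep_facts(2)[OF tensor_class_in[OF assms(1)]] by (simp add: tensor_class_eq_iff)
  from bilinear_form_kills_relators[OF assms(2) this] show ?thesis
    by (simp add: extend_linearly_diff)
qed

lemma tcoord_class:
  assumes "p \<in> formal" "i \<in> I" "j \<in> J"
  shows "tcoord (tensor_class A B p) (i, j) = extend_linearly (\<lambda>(a, b). \<kappa> a i * \<mu> b j) p"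
  unfolding tcoord_def
  using rep_class_form[OF assms(1) coord_product_bilinear[OF assms(2,3)]] by simp

lemma pure_in: "a \<in> carrier A \<Longrightarrow> b \<in> carrier B \<Longrightarrow> pure_tensor A B a b \<in> carrier T"
  by (auto simp: pure_tensor_def intro!: tensor_class_in)

lemma tcoord_pure:
  "\<lbrakk>a \<in> carrier A; b \<in> carrier B; i \<in> I; j \<in> J\<rbrakk> \<Longrightarrow>
    tcoord (pure_tensor A B a b) (i, j) = \<kappa> a i * \<mu> b j"
  by (simp add: pure_tensor_def tcoord_class)

lemma map_scale_formal: "p \<in> formal \<Longrightarrow> Poly_Mapping.map ((*) c) p \<in> formal"
  by (auto simp: in_keys_iff)

lemma add_formal: "p \<in> formal \<Longrightarrow> q \<in> formal \<Longrightarrow> p + q \<in> formal"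
  using keys_add[of p q] by auto

lemma coordinates_tensor: "coordinates T (I \<times> J) tbasis tcoord"
proof
  show "finite (I \<times> J)" by (simp add: A.finite_index B.finite_index)
  show "\<zero>\<^bsub>T\<^esub> \<in> carrier T" by (simp add: tensor_def)
  fix S U c assume S: "S \<in> carrier T"
  note rS = tensor_rep_facts[OF S]
  show "c \<odot>\<^bsub>T\<^esub> S \<in> carrier T"
    using tensor_class_in[OF map_scale_formal[OF rS(1)]] by (simp add: tensor_def)
  show "tcoord (c \<odot>\<^bsub>T\<^esub> S) ij = c * tcoord S ij" if "ij \<in> I \<times> J" for ij
  proof -
    have "c \<odot>\<^bsub>T\<^esub> S = tensor_class A B (Poly_Mapping.map ((*) c) (tensor_rep S))" by (simp add: tensor_def)
    then show ?thesis using that tcoord_class[OF map_scale_formal[OF rS(1)]]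
      by (auto simp: extend_linearly_scale) (simp add: tcoord_def)
  qed
  assume U: "U \<in> carrier T"
  note rU = tensor_rep_facts[OF U]
  show "S \<oplus>\<^bsub>T\<^esub> U \<in> carrier T"
    using tensor_class_in[OF add_formal[OF rS(1) rU(1)]] by (simp add: tensor_def)
  show "tcoord (S \<oplus>\<^bsub>T\<^esub> U) ij = tcoord S ij + tcoord U ij" if "ij \<in> I \<times> J" for ij
  proof -
    have "S \<oplus>\<^bsub>T\<^esub> U = tensor_class A B (tensor_rep S + tensor_rep U)" by (simp add: tensor_def)
    then show ?thesis using that tcoord_class[OF add_formal[OF rS(1) rU(1)]]
      by (auto simp: extend_linearly_add) (simp add: tcoord_def)
  qed
  show "S = U" if eq: "\<And>ij. ij \<in> I \<times> J \<Longrightarrow> tcoord S ij = tcoord U ij"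
  proof -
    have "tensor_class A B (tensor_rep S) = tensor_class A B (tensor_rep U)"
    proof (rule tensor_class_eq_coord[OF rS(1) rU(1)])
      fix i j assume "i \<in> I" "j \<in> J"
      then show "extend_linearly (\<lambda>(a, b). \<kappa> a i * \<mu> b j) (tensor_rep S)
        = extend_linearly (\<lambda>(a, b). \<kappa> a i * \<mu> b j) (tensor_rep U)"
        using eq[of "(i, j)"] by (simp add: tcoord_def)
    qed
    then show ?thesis by (simp add: rS(2) rU(2))
  qed
next
  fix ij assume ij: "ij \<in> I \<times> J"
  then show "tbasis ij \<in> carrier T"
    by (auto simp: tbasis_def intro!: pure_in A.basis_in B.basis_in)
  have "\<zero>\<^bsub>T\<^esub> = tensor_class A B 0" by (simp add: tensor_def)
  then show "tcoord \<zero>\<^bsub>T\<^esub> ij = 0"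
    using ij by (auto simp: tcoord_class)
  fix kl assume "kl \<in> I \<times> J"
  then show "tcoord (tbasis ij) kl = (if ij = kl then 1 else 0)" using ij
    by (auto simp: tbasis_def tcoord_pure A.basis_in B.basis_in A.coord_basis B.coord_basis
        split: if_splits)
qed

end

sublocale two_coordinates \<subseteq> T: coordinates T "I \<times> J" tbasis tcoord
  by (rule coordinates_tensor)

context two_coordinates
begin

lemma pure_bilinear: "bilinear_into A B T (pure_tensor A B)"
  unfolding bilinear_into_def
proof (intro conjI ballI allI)
  show "pure_tensor A B (a \<oplus>\<^bsub>A\<^esub> a') b = pure_tensor A B a b \<oplus>\<^bsub>T\<^esub> pure_tensor A B a' b"
    if "a \<in> carrier A" "a' \<in> carrier A" "b \<in> carrier B" for a a' b
    by (rule T.coord_eqI)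
      (use that in \<open>auto simp: pure_in T.add_in A.add_in T.coord_add tcoord_pure A.coord_add algebra_simps\<close>)
  show "pure_tensor A B a (b \<oplus>\<^bsub>B\<^esub> b') = pure_tensor A B a b \<oplus>\<^bsub>T\<^esub> pure_tensor A B a b'"
    if "a \<in> carrier A" "b \<in> carrier B" "b' \<in> carrier B" for a b b'
    by (rule T.coord_eqI)
      (use that in \<open>auto simp: pure_in T.add_in B.add_in T.coord_add tcoord_pure B.coord_add algebra_simps\<close>)
  show "pure_tensor A B (c \<odot>\<^bsub>A\<^esub> a) b = c \<odot>\<^bsub>T\<^esub> pure_tensor A B a b"
    if "a \<in> carrier A" "b \<in> carrier B" for c a b
    by (rule T.coord_eqI)
      (use that in \<open>auto simp: pure_in T.smult_in A.smult_in T.coord_smult tcoord_pure A.coord_smult algebra_simps\<close>)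
  show "pure_tensor A B a (c \<odot>\<^bsub>B\<^esub> b) = c \<odot>\<^bsub>T\<^esub> pure_tensor A B a b"
    if "a \<in> carrier A" "b \<in> carrier B" for c a b
    by (rule T.coord_eqI)
      (use that in \<open>auto simp: pure_in T.smult_in B.smult_in T.coord_smult tcoord_pure B.coord_smult algebra_simps\<close>)
qed (rule pure_in)

lemma tensor_induct [consumes 1, case_names pure add]:
  assumes S: "S \<in> carrier T"
    and pure: "\<And>a b. a \<in> carrier A \<Longrightarrow> b \<in> carrier B \<Longrightarrow> P (pure_tensor A B a b)"
    and add: "\<And>S U. S \<in> carrier T \<Longrightarrow> U \<in> carrier T \<Longrightarrow> P S \<Longrightarrow> P U \<Longrightarrow> P (S \<oplus>\<^bsub>T\<^esub> U)"
  shows "P S"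
proof -
  interpret abelian_group T by (rule T.abelian_group)
  have term_eq: "c \<odot>\<^bsub>T\<^esub> tbasis ij = pure_tensor A B (c \<odot>\<^bsub>A\<^esub> e (fst ij)) (f (snd ij))"
    if "ij \<in> I \<times> J" for c ij
    using pure_bilinear that A.basis_in B.basis_in
    by (auto simp: bilinear_into_def tbasis_def)
  have zero_eq: "\<zero>\<^bsub>T\<^esub> = pure_tensor A B \<zero>\<^bsub>A\<^esub> \<zero>\<^bsub>B\<^esub>"
    by (rule T.coord_eqI) (auto simp: T.zero_in pure_in A.zero_in B.zero_in T.coord_zero tcoord_pure
        A.coord_zero)
  have "P (\<Oplus>\<^bsub>T\<^esub>ij\<in>F. tcoord S ij \<odot>\<^bsub>T\<^esub> tbasis ij)" if "finite F" "F \<subseteq> I \<times> J" for F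
    using that
  proof (induction F rule: finite_induct)
    case empty
    then show ?case by (auto simp: zero_eq intro!: pure A.zero_in B.zero_in)
  next
    case (insert ij F)
    have "(\<Oplus>\<^bsub>T\<^esub>ij\<in>insert ij F. tcoord S ij \<odot>\<^bsub>T\<^esub> tbasis ij)
      = tcoord S ij \<odot>\<^bsub>T\<^esub> tbasis ij \<oplus>\<^bsub>T\<^esub> (\<Oplus>\<^bsub>T\<^esub>ij\<in>F. tcoord S ij \<odot>\<^bsub>T\<^esub> tbasis ij)"
      using insert by (intro finsum_insert) (auto intro!: T.smult_in T.basis_in)
    moreover have "P (tcoord S ij \<odot>\<^bsub>T\<^esub> tbasis ij)"
      using insert by (auto simp: term_eq intro!: pure A.smult_in A.basis_in B.basis_in)
    ultimately show ?case using insert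
      by (auto intro!: add T.smult_in T.basis_in finsum_closed)
  qed
  from this[OF T.finite_index subset_refl] show ?thesis using T.expansion[OF S] by simp
qed

lemma tensor_lift_in_coord:
  assumes C: "coordinates C K g \<nu>" and h: "bilinear_into A B C h" and S: "S \<in> carrier T"
  shows "tensor_lift C h S \<in> carrier C"
    and "k \<in> K \<Longrightarrow>
      \<nu> (tensor_lift C h S) k = (\<Sum>x\<in>I\<times>J. tcoord S x * \<nu> (h (e (fst x)) (f (snd x))) k)"
proof -
  interpret C: coordinates C K g \<nu> by (rule C)
  note rS = tensor_rep_facts[OF S]
  have in_C: "Poly_Mapping.lookup (tensor_rep S) x \<odot>\<^bsub>C\<^esub> h (fst x) (snd x) \<in> carrier C"
    and in_C': "h (fst x) (snd x) \<in> carrier C"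
    if "x \<in> Poly_Mapping.keys (tensor_rep S)" for x
    using that rS(1) h by (auto simp: bilinear_into_def intro!: C.smult_in)
  show "tensor_lift C h S \<in> carrier C"
    unfolding tensor_lift_def by (rule C.finsum_in) (rule in_C)
  assume k: "k \<in> K"
  have "bilinear_form A B (\<lambda>a b. \<nu> (h a b) k)"
    using h k by (auto simp: bilinear_into_def base_alg_def C.coord_add C.coord_smult)
  have "\<nu> (tensor_lift C h S) k = extend_linearly (\<lambda>(a, b). \<nu> (h a b) k) (tensor_rep S)"
    unfolding tensor_lift_def extend_linearly_def using k
    by (simp add: C.coord_finsum in_C in_C' C.coord_smult case_prod_beta)
  also have "\<dots> = (\<Sum>x\<in>I\<times>J. tcoord S x * \<nu> (h (e (fst x)) (f (snd x))) k)"
    unfolding bilinear_form_expand[OF \<open>bilinear_form A B (\<lambda>a b. \<nu> (h a b) k)\<close> rS(1)]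
    by (simp add: tcoord_def case_prod_beta)
  finally show "\<nu> (tensor_lift C h S) k = (\<Sum>x\<in>I\<times>J. tcoord S x * \<nu> (h (e (fst x)) (f (snd x))) k)" .
qed

lemma tensor_lift_pure:
  assumes C: "coordinates C K g \<nu>" and h: "bilinear_into A B C h"
    and ab: "a \<in> carrier A" "b \<in> carrier B"
  shows "tensor_lift C h (pure_tensor A B a b) = h a b"
proof -
  interpret C: coordinates C K g \<nu> by (rule C)
  note L = tensor_lift_in_coord[OF C h]
  have p: "Poly_Mapping.single (a, b) 1 \<in> formal" using ab by auto
  show ?thesis
  proof (rule C.coord_eqI[OF L(1)[OF pure_in[OF ab]]])
    show "h a b \<in> carrier C" using h ab by (auto simp: bilinear_into_def)
    fix k assume k: "k \<in> K"
    have bf: "bilinear_form A B (\<lambda>a b. \<nu> (h a b) k)"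
      using h k by (auto simp: bilinear_into_def base_alg_def C.coord_add C.coord_smult)
    have "\<nu> (tensor_lift C h (pure_tensor A B a b)) k
      = (\<Sum>(i,j)\<in>I\<times>J. \<kappa> a i * \<mu> b j * \<nu> (h (e i) (f j)) k)"
      unfolding L(2)[OF pure_in[OF ab] k] by (auto intro!: sum.cong simp: tcoord_pure ab)
    also have "\<dots> = \<nu> (h a b) k"
      using bilinear_form_expand[OF bf p] by simp
    finally show "\<nu> (tensor_lift C h (pure_tensor A B a b)) k = \<nu> (h a b) k" .
  qed
qed

lemma tensor_lift_linear:
  assumes C: "coordinates C K g \<nu>" and h: "bilinear_into A B C h"
    and S: "S \<in> carrier T" and U: "U \<in> carrier T"
  shows "tensor_lift C h (S \<oplus>\<^bsub>T\<^esub> U) = tensor_lift C h S \<oplus>\<^bsub>C\<^esub> tensor_lift C h U"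
    and "tensor_lift C h (c \<odot>\<^bsub>T\<^esub> S) = c \<odot>\<^bsub>C\<^esub> tensor_lift C h S"
proof -
  interpret C: coordinates C K g \<nu> by (rule C)
  note L = tensor_lift_in_coord[OF C h]
  note [simp] = L S U T.add_in T.smult_in C.add_in C.smult_in C.coord_add C.coord_smult
    T.sum_coord_add T.sum_coord_smult
  show "tensor_lift C h (S \<oplus>\<^bsub>T\<^esub> U) = tensor_lift C h S \<oplus>\<^bsub>C\<^esub> tensor_lift C h U"
    by (rule C.coord_eqI) simp_all
  show "tensor_lift C h (c \<odot>\<^bsub>T\<^esub> S) = c \<odot>\<^bsub>C\<^esub> tensor_lift C h S"
    by (rule C.coord_eqI) simp_all
qed

text \<open>
The product is defined through chosen representatives. Its coordinates are bilinear in them, and expanding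
one representative at a time makes the choice disappear.
\<close>

lemma mult_in_tcoord:
  assumes mA: "bilinear_into A A A (mult A)" and mB: "bilinear_into B B B (mult B)"
    and S: "S \<in> carrier T" and U: "U \<in> carrier T"
  shows "S \<otimes>\<^bsub>T\<^esub> U \<in> carrier T"
    and "i \<in> I \<Longrightarrow> j \<in> J \<Longrightarrow> tcoord (S \<otimes>\<^bsub>T\<^esub> U) (i, j) =
      (\<Sum>x\<in>I\<times>J. tcoord S x * (\<Sum>y\<in>I\<times>J. tcoord U y *
         (\<kappa> (e (fst x) \<otimes>\<^bsub>A\<^esub> e (fst y)) i * \<mu> (f (snd x) \<otimes>\<^bsub>B\<^esub> f (snd y)) j)))"
proof -
  note rS = tensor_rep_facts[OF S] and rU = tensor_rep_facts[OF U]
  let ?s = "tensor_rep S" and ?u = "tensor_rep U"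
  define w where "w = (\<Sum>x\<in>Poly_Mapping.keys ?s. \<Sum>y\<in>Poly_Mapping.keys ?u.
    Poly_Mapping.single (fst x \<otimes>\<^bsub>A\<^esub> fst y, snd x \<otimes>\<^bsub>B\<^esub> snd y)
      (Poly_Mapping.lookup ?s x * Poly_Mapping.lookup ?u y))"
  have w: "S \<otimes>\<^bsub>T\<^esub> U = tensor_class A B w"
    by (simp add: tensor_def w_def case_prod_beta)
  have sum_formal: "(\<Sum>x\<in>F. p x) \<in> formal" if "\<And>x. x \<in> F \<Longrightarrow> p x \<in> formal" for F and p :: "_ \<Rightarrow> ('a \<times> 'b) \<Rightarrow>\<^sub>0 'k"
    using that
  proof (induction F rule: infinite_finite_induct)
    case (insert x F)
    then show ?case using add_formal[of "p x" "sum p F"] by simp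
  qed auto
  have wf: "w \<in> formal"
    unfolding w_def using rS(1) rU(1) mA mB
    by (intro sum_formal) (auto simp: bilinear_into_def subset_iff)
  then show "S \<otimes>\<^bsub>T\<^esub> U \<in> carrier T" unfolding w by (rule tensor_class_in)
  assume i: "i \<in> I" and j: "j \<in> J"
  let ?g = "\<lambda>a b a' b'. \<kappa> (a \<otimes>\<^bsub>A\<^esub> a') i * \<mu> (b \<otimes>\<^bsub>B\<^esub> b') j"
  have g1: "bilinear_form A B (\<lambda>a' b'. ?g a b a' b')" if "a \<in> carrier A" "b \<in> carrier B" for a b
    using mA mB that i j by (auto simp: bilinear_into_def base_alg_def A.coord_add B.coord_add
        A.coord_smult B.coord_smult algebra_simps)
  have g2: "bilinear_form A B (\<lambda>a b. ?g a b a' b')" if "a' \<in> carrier A" "b' \<in> carrier B" for a' b'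
    using mA mB that i j by (auto simp: bilinear_into_def base_alg_def A.coord_add B.coord_add
        A.coord_smult B.coord_smult algebra_simps)
  have "tcoord (S \<otimes>\<^bsub>T\<^esub> U) (i, j) = extend_linearly (\<lambda>(a, b). \<kappa> a i * \<mu> b j) w"
    unfolding w by (rule tcoord_class[OF wf i j])
  also have "\<dots> = (\<Sum>x\<in>Poly_Mapping.keys ?s. Poly_Mapping.lookup ?s x *
      extend_linearly (\<lambda>(a', b'). ?g (fst x) (snd x) a' b') ?u)"
    by (simp add: w_def extend_linearly_sum) (simp add: extend_linearly_def sum_distrib_left
        case_prod_beta mult.assoc)
  also have "\<dots> = (\<Sum>x\<in>Poly_Mapping.keys ?s. Poly_Mapping.lookup ?s x *
      (\<Sum>(p',q')\<in>I\<times>J. tcoord U (p', q') * ?g (fst x) (snd x) (e p') (f q')))"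
  proof (rule sum.cong[OF refl])
    fix x assume "x \<in> Poly_Mapping.keys ?s"
    then have "fst x \<in> carrier A" "snd x \<in> carrier B" using rS(1) by auto
    from bilinear_form_expand[OF g1[OF this] rU(1)]
    show "Poly_Mapping.lookup ?s x * extend_linearly (\<lambda>(a', b'). ?g (fst x) (snd x) a' b') ?u
      = Poly_Mapping.lookup ?s x * (\<Sum>(p',q')\<in>I\<times>J. tcoord U (p', q') * ?g (fst x) (snd x) (e p') (f q'))"
      by (simp add: tcoord_def)
  qed
  also have "\<dots> = (\<Sum>(p',q')\<in>I\<times>J. tcoord U (p', q') *
      extend_linearly (\<lambda>(a, b). ?g a b (e p') (f q')) ?s)"
    unfolding extend_linearly_def case_prod_beta sum_distrib_left
    by (subst sum.swap) (auto intro!: sum.cong simp: algebra_simps)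
  also have "\<dots> = (\<Sum>(p',q')\<in>I\<times>J. tcoord U (p', q') *
      (\<Sum>(p,q)\<in>I\<times>J. tcoord S (p, q) * ?g (e p) (f q) (e p') (f q')))"
  proof (rule sum.cong[OF refl])
    fix y assume "y \<in> I \<times> J"
    then obtain p' q' where y: "y = (p', q')" and "p' \<in> I" "q' \<in> J" by auto
    then have "e p' \<in> carrier A" "f q' \<in> carrier B" using A.basis_in B.basis_in by auto
    from bilinear_form_expand[OF g2[OF this] rS(1)]
    show "(case y of (p', q') \<Rightarrow> tcoord U (p', q') * extend_linearly (\<lambda>(a, b). ?g a b (e p') (f q')) ?s) =
       (case y of (p', q') \<Rightarrow> tcoord U (p', q') *
          (\<Sum>(p,q)\<in>I\<times>J. tcoord S (p, q) * ?g (e p) (f q) (e p') (f q')))"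
      by (simp add: tcoord_def y)
  qed
  also have "\<dots> = (\<Sum>x\<in>I\<times>J. tcoord S x * (\<Sum>y\<in>I\<times>J. tcoord U y *
         ?g (e (fst x)) (f (snd x)) (e (fst y)) (f (snd y))))"
    unfolding case_prod_beta sum_distrib_left prod.collapse
    by (subst sum.swap) (auto intro!: sum.cong simp: algebra_simps)
  finally show "tcoord (S \<otimes>\<^bsub>T\<^esub> U) (i, j) =
      (\<Sum>x\<in>I\<times>J. tcoord S x * (\<Sum>y\<in>I\<times>J. tcoord U y *
         (\<kappa> (e (fst x) \<otimes>\<^bsub>A\<^esub> e (fst y)) i * \<mu> (f (snd x) \<otimes>\<^bsub>B\<^esub> f (snd y)) j)))" .
qed

lemma tensor_mult_bilinear:
  assumes "bilinear_into A A A (mult A)" "bilinear_into B B B (mult B)"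
  shows "bilinear_into T T T (mult T)"
proof -
  note M = mult_in_tcoord[OF assms]
  note [simp] = M T.add_in T.smult_in T.coord_add T.coord_smult
  have [simp]: "(\<Sum>x\<in>F. c x * (d * h x)) = d * (\<Sum>x\<in>F. c x * h x)" for F and c :: "_ \<Rightarrow> 'k" and d h
    by (simp add: sum_distrib_left mult.left_commute)
  show ?thesis
    unfolding bilinear_into_def
    by (intro conjI allI ballI; (rule T.coord_eqI)?) (auto simp: distrib_left distrib_right sum.distrib mult.assoc sum_distrib_left[symmetric])
qed

lemma tensor_mult_pure:
  assumes mA: "bilinear_into A A A (mult A)" and mB: "bilinear_into B B B (mult B)"
    and a: "a \<in> carrier A" "a' \<in> carrier A" and b: "b \<in> carrier B" "b' \<in> carrier B"
  shows "pure_tensor A B a b \<otimes>\<^bsub>T\<^esub> pure_tensor A B a' b' = pure_tensor A B (a \<otimes>\<^bsub>A\<^esub> a') (b \<otimes>\<^bsub>B\<^esub> b')"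
proof -
  note M = mult_in_tcoord[OF mA mB]
  have ab: "a \<otimes>\<^bsub>A\<^esub> a' \<in> carrier A" "b \<otimes>\<^bsub>B\<^esub> b' \<in> carrier B"
    using mA mB a b by (auto simp: bilinear_into_def)
  show ?thesis
  proof (rule T.coord_eqI)
    show "pure_tensor A B a b \<otimes>\<^bsub>T\<^esub> pure_tensor A B a' b' \<in> carrier T"
      by (intro M(1) pure_in a b)
    show "pure_tensor A B (a \<otimes>\<^bsub>A\<^esub> a') (b \<otimes>\<^bsub>B\<^esub> b') \<in> carrier T"
      by (intro pure_in ab)
    fix ij assume "ij \<in> I \<times> J"
    then obtain i j where ij: "ij = (i, j)" and i: "i \<in> I" and j: "j \<in> J" by auto
    have "bilinear_form A A (\<lambda>a a'. \<kappa> (a \<otimes>\<^bsub>A\<^esub> a') i)" "bilinear_form B B (\<lambda>b b'. \<mu> (b \<otimes>\<^bsub>B\<^esub> b') j)"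
      using mA mB i j by (auto simp: bilinear_into_def base_alg_def A.coord_add B.coord_add
        A.coord_smult B.coord_smult)
    from
      two_coordinates.bilinear_form_apply[OF two_coordinates.intro[OF A.coordinates_axioms A.coordinates_axioms] this(1) a]
      two_coordinates.bilinear_form_apply[OF two_coordinates.intro[OF B.coordinates_axioms B.coordinates_axioms] this(2) b]
    have e: "\<kappa> (a \<otimes>\<^bsub>A\<^esub> a') i * \<mu> (b \<otimes>\<^bsub>B\<^esub> b') j = (\<Sum>p\<in>I. \<Sum>p'\<in>I. \<Sum>q\<in>J. \<Sum>q'\<in>J.
        \<kappa> a p * \<kappa> a' p' * \<kappa> (e p \<otimes>\<^bsub>A\<^esub> e p') i * (\<mu> b q * \<mu> b' q' * \<mu> (f q \<otimes>\<^bsub>B\<^esub> f q') j))"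
      by (simp only: sum_distrib_right) (simp only: sum_distrib_left)
    have "tcoord (pure_tensor A B a b \<otimes>\<^bsub>T\<^esub> pure_tensor A B a' b') (i, j)
      = (\<Sum>(p,q)\<in>I\<times>J. \<Sum>(p',q')\<in>I\<times>J. \<kappa> a p * \<mu> b q * (\<kappa> a' p' * \<mu> b' q') *
         (\<kappa> (e p \<otimes>\<^bsub>A\<^esub> e p') i * \<mu> (f q \<otimes>\<^bsub>B\<^esub> f q') j))"
      unfolding M(2)[OF pure_in[OF a(1) b(1)] pure_in[OF a(2) b(2)] i j]
      by (auto intro!: sum.cong simp: tcoord_pure a b sum_distrib_left mult.assoc)
    also have "\<dots> = (\<Sum>p\<in>I. \<Sum>q\<in>J. \<Sum>p'\<in>I. \<Sum>q'\<in>J. \<kappa> a p * \<mu> b q * (\<kappa> a' p' * \<mu> b' q') *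
         (\<kappa> (e p \<otimes>\<^bsub>A\<^esub> e p') i * \<mu> (f q \<otimes>\<^bsub>B\<^esub> f q') j))"
      by (simp only: sum.cartesian_product[symmetric])
    also have "\<dots> = (\<Sum>p\<in>I. \<Sum>p'\<in>I. \<Sum>q\<in>J. \<Sum>q'\<in>J. \<kappa> a p * \<mu> b q * (\<kappa> a' p' * \<mu> b' q') *
         (\<kappa> (e p \<otimes>\<^bsub>A\<^esub> e p') i * \<mu> (f q \<otimes>\<^bsub>B\<^esub> f q') j))"
      by (intro sum.cong refl sum.swap)
    also have "\<dots> = \<kappa> (a \<otimes>\<^bsub>A\<^esub> a') i * \<mu> (b \<otimes>\<^bsub>B\<^esub> b') j"
      unfolding e by (intro sum.cong refl) (simp add: algebra_simps)
    also have "\<dots> = tcoord (pure_tensor A B (a \<otimes>\<^bsub>A\<^esub> a') (b \<otimes>\<^bsub>B\<^esub> b')) (i, j)"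
      by (simp add: tcoord_pure ab i j)
    finally show "tcoord (pure_tensor A B a b \<otimes>\<^bsub>T\<^esub> pure_tensor A B a' b') ij
      = tcoord (pure_tensor A B (a \<otimes>\<^bsub>A\<^esub> a') (b \<otimes>\<^bsub>B\<^esub> b')) ij" by (simp add: ij)
  qed
qed

lemma one_tensor: "\<one>\<^bsub>T\<^esub> = pure_tensor A B \<one>\<^bsub>A\<^esub> \<one>\<^bsub>B\<^esub>"
  by (simp add: tensor_def)

end

section \<open>Linear algebra of finite families of functions\<close>

lemma sum_fun_apply: "(\<Sum>i\<in>F. f i) x = (\<Sum>i\<in>F. f i x)"
  by (induction F rule: infinite_finite_induct) simp_all

lemma sum_single_delta:
  "finite F \<Longrightarrow> (\<Sum>i\<in>F. (if i = j then 1 else 0) * h i) = (if j \<in> F then h j else (0::'k::semiring_1))"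
  "finite F \<Longrightarrow> (\<Sum>i\<in>F. h i * (if i = j then 1 else 0)) = (if j \<in> F then h j else (0::'k::semiring_1))"
  "finite F \<Longrightarrow> (\<Sum>i\<in>F. (if j = i then 1 else 0) * h i) = (if j \<in> F then h j else (0::'k::semiring_1))"
  "finite F \<Longrightarrow> (\<Sum>i\<in>F. h i * (if j = i then 1 else 0)) = (if j \<in> F then h j else (0::'k::semiring_1))"
  by (simp_all add: if_distrib[of "\<lambda>x. x * _"] if_distrib[of "\<lambda>x. _ * x"] cong: if_cong)

text \<open>
Working with dual functionals avoids bases and dimensions of function spaces: applying a functional to an
equation reads off a coefficient. A dual family for \<open>a\<^sub>0, \<dots>, a\<^sub>n\<^sub>-\<^sub>1\<close> extends by one step unless \<open>a\<^sub>n\<close> coincides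
with the combination that the functionals predict for it.
\<close>

lemma dual_family_or_dependent:
  fixes a :: "nat \<Rightarrow> 'x \<Rightarrow> 'k::field"
  assumes K: "finite K"
  shows "(\<exists>\<phi>. \<forall>i<n. \<forall>j<n. (\<Sum>x\<in>K. \<phi> i x * a j x) = (if i = j then 1 else 0)) \<or>
    (\<exists>k<n. \<exists>c. \<forall>x\<in>K. a k x = (\<Sum>i<k. c i * a i x))"
proof (induction n)
  case 0 show ?case by simp
next
  case (Suc n)
  show ?case
  proof (cases "\<exists>k<Suc n. \<exists>c. \<forall>x\<in>K. a k x = (\<Sum>i<k. c i * a i x)")
    case True then show ?thesis by blast
  next
    case False
    then have "\<not> (\<exists>k<n. \<exists>c. \<forall>x\<in>K. a k x = (\<Sum>i<k. c i * a i x))" using less_SucI by blast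
    with Suc obtain \<phi> where \<phi>: "\<And>i j. i < n \<Longrightarrow> j < n \<Longrightarrow> (\<Sum>x\<in>K. \<phi> i x * a j x) = (if i = j then 1 else 0)"
      by blast
    define p where "p i = (\<Sum>x\<in>K. \<phi> i x * a n x)" for i
    from False obtain y where y: "y \<in> K" and ne: "a n y \<noteq> (\<Sum>i<n. p i * a i y)" by blast
    define d where "d = a n y - (\<Sum>i<n. p i * a i y)"
    have d: "d \<noteq> 0" using ne by (simp add: d_def)
    \<comment> \<open>Evaluation at a point \<open>y\<close> where the prediction fails, corrected to vanish on the earlier functions.\<close>
    define \<psi> where "\<psi> x = ((if x = y then 1 else 0) - (\<Sum>i<n. a i y * \<phi> i x)) / d" for x
    have \<psi>_sum: "(\<Sum>x\<in>K. \<psi> x * b x) = (b y - (\<Sum>i<n. a i y * (\<Sum>x\<in>K. \<phi> i x * b x))) / d" for b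
    proof -
      have "(\<Sum>x\<in>K. \<psi> x * b x) = (\<Sum>x\<in>K. (if x = y then 1 else 0) * b x - (\<Sum>i<n. a i y * \<phi> i x * b x)) / d"
        by (simp add: \<psi>_def sum_divide_distrib sum_distrib_right left_diff_distrib)
      also have "\<dots> = ((\<Sum>x\<in>K. (if x = y then 1 else 0) * b x) - (\<Sum>x\<in>K. \<Sum>i<n. a i y * \<phi> i x * b x)) / d"
        by (simp only: sum_subtractf)
      also have "(\<Sum>x\<in>K. \<Sum>i<n. a i y * \<phi> i x * b x) = (\<Sum>i<n. a i y * (\<Sum>x\<in>K. \<phi> i x * b x))"
        by (subst sum.swap) (simp add: sum_distrib_left mult.assoc)
      finally show ?thesis using K y by (simp add: sum_single_delta)
    qed
    have \<psi>_j: "(\<Sum>x\<in>K. \<psi> x * a j x) = 0" if "j < n" for j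
    proof -
      have "(\<Sum>i<n. a i y * (\<Sum>x\<in>K. \<phi> i x * a j x)) = (\<Sum>i<n. a i y * (if i = j then 1 else 0))"
        by (intro sum.cong) (auto simp: \<phi> that)
      then show ?thesis using that by (simp add: \<psi>_sum sum_single_delta)
    qed
    have \<psi>_n: "(\<Sum>x\<in>K. \<psi> x * a n x) = 1"
      using d by (simp add: \<psi>_sum p_def[symmetric] d_def mult.commute)
    define \<phi>' where "\<phi>' i x = (if i = n then \<psi> x else \<phi> i x - p i * \<psi> x)" for i x
    have "(\<Sum>x\<in>K. \<phi>' i x * a j x) = (if i = j then 1 else 0)" if "i < Suc n" "j < Suc n" for i j
    proof (cases "i = n")
      case True
      then show ?thesis using \<psi>_j[of j] \<psi>_n that by (cases "j = n") (auto simp: \<phi>'_def)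
    next
      case False
      have "(\<Sum>x\<in>K. \<phi>' i x * a j x) = (\<Sum>x\<in>K. \<phi> i x * a j x) - p i * (\<Sum>x\<in>K. \<psi> x * a j x)"
        using False by (simp add: \<phi>'_def left_diff_distrib sum_subtractf sum_distrib_left mult.assoc)
      then show ?thesis using False \<phi>[of i j] \<psi>_j[of j] \<psi>_n that
        by (cases "j = n") (auto simp: p_def)
    qed
    then show ?thesis by blast
  qed
qed

text \<open>
If \<open>F\<close> had fewer than \<open>n\<close> elements, the two factors, padded with zeros to size \<open>n \<times> n\<close>, would be inverse to each other, but the product in the
opposite order has a zero row.
\<close>

lemma identity_factor_bound:
  fixes f :: "'x \<Rightarrow> nat \<Rightarrow> 'k::field"
  assumes "finite F"
    and "\<And>i j. i < n \<Longrightarrow> j < n \<Longrightarrow> (\<Sum>x\<in>F. g i x * f x j) = (if i = j then 1 else 0)"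
  shows "n \<le> card F"
proof (rule ccontr)
  assume "\<not> n \<le> card F"
  then have lt: "card F < n" by simp
  obtain h where h: "bij_betw h {..<card F} F"
    using ex_bij_betw_nat_finite[OF assms(1)] by (auto simp: atLeast0LessThan)
  define G where "G = mat n n (\<lambda>(i, x). if x < card F then g i (h x) else 0)"
  define H where "H = mat n n (\<lambda>(x, j). if x < card F then f (h x) j else 0)"
  have [simp]: "G \<in> carrier_mat n n" "H \<in> carrier_mat n n" by (simp_all add: G_def H_def)
  have "G * H = 1\<^sub>m n"
  proof (rule eq_matI)
    fix i j assume "i < dim_row (1\<^sub>m n :: 'k mat)" "j < dim_col (1\<^sub>m n :: 'k mat)"
    then have ij: "i < n" "j < n" by simp_all
    have "(G * H) $$ (i, j) = (\<Sum>x<n. if x < card F then g i (h x) * f (h x) j else 0)"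
      using ij by (auto simp: G_def H_def scalar_prod_def atLeast0LessThan intro!: sum.cong)
    also have "\<dots> = (\<Sum>x<card F. g i (h x) * f (h x) j)"
      using lt by (intro sum.mono_neutral_cong_right) auto
    also have "\<dots> = (\<Sum>x\<in>F. g i x * f x j)"
      using sum.reindex_bij_betw[OF h, of "\<lambda>x. g i x * f x j"] by simp
    finally show "(G * H) $$ (i, j) = 1\<^sub>m n $$ (i, j)" using assms(2)[OF ij] ij by simp
  qed (simp_all add: G_def H_def)
  then have "H * G = 1\<^sub>m n" by (rule mat_mult_left_right_inverse[rotated 2]) simp_all
  moreover have "(H * G) $$ (n - 1, n - 1) = 0"
    using lt by (auto simp: G_def H_def scalar_prod_def intro!: sum.neutral)
  ultimately show False using lt by simp
qed

lemma left_inverse_is_right_inverse: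
  fixes x y :: "nat \<Rightarrow> nat \<Rightarrow> 'k::field"
  assumes "\<And>i j. i < n \<Longrightarrow> j < n \<Longrightarrow> (\<Sum>l<n. x i l * y l j) = (if i = j then 1 else 0)"
    and "i < n" "j < n"
  shows "(\<Sum>l<n. y i l * x l j) = (if i = j then 1 else 0)"
proof -
  define X where "X = mat n n (\<lambda>(i, l). x i l)"
  define Y where "Y = mat n n (\<lambda>(i, l). y i l)"
  have [simp]: "X \<in> carrier_mat n n" "Y \<in> carrier_mat n n" by (simp_all add: X_def Y_def)
  have "X * Y = 1\<^sub>m n"
    by (rule eq_matI) (auto simp: X_def Y_def scalar_prod_def assms(1) atLeast0LessThan)
  then have "Y * X = 1\<^sub>m n" by (rule mat_mult_left_right_inverse[rotated 2]) simp_all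
  then have "(Y * X) $$ (i, j) = 1\<^sub>m n $$ (i, j)" by simp
  then show ?thesis using assms(2,3) by (simp add: X_def Y_def scalar_prod_def atLeast0LessThan)
qed

section \<open>Matrices indexed by a finite set\<close>

text \<open>
Square matrices are functions that vanish outside a finite index set (\<open>supported\<close>). With an arbitrary index type, tensor
powers are indexed by pairs and triples and the Kronecker product needs no index arithmetic; vanishing
outside the index set makes equality of matrices equality of functions.
\<close>

type_synonym ('i, 'k) fmat = "'i \<Rightarrow> 'i \<Rightarrow> 'k"

definition mm :: "'i set \<Rightarrow> ('i, 'k::field) fmat \<Rightarrow> ('i, 'k) fmat \<Rightarrow> ('i, 'k) fmat" where
  "mm I A B = (\<lambda>p q. \<Sum>x\<in>I. A p x * B x q)"

definition sc :: "'k::field \<Rightarrow> ('i, 'k) fmat \<Rightarrow> ('i, 'k) fmat" where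
  "sc c A = (\<lambda>p q. c * A p q)"

definition idm :: "'i set \<Rightarrow> ('i, 'k::field) fmat" where
  "idm I = (\<lambda>p q. if p = q \<and> p \<in> I then 1 else 0)"

definition kron :: "('i, 'k::field) fmat \<Rightarrow> ('j, 'k) fmat \<Rightarrow> ('i \<times> 'j, 'k) fmat" where
  "kron A B = (\<lambda>x y. A (fst x) (fst y) * B (snd x) (snd y))"

definition supported :: "'i set \<Rightarrow> ('i, 'k::field) fmat \<Rightarrow> bool" where
  "supported I A \<longleftrightarrow> (\<forall>p q. p \<notin> I \<or> q \<notin> I \<longrightarrow> A p q = 0)"

lemma mm_assoc: "mm I (mm I A B) C = mm I A (mm I B C)"
  by (intro ext, simp add: mm_def sum_distrib_left sum_distrib_right mult.assoc) (subst sum.swap, simp)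

lemma mm_sum_left: "mm I (\<Sum>i\<in>F. A i) B = (\<Sum>i\<in>F. mm I (A i) B)"
  by (intro ext, simp add: mm_def sum_fun_apply sum_distrib_right) (subst sum.swap, simp)

lemma mm_sum_right: "mm I A (\<Sum>i\<in>F. B i) = (\<Sum>i\<in>F. mm I A (B i))"
  by (intro ext, simp add: mm_def sum_fun_apply sum_distrib_left) (subst sum.swap, simp)

lemma mm_sc_left: "mm I (sc c A) B = sc c (mm I A B)"
  by (simp add: mm_def sc_def sum_distrib_left mult.assoc)

lemma mm_sc_right: "mm I A (sc c B) = sc c (mm I A B)"
  by (simp add: mm_def sc_def sum_distrib_left mult.left_commute)

lemma sc_sum: "sc c (\<Sum>i\<in>F. A i) = (\<Sum>i\<in>F. sc c (A i))"
  by (intro ext) (simp add: sc_def sum_fun_apply sum_distrib_left)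

lemma sc_sc: "sc c (sc d A) = sc (c * d) A"
  by (simp add: sc_def mult.assoc)

lemma sc_sum_coeff: "sc (\<Sum>i\<in>F. c i) A = (\<Sum>i\<in>F. sc (c i) A)"
  by (intro ext) (simp add: sc_def sum_fun_apply sum_distrib_right)

lemma sc_one [simp]: "sc 1 A = A"
  by (simp add: sc_def)

lemma kron_sum_left: "kron (\<Sum>i\<in>F. A i) B = (\<Sum>i\<in>F. kron (A i) B)"
  by (intro ext) (simp add: kron_def sum_fun_apply sum_distrib_right)

lemma kron_sum_right: "kron A (\<Sum>i\<in>F. B i) = (\<Sum>i\<in>F. kron A (B i))"
  by (intro ext) (simp add: kron_def sum_fun_apply sum_distrib_left)

lemma kron_sc_left: "kron (sc c A) B = sc c (kron A B)"
  by (simp add: kron_def sc_def mult.assoc)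

lemma kron_sc_right: "kron A (sc c B) = sc c (kron A B)"
  by (simp add: kron_def sc_def mult.left_commute)

lemma kron_mm: "mm (I \<times> J) (kron A B) (kron C D) = kron (mm I A C) (mm J B D)"
  by (intro ext) (simp add: mm_def kron_def sum_product sum.cartesian_product case_prod_beta
      mult.assoc mult.left_commute)

lemma kron_idm: "kron (idm I) (idm J) = idm (I \<times> J)"
  by (intro ext) (auto simp: kron_def idm_def mem_Times_iff prod_eq_iff)

lemma mm_idm_left: "finite I \<Longrightarrow> supported I A \<Longrightarrow> mm I (idm I) A = A"
proof (intro ext)
  fix p q assume "finite I" "supported I A"
  have "mm I (idm I) A p q = (\<Sum>x\<in>I. if p = x then A p q else 0)"
    unfolding mm_def idm_def by (rule sum.cong) auto
  then show "mm I (idm I) A p q = A p q"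
    using \<open>finite I\<close> \<open>supported I A\<close> by (auto simp: supported_def)
qed

lemma mm_idm_right: "finite I \<Longrightarrow> supported I A \<Longrightarrow> mm I A (idm I) = A"
proof (intro ext)
  fix p q assume "finite I" "supported I A"
  have "mm I A (idm I) p q = (\<Sum>x\<in>I. if x = q then A p q else 0)"
    unfolding mm_def idm_def by (rule sum.cong) auto
  then show "mm I A (idm I) p q = A p q"
    using \<open>finite I\<close> \<open>supported I A\<close> by (auto simp: supported_def)
qed

lemma supported_idm [simp]: "supported I (idm I)"
  by (auto simp: supported_def idm_def)

lemma supported_mm [simp]: "supported I A \<Longrightarrow> supported I B \<Longrightarrow> supported I (mm I A B)"
  by (auto simp: supported_def mm_def intro!: sum.neutral)

lemma supported_sc [simp]: "supported I A \<Longrightarrow> supported I (sc c A)"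
  by (auto simp: supported_def sc_def)

lemma supported_kron [simp]: "supported I A \<Longrightarrow> supported J B \<Longrightarrow> supported (I \<times> J) (kron A B)"
  by (auto simp: supported_def kron_def)

lemma supported_sum: "(\<And>i. i \<in> F \<Longrightarrow> supported I (A i)) \<Longrightarrow> supported I (\<Sum>i\<in>F. A i)"
  by (auto simp: supported_def sum_fun_apply intro!: sum.neutral)

lemma supported_sum_lessThan [simp]:
  "(\<And>i. i < k \<Longrightarrow> supported I (A i)) \<Longrightarrow> supported I (\<Sum>i<(k::nat). A i)"
  by (rule supported_sum) simp

lemma mm_add: "mm I (A + B) C = mm I A C + mm I B C" "mm I C (A + B) = mm I C A + mm I C B"
  for A B C :: "('i, 'k::field) fmat"
  by (intro ext, simp add: mm_def algebra_simps sum.distrib)+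

lemmas mm_linear = mm_sum_left mm_sum_right mm_sc_left mm_sc_right

text \<open>
Linear independence, witnessed by a dual family of functionals on matrices.
\<close>

definition indep :: "nat \<Rightarrow> (nat \<Rightarrow> (nat, 'k::field) fmat) \<Rightarrow> bool" where
  "indep n a \<longleftrightarrow> (\<exists>\<phi>. \<forall>i<n. \<forall>j<n. (\<Sum>(p,q)\<in>{..<n}\<times>{..<n}. \<phi> i p q * a j p q) = (if i = j then 1 else 0))"

lemma indep_coeff_eq:
  assumes "indep n a"
    and "\<And>p q. p < n \<Longrightarrow> q < n \<Longrightarrow> (\<Sum>i<n. c i * a i p q) = (\<Sum>i<n. d i * a i p q)"
    and "l < n"
  shows "c l = d l"
proof -
  obtain \<phi> where \<phi>: "\<And>i j. i < n \<Longrightarrow> j < n \<Longrightarrow>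
    (\<Sum>x\<in>{..<n}\<times>{..<n}. \<phi> i (fst x) (snd x) * a j (fst x) (snd x)) = (if i = j then 1 else 0)"
    using assms(1) by (auto simp: indep_def case_prod_beta)
  have *: "c l = (\<Sum>x\<in>{..<n}\<times>{..<n}. \<phi> l (fst x) (snd x) * (\<Sum>i<n. c i * a i (fst x) (snd x)))" for c :: "nat \<Rightarrow> 'a"
  proof -
    have "(\<Sum>x\<in>{..<n}\<times>{..<n}. \<phi> l (fst x) (snd x) * (\<Sum>i<n. c i * a i (fst x) (snd x)))
      = (\<Sum>i<n. c i * (\<Sum>x\<in>{..<n}\<times>{..<n}. \<phi> l (fst x) (snd x) * a i (fst x) (snd x)))"
      unfolding sum_distrib_left by (subst sum.swap) (simp add: mult.left_commute)
    also have "\<dots> = (\<Sum>i<n. c i * (if l = i then 1 else 0))"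
      using \<open>l < n\<close> by (intro sum.cong) (auto simp: \<phi>)
    finally show ?thesis using \<open>l < n\<close> by (simp add: sum_single_delta)
  qed
  show ?thesis
    unfolding *[of c] *[of d] by (rule sum.cong[OF refl]) (auto simp: assms(2))
qed

text \<open>
The functionals dual to one leg, applied to that leg alone, isolate the coefficients in the other leg.
\<close>

lemma indep_kron_right:
  assumes "indep n b" "(\<Sum>i<n. kron (x i) (b i)) = (\<Sum>i<n. kron (y i) (b i))" "l < n"
  shows "x l = y l"
proof (intro ext)
  fix p q
  show "x l p q = y l p q"
  proof (rule indep_coeff_eq[OF assms(1) _ assms(3)])
    fix r s
    from fun_cong[OF fun_cong[OF assms(2)], of "(p, r)" "(q, s)"]
    show "(\<Sum>i<n. x i p q * b i r s) = (\<Sum>i<n. y i p q * b i r s)"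
      by (simp add: sum_fun_apply kron_def)
  qed
qed

lemma indep_kron_left:
  assumes "indep n a" "(\<Sum>i<n. kron (a i) (x i)) = (\<Sum>i<n. kron (a i) (y i))" "l < n"
  shows "x l = y l"
proof (intro ext)
  fix p q
  show "x l p q = y l p q"
  proof (rule indep_coeff_eq[OF assms(1) _ assms(3)])
    fix r s
    from fun_cong[OF fun_cong[OF assms(2)], of "(r, p)" "(s, q)"]
    show "(\<Sum>i<n. x i p q * a i r s) = (\<Sum>i<n. y i p q * a i r s)"
      by (simp add: sum_fun_apply kron_def mult.commute)
  qed
qed

lemma indep_kron:
  assumes a: "indep n a" and b: "indep n b"
    and eq: "(\<Sum>i<n. \<Sum>j<n. sc (c i j) (kron (a i) (b j))) = (\<Sum>i<n. \<Sum>j<n. sc (d i j) (kron (a i) (b j)))"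
    and ij: "i < n" "j < n"
  shows "c i j = d i j"
proof -
  have "(\<Sum>i<n. kron (a i) (\<Sum>j<n. sc (c i j) (b j))) = (\<Sum>i<n. kron (a i) (\<Sum>j<n. sc (d i j) (b j)))"
    using eq by (simp add: kron_sum_right kron_sc_right)
  from indep_kron_left[OF a this ij(1)]
  have "(\<Sum>j<n. sc (c i j) (b j)) = (\<Sum>j<n. sc (d i j) (b j))" .
  then have "(\<Sum>j<n. c i j * b j p q) = (\<Sum>j<n. d i j * b j p q)" for p q
    by (auto simp: sc_def sum_fun_apply dest!: fun_cong)
  from indep_coeff_eq[OF b this ij(2)] show ?thesis .
qed

lemma indep_sc_family:
  fixes X Y :: "nat \<Rightarrow> ('x, 'k::field) fmat"
  assumes "indep n a"
    and "\<And>p q. p < n \<Longrightarrow> q < n \<Longrightarrow> (\<Sum>i<n. sc (a i p q) (X i)) = (\<Sum>i<n. sc (a i p q) (Y i))"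
    and "l < n"
  shows "X l = Y l"
proof (intro ext)
  fix x y
  show "X l x y = Y l x y"
  proof (rule indep_coeff_eq[OF assms(1) _ assms(3)])
    fix p q assume "p < n" "q < n"
    from fun_cong[OF fun_cong[OF assms(2)[OF this]], of x y]
    show "(\<Sum>i<n. X i x y * a i p q) = (\<Sum>i<n. Y i x y * a i p q)"
      by (simp add: sum_fun_apply sc_def mult.commute)
  qed
qed

section \<open>The pentagon equation for matrices\<close>

definition leg12_mat :: "nat \<Rightarrow> (nat \<times> nat, 'k::field) fmat \<Rightarrow> ((nat \<times> nat) \<times> nat, 'k) fmat" where
  "leg12_mat n R = kron R (idm {..<n})"

definition leg13_mat :: "nat \<Rightarrow> (nat \<times> nat, 'k::field) fmat \<Rightarrow> ((nat \<times> nat) \<times> nat, 'k) fmat" where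
  "leg13_mat n R = (\<lambda>x y. idm {..<n} (snd (fst x)) (snd (fst y)) *
     R (fst (fst x), snd x) (fst (fst y), snd y))"

definition leg23_mat :: "nat \<Rightarrow> (nat \<times> nat, 'k::field) fmat \<Rightarrow> ((nat \<times> nat) \<times> nat, 'k) fmat" where
  "leg23_mat n R = (\<lambda>x y. idm {..<n} (fst (fst x)) (fst (fst y)) *
     R (snd (fst x), snd x) (snd (fst y), snd y))"

definition pentagon_mat :: "nat \<Rightarrow> (nat \<times> nat, 'k::field) fmat \<Rightarrow> bool" where
  "pentagon_mat n R \<longleftrightarrow>
     (let J3 = ({..<n} \<times> {..<n}) \<times> {..<n} in
      mm J3 (mm J3 (leg12_mat n R) (leg13_mat n R)) (leg23_mat n R)
      = mm J3 (leg23_mat n R) (leg12_mat n R))"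

lemma sum_pairs: "(\<Sum>z\<in>A \<times> B. h z) = (\<Sum>x\<in>A. \<Sum>y\<in>B. h (x, y))"
  by (simp add: sum.cartesian_product)

lemma sum_idm:
  "finite I \<Longrightarrow> (\<Sum>x\<in>I. idm I p x * h x) = (if p \<in> I then h p else (0::'k::field))"
  "finite I \<Longrightarrow> (\<Sum>x\<in>I. h x * idm I x q) = (if q \<in> I then h q else (0::'k::field))"
proof -
  assume I: "finite I"
  have "(\<Sum>x\<in>I. idm I p x * h x) = (\<Sum>x\<in>I. (if p = x then 1 else 0) * h x)"
    by (rule sum.cong) (auto simp: idm_def)
  with I show "(\<Sum>x\<in>I. idm I p x * h x) = (if p \<in> I then h p else 0)" by (simp add: sum_single_delta)
  have "(\<Sum>x\<in>I. h x * idm I x q) = (\<Sum>x\<in>I. h x * (if x = q then 1 else 0))"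
    by (rule sum.cong) (auto simp: idm_def)
  with I show "(\<Sum>x\<in>I. h x * idm I x q) = (if q \<in> I then h q else 0)" by (simp add: sum_single_delta)
qed

text \<open>
The matrix that remains of an operator on the threefold tensor power when the row and the column index of
the first, respectively third, leg are fixed. An operator of the form \<open>1 \<otimes> X\<close>, respectively \<open>X \<otimes> 1\<close>, commutes
with taking slices, which turns identities between legs into identities between two-leg operators.
\<close>

definition slice1 :: "nat \<Rightarrow> nat \<Rightarrow> ((nat \<times> nat) \<times> nat, 'k::field) fmat \<Rightarrow> (nat \<times> nat, 'k) fmat" where
  "slice1 p q Z = (\<lambda>x y. Z ((p, fst x), snd x) ((q, fst y), snd y))"

definition slice3 :: "nat \<Rightarrow> nat \<Rightarrow> ((nat \<times> nat) \<times> nat, 'k::field) fmat \<Rightarrow> (nat \<times> nat, 'k) fmat" where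
  "slice3 t w Z = (\<lambda>x y. Z (x, t) (y, w))"

lemma slice_sum:
  "slice1 p q (\<Sum>i\<in>F. Z i) = (\<Sum>i\<in>F. slice1 p q (Z i))"
  "slice3 p q (\<Sum>i\<in>F. Z i) = (\<Sum>i\<in>F. slice3 p q (Z i))"
  by (intro ext, simp add: slice1_def slice3_def sum_fun_apply)+

lemma slice_kron:
  "slice1 p q (kron (kron A B) C) = sc (A p q) (kron B C)"
  "slice3 t w (kron Z C) = sc (C t w) Z"
  by (intro ext, simp add: slice1_def slice3_def kron_def sc_def mult.assoc mult.commute)+

locale matrix_size =
  fixes n :: nat
begin

abbreviation mul1 :: "(nat, 'k::field) fmat \<Rightarrow> (nat, 'k) fmat \<Rightarrow> (nat, 'k) fmat" (infixl "*\<^sub>1" 70)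
  where "A *\<^sub>1 B \<equiv> mm {..<n} A B"
abbreviation mul2 :: "(nat \<times> nat, 'k::field) fmat \<Rightarrow> (nat \<times> nat, 'k) fmat \<Rightarrow> (nat \<times> nat, 'k) fmat"
  (infixl "*\<^sub>2" 70)
  where "A *\<^sub>2 B \<equiv> mm ({..<n} \<times> {..<n}) A B"
abbreviation mul3 :: "((nat \<times> nat) \<times> nat, 'k::field) fmat \<Rightarrow> ((nat \<times> nat) \<times> nat, 'k) fmat
   \<Rightarrow> ((nat \<times> nat) \<times> nat, 'k) fmat" (infixl "*\<^sub>3" 70)
  where "A *\<^sub>3 B \<equiv> mm (({..<n} \<times> {..<n}) \<times> {..<n}) A B"
abbreviation one1 :: "(nat, 'k::field) fmat" ("1\<^sub>1") where "1\<^sub>1 \<equiv> idm {..<n}"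
abbreviation one2 :: "(nat \<times> nat, 'k::field) fmat" ("1\<^sub>2") where "1\<^sub>2 \<equiv> idm ({..<n} \<times> {..<n})"
abbreviation one3 :: "((nat \<times> nat) \<times> nat, 'k::field) fmat" ("1\<^sub>3")
  where "1\<^sub>3 \<equiv> idm (({..<n} \<times> {..<n}) \<times> {..<n})"
abbreviation "supp1 \<equiv> supported {..<n}"
abbreviation "supp2 \<equiv> supported ({..<n} \<times> {..<n})"
abbreviation "supp3 \<equiv> supported (({..<n} \<times> {..<n}) \<times> {..<n})"
abbreviation "L12 \<equiv> leg12_mat n"
abbreviation "L13 \<equiv> leg13_mat n"
abbreviation "L23 \<equiv> leg23_mat n"

lemma mul_kron: "kron A B *\<^sub>2 kron C D = kron (A *\<^sub>1 C) (B *\<^sub>1 D)"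
  "kron X A *\<^sub>3 kron Y B = kron (X *\<^sub>2 Y) (A *\<^sub>1 B)"
  by (simp_all add: kron_mm)

lemma unit_laws [simp]:
  "supp1 A \<Longrightarrow> 1\<^sub>1 *\<^sub>1 A = A" "supp1 A \<Longrightarrow> A *\<^sub>1 1\<^sub>1 = A"
  "supp2 X \<Longrightarrow> 1\<^sub>2 *\<^sub>2 X = X" "supp2 X \<Longrightarrow> X *\<^sub>2 1\<^sub>2 = X"
  "supp3 Y \<Longrightarrow> 1\<^sub>3 *\<^sub>3 Y = Y" "supp3 Y \<Longrightarrow> Y *\<^sub>3 1\<^sub>3 = Y"
  by (simp_all add: mm_idm_left mm_idm_right)

lemma supp_legs [simp]: "supp2 X \<Longrightarrow> supp3 (L12 X)" "supp2 X \<Longrightarrow> supp3 (L13 X)"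
  "supp2 X \<Longrightarrow> supp3 (L23 X)"
  by (auto simp: supported_def leg12_mat_def leg13_mat_def leg23_mat_def kron_def idm_def)

lemma legs_one [simp]: "L12 1\<^sub>2 = 1\<^sub>3" "L13 1\<^sub>2 = 1\<^sub>3" "L23 1\<^sub>2 = 1\<^sub>3"
  by (intro ext; auto simp: leg12_mat_def leg13_mat_def leg23_mat_def kron_def idm_def prod_eq_iff
      mem_Times_iff)+

lemma leg12_mult: "L12 (X *\<^sub>2 Y) = L12 X *\<^sub>3 L12 Y"
  by (simp add: leg12_mat_def kron_mm)

lemma leg23_mult: "L23 (X *\<^sub>2 Y) = L23 X *\<^sub>3 L23 Y"
proof (intro ext)
  fix x y :: "(nat \<times> nat) \<times> nat"
  obtain p r t q s w where xy: "x = ((p, r), t)" "y = ((q, s), w)" by (metis surj_pair)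
  have "(L23 X *\<^sub>3 L23 Y) x y = (\<Sum>u<n. 1\<^sub>1 p u * (\<Sum>v<n. \<Sum>z<n. X (r, t) (v, z) * (1\<^sub>1 u q * Y (v, z) (s, w))))"
    by (simp add: mm_def leg23_mat_def xy sum_pairs sum_distrib_left mult.assoc)
  also have "\<dots> = L23 (X *\<^sub>2 Y) x y"
    by (simp add: sum_idm leg23_mat_def xy mm_def sum_pairs) (auto simp: idm_def)
  finally show "L23 (X *\<^sub>2 Y) x y = (L23 X *\<^sub>3 L23 Y) x y" by simp
qed

lemma leg13_mult: "L13 (X *\<^sub>2 Y) = L13 X *\<^sub>3 L13 Y"
proof (intro ext)
  fix x y :: "(nat \<times> nat) \<times> nat"
  obtain p r t q s w where xy: "x = ((p, r), t)" "y = ((q, s), w)" by (metis surj_pair)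
  have "(L13 X *\<^sub>3 L13 Y) x y = (\<Sum>u<n. \<Sum>v<n. 1\<^sub>1 r v * (\<Sum>z<n. X (p, t) (u, z) * (1\<^sub>1 v s * Y (u, z) (q, w))))"
    by (simp add: mm_def leg13_mat_def xy sum_pairs sum_distrib_left mult.assoc)
  also have "\<dots> = L13 (X *\<^sub>2 Y) x y"
    by (simp add: sum_idm leg13_mat_def xy mm_def sum_pairs) (auto simp: idm_def)
  finally show "L13 (X *\<^sub>2 Y) x y = (L13 X *\<^sub>3 L13 Y) x y" by simp
qed

lemma legs_kron:
  "L12 (kron A B) = kron (kron A B) 1\<^sub>1" "L13 (kron A B) = kron (kron A 1\<^sub>1) B"
  "L23 (kron A B) = kron (kron 1\<^sub>1 A) B"
  by (intro ext; simp add: leg12_mat_def leg13_mat_def leg23_mat_def kron_def mult.assoc mult.commute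
    mult.left_commute)+

lemma legs_sum:
  "L12 (\<Sum>i\<in>F. X i) = (\<Sum>i\<in>F. L12 (X i))" "L13 (\<Sum>i\<in>F. X i) = (\<Sum>i\<in>F. L13 (X i))"
  "L23 (\<Sum>i\<in>F. X i) = (\<Sum>i\<in>F. L23 (X i))"
  by (intro ext; simp add: leg12_mat_def leg13_mat_def leg23_mat_def kron_def sum_fun_apply
    sum_distrib_left sum_distrib_right)+

lemma slice1_leg23_left: "p < n \<Longrightarrow> slice1 p q (L23 X *\<^sub>3 Z) = X *\<^sub>2 slice1 p q Z"
proof (intro ext)
  fix x y :: "nat \<times> nat" assume p: "p < n"
  have "slice1 p q (L23 X *\<^sub>3 Z) x y
    = (\<Sum>u<n. 1\<^sub>1 p u * (\<Sum>v<n. \<Sum>z<n. X x (v, z) * Z ((u, v), z) ((q, fst y), snd y)))"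
    by (simp add: slice1_def mm_def leg23_mat_def sum_pairs sum_distrib_left mult.assoc)
  then show "slice1 p q (L23 X *\<^sub>3 Z) x y = (X *\<^sub>2 slice1 p q Z) x y"
    using p by (simp add: sum_idm mm_def sum_pairs slice1_def)
qed

lemma slice1_leg23_right: "q < n \<Longrightarrow> slice1 p q (Z *\<^sub>3 L23 X) = slice1 p q Z *\<^sub>2 X"
proof (intro ext)
  fix x y :: "nat \<times> nat" assume q: "q < n"
  have "slice1 p q (Z *\<^sub>3 L23 X) x y
    = (\<Sum>u<n. (\<Sum>v<n. \<Sum>z<n. Z ((p, fst x), snd x) ((u, v), z) * X (v, z) y) * 1\<^sub>1 u q)"
    by (simp add: slice1_def mm_def leg23_mat_def sum_pairs sum_distrib_left mult.assoc mult.commute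
      mult.left_commute)
  then show "slice1 p q (Z *\<^sub>3 L23 X) x y = (slice1 p q Z *\<^sub>2 X) x y"
    using q by (simp add: sum_idm mm_def sum_pairs slice1_def)
qed

lemma slice3_leg12_left: "t < n \<Longrightarrow> slice3 t w (L12 X *\<^sub>3 Z) = X *\<^sub>2 slice3 t w Z"
proof (intro ext)
  fix x y :: "nat \<times> nat" assume t: "t < n"
  have "slice3 t w (L12 X *\<^sub>3 Z) x y
    = (\<Sum>u\<in>{..<n}\<times>{..<n}. \<Sum>z<n. 1\<^sub>1 t z * (X x u * Z (u, z) (y, w)))"
    by (simp add: slice3_def mm_def leg12_mat_def kron_def sum_pairs mult.assoc mult.left_commute)
  then show "slice3 t w (L12 X *\<^sub>3 Z) x y = (X *\<^sub>2 slice3 t w Z) x y"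
    using t by (simp add: sum_idm mm_def slice3_def)
qed

lemma slice3_leg12_right: "w < n \<Longrightarrow> slice3 t w (Z *\<^sub>3 L12 X) = slice3 t w Z *\<^sub>2 X"
proof (intro ext)
  fix x y :: "nat \<times> nat" assume w: "w < n"
  have "slice3 t w (Z *\<^sub>3 L12 X) x y
    = (\<Sum>u\<in>{..<n}\<times>{..<n}. \<Sum>z<n. (Z (x, t) (u, z) * X u y) * 1\<^sub>1 z w)"
    by (simp add: slice3_def mm_def leg12_mat_def kron_def sum_pairs mult.assoc)
  then show "slice3 t w (Z *\<^sub>3 L12 X) x y = (slice3 t w Z *\<^sub>2 X) x y"
    using w by (simp add: sum_idm mm_def slice3_def)
qed

end

locale pentagon_solution = matrix_size n for n +
  fixes R R' :: "(nat \<times> nat, 'k::field) fmat"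
  assumes pos: "n > 0"
    and supp_R [simp]: "supp2 R" and supp_R' [simp]: "supp2 R'"
    and R_R' [simp]: "R *\<^sub>2 R' = 1\<^sub>2"
    and R'_R [simp]: "R' *\<^sub>2 R = 1\<^sub>2"
    and pentagon: "pentagon_mat n R"
begin

lemma pentagon_legs: "L12 R *\<^sub>3 L13 R *\<^sub>3 L23 R = L23 R *\<^sub>3 L12 R"
  using pentagon by (simp add: pentagon_mat_def Let_def)

lemma leg_inverse [simp]:
  "L12 R *\<^sub>3 L12 R' = 1\<^sub>3" "L12 R' *\<^sub>3 L12 R = 1\<^sub>3"
  "L13 R *\<^sub>3 L13 R' = 1\<^sub>3" "L13 R' *\<^sub>3 L13 R = 1\<^sub>3"
  "L23 R *\<^sub>3 L23 R' = 1\<^sub>3" "L23 R' *\<^sub>3 L23 R = 1\<^sub>3"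
  by (simp_all flip: leg12_mult leg13_mult leg23_mult)

lemma leg_cancel [simp]:
  assumes "supp3 Z"
  shows "L12 R *\<^sub>3 (L12 R' *\<^sub>3 Z) = Z" "L12 R' *\<^sub>3 (L12 R *\<^sub>3 Z) = Z"
  "L13 R *\<^sub>3 (L13 R' *\<^sub>3 Z) = Z" "L13 R' *\<^sub>3 (L13 R *\<^sub>3 Z) = Z"
  "L23 R *\<^sub>3 (L23 R' *\<^sub>3 Z) = Z" "L23 R' *\<^sub>3 (L23 R *\<^sub>3 Z) = Z"
  using assms by (simp_all flip: mm_assoc)

lemma legs_12_13: "L12 R *\<^sub>3 L13 R = L23 R *\<^sub>3 L12 R *\<^sub>3 L23 R'"
proof -
  have "L12 R *\<^sub>3 L13 R *\<^sub>3 L23 R *\<^sub>3 L23 R' = L12 R *\<^sub>3 L13 R"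
    by (simp add: mm_assoc)
  then show ?thesis by (simp add: pentagon_legs)
qed

lemma legs_13_23: "L13 R *\<^sub>3 L23 R = L12 R' *\<^sub>3 L23 R *\<^sub>3 L12 R"
proof -
  have "L12 R' *\<^sub>3 (L12 R *\<^sub>3 L13 R *\<^sub>3 L23 R) = L13 R *\<^sub>3 L23 R"
    by (simp add: mm_assoc)
  then show ?thesis unfolding pentagon_legs by (simp only: mm_assoc)
qed

lemma legs_13_12_inverse: "L13 R' *\<^sub>3 L12 R' = L23 R *\<^sub>3 L12 R' *\<^sub>3 L23 R'"
proof -
  have "L23 R *\<^sub>3 L12 R' *\<^sub>3 L23 R' = L23 R *\<^sub>3 L12 R' *\<^sub>3 L23 R' *\<^sub>3 (L12 R *\<^sub>3 L13 R *\<^sub>3 (L13 R' *\<^sub>3 L12 R'))"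
    by (simp add: mm_assoc)
  also have "\<dots> = L23 R *\<^sub>3 L12 R' *\<^sub>3 L23 R' *\<^sub>3 (L23 R *\<^sub>3 L12 R *\<^sub>3 L23 R' *\<^sub>3 (L13 R' *\<^sub>3 L12 R'))"
    by (simp only: legs_12_13)
  also have "\<dots> = L13 R' *\<^sub>3 L12 R'" by (simp add: mm_assoc)
  finally show ?thesis by simp
qed

lemma legs_23_13_inverse: "L23 R' *\<^sub>3 L13 R' = L12 R' *\<^sub>3 L23 R' *\<^sub>3 L12 R"
proof -
  have "L12 R' *\<^sub>3 L23 R' *\<^sub>3 L12 R = L12 R' *\<^sub>3 L23 R' *\<^sub>3 L12 R *\<^sub>3 (L13 R *\<^sub>3 L23 R *\<^sub>3 (L23 R' *\<^sub>3 L13 R'))"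
    by (simp add: mm_assoc)
  also have "\<dots> = L12 R' *\<^sub>3 L23 R' *\<^sub>3 L12 R *\<^sub>3 (L12 R' *\<^sub>3 L23 R *\<^sub>3 L12 R *\<^sub>3 (L23 R' *\<^sub>3 L13 R'))"
    by (simp only: legs_13_23)
  also have "\<dots> = L23 R' *\<^sub>3 L13 R'" by (simp add: mm_assoc)
  finally show ?thesis by simp
qed

text \<open>
The entry \<open>(p, q)\<close> in the first leg of \<open>R\<^sup>1\<^sup>2 R\<^sup>1\<^sup>3 = R\<^sup>2\<^sup>3 R\<^sup>1\<^sup>2 (R\<^sup>2\<^sup>3)\<^sup>-\<^sup>1\<close>. The left-hand side involves products of the
first legs, the right-hand side conjugates the second ones: this links the product of the \<open>a\<^sub>i\<close> to a
comultiplication of the \<open>b\<^sub>i\<close>.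
\<close>

lemma comult_slices:
  assumes R: "R = (\<Sum>i<n. kron (a i) (b i))"
    and supp: "\<And>i. i < n \<Longrightarrow> supp1 (a i)" "\<And>i. i < n \<Longrightarrow> supp1 (b i)"
    and pq: "p < n" "q < n"
  shows "(\<Sum>i<n. \<Sum>j<n. sc ((a i *\<^sub>1 a j) p q) (kron (b i) (b j)))
    = (\<Sum>k<n. sc (a k p q) (R *\<^sub>2 kron (b k) 1\<^sub>1 *\<^sub>2 R'))"
proof -
  have "slice1 p q (L12 R *\<^sub>3 L13 R) = (\<Sum>i<n. \<Sum>j<n. sc ((a i *\<^sub>1 a j) p q) (kron (b i) (b j)))"
    using supp by (simp add: R legs_sum legs_kron mm_sum_left)
      (simp add: mm_sum_right mul_kron slice_sum slice_kron)
  moreover have "slice1 p q (L12 R) = (\<Sum>k<n. sc (a k p q) (kron (b k) 1\<^sub>1))"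
    by (simp add: R legs_sum legs_kron slice_sum slice_kron)
  ultimately show ?thesis
    using pq by (simp add: legs_12_13 slice1_leg23_left slice1_leg23_right mm_linear mm_assoc)
qed

text \<open>
The same for the inverse of the equation. Inversion reverses the order of factors, so the second legs of
\<open>R\<^sup>-\<^sup>1\<close>, the antipodes of those of \<open>R\<close>, are comultiplied in the opposite order.
\<close>

lemma comult_inverse_slices:
  assumes R': "R' = (\<Sum>i<n. kron (a i) (b i))"
    and supp: "\<And>i. i < n \<Longrightarrow> supp1 (a i)" "\<And>i. i < n \<Longrightarrow> supp1 (b i)"
    and pq: "p < n" "q < n"
  shows "(\<Sum>i<n. \<Sum>j<n. sc ((a i *\<^sub>1 a j) p q) (kron (b j) (b i)))
    = (\<Sum>k<n. sc (a k p q) (R *\<^sub>2 kron (b k) 1\<^sub>1 *\<^sub>2 R'))"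
proof -
  have "slice1 p q (L13 R' *\<^sub>3 L12 R') = (\<Sum>i<n. \<Sum>j<n. sc ((a i *\<^sub>1 a j) p q) (kron (b j) (b i)))"
    using supp by (simp add: R' legs_sum legs_kron mm_sum_left)
      (simp add: mm_sum_right mul_kron slice_sum slice_kron)
  moreover have "slice1 p q (L12 R') = (\<Sum>k<n. sc (a k p q) (kron (b k) 1\<^sub>1))"
    by (simp add: R' legs_sum legs_kron slice_sum slice_kron)
  ultimately show ?thesis
    using pq by (simp add: legs_13_12_inverse slice1_leg23_left slice1_leg23_right mm_linear mm_assoc)
qed

text \<open>
The entry \<open>(t, w)\<close> in the third leg of \<open>R\<^sup>1\<^sup>3 R\<^sup>2\<^sup>3 = (R\<^sup>1\<^sup>2)\<^sup>-\<^sup>1 R\<^sup>2\<^sup>3 R\<^sup>1\<^sup>2\<close>, with the roles of the two legs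
exchanged.
\<close>

lemma mult_slices:
  assumes R: "R = (\<Sum>i<n. kron (a i) (b i))"
    and supp: "\<And>i. i < n \<Longrightarrow> supp1 (a i)" "\<And>i. i < n \<Longrightarrow> supp1 (b i)"
    and tw: "t < n" "w < n"
  shows "(\<Sum>i<n. \<Sum>j<n. sc ((b i *\<^sub>1 b j) t w) (kron (a i) (a j)))
    = (\<Sum>k<n. sc (b k t w) (R' *\<^sub>2 kron 1\<^sub>1 (a k) *\<^sub>2 R))"
proof -
  have "slice3 t w (L13 R *\<^sub>3 L23 R) = (\<Sum>i<n. \<Sum>j<n. sc ((b i *\<^sub>1 b j) t w) (kron (a i) (a j)))"
    using supp by (simp add: R legs_sum legs_kron mm_sum_left)
      (simp add: mm_sum_right mul_kron slice_sum slice_kron)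
  moreover have "slice3 t w (L23 R) = (\<Sum>k<n. sc (b k t w) (kron 1\<^sub>1 (a k)))"
    by (simp add: R legs_sum legs_kron slice_sum slice_kron)
  ultimately show ?thesis
    using tw by (simp add: legs_13_23 slice3_leg12_left slice3_leg12_right mm_linear mm_assoc)
qed

lemma mult_inverse_slices:
  assumes R': "R' = (\<Sum>i<n. kron (a i) (b i))"
    and supp: "\<And>i. i < n \<Longrightarrow> supp1 (a i)" "\<And>i. i < n \<Longrightarrow> supp1 (b i)"
    and tw: "t < n" "w < n"
  shows "(\<Sum>i<n. \<Sum>j<n. sc ((b i *\<^sub>1 b j) t w) (kron (a j) (a i)))
    = (\<Sum>k<n. sc (b k t w) (R' *\<^sub>2 kron 1\<^sub>1 (a k) *\<^sub>2 R))"
proof -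
  have "slice3 t w (L23 R' *\<^sub>3 L13 R') = (\<Sum>i<n. \<Sum>j<n. sc ((b i *\<^sub>1 b j) t w) (kron (a j) (a i)))"
    using supp by (simp add: R' legs_sum legs_kron mm_sum_left)
      (simp add: mm_sum_right mul_kron slice_sum slice_kron)
  moreover have "slice3 t w (L23 R') = (\<Sum>k<n. sc (b k t w) (kron 1\<^sub>1 (a k)))"
    by (simp add: R' legs_sum legs_kron slice_sum slice_kron)
  ultimately show ?thesis
    using tw by (simp add: legs_23_13_inverse slice3_leg12_left slice3_leg12_right mm_linear mm_assoc)
qed

end

section \<open>Units lie in subalgebras\<close>

lemma mm_funpow_sum: "(mm J R ^^ k) (\<Sum>i\<in>F. sc (c i) (Z i)) = (\<Sum>i\<in>F. sc (c i) ((mm J R ^^ k) (Z i)))"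
  by (induction k) (simp_all add: mm_linear)

lemma supported_funpow: "supported J R \<Longrightarrow> supported J Z \<Longrightarrow> supported J ((mm J R ^^ k) Z)"
  by (induction k) simp_all

text \<open>
More matrices than there are entries cannot have a dual family.
\<close>

lemma powers_dependent:
  fixes R :: "('i, 'k::field) fmat"
  assumes J: "finite J" and R: "supported J R"
  shows "\<exists>k c. (mm J R ^^ k) (idm J) = (\<Sum>i<k. sc (c i) ((mm J R ^^ i) (idm J)))"
proof -
  let ?a = "\<lambda>k x. (mm J R ^^ k) (idm J) (fst x) (snd x)"
  have K: "finite (J \<times> J)" using J by simp
  have "\<not> (\<exists>\<phi>. \<forall>i<Suc (card (J \<times> J)). \<forall>j<Suc (card (J \<times> J)).
      (\<Sum>x\<in>J\<times>J. \<phi> i x * ?a j x) = (if i = j then 1 else 0))"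
  proof
    assume "\<exists>\<phi>. \<forall>i<Suc (card (J \<times> J)). \<forall>j<Suc (card (J \<times> J)).
      (\<Sum>x\<in>J\<times>J. \<phi> i x * ?a j x) = (if i = j then 1 else 0)"
    then obtain \<phi> where "\<And>i j. i < Suc (card (J \<times> J)) \<Longrightarrow> j < Suc (card (J \<times> J)) \<Longrightarrow>
      (\<Sum>x\<in>J\<times>J. \<phi> i x * ?a j x) = (if i = j then 1 else 0)" by blast
    from identity_factor_bound[OF K, of "Suc (card (J \<times> J))" \<phi> "\<lambda>x j. ?a j x", OF this]
    show False by simp
  qed
  with dual_family_or_dependent[OF K, of "Suc (card (J \<times> J))" ?a]
  obtain k c where kc: "\<forall>x\<in>J\<times>J. ?a k x = (\<Sum>i<k. c i * ?a i x)" by blast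
  have "(mm J R ^^ k) (idm J) = (\<Sum>i<k. sc (c i) ((mm J R ^^ i) (idm J)))"
  proof (intro ext)
    fix p q
    have supp: "supported J ((mm J R ^^ i) (idm J))" for i
      by (rule supported_funpow[OF R]) simp
    then have "supported J (\<Sum>i<k. sc (c i) ((mm J R ^^ i) (idm J)))" by simp
    with supp[of k] kc show "(mm J R ^^ k) (idm J) p q = (\<Sum>i<k. sc (c i) ((mm J R ^^ i) (idm J))) p q"
      by (cases "p \<in> J \<and> q \<in> J") (auto simp: supported_def sum_fun_apply sc_def)
  qed
  then show ?thesis by blast
qed

text \<open>
A linear relation between the powers of \<open>R\<^sup>-\<^sup>1\<close>, multiplied by a high power of \<open>R\<close>, expresses \<open>1\<close> by positive
powers of \<open>R\<close>, which lie in \<open>P\<close>; one more factor \<open>R\<^sup>-\<^sup>1\<close> gives \<open>R\<^sup>-\<^sup>1\<close> itself. It matters that \<open>P\<close> is not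
supposed to contain the unit: for the span of the \<open>a\<^sub>i \<otimes> b\<^sub>j\<close> this is part of what has to be shown.
\<close>

lemma inverse_in_subalgebra:
  fixes R R' :: "('i, 'k::field) fmat"
  assumes J: "finite J" and supp: "supported J R" "supported J R'"
    and inv: "mm J R R' = idm J" "mm J R' R = idm J"
    and zero: "P 0" and add: "\<And>X Y. P X \<Longrightarrow> P Y \<Longrightarrow> P (X + Y)"
    and sc: "\<And>c X. P X \<Longrightarrow> P (sc c X)" and mm: "\<And>X Y. P X \<Longrightarrow> P Y \<Longrightarrow> P (mm J X Y)"
    and R: "P R"
  shows "P (idm J)" "P R'"
proof -
  \<comment> \<open>After multiplication by the power \<open>k\<close> of \<open>R\<close>, the leading term of this relation is the unit.\<close>
  obtain k c where kc: "(mm J R' ^^ k) (idm J) = (\<Sum>i<k. sc (c i) ((mm J R' ^^ i) (idm J)))"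
    using powers_dependent[OF J supp(2)] by blast
  have cancel: "mm J R (mm J R' Z) = Z" "mm J R' (mm J R Z) = Z" if "supported J Z" for Z
    using J that by (simp_all flip: mm_assoc add: inv mm_idm_left)
  have power_cancel: "(mm J R ^^ k) ((mm J R' ^^ i) (idm J)) = (mm J R ^^ (k - i)) (idm J)" if "i \<le> k" for i k
    using that
  proof (induction i arbitrary: k)
    case (Suc i)
    then obtain k' where k': "k = Suc k'" by (cases k) auto
    have "(mm J R ^^ Suc k') ((mm J R' ^^ Suc i) (idm J))
      = (mm J R ^^ k') (mm J R (mm J R' ((mm J R' ^^ i) (idm J))))"
      by (subst funpow_Suc_right[of k']) simp
    then show ?case using Suc k' by (simp add: cancel supported_funpow[OF supp(2)] del: funpow.simps)
  qed simp
  have sum: "P (\<Sum>i\<in>F. Z i)" if "\<And>i. i \<in> F \<Longrightarrow> P (Z i)" for F and Z :: "nat \<Rightarrow> ('i, 'k) fmat"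
    using that by (induction F rule: infinite_finite_induct) (auto intro: zero add)
  have power: "P ((mm J R ^^ Suc i) (idm J))" for i
    by (induction i) (use supp J R mm in \<open>simp_all add: mm_idm_right\<close>)
  have "idm J = (mm J R ^^ k) ((mm J R' ^^ k) (idm J))" by (simp add: power_cancel)
  also have "\<dots> = (\<Sum>i<k. sc (c i) ((mm J R ^^ (k - i)) (idm J)))"
    unfolding kc mm_funpow_sum by (rule sum.cong) (auto simp: power_cancel)
  finally have one: "idm J = (\<Sum>i<k. sc (c i) ((mm J R ^^ (k - i)) (idm J)))" .
  have "P (\<Sum>i<k. sc (c i) ((mm J R ^^ (k - i)) (idm J)))"
  proof (intro sum sc)
    fix i assume "i \<in> {..<k}"
    then have "k - i = Suc (k - i - 1)" by simp
    then show "P ((mm J R ^^ (k - i)) (idm J))" using power[of "k - i - 1"] by (simp only:)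
  qed
  then show 1: "P (idm J)" by (simp only: one[symmetric])
  have power': "P ((mm J R ^^ i) (idm J))" for i
    using power[of "i - 1"] 1 by (cases i) auto
  have drop: "mm J R' ((mm J R ^^ Suc j) (idm J)) = (mm J R ^^ j) (idm J)" for j
    by (simp add: cancel supported_funpow[OF supp(1)])
  have "R' = mm J R' (idm J)" using J supp by (simp add: mm_idm_right)
  also have "\<dots> = (\<Sum>i<k. sc (c i) (mm J R' ((mm J R ^^ (k - i)) (idm J))))"
    by (subst one) (simp add: mm_linear)
  also have "\<dots> = (\<Sum>i<k. sc (c i) ((mm J R ^^ (k - i - 1)) (idm J)))"
  proof (rule sum.cong[OF refl])
    fix i assume "i \<in> {..<k}"
    then have "k - i = Suc (k - i - 1)" by simp
    then show "sc (c i) (mm J R' ((mm J R ^^ (k - i)) (idm J))) = sc (c i) ((mm J R ^^ (k - i - 1)) (idm J))"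
      using drop[of "k - i - 1"] by (simp only:)
  qed
  finally show "P R'" using power' by (auto intro: sum sc)
qed

section \<open>Structure constants of a solution\<close>

text \<open>
Tensor products of dual functionals, bundled with linearity.
\<close>

lemma kron_dual_functional:
  fixes a b :: "nat \<Rightarrow> (nat, 'k::field) fmat"
  assumes "indep n a" "indep n b"
  obtains F :: "nat \<Rightarrow> nat \<Rightarrow> (nat \<times> nat, 'k) fmat \<Rightarrow> 'k"
  where "\<And>i j x. i < n \<Longrightarrow> j < n \<Longrightarrow> F i j (\<Sum>i<n. \<Sum>j<n. sc (x i j) (kron (a i) (b j))) = x i j"
    and "\<And>i j y Z. F i j (\<Sum>k<n. sc (y k) (Z k)) = (\<Sum>k<n. y k * F i j (Z k))"
proof -
  obtain \<phi> where \<phi>: "\<And>i j. i < n \<Longrightarrow> j < n \<Longrightarrow>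
    (\<Sum>x\<in>{..<n}\<times>{..<n}. \<phi> i (fst x) (snd x) * a j (fst x) (snd x)) = (if i = j then 1 else 0)"
    using assms(1) by (auto simp: indep_def case_prod_beta)
  obtain \<psi> where \<psi>: "\<And>i j. i < n \<Longrightarrow> j < n \<Longrightarrow>
    (\<Sum>x\<in>{..<n}\<times>{..<n}. \<psi> i (fst x) (snd x) * b j (fst x) (snd x)) = (if i = j then 1 else 0)"
    using assms(2) by (auto simp: indep_def case_prod_beta)
  let ?K = "{..<n}\<times>{..<n}"
  define F where "F i j Z = (\<Sum>x\<in>?K. \<Sum>y\<in>?K. \<phi> i (fst x) (snd x) * \<psi> j (fst y) (snd y) *
    Z (fst x, fst y) (snd x, snd y))" for i j and Z :: "(nat \<times> nat, 'k) fmat"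
  have add: "F i j (\<Sum>k\<in>G. Z k) = (\<Sum>k\<in>G. F i j (Z k))" for i j G and Z :: "nat \<Rightarrow> (nat \<times> nat, 'k) fmat"
    unfolding F_def sum_fun_apply sum_distrib_left
    by (subst sum.swap[of _ G ?K], subst sum.swap[of _ G ?K]) simp
  have sc: "F i j (sc c Z) = c * F i j Z" for i j c Z
    by (simp add: F_def sc_def sum_distrib_left mult.left_commute)
  have kron: "F i j (kron (a i') (b j')) = (if i = i' then 1 else 0) * (if j = j' then 1 else 0)"
    if "i < n" "j < n" "i' < n" "j' < n" for i j i' j'
  proof -
    have "F i j (kron (a i') (b j')) = (\<Sum>x\<in>?K. \<phi> i (fst x) (snd x) * a i' (fst x) (snd x)) *
      (\<Sum>y\<in>?K. \<psi> j (fst y) (snd y) * b j' (fst y) (snd y))"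
      by (simp add: F_def kron_def sum_product mult_ac)
    then show ?thesis using that by (simp add: \<phi> \<psi>)
  qed
  show thesis
  proof (rule that)
    fix i j x assume ij: "i < n" "j < n"
    have "F i j (\<Sum>i<n. \<Sum>j<n. sc (x i j) (kron (a i) (b j))) =
      (\<Sum>i'<n. \<Sum>j'<n. x i' j' * ((if i = i' then 1 else 0) * (if j = j' then 1 else 0)))"
      using ij by (simp add: add sc kron)
    also have "\<dots> = (\<Sum>i'<n. (if i = i' then 1 else 0) * (\<Sum>j'<n. x i' j' * (if j = j' then 1 else 0)))"
      by (simp add: sum_distrib_left mult_ac)
    also have "\<dots> = x i j" using ij by (simp add: sum_single_delta)
    finally show "F i j (\<Sum>i<n. \<Sum>j<n. sc (x i j) (kron (a i) (b j))) = x i j" .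
  qed (simp add: add sc)
qed

text \<open>
The slice identities have the form \<open>\<Sum> X\<^sub>i\<^sub>j(p,q) K\<^sub>i\<^sub>j = \<Sum> a\<^sub>k(p,q) Y\<^sub>k\<close>. If the \<open>X\<^sub>i\<^sub>j\<close> are combinations of the independent
\<open>a\<^sub>k\<close>, comparing coefficients determines the \<open>Y\<^sub>k\<close>; the next lemma goes in the opposite direction. With a
product for \<open>X\<close> and a conjugate for \<open>Y\<close>, multiplication of one leg and comultiplication of the other thus
have the same structure constants.
\<close>

lemma slice_structure_right:
  fixes a :: "nat \<Rightarrow> (nat, 'k::field) fmat" and Y :: "nat \<Rightarrow> ('x, 'k) fmat"
  assumes a: "indep n a"
    and X: "\<And>i j. i < n \<Longrightarrow> j < n \<Longrightarrow> X i j = (\<Sum>k<n. sc (d k i j) (a k))"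
    and slices: "\<And>p q. p < n \<Longrightarrow> q < n \<Longrightarrow>
      (\<Sum>i<n. \<Sum>j<n. sc (X i j p q) (K i j)) = (\<Sum>k<n. sc (a k p q) (Y k))"
    and k: "k < n"
  shows "Y k = (\<Sum>i<n. \<Sum>j<n. sc (d k i j) (K i j))"
proof (rule indep_sc_family[OF a _ k])
  fix p q assume pq: "p < n" "q < n"
  have "(\<Sum>k<n. sc (a k p q) (Y k)) = (\<Sum>i<n. \<Sum>j<n. sc (\<Sum>k<n. d k i j * a k p q) (K i j))"
    unfolding slices[OF pq, symmetric] by (intro sum.cong) (auto simp: X sum_fun_apply sc_def)
  also have "\<dots> = (\<Sum>i<n. \<Sum>j<n. \<Sum>k<n. sc (a k p q) (sc (d k i j) (K i j)))"
    by (simp add: sc_sum_coeff sc_sc mult.commute)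
  also have "\<dots> = (\<Sum>k<n. \<Sum>i<n. \<Sum>j<n. sc (a k p q) (sc (d k i j) (K i j)))"
    by (rule trans[OF sum.cong[OF refl sum.swap] sum.swap])
  finally show "(\<Sum>k<n. sc (a k p q) (Y k)) = (\<Sum>k<n. sc (a k p q) (\<Sum>i<n. \<Sum>j<n. sc (d k i j) (K i j)))"
    by (simp add: sc_sum)
qed

lemma slice_structure_left:
  fixes a b b' :: "nat \<Rightarrow> (nat, 'k::field) fmat"
  assumes b: "indep n b" "indep n b'"
    and supp: "\<And>k. k < n \<Longrightarrow> supported {..<n} (a k)"
      "\<And>i j. i < n \<Longrightarrow> j < n \<Longrightarrow> supported {..<n} (X i j)"
    and Y: "\<And>k. k < n \<Longrightarrow> Y k = (\<Sum>i<n. \<Sum>j<n. sc (d k i j) (kron (b i) (b' j)))"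
    and slices: "\<And>p q. p < n \<Longrightarrow> q < n \<Longrightarrow>
      (\<Sum>i<n. \<Sum>j<n. sc (X i j p q) (kron (b i) (b' j))) = (\<Sum>k<n. sc (a k p q) (Y k))"
    and ij: "i < n" "j < n"
  shows "X i j = (\<Sum>k<n. sc (d k i j) (a k))"
proof (intro ext)
  fix p q
  show "X i j p q = (\<Sum>k<n. sc (d k i j) (a k)) p q"
  proof (cases "p < n \<and> q < n")
    case True
    have "(\<Sum>i<n. \<Sum>j<n. sc (X i j p q) (kron (b i) (b' j)))
      = (\<Sum>k<n. \<Sum>i<n. \<Sum>j<n. sc (d k i j * a k p q) (kron (b i) (b' j)))"
      using slices True by (simp add: Y sc_sum sc_sc mult.commute)
    also have "\<dots> = (\<Sum>i<n. \<Sum>j<n. \<Sum>k<n. sc (d k i j * a k p q) (kron (b i) (b' j)))"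
      by (subst sum.swap, rule sum.cong[OF refl], rule sum.swap)
    also have "\<dots> = (\<Sum>i<n. \<Sum>j<n. sc (\<Sum>k<n. d k i j * a k p q) (kron (b i) (b' j)))"
      by (simp add: sc_sum_coeff)
    finally show ?thesis
      using indep_kron[OF b _ ij] by (simp add: sum_fun_apply sc_def)
  next
    case False
    then show ?thesis using supp ij by (auto simp: supported_def sum_fun_apply sc_def)
  qed
qed

text \<open>
The \<open>X\<^sub>i\<^sub>j\<close> are combinations of the \<open>a\<^sub>k\<close> even if nothing is known about the \<open>Y\<^sub>k\<close>: a functional dual to
\<open>b\<^sub>i \<otimes> b\<^sub>j\<close> isolates \<open>X\<^sub>i\<^sub>j(p,q)\<close> and takes the values \<open>d\<^sub>k\<^sub>i\<^sub>j\<close> on the \<open>Y\<^sub>k\<close>. This is where the span of the legs is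
seen to be closed under multiplication.
\<close>

lemma slice_structure:
  fixes a b :: "nat \<Rightarrow> (nat, 'k::field) fmat"
  assumes a: "indep n a" and b: "indep n b"
    and supp: "\<And>k. k < n \<Longrightarrow> supported {..<n} (a k)"
      "\<And>i j. i < n \<Longrightarrow> j < n \<Longrightarrow> supported {..<n} (X i j)"
    and slices: "\<And>p q. p < n \<Longrightarrow> q < n \<Longrightarrow>
      (\<Sum>i<n. \<Sum>j<n. sc (X i j p q) (kron (b i) (b j))) = (\<Sum>k<n. sc (a k p q) (Y k))"
  shows "\<exists>d. \<forall>i<n. \<forall>j<n. X i j = (\<Sum>k<n. sc (d k i j) (a k))"
proof -
  obtain F :: "nat \<Rightarrow> nat \<Rightarrow> (nat \<times> nat, 'k) fmat \<Rightarrow> 'k"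
    where F: "\<And>i j x. i < n \<Longrightarrow> j < n \<Longrightarrow> F i j (\<Sum>i<n. \<Sum>j<n. sc (x i j) (kron (b i) (b j))) = x i j"
    and lin: "\<And>i j y Z. F i j (\<Sum>k<n. sc (y k) (Z k)) = (\<Sum>k<n. y k * F i j (Z k))"
    using kron_dual_functional[OF b b] by blast
  have "X i j = (\<Sum>k<n. sc (F i j (Y k)) (a k))" if ij: "i < n" "j < n" for i j
  proof (intro ext)
    fix p q
    show "X i j p q = (\<Sum>k<n. sc (F i j (Y k)) (a k)) p q"
    proof (cases "p < n \<and> q < n")
      case True
      then have "X i j p q = F i j (\<Sum>k<n. sc (a k p q) (Y k))"
        using F[OF ij, of "\<lambda>i j. X i j p q"] slices by simp
      then show ?thesis unfolding lin by (simp add: sum_fun_apply sc_def mult.commute)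
    next
      case False
      then show ?thesis using supp ij by (auto simp: supported_def sum_fun_apply sc_def)
    qed
  qed
  then show ?thesis by (intro exI[of _ "\<lambda>k i j. F i j (Y k)"]) simp
qed

definition kron_span :: "nat \<Rightarrow> (nat \<Rightarrow> (nat, 'k::field) fmat) \<Rightarrow> (nat \<Rightarrow> (nat, 'k) fmat)
    \<Rightarrow> (nat \<times> nat, 'k) fmat \<Rightarrow> bool" where
  "kron_span n a b Z \<longleftrightarrow> (\<exists>x. Z = (\<Sum>i<n. \<Sum>j<n. sc (x i j) (kron (a i) (b j))))"

lemma sc_add: "sc (c + d) A = sc c A + sc d A" "sc c (A + B) = sc c A + sc c B"
  by (intro ext, simp add: sc_def algebra_simps)+

lemma sc_zero [simp]: "sc 0 A = 0"
  by (intro ext) (simp add: sc_def)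

lemma sum_sc_delta:
  fixes n j :: nat
  shows "(\<Sum>i<n. sc (if i = j then 1 else 0) (A i)) = (if j < n then A j else 0)"
  "(\<Sum>i<n. sc (if j = i then 1 else 0) (A i)) = (if j < n then A j else 0)"
proof -
  have "(\<Sum>i<n. sc (if i = j then 1 else 0) (A i)) = (\<Sum>i<n. if i = j then A i else 0)"
    by (rule sum.cong) auto
  then show 1: "(\<Sum>i<n. sc (if i = j then 1 else 0) (A i)) = (if j < n then A j else 0)"
    by simp
  show "(\<Sum>i<n. sc (if j = i then 1 else 0) (A i)) = (if j < n then A j else 0)"
    using 1 by (simp add: eq_commute[of j])
qed

lemma kron_span_closed:
  shows "kron_span n a b 0"
    and "kron_span n a b X \<Longrightarrow> kron_span n a b Y \<Longrightarrow> kron_span n a b (X + Y)"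
    and "kron_span n a b X \<Longrightarrow> kron_span n a b (sc c X)"
    and "i < n \<Longrightarrow> j < n \<Longrightarrow> kron_span n a b (kron (a i) (b j))"
proof -
  show "kron_span n a b 0"
    unfolding kron_span_def by (rule exI[of _ "\<lambda>i j. 0"]) simp
  show "kron_span n a b (X + Y)" if "kron_span n a b X" "kron_span n a b Y"
  proof -
    obtain x y where "X = (\<Sum>i<n. \<Sum>j<n. sc (x i j) (kron (a i) (b j)))"
      "Y = (\<Sum>i<n. \<Sum>j<n. sc (y i j) (kron (a i) (b j)))" using \<open>kron_span n a b X\<close> \<open>kron_span n a b Y\<close>
      unfolding kron_span_def by blast
    then show ?thesis
      unfolding kron_span_def by (intro exI[of _ "\<lambda>i j. x i j + y i j"]) (simp add: sc_add sum.distrib)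
  qed
  show "kron_span n a b (sc c X)" if "kron_span n a b X"
  proof -
    obtain x where "X = (\<Sum>i<n. \<Sum>j<n. sc (x i j) (kron (a i) (b j)))" using \<open>kron_span n a b X\<close>
      unfolding kron_span_def by blast
    then show ?thesis
      unfolding kron_span_def by (intro exI[of _ "\<lambda>i j. c * x i j"]) (simp add: sc_sum sc_sc)
  qed
  show "kron_span n a b (kron (a i) (b j))" if "i < n" "j < n"
  proof -
    have "(\<Sum>i'<n. \<Sum>j'<n. sc ((if i' = i then 1 else 0) * (if j' = j then 1 else 0)) (kron (a i') (b j')))
      = (\<Sum>i'<n. sc (if i' = i then 1 else 0) (\<Sum>j'<n. sc (if j' = j then 1 else 0) (kron (a i') (b j'))))"
      by (simp only: sc_sum sc_sc)
    also have "\<dots> = kron (a i) (b j)" using that by (simp add: sum_sc_delta)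
    finally show ?thesis
      unfolding kron_span_def
      by (intro exI[of _ "\<lambda>i' j'. (if i' = i then 1 else 0) * (if j' = j then 1 else 0)"]) (rule sym)
  qed
qed

lemma kron_span_sum: "(\<And>i. i \<in> F \<Longrightarrow> kron_span n a b (Z i)) \<Longrightarrow> kron_span n a b (\<Sum>i\<in>F. Z i)"
  by (induction F rule: infinite_finite_induct) (auto intro: kron_span_closed)

lemma kron_span_mm:
  assumes a: "\<And>i j. i < n \<Longrightarrow> j < n \<Longrightarrow> mm {..<n} (a i) (a j) = (\<Sum>k<n. sc (d k i j) (a k))"
    and b: "\<And>i j. i < n \<Longrightarrow> j < n \<Longrightarrow> mm {..<n} (b i) (b j) = (\<Sum>k<n. sc (m i j k) (b k))"
    and XY: "kron_span n a b X" "kron_span n a b Y"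
  shows "kron_span n a b (mm ({..<n}\<times>{..<n}) X Y)"
proof -
  obtain x y where X: "X = (\<Sum>i<n. \<Sum>j<n. sc (x i j) (kron (a i) (b j)))"
    and Y: "Y = (\<Sum>i<n. \<Sum>j<n. sc (y i j) (kron (a i) (b j)))"
    using XY unfolding kron_span_def by blast
  show ?thesis
    unfolding X Y mm_linear sc_sum kron_mm
    by (intro kron_span_sum kron_span_closed(3))
      (auto simp: a b kron_sum_left kron_sum_right kron_sc_left kron_sc_right
       intro!: kron_span_sum kron_span_closed)
qed

section \<open>Structure constants of a Hopf algebra\<close>

text \<open>
The Hopf algebra axioms for \<open>e\<^sub>i e\<^sub>j = \<Sum> m\<^sub>i\<^sub>j\<^sub>k e\<^sub>k\<close>, \<open>\<Delta> e\<^sub>k = \<Sum> d\<^sub>k\<^sub>i\<^sub>j e\<^sub>i \<otimes> e\<^sub>j\<close>, \<open>1 = \<Sum> \<eta>\<^sub>i e\<^sub>i\<close>, counit \<open>\<epsilon>\<close> and antipode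
\<open>e\<^sub>i \<mapsto> \<Sum> s\<^sub>i\<^sub>j e\<^sub>j\<close>.
\<close>

locale hopf_constants =
  fixes n :: nat and m d :: "nat \<Rightarrow> nat \<Rightarrow> nat \<Rightarrow> 'k::field" and \<eta> \<epsilon> :: "nat \<Rightarrow> 'k"
    and s :: "nat \<Rightarrow> nat \<Rightarrow> 'k"
  assumes assoc: "\<lbrakk>i < n; j < n; l < n; p < n\<rbrakk> \<Longrightarrow>
      (\<Sum>k<n. m i j k * m k l p) = (\<Sum>k<n. m j l k * m i k p)"
    and unit_left: "\<lbrakk>j < n; p < n\<rbrakk> \<Longrightarrow> (\<Sum>i<n. \<eta> i * m i j p) = (if j = p then 1 else 0)"
    and unit_right: "\<lbrakk>i < n; p < n\<rbrakk> \<Longrightarrow> (\<Sum>j<n. \<eta> j * m i j p) = (if i = p then 1 else 0)"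
    and coassoc: "\<lbrakk>k < n; i < n; j < n; l < n\<rbrakk> \<Longrightarrow>
      (\<Sum>p<n. d k p l * d p i j) = (\<Sum>p<n. d k i p * d p j l)"
    and counit_left: "\<lbrakk>k < n; j < n\<rbrakk> \<Longrightarrow> (\<Sum>i<n. \<epsilon> i * d k i j) = (if k = j then 1 else 0)"
    and counit_right: "\<lbrakk>k < n; i < n\<rbrakk> \<Longrightarrow> (\<Sum>j<n. \<epsilon> j * d k i j) = (if k = i then 1 else 0)"
    and comult_mult: "\<lbrakk>i < n; j < n; p < n; q < n\<rbrakk> \<Longrightarrow> (\<Sum>k<n. m i j k * d k p q) =
      (\<Sum>r<n. \<Sum>t<n. \<Sum>r'<n. \<Sum>t'<n. d i r t * d j r' t' * (m r r' p * m t t' q))"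
    and comult_one: "\<lbrakk>p < n; q < n\<rbrakk> \<Longrightarrow> (\<Sum>k<n. \<eta> k * d k p q) = \<eta> p * \<eta> q"
    and counit_mult: "\<lbrakk>i < n; j < n\<rbrakk> \<Longrightarrow> (\<Sum>k<n. m i j k * \<epsilon> k) = \<epsilon> i * \<epsilon> j"
    and counit_one: "(\<Sum>k<n. \<eta> k * \<epsilon> k) = 1"
    and antipode_left: "\<lbrakk>k < n; p < n\<rbrakk> \<Longrightarrow>
      (\<Sum>i<n. \<Sum>l<n. \<Sum>j<n. s i l * (d k i j * m l j p)) = \<epsilon> k * \<eta> p"
    and antipode_right: "\<lbrakk>k < n; p < n\<rbrakk> \<Longrightarrow>
      (\<Sum>j<n. \<Sum>i<n. \<Sum>l<n. s i l * (d k j i * m j l p)) = \<epsilon> k * \<eta> p"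

lemma collect_sc1:
  "(\<Sum>r\<in>F. \<Sum>p\<in>G. sc (x r p) (K p)) = (\<Sum>p\<in>G. sc (\<Sum>r\<in>F. x r p) (K p))"
  by (subst sum.swap) (simp add: sc_sum_coeff)

lemma collect_sc2:
  "(\<Sum>r\<in>F. \<Sum>p\<in>G. \<Sum>q\<in>H. sc (x r p q) (K p q)) = (\<Sum>p\<in>G. \<Sum>q\<in>H. sc (\<Sum>r\<in>F. x r p q) (K p q))"
  by (subst sum.swap) (simp add: collect_sc1)

lemma indep_sc:
  assumes "indep n a" "(\<Sum>i<n. sc (c i) (a i)) = (\<Sum>i<n. sc (c' i) (a i))" "l < n"
  shows "c l = c' l"
proof (rule indep_coeff_eq[OF assms(1) _ assms(3)])
  fix p q
  from fun_cong[OF fun_cong[OF assms(2)], of p q]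
  show "(\<Sum>i<n. c i * a i p q) = (\<Sum>i<n. c' i * a i p q)" by (simp add: sum_fun_apply sc_def)
qed

lemma kron_lincomb:
  "kron (\<Sum>p<n. sc (x p) (a p)) (\<Sum>q<n. sc (y q) (b q)) = (\<Sum>p<n. \<Sum>q<n. sc (x p * y q) (kron (a p) (b q)))"
  by (simp add: kron_sum_left kron_sc_left) (simp add: kron_sum_right kron_sc_right sc_sum sc_sc)

text \<open>
The \<open>b\<^sub>i\<close> play the part of a basis of a Hopf algebra with constants \<open>m, d\<close> and the \<open>a\<^sub>i\<close> that of the dual basis
of its dual, whose product has the constants \<open>d\<close>.
\<close>

locale pentagon_realization = pentagon_solution n R R'
  for n and R R' :: "(nat \<times> nat, 'k::field) fmat" +
  fixes a b :: "nat \<Rightarrow> (nat, 'k) fmat" and m d :: "nat \<Rightarrow> nat \<Rightarrow> nat \<Rightarrow> 'k"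
  assumes supp_a [simp]: "i < n \<Longrightarrow> supp1 (a i)" and supp_b [simp]: "i < n \<Longrightarrow> supp1 (b i)"
    and indep_a: "indep n a" and indep_b: "indep n b"
    and R_sum: "R = (\<Sum>i<n. kron (a i) (b i))"
    and mult_a: "\<lbrakk>i < n; j < n\<rbrakk> \<Longrightarrow> a i *\<^sub>1 a j = (\<Sum>k<n. sc (d k i j) (a k))"
    and mult_b: "\<lbrakk>i < n; j < n\<rbrakk> \<Longrightarrow> b i *\<^sub>1 b j = (\<Sum>k<n. sc (m i j k) (b k))"
begin

text \<open>
The comultiplication is conjugation by \<open>R\<close>; the dual algebra is comultiplied by conjugation with \<open>R\<^sup>-\<^sup>1\<close>.
\<close>

lemma comult_b:
  "k < n \<Longrightarrow> R *\<^sub>2 kron (b k) 1\<^sub>1 *\<^sub>2 R' = (\<Sum>i<n. \<Sum>j<n. sc (d k i j) (kron (b i) (b j)))"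
  by (rule slice_structure_right[OF indep_a mult_a comult_slices[OF R_sum]]) simp_all

lemma comult_a:
  "k < n \<Longrightarrow> R' *\<^sub>2 kron 1\<^sub>1 (a k) *\<^sub>2 R = (\<Sum>i<n. \<Sum>j<n. sc (m i j k) (kron (a i) (a j)))"
  by (rule slice_structure_right[where d = "\<lambda>k i j. m i j k", OF indep_b mult_b mult_slices[OF R_sum]])
    simp_all

lemma R_in_span: "kron_span n a b R"
  unfolding R_sum by (intro kron_span_sum kron_span_closed) simp_all

lemma one_and_inverse_in_span: "kron_span n a b 1\<^sub>2" "kron_span n a b R'"
proof -
  have "finite ({..<n} \<times> {..<n})" by simp
  note * = inverse_in_subalgebra[OF this supp_R supp_R' R_R' R'_R,
      of "kron_span n a b", OF kron_span_closed(1-3) kron_span_mm[OF mult_a mult_b] R_in_span]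
  show "kron_span n a b 1\<^sub>2" "kron_span n a b R'" by (rule *; assumption)+
qed

text \<open>
Fixing a diagonal entry in one leg of \<open>1 \<otimes> 1 = \<Sum> x\<^sub>i\<^sub>j a\<^sub>i \<otimes> b\<^sub>j\<close> expresses \<open>1\<close> through the other leg. The counit of the
\<open>b\<^sub>i\<close> is the unit of the \<open>a\<^sub>i\<close>.
\<close>

lemma units_exist:
  "\<exists>\<eta> \<epsilon> s. 1\<^sub>1 = (\<Sum>i<n. sc (\<epsilon> i) (a i)) \<and> 1\<^sub>1 = (\<Sum>i<n. sc (\<eta> i) (b i)) \<and>
     R' = (\<Sum>i<n. \<Sum>j<n. sc (s i j) (kron (a i) (b j)))"
proof -
  obtain x where x: "1\<^sub>2 = (\<Sum>i<n. \<Sum>j<n. sc (x i j) (kron (a i) (b j)))"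
    using one_and_inverse_in_span(1) unfolding kron_span_def by blast
  then have x': "kron 1\<^sub>1 1\<^sub>1 = (\<Sum>i<n. \<Sum>j<n. sc (x i j) (kron (a i) (b j)))"
    by (simp add: kron_idm)
  have entry: "1\<^sub>1 p q * 1\<^sub>1 r t = (\<Sum>i<n. \<Sum>j<n. x i j * (a i p q * b j r t))" for p q r t
    using fun_cong[OF fun_cong[OF x'], of "(p, r)" "(q, t)"]
    by (simp add: sum_fun_apply sc_def kron_def)
  have one00: "1\<^sub>1 0 0 = (1::'k)" using pos by (simp add: idm_def)
  have "1\<^sub>1 = (\<Sum>i<n. sc (\<Sum>j<n. x i j * b j 0 0) (a i))"
    by (intro ext, use entry[of _ _ 0 0] in \<open>simp add: one00 sum_fun_apply sc_def sum_distrib_left mult_ac\<close>)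
  moreover have "1\<^sub>1 = (\<Sum>j<n. sc (\<Sum>i<n. x i j * a i 0 0) (b j))"
  proof (intro ext)
    fix p q
    show "1\<^sub>1 p q = (\<Sum>j<n. sc (\<Sum>i<n. x i j * a i 0 0) (b j)) p q"
      using entry[of 0 0 p q]
      by (subst (asm) sum.swap) (simp add: one00 sum_fun_apply sc_def sum_distrib_left mult_ac)
  qed
  moreover obtain s where "R' = (\<Sum>i<n. \<Sum>j<n. sc (s i j) (kron (a i) (b j)))"
    using one_and_inverse_in_span(2) unfolding kron_span_def by blast
  ultimately show ?thesis by (intro exI conjI)
qed

end

locale pentagon_hopf = pentagon_realization n R R' a b m d
  for n and R R' :: "(nat \<times> nat, 'k::field) fmat" and a b m d +
  fixes \<eta> \<epsilon> :: "nat \<Rightarrow> 'k" and s :: "nat \<Rightarrow> nat \<Rightarrow> 'k"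
  assumes one_a: "1\<^sub>1 = (\<Sum>i<n. sc (\<epsilon> i) (a i))" and one_b: "1\<^sub>1 = (\<Sum>i<n. sc (\<eta> i) (b i))"
    and R'_sum: "R' = (\<Sum>i<n. \<Sum>j<n. sc (s i j) (kron (a i) (b j)))"
begin

lemma one_kron: "(\<Sum>p<n. \<Sum>q<n. sc (\<epsilon> p * \<eta> q) (kron (a p) (b q))) = 1\<^sub>2"
  using kron_lincomb[of \<epsilon> a n \<eta> b] by (simp add: kron_idm flip: one_a one_b)

text \<open>
The axioms of a Hopf algebra now come from properties of matrix multiplication: associativity of the \<open>a\<^sub>i\<close> is
coassociativity of the \<open>b\<^sub>i\<close>, their unit is the counit, conjugation is multiplicative, and
\<open>R\<^sup>-\<^sup>1 R = 1 = R R\<^sup>-\<^sup>1\<close> is the antipode axiom.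
\<close>

lemma b_assoc:
  assumes "i < n" "j < n" "l < n" "p < n"
  shows "(\<Sum>k<n. m i j k * m k l p) = (\<Sum>k<n. m j l k * m i k p)"
proof (rule indep_sc[OF indep_b _ assms(4)])
  have "(\<Sum>p<n. sc (\<Sum>k<n. m i j k * m k l p) (b p)) = (b i *\<^sub>1 b j) *\<^sub>1 b l"
    using assms by (simp add: mult_b mm_linear sc_sum sc_sc collect_sc1)
  also have "\<dots> = (\<Sum>p<n. sc (\<Sum>k<n. m j l k * m i k p) (b p))"
    unfolding mm_assoc using assms by (simp add: mult_b mm_linear sc_sum sc_sc collect_sc1)
  finally show "(\<Sum>p<n. sc (\<Sum>k<n. m i j k * m k l p) (b p)) = (\<Sum>p<n. sc (\<Sum>k<n. m j l k * m i k p) (b p))" .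
qed

lemma a_assoc:
  assumes "k < n" "i < n" "j < n" "l < n"
  shows "(\<Sum>p<n. d k p l * d p i j) = (\<Sum>p<n. d k i p * d p j l)"
proof (rule indep_sc[OF indep_a _ assms(1)])
  have "(\<Sum>k<n. sc (\<Sum>p<n. d k p l * d p i j) (a k)) = (a i *\<^sub>1 a j) *\<^sub>1 a l"
    using assms by (simp add: mult_a mm_linear sc_sum sc_sc collect_sc1 mult.commute)
  also have "\<dots> = (\<Sum>k<n. sc (\<Sum>p<n. d k i p * d p j l) (a k))"
    unfolding mm_assoc using assms by (simp add: mult_a mm_linear sc_sum sc_sc collect_sc1 mult.commute)
  finally show "(\<Sum>k<n. sc (\<Sum>p<n. d k p l * d p i j) (a k)) = (\<Sum>k<n. sc (\<Sum>p<n. d k i p * d p j l) (a k))" .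
qed

lemma b_unit:
  assumes "j < n" "p < n"
  shows "(\<Sum>i<n. \<eta> i * m i j p) = (if j = p then 1 else 0)"
    and "(\<Sum>i<n. \<eta> i * m j i p) = (if j = p then 1 else 0)"
proof -
  have "(\<Sum>p<n. sc (\<Sum>i<n. \<eta> i * m i j p) (b p)) = (\<Sum>i<n. sc (\<eta> i) (b i)) *\<^sub>1 b j"
    using assms by (simp add: mult_b mm_linear sc_sum sc_sc collect_sc1)
  also have "\<dots> = (\<Sum>p<n. sc (if j = p then 1 else 0) (b p))"
    using assms by (simp add: sum_sc_delta flip: one_b)
  finally show "(\<Sum>i<n. \<eta> i * m i j p) = (if j = p then 1 else 0)"
    by (rule indep_sc[OF indep_b _ assms(2)])
  have "(\<Sum>p<n. sc (\<Sum>i<n. \<eta> i * m j i p) (b p)) = b j *\<^sub>1 (\<Sum>i<n. sc (\<eta> i) (b i))"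
    using assms by (simp add: mult_b mm_linear sc_sum sc_sc collect_sc1)
  also have "\<dots> = (\<Sum>p<n. sc (if j = p then 1 else 0) (b p))"
    using assms by (simp add: sum_sc_delta flip: one_b)
  finally show "(\<Sum>i<n. \<eta> i * m j i p) = (if j = p then 1 else 0)"
    by (rule indep_sc[OF indep_b _ assms(2)])
qed

lemma a_unit:
  assumes "j < n" "k < n"
  shows "(\<Sum>i<n. \<epsilon> i * d k i j) = (if k = j then 1 else 0)"
    and "(\<Sum>i<n. \<epsilon> i * d k j i) = (if k = j then 1 else 0)"
proof -
  have "(\<Sum>k<n. sc (\<Sum>i<n. \<epsilon> i * d k i j) (a k)) = (\<Sum>i<n. sc (\<epsilon> i) (a i)) *\<^sub>1 a j"
    using assms by (simp add: mult_a mm_linear sc_sum sc_sc collect_sc1)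
  also have "\<dots> = (\<Sum>k<n. sc (if k = j then 1 else 0) (a k))"
    using assms by (simp add: sum_sc_delta flip: one_a)
  finally show "(\<Sum>i<n. \<epsilon> i * d k i j) = (if k = j then 1 else 0)"
    by (rule indep_sc[OF indep_a _ assms(2)])
  have "(\<Sum>k<n. sc (\<Sum>i<n. \<epsilon> i * d k j i) (a k)) = a j *\<^sub>1 (\<Sum>i<n. sc (\<epsilon> i) (a i))"
    using assms by (simp add: mult_a mm_linear sc_sum sc_sc collect_sc1)
  also have "\<dots> = (\<Sum>k<n. sc (if k = j then 1 else 0) (a k))"
    using assms by (simp add: sum_sc_delta flip: one_a)
  finally show "(\<Sum>i<n. \<epsilon> i * d k j i) = (if k = j then 1 else 0)"
    by (rule indep_sc[OF indep_a _ assms(2)])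
qed

lemma cancel2 [simp]:
  "supp2 Z \<Longrightarrow> R *\<^sub>2 (R' *\<^sub>2 Z) = Z" "supp2 Z \<Longrightarrow> R' *\<^sub>2 (R *\<^sub>2 Z) = Z"
  by (simp_all flip: mm_assoc)

lemma comult_multiplicative:
  assumes "i < n" "j < n" "p < n" "q < n"
  shows "(\<Sum>k<n. m i j k * d k p q) =
      (\<Sum>r<n. \<Sum>t<n. \<Sum>r'<n. \<Sum>t'<n. d i r t * d j r' t' * (m r r' p * m t t' q))"
proof (rule indep_kron[OF indep_b indep_b _ assms(3,4)])
  have "(\<Sum>p<n. \<Sum>q<n. sc (\<Sum>k<n. m i j k * d k p q) (kron (b p) (b q)))
    = (\<Sum>k<n. sc (m i j k) (\<Sum>p<n. \<Sum>q<n. sc (d k p q) (kron (b p) (b q))))"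
    by (simp add: sc_sum sc_sc collect_sc2)
  also have "\<dots> = (\<Sum>k<n. sc (m i j k) (R *\<^sub>2 kron (b k) 1\<^sub>1 *\<^sub>2 R'))"
    by (simp add: comult_b)
  also have "\<dots> = R *\<^sub>2 kron (b i *\<^sub>1 b j) 1\<^sub>1 *\<^sub>2 R'"
    using assms by (simp add: mult_b mm_linear kron_sum_left kron_sc_left)
  also have "\<dots> = (R *\<^sub>2 kron (b i) 1\<^sub>1 *\<^sub>2 R') *\<^sub>2 (R *\<^sub>2 kron (b j) 1\<^sub>1 *\<^sub>2 R')"
    using assms by (simp add: mm_assoc) (simp add: mul_kron flip: mm_assoc)
  also have "\<dots> = (\<Sum>r<n. \<Sum>t<n. \<Sum>r'<n. \<Sum>t'<n. sc (d i r t * d j r' t') (kron (b r *\<^sub>1 b r') (b t *\<^sub>1 b t')))"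
    using assms by (simp add: comult_b mm_sum_left mm_sc_left)
      (simp add: mm_sum_right mm_sc_right mul_kron sc_sum sc_sc mult.commute)
  also have "\<dots> = (\<Sum>p<n. \<Sum>q<n. sc (\<Sum>r<n. \<Sum>t<n. \<Sum>r'<n. \<Sum>t'<n.
      d i r t * d j r' t' * (m r r' p * m t t' q)) (kron (b p) (b q)))"
    by (simp add: mult_b kron_lincomb sc_sum sc_sc collect_sc2)
  finally show "(\<Sum>p<n. \<Sum>q<n. sc (\<Sum>k<n. m i j k * d k p q) (kron (b p) (b q))) =
    (\<Sum>p<n. \<Sum>q<n. sc (\<Sum>r<n. \<Sum>t<n. \<Sum>r'<n. \<Sum>t'<n.
      d i r t * d j r' t' * (m r r' p * m t t' q)) (kron (b p) (b q)))" .
qed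

lemma comult_unit:
  assumes "p < n" "q < n"
  shows "(\<Sum>k<n. \<eta> k * d k p q) = \<eta> p * \<eta> q"
proof (rule indep_kron[OF indep_b indep_b _ assms])
  have "(\<Sum>p<n. \<Sum>q<n. sc (\<Sum>k<n. \<eta> k * d k p q) (kron (b p) (b q)))
    = (\<Sum>k<n. sc (\<eta> k) (R *\<^sub>2 kron (b k) 1\<^sub>1 *\<^sub>2 R'))"
    by (simp add: comult_b sc_sum sc_sc collect_sc2)
  also have "\<dots> = R *\<^sub>2 kron (\<Sum>k<n. sc (\<eta> k) (b k)) 1\<^sub>1 *\<^sub>2 R'"
    by (simp add: mm_linear kron_sum_left kron_sc_left)
  also have "\<dots> = kron 1\<^sub>1 1\<^sub>1"
    by (simp add: kron_idm flip: one_b)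
  also have "\<dots> = (\<Sum>p<n. \<Sum>q<n. sc (\<eta> p * \<eta> q) (kron (b p) (b q)))"
    by (subst (1 2) one_b) (rule kron_lincomb)
  finally show "(\<Sum>p<n. \<Sum>q<n. sc (\<Sum>k<n. \<eta> k * d k p q) (kron (b p) (b q)))
    = (\<Sum>p<n. \<Sum>q<n. sc (\<eta> p * \<eta> q) (kron (b p) (b q)))" .
qed

lemma counit_multiplicative:
  assumes "i < n" "j < n"
  shows "(\<Sum>k<n. m i j k * \<epsilon> k) = \<epsilon> i * \<epsilon> j"
proof (rule indep_kron[OF indep_a indep_a _ assms])
  have "(\<Sum>p<n. \<Sum>q<n. sc (\<Sum>k<n. m p q k * \<epsilon> k) (kron (a p) (a q)))
    = (\<Sum>k<n. sc (\<epsilon> k) (R' *\<^sub>2 kron 1\<^sub>1 (a k) *\<^sub>2 R))"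
    by (simp add: comult_a sc_sum sc_sc collect_sc2 mult.commute)
  also have "\<dots> = R' *\<^sub>2 kron 1\<^sub>1 (\<Sum>k<n. sc (\<epsilon> k) (a k)) *\<^sub>2 R"
    by (simp add: mm_linear kron_sum_right kron_sc_right)
  also have "\<dots> = kron 1\<^sub>1 1\<^sub>1"
    by (simp add: kron_idm flip: one_a)
  also have "\<dots> = (\<Sum>p<n. \<Sum>q<n. sc (\<epsilon> p * \<epsilon> q) (kron (a p) (a q)))"
    by (subst (1 2) one_a) (rule kron_lincomb)
  finally show "(\<Sum>p<n. \<Sum>q<n. sc (\<Sum>k<n. m p q k * \<epsilon> k) (kron (a p) (a q)))
    = (\<Sum>p<n. \<Sum>q<n. sc (\<epsilon> p * \<epsilon> q) (kron (a p) (a q)))" .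
qed

lemma eta_nonzero: "\<exists>p<n. \<eta> p \<noteq> 0"
proof (rule ccontr)
  assume "\<not> (\<exists>p<n. \<eta> p \<noteq> 0)"
  then have "(\<Sum>i<n. sc (\<eta> i) (b i)) = 0" by (intro sum.neutral) auto
  then have "1\<^sub>1 0 0 = (0::'k)" by (simp flip: one_b)
  then show False using pos by (simp add: idm_def)
qed

lemma counit_unit: "(\<Sum>k<n. \<eta> k * \<epsilon> k) = 1"
proof -
  obtain p where p: "p < n" "\<eta> p \<noteq> 0" using eta_nonzero by blast
  have "\<eta> p * (\<Sum>q<n. \<eta> q * \<epsilon> q) = (\<Sum>q<n. \<epsilon> q * (\<Sum>k<n. \<eta> k * d k p q))"
    using p by (simp add: comult_unit sum_distrib_left mult_ac)
  also have "\<dots> = (\<Sum>k<n. \<eta> k * (\<Sum>q<n. \<epsilon> q * d k p q))"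
    unfolding sum_distrib_left by (subst sum.swap) (simp add: mult_ac)
  also have "\<dots> = (\<Sum>k<n. \<eta> k * (if k = p then 1 else 0))"
    using p by (intro sum.cong) (auto simp: a_unit)
  also have "\<dots> = \<eta> p" using p by (simp add: sum_single_delta)
  finally show ?thesis using p by simp
qed

lemma antipode_left':
  assumes "k < n" "p < n"
  shows "(\<Sum>i<n. \<Sum>l<n. \<Sum>j<n. s i l * (d k i j * m l j p)) = \<epsilon> k * \<eta> p"
proof (rule indep_kron[OF indep_a indep_b _ assms])
  have "R' *\<^sub>2 R = (\<Sum>i<n. \<Sum>l<n. sc (s i l) (kron (a i) (b l))) *\<^sub>2 (\<Sum>j<n. kron (a j) (b j))"
    by (simp only: R_sum R'_sum)
  also have "\<dots> = (\<Sum>i<n. \<Sum>l<n. \<Sum>j<n. sc (s i l) (kron (a i *\<^sub>1 a j) (b l *\<^sub>1 b j)))"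
    by (simp add: mm_sum_left mm_sc_left) (simp add: mm_sum_right mul_kron sc_sum)
  also have "\<dots> = (\<Sum>k<n. \<Sum>p<n. sc (\<Sum>i<n. \<Sum>l<n. \<Sum>j<n. s i l * (d k i j * m l j p)) (kron (a k) (b p)))"
    by (simp add: mult_a mult_b kron_lincomb sc_sum sc_sc collect_sc2)
  finally show "(\<Sum>k<n. \<Sum>p<n. sc (\<Sum>i<n. \<Sum>l<n. \<Sum>j<n. s i l * (d k i j * m l j p)) (kron (a k) (b p)))
    = (\<Sum>p<n. \<Sum>q<n. sc (\<epsilon> p * \<eta> q) (kron (a p) (b q)))"
    by (simp add: one_kron)
qed

lemma antipode_right':
  assumes "k < n" "p < n"
  shows "(\<Sum>j<n. \<Sum>i<n. \<Sum>l<n. s i l * (d k j i * m j l p)) = \<epsilon> k * \<eta> p"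
proof (rule indep_kron[OF indep_a indep_b _ assms])
  have "R *\<^sub>2 R' = (\<Sum>j<n. kron (a j) (b j)) *\<^sub>2 (\<Sum>i<n. \<Sum>l<n. sc (s i l) (kron (a i) (b l)))"
    by (simp only: R_sum R'_sum)
  also have "\<dots> = (\<Sum>j<n. \<Sum>i<n. \<Sum>l<n. sc (s i l) (kron (a j *\<^sub>1 a i) (b j *\<^sub>1 b l)))"
    by (simp add: mm_sum_left) (simp add: mm_sum_right mm_sc_right mul_kron sc_sum)
  also have "\<dots> = (\<Sum>k<n. \<Sum>p<n. sc (\<Sum>j<n. \<Sum>i<n. \<Sum>l<n. s i l * (d k j i * m j l p)) (kron (a k) (b p)))"
    by (simp add: mult_a mult_b kron_lincomb sc_sum sc_sc collect_sc2)
  finally show "(\<Sum>k<n. \<Sum>p<n. sc (\<Sum>j<n. \<Sum>i<n. \<Sum>l<n. s i l * (d k j i * m j l p)) (kron (a k) (b p)))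
    = (\<Sum>p<n. \<Sum>q<n. sc (\<epsilon> p * \<eta> q) (kron (a p) (b q)))"
    by (simp add: one_kron)
qed

lemma constants: "hopf_constants n m d \<eta> \<epsilon> s"
  by (rule hopf_constants.intro)
    (fact b_assoc b_unit a_assoc a_unit comult_multiplicative comult_unit counit_multiplicative
      counit_unit antipode_left' antipode_right' | rule b_unit a_unit; assumption)+

end

section \<open>Every solution is conjugate to a regular one\<close>

text \<open>
In the basis \<open>e\<close>, the matrices of \<open>h \<mapsto> \<Sum> h\<^sub>1 \<langle>e\<^sub>i\<^sup>*, h\<^sub>2\<rangle>\<close> and of left multiplication by \<open>e\<^sub>i\<close>; columns are images
of basis vectors.
\<close>

definition regular_a :: "nat \<Rightarrow> (nat \<Rightarrow> nat \<Rightarrow> nat \<Rightarrow> 'k::field) \<Rightarrow> nat \<Rightarrow> (nat, 'k) fmat" where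
  "regular_a n d i = (\<lambda>p q. if p < n \<and> q < n then d q p i else 0)"

definition regular_b :: "nat \<Rightarrow> (nat \<Rightarrow> nat \<Rightarrow> nat \<Rightarrow> 'k::field) \<Rightarrow> nat \<Rightarrow> (nat, 'k) fmat" where
  "regular_b n m i = (\<lambda>p q. if p < n \<and> q < n then m i q p else 0)"

definition regular_solution :: "nat \<Rightarrow> (nat \<Rightarrow> nat \<Rightarrow> nat \<Rightarrow> 'k::field) \<Rightarrow> (nat \<Rightarrow> nat \<Rightarrow> nat \<Rightarrow> 'k)
    \<Rightarrow> (nat \<times> nat, 'k) fmat" where
  "regular_solution n m d = (\<Sum>i<n. kron (regular_a n d i) (regular_b n m i))"

lemma supp_regular [simp]:
  "supported {..<n} (regular_a n d i)" "supported {..<n} (regular_b n m i)"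
  by (auto simp: supported_def regular_a_def regular_b_def)

lemma indep_basechange:
  fixes b :: "nat \<Rightarrow> (nat, 'k::field) fmat"
  assumes b: "indep n b"
    and inv: "\<And>i j. i < n \<Longrightarrow> j < n \<Longrightarrow> (\<Sum>l<n. t i l * x l j) = (if i = j then 1 else 0)"
  shows "indep n (\<lambda>i. \<Sum>j<n. sc (t i j) (b j))"
proof -
  obtain \<phi> where \<phi>: "\<And>i j. i < n \<Longrightarrow> j < n \<Longrightarrow>
    (\<Sum>x\<in>{..<n}\<times>{..<n}. \<phi> i (fst x) (snd x) * b j (fst x) (snd x)) = (if i = j then 1 else 0)"
    using b by (auto simp: indep_def case_prod_beta)
  have "(\<Sum>y\<in>{..<n}\<times>{..<n}. (\<Sum>k<n. x k i * \<phi> k (fst y) (snd y)) *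
      (\<Sum>l<n. sc (t j l) (b l)) (fst y) (snd y)) = (if i = j then 1 else 0)" if "i < n" "j < n" for i j
  proof -
    have "(\<Sum>y\<in>{..<n}\<times>{..<n}. (\<Sum>k<n. x k i * \<phi> k (fst y) (snd y)) *
      (\<Sum>l<n. sc (t j l) (b l)) (fst y) (snd y))
      = (\<Sum>y\<in>{..<n}\<times>{..<n}. \<Sum>k<n. \<Sum>l<n. x k i * t j l * (\<phi> k (fst y) (snd y) * b l (fst y) (snd y)))"
      unfolding sum_fun_apply sc_def sum_product by (intro sum.cong refl) (simp add: mult_ac)
    also have "\<dots> = (\<Sum>k<n. \<Sum>l<n. x k i * t j l * (\<Sum>y\<in>{..<n}\<times>{..<n}. \<phi> k (fst y) (snd y) * b l (fst y) (snd y)))"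
      unfolding sum_distrib_left
      by (subst sum.swap, rule sum.cong[OF refl], rule sum.swap)
    also have "\<dots> = (\<Sum>k<n. \<Sum>l<n. x k i * t j l * (if k = l then 1 else 0))"
      by (intro sum.cong) (auto simp: \<phi>)
    also have "\<dots> = (\<Sum>k<n. t j k * x k i)"
      by (intro sum.cong) (auto simp: sum_single_delta mult.commute)
    also have "\<dots> = (if i = j then 1 else 0)" using inv[of j i] that by auto
    finally show ?thesis .
  qed
  then show ?thesis
    unfolding indep_def case_prod_beta by (intro exI[of _ "\<lambda>i p q. \<Sum>k<n. x k i * \<phi> k p q"]) simp
qed

lemma kron_zero_left [simp]: "kron 0 B = 0"
  by (intro ext, simp add: kron_def)+

context pentagon_hopf
begin

text \<open>
The antipode of \<open>b\<^sub>i\<close>; hence \<open>R\<^sup>-\<^sup>1 = \<Sum> a\<^sub>i \<otimes> \<sigma>\<^sub>i\<close>, and the slices of the inverted pentagon equation show that \<open>\<sigma>\<close>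
reverses products and coproducts.
\<close>

definition \<sigma> :: "nat \<Rightarrow> (nat, 'k) fmat" where
  "\<sigma> i = (\<Sum>j<n. sc (s i j) (b j))"

lemma supp_\<sigma> [simp]: "supp1 (\<sigma> i)"
  by (simp add: \<sigma>_def)

lemma R'_\<sigma>: "R' = (\<Sum>i<n. kron (a i) (\<sigma> i))"
  by (simp add: R'_sum \<sigma>_def kron_sum_right kron_sc_right)

lemma \<sigma>_mult:
  assumes "i < n" "j < n"
  shows "\<sigma> j *\<^sub>1 \<sigma> i = (\<Sum>k<n. sc (m i j k) (\<sigma> k))"
proof (rule slice_structure_left[where X = "\<lambda>i j. \<sigma> j *\<^sub>1 \<sigma> i" and d = "\<lambda>k i j. m i j k",
      OF indep_a indep_a _ _ comult_a _ assms])
  fix t w assume tw: "t < n" "w < n"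
  have "(\<Sum>i<n. \<Sum>j<n. sc ((\<sigma> j *\<^sub>1 \<sigma> i) t w) (kron (a i) (a j)))
    = (\<Sum>i<n. \<Sum>j<n. sc ((\<sigma> i *\<^sub>1 \<sigma> j) t w) (kron (a j) (a i)))"
    by (rule sum.swap)
  also have "\<dots> = (\<Sum>k<n. sc (\<sigma> k t w) (R' *\<^sub>2 kron 1\<^sub>1 (a k) *\<^sub>2 R))"
    by (rule mult_inverse_slices[OF R'_\<sigma> _ _ tw]) simp_all
  finally show "(\<Sum>i<n. \<Sum>j<n. sc ((\<sigma> j *\<^sub>1 \<sigma> i) t w) (kron (a i) (a j)))
    = (\<Sum>k<n. sc (\<sigma> k t w) (R' *\<^sub>2 kron 1\<^sub>1 (a k) *\<^sub>2 R))" .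
qed simp_all

lemma comult_\<sigma>:
  "k < n \<Longrightarrow> R *\<^sub>2 kron (\<sigma> k) 1\<^sub>1 *\<^sub>2 R' = (\<Sum>i<n. \<Sum>j<n. sc (d k i j) (kron (\<sigma> j) (\<sigma> i)))"
  by (rule slice_structure_right[OF indep_a mult_a comult_inverse_slices[OF R'_\<sigma>]]) simp_all

text \<open>
By the argument that put \<open>R\<^sup>-\<^sup>1\<close> into the span of the \<open>a\<^sub>i \<otimes> b\<^sub>j\<close>, with \<open>R\<close> and \<open>R\<^sup>-\<^sup>1\<close> exchanged. Consequently the
\<open>b\<^sub>i\<close> are combinations of the \<open>\<sigma>\<^sub>j\<close>: the antipode is bijective.
\<close>

lemma R_in_span_\<sigma>: "kron_span n a \<sigma> R"
proof -
  have "finite ({..<n} \<times> {..<n})" by simp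
  moreover have "kron_span n a \<sigma> R'"
    unfolding R'_\<sigma> by (intro kron_span_sum kron_span_closed) simp_all
  moreover have "kron_span n a \<sigma> (X *\<^sub>2 Y)" if "kron_span n a \<sigma> X" "kron_span n a \<sigma> Y" for X Y
    by (rule kron_span_mm[OF mult_a \<sigma>_mult[of _ _] that])
  ultimately show ?thesis
    using inverse_in_subalgebra(2)[OF _ supp_R' supp_R R'_R R_R', of "kron_span n a \<sigma>"]
      kron_span_closed(1-3)[of n a \<sigma>] by blast
qed

end

text \<open>
The coefficients \<open>x\<close> are those of the inverse of the antipode, \<open>b\<^sub>i \<mapsto> \<Sum> x\<^sub>i\<^sub>j b\<^sub>j\<close>.
\<close>

locale pentagon_antipode = pentagon_hopf n R R' a b m d \<eta> \<epsilon> s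
  for n and R R' :: "(nat \<times> nat, 'k::field) fmat" and a b m d \<eta> \<epsilon> s +
  fixes x :: "nat \<Rightarrow> nat \<Rightarrow> 'k"
  assumes R_x: "R = (\<Sum>i<n. \<Sum>j<n. sc (x i j) (kron (a i) (\<sigma> j)))"
begin

text \<open>
The first legs of \<open>R\<close> that belong to the second legs \<open>\<sigma>\<^sub>j\<close>. They represent the dual algebra with reversed
multiplication.
\<close>

definition a' :: "nat \<Rightarrow> (nat, 'k) fmat" where
  "a' j = (\<Sum>i<n. sc (x i j) (a i))"

lemma supp_a' [simp]: "supp1 (a' j)"
  by (simp add: a'_def)

lemma R_a': "R = (\<Sum>j<n. kron (a' j) (\<sigma> j))"
  by (subst R_x, subst sum.swap) (simp add: a'_def kron_sum_left kron_sc_left)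

lemma b_\<sigma>: "i < n \<Longrightarrow> b i = (\<Sum>j<n. sc (x i j) (\<sigma> j))"
proof (rule indep_kron_left[where x = b and y = "\<lambda>i. \<Sum>j<n. sc (x i j) (\<sigma> j)", OF indep_a])
  have "(\<Sum>i<n. kron (a i) (b i)) = R" by (simp only: R_sum)
  also have "\<dots> = (\<Sum>i<n. kron (a i) (\<Sum>j<n. sc (x i j) (\<sigma> j)))"
    by (subst R_x) (simp add: kron_sum_right kron_sc_right)
  finally show "(\<Sum>i<n. kron (a i) (b i)) = (\<Sum>i<n. kron (a i) (\<Sum>j<n. sc (x i j) (\<sigma> j)))" .
qed

lemma x_s: "i < n \<Longrightarrow> k < n \<Longrightarrow> (\<Sum>j<n. x i j * s j k) = (if i = k then 1 else 0)"
proof (rule indep_sc[OF indep_b])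
  assume "i < n" "k < n"
  have "(\<Sum>k<n. sc (\<Sum>j<n. x i j * s j k) (b k)) = b i"
    unfolding b_\<sigma>[OF \<open>i < n\<close>] by (simp add: \<sigma>_def sc_sum sc_sc collect_sc1)
  then show "(\<Sum>k<n. sc (\<Sum>j<n. x i j * s j k) (b k)) = (\<Sum>k<n. sc (if i = k then 1 else 0) (b k))"
    using \<open>i < n\<close> by (simp add: sum_sc_delta)
qed

lemma indep_\<sigma>: "indep n \<sigma>"
  unfolding \<sigma>_def[abs_def]
  by (rule indep_basechange[OF indep_b, of _ x]) (rule left_inverse_is_right_inverse[OF x_s])

lemma a'_mult:
  assumes "i < n" "j < n"
  shows "a' i *\<^sub>1 a' j = (\<Sum>k<n. sc (d k j i) (a' k))"
proof (rule slice_structure_left[where X = "\<lambda>i j. a' i *\<^sub>1 a' j" and d = "\<lambda>k i j. d k j i",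
      OF indep_\<sigma> indep_\<sigma> _ _ _ comult_slices[OF R_a'] assms])
  fix k assume "k < n"
  show "R *\<^sub>2 kron (\<sigma> k) 1\<^sub>1 *\<^sub>2 R' = (\<Sum>i<n. \<Sum>j<n. sc (d k j i) (kron (\<sigma> i) (\<sigma> j)))"
    unfolding comult_\<sigma>[OF \<open>k < n\<close>] by (rule sum.swap)
qed simp_all

lemma one_\<sigma>: "1\<^sub>1 = (\<Sum>k<n. sc (\<eta> k) (\<sigma> k))"
proof -
  let ?w = "\<Sum>k<n. sc (\<eta> k) (\<sigma> k)"
  have right: "\<sigma> i *\<^sub>1 ?w = \<sigma> i" if "i < n" for i
  proof -
    have "\<sigma> i *\<^sub>1 ?w = (\<Sum>k<n. sc (\<Sum>j<n. \<eta> j * m j i k) (\<sigma> k))"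
      using that by (simp add: mm_linear \<sigma>_mult sc_sum sc_sc collect_sc1)
    also have "\<dots> = (\<Sum>k<n. sc (if i = k then 1 else 0) (\<sigma> k))"
      using that by (intro sum.cong) (auto simp: b_unit)
    finally show ?thesis using that by (simp add: sum_sc_delta)
  qed
  have "1\<^sub>1 *\<^sub>1 ?w = (\<Sum>i<n. sc (\<eta> i) (\<Sum>j<n. sc (x i j) (\<sigma> j))) *\<^sub>1 ?w"
    by (subst one_b) (simp add: b_\<sigma>)
  also have "\<dots> = (\<Sum>i<n. sc (\<eta> i) (\<Sum>j<n. sc (x i j) (\<sigma> j *\<^sub>1 ?w)))"
    by (simp only: mm_sum_left mm_sc_left)
  also have "\<dots> = (\<Sum>i<n. sc (\<eta> i) (\<Sum>j<n. sc (x i j) (\<sigma> j)))"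
    by (simp add: right)
  also have "\<dots> = 1\<^sub>1" by (subst one_b) (simp add: b_\<sigma>)
  finally show ?thesis by simp
qed

text \<open>
The \<open>\<sigma>\<^sub>i\<close> and the \<open>b\<^sub>i\<close> satisfy the same multiplication rule up to reversal, and \<open>1\<close> has the same coefficients in
both families. Hence an equation for products of the \<open>\<sigma>\<^sub>i\<close> may be read for reversed products of the \<open>b\<^sub>i\<close>.
\<close>

lemma transfer_\<sigma>:
  assumes "(\<Sum>i<n. \<Sum>j<n. kron (X i j) (\<sigma> i *\<^sub>1 \<sigma> j)) = 1\<^sub>2"
  shows "(\<Sum>i<n. \<Sum>j<n. kron (X i j) (b j *\<^sub>1 b i)) = 1\<^sub>2"
proof -
  have collect: "(\<Sum>i<n. \<Sum>j<n. \<Sum>k<n. kron (sc (m j i k) (X i j)) (c k))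
    = (\<Sum>k<n. kron (\<Sum>i<n. \<Sum>j<n. sc (m j i k) (X i j)) (c k))" for c :: "nat \<Rightarrow> (nat, 'k) fmat"
    unfolding kron_sum_left by (rule trans[OF sum.cong[OF refl sum.swap] sum.swap])
  have "(\<Sum>k<n. kron (\<Sum>i<n. \<Sum>j<n. sc (m j i k) (X i j)) (\<sigma> k)) = kron 1\<^sub>1 1\<^sub>1"
    using assms by (simp add: \<sigma>_mult kron_sum_right kron_sc_right kron_idm kron_sc_left flip: collect)
  also have "\<dots> = (\<Sum>k<n. kron (sc (\<eta> k) 1\<^sub>1) (\<sigma> k))"
    by (subst (2) one_\<sigma>) (simp add: kron_sum_right kron_sc_right kron_sc_left)
  finally have coeff: "(\<Sum>k<n. kron (\<Sum>i<n. \<Sum>j<n. sc (m j i k) (X i j)) (\<sigma> k))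
    = (\<Sum>k<n. kron (sc (\<eta> k) 1\<^sub>1) (\<sigma> k))" .
  have eq: "(\<Sum>i<n. \<Sum>j<n. sc (m j i k) (X i j)) = sc (\<eta> k) 1\<^sub>1" if "k < n" for k
    by (rule indep_kron_right[where x = "\<lambda>k. \<Sum>i<n. \<Sum>j<n. sc (m j i k) (X i j)"
        and y = "\<lambda>k. sc (\<eta> k) 1\<^sub>1", OF indep_\<sigma> coeff that])
  have "(\<Sum>i<n. \<Sum>j<n. kron (X i j) (b j *\<^sub>1 b i))
    = (\<Sum>k<n. kron (\<Sum>i<n. \<Sum>j<n. sc (m j i k) (X i j)) (b k))"
    by (simp add: mult_b kron_sum_right kron_sc_right kron_sc_left flip: collect)
  also have "\<dots> = (\<Sum>k<n. kron (sc (\<eta> k) 1\<^sub>1) (b k))" by (simp add: eq)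
  also have "\<dots> = kron 1\<^sub>1 1\<^sub>1"
    by (subst (2) one_b) (simp add: kron_sum_right kron_sc_right kron_sc_left)
  finally show ?thesis by (simp add: kron_idm)
qed

lemma a_a'_unit: "(\<Sum>i<n. \<Sum>j<n. kron (a i *\<^sub>1 a' j) (b j *\<^sub>1 b i)) = 1\<^sub>2"
proof (rule transfer_\<sigma>)
  have "R' *\<^sub>2 R = (\<Sum>i<n. kron (a i) (\<sigma> i)) *\<^sub>2 (\<Sum>j<n. kron (a' j) (\<sigma> j))"
    by (simp only: R'_\<sigma> R_a')
  then show "(\<Sum>i<n. \<Sum>j<n. kron (a i *\<^sub>1 a' j) (\<sigma> i *\<^sub>1 \<sigma> j)) = 1\<^sub>2"
    by (simp add: mm_sum_left) (simp add: mm_sum_right mul_kron)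
qed

lemma a'_a_unit: "(\<Sum>i<n. \<Sum>j<n. kron (a' i *\<^sub>1 a j) (b j *\<^sub>1 b i)) = 1\<^sub>2"
proof (rule transfer_\<sigma>)
  have "R *\<^sub>2 R' = (\<Sum>j<n. kron (a' j) (\<sigma> j)) *\<^sub>2 (\<Sum>i<n. kron (a i) (\<sigma> i))"
    by (simp only: R'_\<sigma> R_a')
  then show "(\<Sum>i<n. \<Sum>j<n. kron (a' i *\<^sub>1 a j) (\<sigma> i *\<^sub>1 \<sigma> j)) = 1\<^sub>2"
    by (simp add: mm_sum_left) (simp add: mm_sum_right mul_kron)
qed

text \<open>
The projection to the coinvariants in the fundamental theorem of Hopf modules, \<open>v \<mapsto> \<Sum> S\<^sup>-\<^sup>1(v\<^sub>1) v\<^sub>0\<close>. The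
Hopf module is \<open>k\<^sup>n\<close> with the action of the \<open>b\<^sub>i\<close> and the coaction \<open>v \<mapsto> \<Sum> a\<^sub>i v \<otimes> b\<^sub>i\<close>.
\<close>

definition E :: "(nat, 'k) fmat" where
  "E = (\<Sum>j<n. b j *\<^sub>1 a' j)"

lemma supp_E [simp]: "supp1 E"
  by (simp add: E_def)

text \<open>
The image of \<open>E\<close> consists of vectors that \<open>R\<close> fixes in its first leg: \<open>R (v \<otimes> w) = v \<otimes> w\<close>.
\<close>

lemma R_E: "R *\<^sub>2 kron E 1\<^sub>1 = kron E 1\<^sub>1"
proof -
  have one: "(\<Sum>q<n. \<Sum>l<n. kron (a l *\<^sub>1 a' q) (b q *\<^sub>1 b l)) = 1\<^sub>2"
    by (subst sum.swap) (rule a_a'_unit)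
  have "R *\<^sub>2 kron E 1\<^sub>1 = (\<Sum>j<n. R *\<^sub>2 kron (b j) 1\<^sub>1 *\<^sub>2 kron (a' j) 1\<^sub>1)"
    by (simp add: E_def kron_sum_left mm_sum_right mm_assoc mul_kron)
  also have "\<dots> = (\<Sum>j<n. (R *\<^sub>2 kron (b j) 1\<^sub>1 *\<^sub>2 R') *\<^sub>2 R *\<^sub>2 kron (a' j) 1\<^sub>1)"
    by (simp add: mm_assoc)
  also have "\<dots> = (\<Sum>j<n. \<Sum>p<n. \<Sum>q<n. kron (b p) (b q) *\<^sub>2 R *\<^sub>2 kron (sc (d j p q) (a' j)) 1\<^sub>1)"
    by (simp add: comult_b mm_linear kron_sc_left)
  also have "\<dots> = (\<Sum>p<n. \<Sum>q<n. \<Sum>j<n. kron (b p) (b q) *\<^sub>2 R *\<^sub>2 kron (sc (d j p q) (a' j)) 1\<^sub>1)"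
    by (subst sum.swap, rule sum.cong[OF refl], rule sum.swap)
  also have "\<dots> = (\<Sum>p<n. \<Sum>q<n. kron (b p) (b q) *\<^sub>2 R *\<^sub>2 kron (a' q *\<^sub>1 a' p) 1\<^sub>1)"
    by (simp add: a'_mult kron_sum_left mm_sum_right)
  also have "\<dots> = (\<Sum>p<n. \<Sum>q<n. \<Sum>l<n. kron (b p *\<^sub>1 (a l *\<^sub>1 (a' q *\<^sub>1 a' p))) (b q *\<^sub>1 b l))"
    by (subst R_sum) (simp add: mm_sum_right mm_sum_left mul_kron mm_assoc)
  also have "\<dots> = (\<Sum>p<n. kron (b p) 1\<^sub>1 *\<^sub>2 (\<Sum>q<n. \<Sum>l<n. kron (a l *\<^sub>1 a' q) (b q *\<^sub>1 b l)) *\<^sub>2 kron (a' p) 1\<^sub>1)"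
    by (simp add: mm_sum_right mm_sum_left mul_kron mm_assoc)
  also have "\<dots> = kron E 1\<^sub>1"
    by (simp add: one mul_kron E_def kron_sum_left)
  finally show ?thesis .
qed

text \<open>
Multiplying the second leg of \<open>\<Sum> a'\<^sub>i a\<^sub>j \<otimes> b\<^sub>j b\<^sub>i = 1 \<otimes> 1\<close> by the first. It says that the coinvariants generate \<open>k\<^sup>n\<close>
under the \<open>b\<^sub>i\<close>; here it is used to see that \<open>E\<close> is not zero.
\<close>

lemma E_partition: "(\<Sum>i<n. b i *\<^sub>1 E *\<^sub>1 a i) = 1\<^sub>1"
proof -
  \<comment> \<open>The linear map \<open>X \<otimes> Y \<mapsto> Y X\<close>.\<close>
  define contract where "contract C = (\<lambda>p q. \<Sum>y<n. C (y, p) (q, y))" for C :: "(nat \<times> nat, 'k) fmat"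
  have contract_sum: "contract (\<Sum>i<n. Z i) = (\<Sum>i<n. contract (Z i))" for Z
    by (intro ext, simp add: contract_def sum_fun_apply) (rule sum.swap)
  have contract_kron: "contract (kron X Y) = Y *\<^sub>1 X" for X Y
    by (intro ext) (simp add: contract_def kron_def mm_def mult.commute)
  have "contract (\<Sum>i<n. \<Sum>j<n. kron (a' i *\<^sub>1 a j) (b j *\<^sub>1 b i)) = contract (kron 1\<^sub>1 1\<^sub>1)"
    by (simp add: a'_a_unit kron_idm)
  then have "(\<Sum>i<n. \<Sum>j<n. b j *\<^sub>1 b i *\<^sub>1 (a' i *\<^sub>1 a j)) = 1\<^sub>1"
    by (simp add: contract_sum contract_kron)
  then show ?thesis
    by (subst (asm) sum.swap) (simp add: E_def mm_sum_left mm_sum_right mm_assoc)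
qed

lemma E_nonzero: "\<exists>p q. E p q \<noteq> 0"
proof (rule ccontr)
  assume "\<not> (\<exists>p q. E p q \<noteq> 0)"
  then have "b i *\<^sub>1 E *\<^sub>1 a i = 0" for i by (intro ext) (simp add: mm_def)
  then have "1\<^sub>1 0 0 = (0::'k)" using E_partition by (simp flip: E_partition)
  then show False using pos by (simp add: idm_def)
qed

text \<open>
On a coinvariant vector \<open>v\<close>, the \<open>a\<^sub>i\<close> act on \<open>b\<^sub>k v\<close> as they act on \<open>e\<^sub>k\<close> in the regular solution, because
\<open>R (b\<^sub>k \<otimes> 1) = \<Delta>(b\<^sub>k) R\<close> and \<open>R\<close> fixes \<open>v\<close>.
\<close>

lemma a_b_E:
  assumes "i < n" "k < n"
  shows "a i *\<^sub>1 (b k *\<^sub>1 E) = (\<Sum>j<n. sc (d k j i) (b j *\<^sub>1 E))"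
proof (rule indep_kron_right[OF indep_b _ assms(1)])
  have "(\<Sum>i<n. kron (a i *\<^sub>1 (b k *\<^sub>1 E)) (b i)) = R *\<^sub>2 kron (b k) 1\<^sub>1 *\<^sub>2 kron E 1\<^sub>1"
    using assms by (simp add: R_sum mm_sum_left mul_kron mm_assoc)
  also have "\<dots> = (R *\<^sub>2 kron (b k) 1\<^sub>1 *\<^sub>2 R') *\<^sub>2 (R *\<^sub>2 kron E 1\<^sub>1)"
    using assms by (simp add: mm_assoc)
  also have "\<dots> = (\<Sum>i<n. \<Sum>j<n. sc (d k i j) (kron (b i *\<^sub>1 E) (b j)))"
    unfolding R_E using assms by (simp add: comult_b mm_linear mul_kron)
  also have "\<dots> = (\<Sum>i<n. kron (\<Sum>j<n. sc (d k j i) (b j *\<^sub>1 E)) (b i))"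
    by (subst sum.swap) (simp add: kron_sum_left kron_sc_left)
  finally show "(\<Sum>i<n. kron (a i *\<^sub>1 (b k *\<^sub>1 E)) (b i))
    = (\<Sum>i<n. kron (\<Sum>j<n. sc (d k j i) (b j *\<^sub>1 E)) (b i))" .
qed

text \<open>
\<open>\<Sum> S\<^sup>-\<^sup>1(h\<^sub>2) h\<^sub>1 = \<epsilon>(h)\<close> for \<open>h = b\<^sub>k\<close>.
\<close>

lemma counit_formula:
  assumes "k < n"
  shows "(\<Sum>l<n. \<Sum>q<n. \<Sum>i<n. sc (x i q * d k l i) (b q *\<^sub>1 b l)) = sc (\<epsilon> k) 1\<^sub>1"
proof (rule indep_kron_left[OF indep_a _ assms])
  have "(\<Sum>k<n. kron (a k) (\<Sum>l<n. \<Sum>q<n. \<Sum>i<n. sc (x i q * d k l i) (b q *\<^sub>1 b l)))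
    = (\<Sum>k<n. \<Sum>l<n. \<Sum>q<n. \<Sum>i<n. sc (x i q * d k l i) (kron (a k) (b q *\<^sub>1 b l)))"
    by (simp add: kron_sum_right kron_sc_right)
  also have "\<dots> = (\<Sum>l<n. \<Sum>q<n. \<Sum>i<n. \<Sum>k<n. sc (x i q * d k l i) (kron (a k) (b q *\<^sub>1 b l)))"
    by (subst sum.swap, rule sum.cong[OF refl], subst sum.swap, rule sum.cong[OF refl], rule sum.swap)
  also have "\<dots> = (\<Sum>l<n. \<Sum>q<n. kron (a l *\<^sub>1 a' q) (b q *\<^sub>1 b l))"
    by (simp add: a'_def mm_linear mult_a kron_sum_left kron_sc_left sc_sum sc_sc)
  also have "\<dots> = kron 1\<^sub>1 1\<^sub>1" by (simp add: a_a'_unit kron_idm)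
  also have "\<dots> = (\<Sum>k<n. kron (a k) (sc (\<epsilon> k) 1\<^sub>1))"
    by (subst one_a) (simp add: kron_sum_left kron_sc_left kron_sc_right)
  finally show "(\<Sum>k<n. kron (a k) (\<Sum>l<n. \<Sum>q<n. \<Sum>i<n. sc (x i q * d k l i) (b q *\<^sub>1 b l)))
    = (\<Sum>k<n. kron (a k) (sc (\<epsilon> k) 1\<^sub>1))" .
qed

text \<open>
A nonzero coinvariant vector \<open>v\<close> is killed by no nonzero \<open>h\<close>. If \<open>h v = 0\<close>, then applying the \<open>a\<^sub>i\<close> gives
\<open>\<Sum> h\<^sub>1 v \<langle>e\<^sub>i\<^sup>*, h\<^sub>2\<rangle> = 0\<close>, so the annihilator is closed under \<open>h \<mapsto> \<Sum> h\<^sub>1 \<langle>e\<^sub>i\<^sup>*, h\<^sub>2\<rangle>\<close>. It lies in the kernel of the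
counit, since \<open>\<epsilon>(h) v = \<Sum> S\<^sup>-\<^sup>1(h\<^sub>2) h\<^sub>1 v\<close>. Together these give \<open>\<langle>e\<^sub>i\<^sup>*, h\<rangle> = 0\<close> for all \<open>i\<close>. As a vector, \<open>v\<close> is the
column \<open>q0\<close> of \<open>E\<close>.
\<close>

lemma cyclic_vector_free:
  assumes q0: "E p0 q0 \<noteq> 0"
    and zero: "\<And>p. (\<Sum>k<n. c k * (b k *\<^sub>1 E) p q0) = 0" and i: "i < n"
  shows "c i = 0"
proof -
  have closed: "(\<Sum>j<n. (\<Sum>k<n. c k * d k j i) * (b j *\<^sub>1 E) p q0) = 0"
    if zero: "\<And>p. (\<Sum>k<n. c k * (b k *\<^sub>1 E) p q0) = 0" and i: "i < n" for c :: "nat \<Rightarrow> 'k" and i p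
  proof -
    have "(\<Sum>j<n. (\<Sum>k<n. c k * d k j i) * (b j *\<^sub>1 E) p q0)
      = (\<Sum>k<n. c k * (\<Sum>j<n. d k j i * (b j *\<^sub>1 E) p q0))"
      unfolding sum_distrib_left sum_distrib_right by (subst sum.swap) (simp add: mult.assoc)
    also have "\<dots> = (\<Sum>k<n. c k * (a i *\<^sub>1 (b k *\<^sub>1 E)) p q0)"
      using i by (simp add: a_b_E sum_fun_apply sc_def)
    also have "\<dots> = (\<Sum>y<n. a i p y * (\<Sum>k<n. c k * (b k *\<^sub>1 E) y q0))"
      unfolding mm_def[of _ "a i"] sum_distrib_left by (subst sum.swap) (simp add: mult.left_commute)
    finally show ?thesis by (simp add: zero)
  qed
  have counit: "(\<Sum>k<n. c k * \<epsilon> k) = 0"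
    if zero: "\<And>p. (\<Sum>k<n. c k * (b k *\<^sub>1 E) p q0) = 0" for c :: "nat \<Rightarrow> 'k"
  proof -
    have "\<epsilon> k * E p0 q0 = (\<Sum>l<n. \<Sum>q<n. \<Sum>i<n. x i q * d k l i * (b q *\<^sub>1 (b l *\<^sub>1 E)) p0 q0)"
      if "k < n" for k
    proof -
      have "\<epsilon> k * E p0 q0 = (sc (\<epsilon> k) 1\<^sub>1 *\<^sub>1 E) p0 q0" by (simp add: mm_sc_left) (simp add: sc_def)
      also have "\<dots> = (\<Sum>l<n. \<Sum>q<n. \<Sum>i<n. x i q * d k l i * (b q *\<^sub>1 (b l *\<^sub>1 E)) p0 q0)"
        unfolding counit_formula[OF that, symmetric]
        by (simp add: mm_linear mm_assoc sum_fun_apply) (simp add: sc_def)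
      finally show ?thesis .
    qed
    then have "(\<Sum>k<n. c k * \<epsilon> k) * E p0 q0
      = (\<Sum>k<n. c k * (\<Sum>l<n. \<Sum>q<n. \<Sum>i<n. x i q * d k l i * (b q *\<^sub>1 (b l *\<^sub>1 E)) p0 q0))"
      by (simp add: sum_distrib_right mult.assoc)
    also have "\<dots> = (\<Sum>k<n. \<Sum>l<n. \<Sum>q<n. \<Sum>i<n. \<Sum>y<n. x i q * b q p0 y * (c k * d k l i * (b l *\<^sub>1 E) y q0))"
      by (simp add: mm_def[of _ "b _" "mm _ _ _"] sum_distrib_left mult_ac)
    also have "\<dots> = (\<Sum>q<n. \<Sum>i<n. \<Sum>y<n. \<Sum>l<n. \<Sum>k<n. x i q * b q p0 y * (c k * d k l i * (b l *\<^sub>1 E) y q0))"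
    proof -
      have swap: "(\<Sum>k<n. \<Sum>l<n. \<Sum>q<n. \<Sum>i<n. \<Sum>y<n. f k l q i y) = (\<Sum>q<n. \<Sum>i<n. \<Sum>y<n. \<Sum>l<n. \<Sum>k<n. f k l q i y)"
        for f :: "nat \<Rightarrow> nat \<Rightarrow> nat \<Rightarrow> nat \<Rightarrow> nat \<Rightarrow> 'k"
      proof -
        have "(\<Sum>k<n. \<Sum>l<n. \<Sum>q<n. \<Sum>i<n. \<Sum>y<n. f k l q i y)
          = (\<Sum>(k,l)\<in>{..<n}\<times>{..<n}. \<Sum>(q,i,y)\<in>{..<n}\<times>{..<n}\<times>{..<n}. f k l q i y)"
          by (simp only: sum.cartesian_product[symmetric])
        also have "\<dots> = (\<Sum>(q,i,y)\<in>{..<n}\<times>{..<n}\<times>{..<n}. \<Sum>(k,l)\<in>{..<n}\<times>{..<n}. f k l q i y)"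
          unfolding case_prod_beta by (rule sum.swap)
        also have "\<dots> = (\<Sum>q<n. \<Sum>i<n. \<Sum>y<n. \<Sum>k<n. \<Sum>l<n. f k l q i y)"
          by (simp only: sum.cartesian_product[symmetric])
        also have "\<dots> = (\<Sum>q<n. \<Sum>i<n. \<Sum>y<n. \<Sum>l<n. \<Sum>k<n. f k l q i y)"
          by (intro sum.cong refl sum.swap)
        finally show ?thesis .
      qed
      show ?thesis by (rule swap)
    qed
    also have "\<dots> = (\<Sum>q<n. \<Sum>i<n. \<Sum>y<n. x i q * b q p0 y * (\<Sum>l<n. (\<Sum>k<n. c k * d k l i) * (b l *\<^sub>1 E) y q0))"
      by (simp add: sum_distrib_left sum_distrib_right)
    also have "\<dots> = 0"
      by (simp add: closed[OF zero])
    finally show ?thesis using q0 by simp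
  qed
  have "c i = (\<Sum>k<n. c k * (if k = i then 1 else 0))" using i by (simp add: sum_single_delta)
  also have "\<dots> = (\<Sum>k<n. c k * (\<Sum>j<n. \<epsilon> j * d k j i))"
    using i by (simp add: a_unit)
  also have "\<dots> = (\<Sum>j<n. (\<Sum>k<n. c k * d k j i) * \<epsilon> j)"
    unfolding sum_distrib_left sum_distrib_right by (subst sum.swap) (simp add: mult_ac)
  also have "\<dots> = 0"
    by (rule counit) (rule closed[OF zero i])
  finally show ?thesis .
qed

text \<open>
By \<open>cyclic_vector_free\<close> the \<open>n\<close> vectors \<open>b\<^sub>k v\<close> form a basis of \<open>k\<^sup>n\<close>. In this basis the \<open>b\<^sub>i\<close> act by left
multiplication and the \<open>a\<^sub>i\<close> as in \<open>a_b_E\<close>, that is, as in the regular solution.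
\<close>

theorem conjugate_to_regular:
  "\<exists>u v. supp1 u \<and> supp1 v \<and> u *\<^sub>1 v = 1\<^sub>1 \<and> v *\<^sub>1 u = 1\<^sub>1 \<and>
    R = kron u u *\<^sub>2 regular_solution n m d *\<^sub>2 kron v v"
proof -
  obtain p0 q0 where q0: "E p0 q0 \<noteq> 0" using E_nonzero by blast
  define u where "u = (\<lambda>p k. if k < n then (b k *\<^sub>1 E) p q0 else 0)"
  have u: "u p k = (b k *\<^sub>1 E) p q0" if "k < n" for p k using that by (simp add: u_def)
  have supp_bE: "supp1 (b k *\<^sub>1 E)" if "k < n" for k using that by simp
  then have supp_u: "supp1 u" unfolding supported_def u_def by simp
  \<comment> \<open>A family dual to the columns of \<open>u\<close> is a left inverse of \<open>u\<close>.\<close>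
  have "\<exists>v. \<forall>i<n. \<forall>k<n. (\<Sum>p<n. v i p * u p k) = (if i = k then 1 else 0)"
  proof (rule ccontr)
    assume "\<not> ?thesis"
    with dual_family_or_dependent[of "{..<n}" n "\<lambda>k p. u p k"]
    obtain k c where k: "k < n" and kc: "\<And>p. p < n \<Longrightarrow> u p k = (\<Sum>i<k. c i * u p i)" by auto
    define c' where "c' i = (if i < k then c i else if i = k then - 1 else 0)" for i
    have "(\<Sum>i<n. c' i * (b i *\<^sub>1 E) p q0) = 0" for p
    proof (cases "p < n")
      case True
      have "(\<Sum>i<n. c' i * u p i) = (\<Sum>i<Suc k. c' i * u p i)"
        using k by (intro sum.mono_neutral_right) (auto simp: c'_def)
      also have "\<dots> = (\<Sum>i<k. c i * u p i) - u p k"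
        by (simp add: c'_def)
      finally show ?thesis using kc[OF True] by (simp add: u)
    next
      case False
      then show ?thesis using supp_bE by (auto simp: supported_def intro!: sum.neutral)
    qed
    from cyclic_vector_free[OF q0 this k] show False by (simp add: c'_def)
  qed
  then obtain v' where v': "\<And>i k. i < n \<Longrightarrow> k < n \<Longrightarrow> (\<Sum>p<n. v' i p * u p k) = (if i = k then 1 else 0)"
    by blast
  define v where "v = (\<lambda>i p. if i < n \<and> p < n then v' i p else 0)"
  have supp_v: "supp1 v" by (auto simp: supported_def v_def)
  have v_u: "v *\<^sub>1 u = 1\<^sub>1"
  proof (intro ext)
    fix i k
    show "(v *\<^sub>1 u) i k = 1\<^sub>1 i k"
      using v'[of i k] by (cases "i < n"; cases "k < n") (auto simp: mm_def v_def u_def idm_def)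
  qed
  have u_v: "u *\<^sub>1 v = 1\<^sub>1"
  proof (intro ext)
    fix i k
    show "(u *\<^sub>1 v) i k = 1\<^sub>1 i k"
    proof (cases "i < n \<and> k < n")
      case True
      then show ?thesis
        using left_inverse_is_right_inverse[OF v', of i k] by (simp add: mm_def v_def idm_def)
    next
      case False
      have "supp1 (u *\<^sub>1 v)" using supp_u supp_v by simp
      with False show ?thesis by (auto simp: supported_def idm_def)
    qed
  qed
  have a_u: "a i *\<^sub>1 u = u *\<^sub>1 regular_a n d i" if i: "i < n" for i
  proof (intro ext)
    fix p k
    show "(a i *\<^sub>1 u) p k = (u *\<^sub>1 regular_a n d i) p k"
    proof (cases "k < n")
      case True
      have "(a i *\<^sub>1 u) p k = (a i *\<^sub>1 (b k *\<^sub>1 E)) p q0"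
        using True by (simp add: mm_def[of _ "a i"] u)
      also have "\<dots> = (\<Sum>j<n. d k j i * u p j)"
        using True i by (simp add: a_b_E sum_fun_apply sc_def u)
      also have "\<dots> = (u *\<^sub>1 regular_a n d i) p k"
        using True by (simp add: mm_def regular_a_def mult.commute)
      finally show ?thesis .
    qed (simp add: mm_def u_def regular_a_def)
  qed
  have b_u: "b i *\<^sub>1 u = u *\<^sub>1 regular_b n m i" if i: "i < n" for i
  proof (intro ext)
    fix p k
    show "(b i *\<^sub>1 u) p k = (u *\<^sub>1 regular_b n m i) p k"
    proof (cases "k < n")
      case True
      have "(b i *\<^sub>1 u) p k = (b i *\<^sub>1 (b k *\<^sub>1 E)) p q0"
        using True by (simp add: mm_def[of _ "b i"] u)
      also have "b i *\<^sub>1 (b k *\<^sub>1 E) = (\<Sum>j<n. sc (m i k j) (b j *\<^sub>1 E))"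
        using True i by (simp add: mult_b mm_linear flip: mm_assoc)
      also have "\<dots> p q0 = (\<Sum>j<n. m i k j * u p j)"
        by (simp add: sum_fun_apply sc_def u)
      also have "\<dots> = (u *\<^sub>1 regular_b n m i) p k"
        using True by (simp add: mm_def regular_b_def mult.commute)
      finally show ?thesis .
    qed (simp add: mm_def u_def regular_b_def)
  qed
  have "R *\<^sub>2 kron u u = kron u u *\<^sub>2 regular_solution n m d"
    by (simp add: R_sum regular_solution_def mm_linear mul_kron a_u b_u)
  then have "R *\<^sub>2 kron u u *\<^sub>2 kron v v = kron u u *\<^sub>2 regular_solution n m d *\<^sub>2 kron v v"
    by simp
  then have "R = kron u u *\<^sub>2 regular_solution n m d *\<^sub>2 kron v v"
    by (simp add: mm_assoc mul_kron u_v kron_idm)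
  with supp_u supp_v u_v v_u show ?thesis by blast
qed

end

section \<open>Realizations of structure constants\<close>

definition realizes :: "nat \<Rightarrow> (nat \<times> nat, 'k::field) fmat \<Rightarrow> (nat \<Rightarrow> nat \<Rightarrow> nat \<Rightarrow> 'k)
    \<Rightarrow> (nat \<Rightarrow> nat \<Rightarrow> nat \<Rightarrow> 'k) \<Rightarrow> bool" where
  "realizes n R m d \<longleftrightarrow> (\<exists>R' a b. pentagon_realization n R R' a b m d)"

lemma (in pentagon_realization) hopf_constants_exist: "\<exists>\<eta> \<epsilon> s. hopf_constants n m d \<eta> \<epsilon> s"
proof -
  obtain \<eta> \<epsilon> s where "1\<^sub>1 = (\<Sum>i<n. sc (\<epsilon> i) (a i))" "1\<^sub>1 = (\<Sum>i<n. sc (\<eta> i) (b i))"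
     "R' = (\<Sum>i<n. \<Sum>j<n. sc (s i j) (kron (a i) (b j)))"
    using units_exist by blast
  then interpret pentagon_hopf n R R' a b m d \<eta> \<epsilon> s by unfold_locales
  show ?thesis using constants by blast
qed

lemma (in pentagon_realization) realization_conjugate_to_regular:
  "\<exists>u v. supp1 u \<and> supp1 v \<and> u *\<^sub>1 v = 1\<^sub>1 \<and> v *\<^sub>1 u = 1\<^sub>1 \<and>
    R = kron u u *\<^sub>2 regular_solution n m d *\<^sub>2 kron v v"
proof -
  obtain \<eta> \<epsilon> s where "1\<^sub>1 = (\<Sum>i<n. sc (\<epsilon> i) (a i))" "1\<^sub>1 = (\<Sum>i<n. sc (\<eta> i) (b i))"
     "R' = (\<Sum>i<n. \<Sum>j<n. sc (s i j) (kron (a i) (b j)))"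
    using units_exist by blast
  then interpret pentagon_hopf n R R' a b m d \<eta> \<epsilon> s by unfold_locales
  obtain x where "R = (\<Sum>i<n. \<Sum>j<n. sc (x i j) (kron (a i) (\<sigma> j)))"
    using R_in_span_\<sigma> unfolding kron_span_def by blast
  then interpret pentagon_antipode n R R' a b m d \<eta> \<epsilon> s x by unfold_locales
  show ?thesis by (rule conjugate_to_regular)
qed

context matrix_size
begin

lemma slice1_eqI:
  assumes "supp3 X" "supp3 Y" "\<And>p q. p < n \<Longrightarrow> q < n \<Longrightarrow> slice1 p q X = slice1 p q Y"
  shows "X = Y"
proof (intro ext)
  fix x y :: "(nat \<times> nat) \<times> nat"
  obtain p r t q w z where xy: "x = ((p, r), t)" "y = ((q, w), z)" by (metis surj_pair)
  show "X x y = Y x y"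
  proof (cases "p < n \<and> q < n")
    case True
    then show ?thesis
      using fun_cong[OF fun_cong[OF assms(3)[of p q]], of "(r, t)" "(w, z)"] by (simp add: slice1_def xy)
  next
    case False
    then show ?thesis using assms(1,2) by (auto simp: supported_def xy)
  qed
qed

text \<open>
Slicing the first leg turns the pentagon equation into the intertwining relation \<open>R (b\<^sub>k \<otimes> 1) = \<Delta>(b\<^sub>k) R\<close>.
\<close>

lemma pentagon_from_comult:
  assumes supp: "\<And>i. i < n \<Longrightarrow> supp1 (a i)" "\<And>i. i < n \<Longrightarrow> supp1 (b i)"
    and R: "R = (\<Sum>i<n. kron (a i) (b i))"
    and mult_a: "\<And>i j. i < n \<Longrightarrow> j < n \<Longrightarrow> a i *\<^sub>1 a j = (\<Sum>k<n. sc (d k i j) (a k))"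
    and comult: "\<And>k. k < n \<Longrightarrow>
      R *\<^sub>2 kron (b k) 1\<^sub>1 = (\<Sum>i<n. \<Sum>j<n. sc (d k i j) (kron (b i) (b j))) *\<^sub>2 R"
  shows "pentagon_mat n R"
proof -
  have supp_R: "supp2 R" unfolding R using supp by simp
  have "L12 R *\<^sub>3 L13 R *\<^sub>3 L23 R = L23 R *\<^sub>3 L12 R"
  proof (rule slice1_eqI)
    fix p q assume pq: "p < n" "q < n"
    have "slice1 p q (L12 R *\<^sub>3 L13 R) = (\<Sum>i<n. \<Sum>j<n. sc ((a i *\<^sub>1 a j) p q) (kron (b i) (b j)))"
      using supp by (simp add: R legs_sum legs_kron mm_sum_left)
        (simp add: mm_sum_right mul_kron slice_sum slice_kron)
    also have "\<dots> = (\<Sum>i<n. \<Sum>j<n. \<Sum>k<n. sc (a k p q) (sc (d k i j) (kron (b i) (b j))))"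
      by (simp add: mult_a sum_fun_apply sc_sum_coeff sc_sc)
        (simp add: sc_def mult_ac)
    also have "\<dots> = (\<Sum>k<n. sc (a k p q) (\<Sum>i<n. \<Sum>j<n. sc (d k i j) (kron (b i) (b j))))"
      unfolding sc_sum by (rule trans[OF sum.cong[OF refl sum.swap] sum.swap])
    finally have "slice1 p q (L12 R *\<^sub>3 L13 R *\<^sub>3 L23 R)
      = (\<Sum>k<n. sc (a k p q) (\<Sum>i<n. \<Sum>j<n. sc (d k i j) (kron (b i) (b j)))) *\<^sub>2 R"
      using pq by (simp add: slice1_leg23_right)
    also have "\<dots> = R *\<^sub>2 (\<Sum>k<n. sc (a k p q) (kron (b k) 1\<^sub>1))"
      by (simp add: mm_linear comult)
    also have "(\<Sum>k<n. sc (a k p q) (kron (b k) 1\<^sub>1)) = slice1 p q (L12 R)"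
      by (simp add: R legs_sum legs_kron slice_sum slice_kron)
    finally show "slice1 p q (L12 R *\<^sub>3 L13 R *\<^sub>3 L23 R) = slice1 p q (L23 R *\<^sub>3 L12 R)"
      using pq by (simp add: slice1_leg23_left)
  qed (use supp_R in simp_all)
  then show ?thesis by (simp add: pentagon_mat_def Let_def)
qed

lemma conjugate_realization:
  assumes "pentagon_realization n R R' a b m d"
    and u: "supp1 u" and v: "supp1 v" and uv: "u *\<^sub>1 v = 1\<^sub>1" "v *\<^sub>1 u = 1\<^sub>1"
  shows "pentagon_realization n (kron u u *\<^sub>2 R *\<^sub>2 kron v v) (kron u u *\<^sub>2 R' *\<^sub>2 kron v v)
    (\<lambda>i. u *\<^sub>1 a i *\<^sub>1 v) (\<lambda>i. u *\<^sub>1 b i *\<^sub>1 v) m d"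
proof -
  interpret pentagon_realization n R R' a b m d by fact
  let ?R = "kron u u *\<^sub>2 R *\<^sub>2 kron v v" and ?R' = "kron u u *\<^sub>2 R' *\<^sub>2 kron v v"
  have [simp]: "kron v v *\<^sub>2 (kron u u *\<^sub>2 Z) = Z" "kron u u *\<^sub>2 (kron v v *\<^sub>2 Z) = Z" if "supp2 Z" for Z :: "(nat \<times> nat, 'a) fmat"
    using that by (simp_all add: mul_kron uv kron_idm flip: mm_assoc)
  have [simp]: "v *\<^sub>1 (u *\<^sub>1 Z) = Z" if "supp1 Z" for Z :: "(nat, 'a) fmat"
    using that by (simp add: uv flip: mm_assoc)
  have [simp]: "R *\<^sub>2 (R' *\<^sub>2 Z) = Z" "R' *\<^sub>2 (R *\<^sub>2 Z) = Z" if "supp2 Z" for Z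
    using that by (simp_all flip: mm_assoc)
  have UV: "kron u u *\<^sub>2 kron v v = 1\<^sub>2" by (simp add: mul_kron uv kron_idm)
  have sum: "?R = (\<Sum>i<n. kron (u *\<^sub>1 a i *\<^sub>1 v) (u *\<^sub>1 b i *\<^sub>1 v))"
    by (simp add: R_sum mm_linear mul_kron)
  have mult: "u *\<^sub>1 c *\<^sub>1 v *\<^sub>1 (u *\<^sub>1 e *\<^sub>1 v) = u *\<^sub>1 (c *\<^sub>1 e) *\<^sub>1 v" if "supp1 c" "supp1 e" for c e
    using that v by (simp add: mm_assoc)
  have mult_a': "u *\<^sub>1 a i *\<^sub>1 v *\<^sub>1 (u *\<^sub>1 a j *\<^sub>1 v) = (\<Sum>k<n. sc (d k i j) (u *\<^sub>1 a k *\<^sub>1 v))"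
    if "i < n" "j < n" for i j
    using that by (simp add: mult) (simp add: mult_a mm_linear)
  have mult_b': "u *\<^sub>1 b i *\<^sub>1 v *\<^sub>1 (u *\<^sub>1 b j *\<^sub>1 v) = (\<Sum>k<n. sc (m i j k) (u *\<^sub>1 b k *\<^sub>1 v))"
    if "i < n" "j < n" for i j
    using that by (simp add: mult) (simp add: mult_b mm_linear)
  have indep: "indep n (\<lambda>i. u *\<^sub>1 c i *\<^sub>1 v)" if c: "indep n c" and supp: "\<And>i. i < n \<Longrightarrow> supp1 (c i)" for c
  proof -
    obtain \<phi> where \<phi>: "\<And>i j. i < n \<Longrightarrow> j < n \<Longrightarrow>
      (\<Sum>p<n. \<Sum>q<n. \<phi> i p q * c j p q) = (if i = j then 1 else 0)"
      using c by (auto simp: indep_def sum_pairs)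
    have "(\<Sum>p<n. \<Sum>q<n. (\<Sum>x<n. \<Sum>y<n. v x p * \<phi> i x y * u q y) * (u *\<^sub>1 c j *\<^sub>1 v) p q) = (if i = j then 1 else 0)"
      if ij: "i < n" "j < n" for i j
    proof -
      have "(\<Sum>p<n. \<Sum>q<n. (\<Sum>x<n. \<Sum>y<n. v x p * \<phi> i x y * u q y) * (u *\<^sub>1 c j *\<^sub>1 v) p q)
        = (\<Sum>(p,q)\<in>{..<n}\<times>{..<n}. \<Sum>(x,y)\<in>{..<n}\<times>{..<n}. v x p * \<phi> i x y * u q y * (u *\<^sub>1 c j *\<^sub>1 v) p q)"
        by (simp only: sum_distrib_right sum.cartesian_product[symmetric])
      also have "\<dots> = (\<Sum>(x,y)\<in>{..<n}\<times>{..<n}. \<Sum>(p,q)\<in>{..<n}\<times>{..<n}. v x p * \<phi> i x y * u q y * (u *\<^sub>1 c j *\<^sub>1 v) p q)"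
        unfolding case_prod_beta by (rule sum.swap)
      also have "\<dots> = (\<Sum>(x,y)\<in>{..<n}\<times>{..<n}. \<phi> i x y * (v *\<^sub>1 ((u *\<^sub>1 c j *\<^sub>1 v) *\<^sub>1 u)) x y)"
        unfolding mm_def[of _ v] mm_def[of _ "_ *\<^sub>1 v"]
        by (intro sum.cong refl) (auto simp: sum_pairs sum_distrib_left mult_ac)
      also have "\<dots> = (\<Sum>(x,y)\<in>{..<n}\<times>{..<n}. \<phi> i x y * c j x y)"
        using supp[OF ij(2)] uv by (simp add: mm_assoc)
      finally show ?thesis using \<phi>[OF ij] by (simp add: sum_pairs)
    qed
    then show ?thesis
      unfolding indep_def sum_pairs by (intro exI[of _ "\<lambda>i p q. \<Sum>x<n. \<Sum>y<n. v x p * \<phi> i x y * u q y"]) simp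
  qed
  have comult: "?R *\<^sub>2 kron (u *\<^sub>1 b k *\<^sub>1 v) 1\<^sub>1
    = (\<Sum>i<n. \<Sum>j<n. sc (d k i j) (kron (u *\<^sub>1 b i *\<^sub>1 v) (u *\<^sub>1 b j *\<^sub>1 v))) *\<^sub>2 ?R" if k: "k < n" for k
  proof -
    have 1: "kron (u *\<^sub>1 c *\<^sub>1 v) 1\<^sub>1 = kron u u *\<^sub>2 kron c 1\<^sub>1 *\<^sub>2 kron v v" for c
      using u v uv by (simp add: mul_kron)
    have "?R *\<^sub>2 kron (u *\<^sub>1 b k *\<^sub>1 v) 1\<^sub>1 = kron u u *\<^sub>2 (R *\<^sub>2 kron (b k) 1\<^sub>1 *\<^sub>2 R') *\<^sub>2 R *\<^sub>2 kron v v"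
      unfolding 1 using k u v by (simp add: mm_assoc)
    also have "\<dots> = (kron u u *\<^sub>2 (R *\<^sub>2 kron (b k) 1\<^sub>1 *\<^sub>2 R') *\<^sub>2 kron v v) *\<^sub>2 ?R"
      using k u v by (simp add: mm_assoc)
    also have "kron u u *\<^sub>2 (R *\<^sub>2 kron (b k) 1\<^sub>1 *\<^sub>2 R') *\<^sub>2 kron v v
      = (\<Sum>i<n. \<Sum>j<n. sc (d k i j) (kron (u *\<^sub>1 b i *\<^sub>1 v) (u *\<^sub>1 b j *\<^sub>1 v)))"
      using k by (simp add: comult_b mm_linear mul_kron)
    finally show ?thesis .
  qed
  show ?thesis
  proof unfold_locales
    show "n > 0" by (rule pos)
    show "?R *\<^sub>2 ?R' = 1\<^sub>2" "?R' *\<^sub>2 ?R = 1\<^sub>2"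
      using u v UV by (simp_all add: mm_assoc)
    show "pentagon_mat n ?R"
      by (rule pentagon_from_comult[OF _ _ sum mult_a' comult]) (use u v in simp_all)
  qed (use u v in \<open>simp_all add: sum mult_a' mult_b' indep indep_a indep_b\<close>)
qed

end

text \<open>
Both are conjugate to the regular solution of \<open>m, d\<close>.
\<close>

lemma common_constants_conjugate:
  assumes "realizes n R1 m d" "realizes n R2 m d"
  shows "\<exists>u v. supported {..<n} u \<and> supported {..<n} v \<and>
    mm {..<n} u v = idm {..<n} \<and> mm {..<n} v u = idm {..<n} \<and>
    R2 = mm ({..<n}\<times>{..<n}) (mm ({..<n}\<times>{..<n}) (kron u u) R1) (kron v v)"
proof -
  interpret matrix_size n .
  obtain R1' a1 b1 where 1: "pentagon_realization n R1 R1' a1 b1 m d"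
    using assms(1) unfolding realizes_def by blast
  obtain R2' a2 b2 where 2: "pentagon_realization n R2 R2' a2 b2 m d"
    using assms(2) unfolding realizes_def by blast
  let ?R = "regular_solution n m d"
  obtain u1 v1 where u1: "supp1 u1" "supp1 v1" "u1 *\<^sub>1 v1 = 1\<^sub>1" "v1 *\<^sub>1 u1 = 1\<^sub>1"
    and R1: "R1 = kron u1 u1 *\<^sub>2 ?R *\<^sub>2 kron v1 v1"
    using pentagon_realization.realization_conjugate_to_regular[OF 1] by blast
  obtain u2 v2 where u2: "supp1 u2" "supp1 v2" "u2 *\<^sub>1 v2 = 1\<^sub>1" "v2 *\<^sub>1 u2 = 1\<^sub>1"
    and R2: "R2 = kron u2 u2 *\<^sub>2 ?R *\<^sub>2 kron v2 v2"
    using pentagon_realization.realization_conjugate_to_regular[OF 2] by blast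
  have cancel: "v1 *\<^sub>1 (u1 *\<^sub>1 Z) = Z" "v2 *\<^sub>1 (u2 *\<^sub>1 Z) = Z" if "supp1 Z" for Z
    using that u1 u2 by (simp_all flip: mm_assoc)
  have cancel2: "kron v1 v1 *\<^sub>2 (kron u1 u1 *\<^sub>2 Z) = Z" if "supp2 Z" for Z
    using that u1 by (simp add: mul_kron kron_idm flip: mm_assoc)
  have supp_reg: "supp2 ?R" by (simp add: regular_solution_def)
  show ?thesis
  proof (intro exI conjI)
    show "supp1 (u2 *\<^sub>1 v1)" "supp1 (u1 *\<^sub>1 v2)" using u1 u2 by simp_all
    show "u2 *\<^sub>1 v1 *\<^sub>1 (u1 *\<^sub>1 v2) = 1\<^sub>1" "u1 *\<^sub>1 v2 *\<^sub>1 (u2 *\<^sub>1 v1) = 1\<^sub>1"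
      using u1 u2 by (simp_all add: mm_assoc cancel)
    show "R2 = kron (u2 *\<^sub>1 v1) (u2 *\<^sub>1 v1) *\<^sub>2 R1 *\<^sub>2 kron (u1 *\<^sub>1 v2) (u1 *\<^sub>1 v2)"
      unfolding R1 R2 mul_kron(1)[symmetric]
      using u1 u2 supp_reg by (simp add: mm_assoc cancel2)
  qed
qed

lemma realizes_conj_invariant:
  assumes "realizes n R m d" "supported {..<n} u" "supported {..<n} v"
    "mm {..<n} u v = idm {..<n}" "mm {..<n} v u = idm {..<n}"
  shows "realizes n (mm ({..<n}\<times>{..<n}) (mm ({..<n}\<times>{..<n}) (kron u u) R) (kron v v)) m d"
  using assms matrix_size.conjugate_realization unfolding realizes_def by blast

section \<open>Length\<close>

text \<open>
Applying the two dual families to the legs factors the \<open>n \<times> n\<close> identity matrix through the index set \<open>F\<close>.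
\<close>

lemma indep_length_bound:
  fixes a b :: "nat \<Rightarrow> (nat, 'k::field) fmat" and F :: "nat set"
  assumes a: "indep n a" and b: "indep n b" and F: "finite F"
    and eq: "(\<Sum>i<n. kron (a i) (b i)) = (\<Sum>l\<in>F. kron (c l) (e l))"
  shows "n \<le> card F"
proof -
  let ?K = "{..<n} \<times> {..<n}"
  obtain \<phi> where \<phi>: "\<And>i j. i < n \<Longrightarrow> j < n \<Longrightarrow>
    (\<Sum>y\<in>?K. \<phi> i (fst y) (snd y) * a j (fst y) (snd y)) = (if i = j then 1 else 0)"
    using a by (auto simp: indep_def case_prod_beta)
  obtain \<psi> where \<psi>: "\<And>i j. i < n \<Longrightarrow> j < n \<Longrightarrow>
    (\<Sum>y\<in>?K. \<psi> i (fst y) (snd y) * b j (fst y) (snd y)) = (if i = j then 1 else 0)"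
    using b by (auto simp: indep_def case_prod_beta)
  have factor: "(\<Sum>l\<in>G. (\<Sum>y\<in>?K. \<phi> i (fst y) (snd y) * c l (fst y) (snd y)) *
        (\<Sum>z\<in>?K. \<psi> j (fst z) (snd z) * e l (fst z) (snd z)))
    = (\<Sum>y\<in>?K. \<Sum>z\<in>?K. \<phi> i (fst y) (snd y) * \<psi> j (fst z) (snd z) *
        (\<Sum>l\<in>G. kron (c l) (e l)) (fst y, fst z) (snd y, snd z))"
    for i j and G :: "nat set" and c e :: "nat \<Rightarrow> (nat, 'k) fmat"
    unfolding sum_product sum_fun_apply unfolding sum_distrib_left
    by (rule trans[OF sum.swap], rule sum.cong[OF refl], rule trans[OF sum.swap])
      (simp add: kron_def mult_ac)
  show ?thesis
  proof (rule identity_factor_bound[OF F])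
    fix i j assume ij: "i < n" "j < n"
    have "(\<Sum>l\<in>F. (\<Sum>y\<in>?K. \<phi> i (fst y) (snd y) * c l (fst y) (snd y)) *
        (\<Sum>z\<in>?K. \<psi> j (fst z) (snd z) * e l (fst z) (snd z)))
      = (\<Sum>l<n. (\<Sum>y\<in>?K. \<phi> i (fst y) (snd y) * a l (fst y) (snd y)) *
        (\<Sum>z\<in>?K. \<psi> j (fst z) (snd z) * b l (fst z) (snd z)))"
      by (simp only: factor eq)
    also have "\<dots> = (\<Sum>l<n. (if i = l then 1 else 0) * (if j = l then 1 else 0))"
      using ij by (intro sum.cong) (auto simp: \<phi> \<psi>)
    also have "\<dots> = (if i = j then 1 else 0)"
      using ij by (subst sum_single_delta) auto
    finally show "(\<Sum>l\<in>F. (\<Sum>y\<in>?K. \<phi> i (fst y) (snd y) * c l (fst y) (snd y)) *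
        (\<Sum>z\<in>?K. \<psi> j (fst z) (snd z) * e l (fst z) (snd z))) = (if i = j then 1 else 0)" .
  qed
qed

lemma indep_or_dependent:
  fixes a :: "nat \<Rightarrow> (nat, 'k::field) fmat"
  assumes supp: "\<And>i. i < n \<Longrightarrow> supported {..<n} (a i)"
  shows "indep n a \<or> (\<exists>k<n. \<exists>c. a k = (\<Sum>i<k. sc (c i) (a i)))"
proof -
  let ?K = "{..<n} \<times> {..<n}"
  have "finite ?K" by simp
  from dual_family_or_dependent[OF this, of n "\<lambda>i x. a i (fst x) (snd x)"]
  show ?thesis
  proof
    assume "\<exists>\<phi>. \<forall>i<n. \<forall>j<n. (\<Sum>x\<in>?K. \<phi> i x * a j (fst x) (snd x)) = (if i = j then 1 else 0)"
    then obtain \<phi> where "\<forall>i<n. \<forall>j<n. (\<Sum>x\<in>?K. \<phi> i x * a j (fst x) (snd x)) = (if i = j then 1 else 0)" ..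
    then have "indep n a"
      unfolding indep_def case_prod_beta by (intro exI[of _ "\<lambda>i p q. \<phi> i (p, q)"]) simp
    then show ?thesis ..
  next
    assume "\<exists>k<n. \<exists>c. \<forall>x\<in>?K. a k (fst x) (snd x) = (\<Sum>i<k. c i * a i (fst x) (snd x))"
    then obtain k c where k: "k < n" and kc: "\<forall>x\<in>?K. a k (fst x) (snd x) = (\<Sum>i<k. c i * a i (fst x) (snd x))"
      by blast
    have "a k = (\<Sum>i<k. sc (c i) (a i))"
    proof (intro ext)
      fix p q
      have "a i p q = 0" if "i \<le> k" "\<not> (p < n \<and> q < n)" for i
        using supp[of i] k that by (auto simp: supported_def)
      then show "a k p q = (\<Sum>i<k. sc (c i) (a i)) p q"
        using kc by (cases "p < n \<and> q < n") (auto simp: sum_fun_apply sc_def)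
    qed
    then show ?thesis using k by blast
  qed
qed

text \<open>
If one leg is a combination of the others, it can be absorbed into them and one term is saved.
\<close>

lemma minimal_length_indep:
  fixes a b :: "nat \<Rightarrow> (nat, 'k::field) fmat"
  assumes supp: "\<And>i. i < n \<Longrightarrow> supported {..<n} (a i)" "\<And>i. i < n \<Longrightarrow> supported {..<n} (b i)"
    and min: "\<And>(F :: nat set) c e. finite F \<Longrightarrow> (\<And>i. i \<in> F \<Longrightarrow> supported {..<n} (c i)) \<Longrightarrow>
      (\<And>i. i \<in> F \<Longrightarrow> supported {..<n} (e i)) \<Longrightarrow>
      (\<Sum>i<n. kron (a i) (b i)) = (\<Sum>i\<in>F. kron (c i) (e i)) \<Longrightarrow> n \<le> card F"
  shows "indep n a" "indep n b"
proof -
  have supp_add: "supported {..<n} (A + sc x B)" if "supported {..<n} A" "supported {..<n} B"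
    for A B :: "(nat, 'k) fmat" and x
    using that by (auto simp: supported_def sc_def)
  have kron_add: "kron A (B + C) = kron A B + kron A C" "kron (B + C) A = kron B A + kron C A"
    for A B C :: "(nat, 'k) fmat"
    by (intro ext, simp add: kron_def algebra_simps)+
  show "indep n a"
  proof (rule ccontr)
    assume "\<not> indep n a"
    then obtain k c where k: "k < n" and kc: "a k = (\<Sum>i<k. sc (c i) (a i))"
      using indep_or_dependent[of n a] supp by blast
    define x where "x i = (if i < k then c i else 0)" for i
    have kc': "a k = (\<Sum>i\<in>{..<n} - {k}. sc (x i) (a i))"
      unfolding kc using k by (intro sum.mono_neutral_cong_left) (auto simp: x_def)
    have "(\<Sum>i<n. kron (a i) (b i)) = kron (a k) (b k) + (\<Sum>i\<in>{..<n} - {k}. kron (a i) (b i))"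
      using k by (simp add: sum.remove)
    also have "\<dots> = (\<Sum>i\<in>{..<n} - {k}. kron (a i) (b i + sc (x i) (b k)))"
      by (subst kc') (simp add: kron_sum_left kron_sc_left kron_sc_right kron_add sum.distrib add.commute)
    finally have "n \<le> card ({..<n} - {k})"
      using k supp by (intro min) (auto intro!: supp_add)
    then show False using k by simp
  qed
  show "indep n b"
  proof (rule ccontr)
    assume "\<not> indep n b"
    then obtain k c where k: "k < n" and kc: "b k = (\<Sum>i<k. sc (c i) (b i))"
      using indep_or_dependent[of n b] supp by blast
    define x where "x i = (if i < k then c i else 0)" for i
    have kc': "b k = (\<Sum>i\<in>{..<n} - {k}. sc (x i) (b i))"
      unfolding kc using k by (intro sum.mono_neutral_cong_left) (auto simp: x_def)
    have "(\<Sum>i<n. kron (a i) (b i)) = kron (a k) (b k) + (\<Sum>i\<in>{..<n} - {k}. kron (a i) (b i))"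
      using k by (simp add: sum.remove)
    also have "\<dots> = (\<Sum>i\<in>{..<n} - {k}. kron (a i + sc (x i) (a k)) (b i))"
      by (subst kc') (simp add: kron_sum_right kron_sc_left kron_sc_right kron_add sum.distrib add.commute)
    finally have "n \<le> card ({..<n} - {k})"
      using k supp by (intro min) (auto intro!: supp_add)
    then show False using k by simp
  qed
qed

lemma (in pentagon_solution) realizes_exists:
  assumes R: "R = (\<Sum>i<n. kron (a i) (b i))"
    and supp: "\<And>i. i < n \<Longrightarrow> supp1 (a i)" "\<And>i. i < n \<Longrightarrow> supp1 (b i)"
    and indep: "indep n a" "indep n b"
  shows "\<exists>m d. realizes n R m d"
proof -
  have "\<exists>d. \<forall>i<n. \<forall>j<n. a i *\<^sub>1 a j = (\<Sum>k<n. sc (d k i j) (a k))"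
    by (rule slice_structure[OF indep _ _ comult_slices[OF R supp]]) (use supp in simp_all)
  then obtain d where d: "\<forall>i<n. \<forall>j<n. a i *\<^sub>1 a j = (\<Sum>k<n. sc (d k i j) (a k))" ..
  have "\<exists>m. \<forall>i<n. \<forall>j<n. b i *\<^sub>1 b j = (\<Sum>k<n. sc (m k i j) (b k))"
    by (rule slice_structure[OF indep(2,1) _ _ mult_slices[OF R supp]]) (use supp in simp_all)
  then obtain m where m: "\<forall>i<n. \<forall>j<n. b i *\<^sub>1 b j = (\<Sum>k<n. sc (m k i j) (b k))" ..
  have "pentagon_realization n R R' a b (\<lambda>i j k. m k i j) d"
    by unfold_locales (use supp indep R m d in simp_all)
  then show ?thesis unfolding realizes_def by blast
qed

section \<open>The regular solution of a Hopf algebra\<close>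

context hopf_constants
begin

interpretation matrix_size n .

text \<open>
Associativity and coassociativity are the multiplication rules of the two families, the functionals
\<open>X \<mapsto> \<langle>e\<^sub>i\<^sup>*, X 1\<rangle>\<close> and \<open>X \<mapsto> \<epsilon>(X e\<^sub>i)\<close> are dual to them, and multiplicativity of the comultiplication gives the
intertwining relation behind the pentagon equation.
\<close>

lemma regular_realization:
  assumes pos: "n > 0"
  shows "realizes n (regular_solution n m d) m d"
proof -
  let ?a = "regular_a n d" and ?b = "regular_b n m"
  have R: "regular_solution n m d = (\<Sum>i<n. kron (?a i) (?b i))" by (simp add: regular_solution_def)
  have mult_a: "?a i *\<^sub>1 ?a j = (\<Sum>k<n. sc (d k i j) (?a k))" if "i < n" "j < n" for i j
  proof (intro ext)
    fix p q
    show "(?a i *\<^sub>1 ?a j) p q = (\<Sum>k<n. sc (d k i j) (?a k)) p q"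
      using coassoc[of q p i j] that
      by (cases "p < n \<and> q < n") (auto simp: mm_def regular_a_def sum_fun_apply sc_def mult.commute)
  qed
  have mult_b: "?b i *\<^sub>1 ?b j = (\<Sum>k<n. sc (m i j k) (?b k))" if "i < n" "j < n" for i j
  proof (intro ext)
    fix p q
    show "(?b i *\<^sub>1 ?b j) p q = (\<Sum>k<n. sc (m i j k) (?b k)) p q"
      using assoc[of i j q p] that
      by (cases "p < n \<and> q < n") (auto simp: mm_def regular_b_def sum_fun_apply sc_def mult.commute)
  qed
  have one_a: "(\<Sum>k<n. sc (\<epsilon> k) (?a k)) = 1\<^sub>1"
  proof (intro ext)
    fix p q
    show "(\<Sum>k<n. sc (\<epsilon> k) (?a k)) p q = 1\<^sub>1 p q"
      using counit_right[of q p]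
      by (cases "p < n \<and> q < n") (auto simp: idm_def regular_a_def sum_fun_apply sc_def)
  qed
  have one_b: "(\<Sum>k<n. sc (\<eta> k) (?b k)) = 1\<^sub>1"
  proof (intro ext)
    fix p q
    show "(\<Sum>k<n. sc (\<eta> k) (?b k)) p q = 1\<^sub>1 p q"
      using unit_left[of q p]
      by (cases "p < n \<and> q < n") (auto simp: idm_def regular_b_def sum_fun_apply sc_def)
  qed
  have indep_a: "indep n ?a"
    unfolding indep_def sum_pairs
  proof (intro exI[of _ "\<lambda>i p q. \<epsilon> p * (if i = q then 1 else 0)"] allI impI)
    fix i j assume ij: "i < n" "j < n"
    have "(\<Sum>p<n. \<Sum>q<n. case (p, q) of (p, q) \<Rightarrow> \<epsilon> p * (if i = q then 1 else 0) * ?a j p q)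
      = (\<Sum>p<n. \<Sum>q<n. (if i = q then 1 else 0) * (\<epsilon> p * d q p j))"
      by (intro sum.cong) (auto simp: regular_a_def)
    also have "\<dots> = (\<Sum>p<n. \<epsilon> p * d i p j)"
      using ij by (simp add: sum_single_delta)
    finally show "(\<Sum>p<n. \<Sum>q<n. case (p, q) of (p, q) \<Rightarrow> \<epsilon> p * (if i = q then 1 else 0) * ?a j p q)
      = (if i = j then 1 else 0)" using ij by (simp add: counit_left)
  qed
  have indep_b: "indep n ?b"
    unfolding indep_def sum_pairs
  proof (intro exI[of _ "\<lambda>i p q. \<eta> q * (if i = p then 1 else 0)"] allI impI)
    fix i j assume ij: "i < n" "j < n"
    have "(\<Sum>p<n. \<Sum>q<n. case (p, q) of (p, q) \<Rightarrow> \<eta> q * (if i = p then 1 else 0) * ?b j p q)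
      = (\<Sum>p<n. (if i = p then 1 else 0) * (\<Sum>q<n. \<eta> q * m j q p))"
      by (intro sum.cong) (auto simp: regular_b_def)
    also have "\<dots> = (\<Sum>q<n. \<eta> q * m j q i)"
      using ij by (simp add: sum_single_delta)
    finally show "(\<Sum>p<n. \<Sum>q<n. case (p, q) of (p, q) \<Rightarrow> \<eta> q * (if i = p then 1 else 0) * ?b j p q)
      = (if i = j then 1 else 0)" using ij by (auto simp: unit_right)
  qed
  have comult: "regular_solution n m d *\<^sub>2 kron (?b k) 1\<^sub>1
    = (\<Sum>i<n. \<Sum>j<n. sc (d k i j) (kron (?b i) (?b j))) *\<^sub>2 regular_solution n m d" if k: "k < n" for k
  proof -
    \<comment> \<open>The operator identity \<open>f \<rightharpoonup> (h x) = \<Sum> h\<^sub>1 ((f h\<^sub>2) \<rightharpoonup> x)\<close>, that is, \<open>\<Delta>(h x) = \<Delta>(h) \<Delta>(x)\<close> paired with \<open>f\<close>.\<close>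
    have exchange: "?a i *\<^sub>1 ?b k = (\<Sum>r<n. \<Sum>t<n. \<Sum>l<n. sc (d k r t * m t l i) (?b r *\<^sub>1 ?a l))" if i: "i < n" for i
    proof (intro ext)
      fix p y
      show "(?a i *\<^sub>1 ?b k) p y = (\<Sum>r<n. \<Sum>t<n. \<Sum>l<n. sc (d k r t * m t l i) (?b r *\<^sub>1 ?a l)) p y"
      proof (cases "p < n \<and> y < n")
        case True
        have "(?a i *\<^sub>1 ?b k) p y = (\<Sum>z<n. m k y z * d z p i)"
          using True by (simp add: mm_def regular_a_def regular_b_def mult.commute)
        also have "\<dots> = (\<Sum>r<n. \<Sum>t<n. \<Sum>z<n. \<Sum>l<n. d k r t * d y z l * (m r z p * m t l i))"
          using True i k by (simp add: comult_mult)
        also have "\<dots> = (\<Sum>r<n. \<Sum>t<n. \<Sum>l<n. \<Sum>z<n. d k r t * d y z l * (m r z p * m t l i))"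
          by (intro sum.cong refl sum.swap)
        also have "\<dots> = (\<Sum>r<n. \<Sum>t<n. \<Sum>l<n. sc (d k r t * m t l i) (?b r *\<^sub>1 ?a l)) p y"
          using True by (simp add: sum_fun_apply sc_def mm_def regular_a_def regular_b_def
              sum_distrib_left mult_ac)
        finally show ?thesis .
      next
        case False
        then show ?thesis by (auto simp: sum_fun_apply sc_def mm_def regular_a_def regular_b_def)
      qed
    qed
    have "regular_solution n m d *\<^sub>2 kron (?b k) 1\<^sub>1 = (\<Sum>i<n. kron (?a i *\<^sub>1 ?b k) (?b i))"
      by (simp add: R mm_linear mul_kron)
    also have "\<dots> = (\<Sum>i<n. \<Sum>r<n. \<Sum>t<n. \<Sum>l<n. sc (d k r t * m t l i) (kron (?b r *\<^sub>1 ?a l) (?b i)))"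
      by (simp add: exchange kron_sum_left kron_sc_left)
    also have "\<dots> = (\<Sum>r<n. \<Sum>t<n. \<Sum>l<n. \<Sum>i<n. sc (d k r t * m t l i) (kron (?b r *\<^sub>1 ?a l) (?b i)))"
      by (subst sum.swap, rule sum.cong[OF refl], subst sum.swap, rule sum.cong[OF refl], rule sum.swap)
    also have "\<dots> = (\<Sum>r<n. \<Sum>t<n. \<Sum>l<n. sc (d k r t) (kron (?b r *\<^sub>1 ?a l) (?b t *\<^sub>1 ?b l)))"
      by (simp add: mult_b kron_sum_right kron_sc_right sc_sum sc_sc)
    also have "\<dots> = (\<Sum>i<n. \<Sum>j<n. sc (d k i j) (kron (?b i) (?b j))) *\<^sub>2 regular_solution n m d"
      by (simp add: R mm_sum_left mm_sc_left) (simp add: mm_sum_right mul_kron sc_sum)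
    finally show ?thesis .
  qed
  define R' where "R' = (\<Sum>i<n. \<Sum>l<n. sc (s i l) (kron (?a i) (?b l)))"
  have one: "(\<Sum>k<n. \<Sum>p<n. sc (\<epsilon> k * \<eta> p) (kron (?a k) (?b p))) = 1\<^sub>2"
    using kron_lincomb[of \<epsilon> ?a n \<eta> ?b] by (simp add: kron_idm one_a one_b)
  have "R' *\<^sub>2 regular_solution n m d
    = (\<Sum>i<n. \<Sum>l<n. \<Sum>j<n. sc (s i l) (kron (?a i *\<^sub>1 ?a j) (?b l *\<^sub>1 ?b j)))"
    by (simp add: R R'_def mm_sum_left mm_sc_left) (simp add: mm_sum_right mul_kron sc_sum)
  also have "\<dots> = (\<Sum>k<n. \<Sum>p<n. sc (\<Sum>i<n. \<Sum>l<n. \<Sum>j<n. s i l * (d k i j * m l j p)) (kron (?a k) (?b p)))"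
    by (simp add: mult_a mult_b kron_lincomb sc_sum sc_sc collect_sc2)
  also have "\<dots> = 1\<^sub>2" by (simp add: antipode_left one)
  finally have inv1: "R' *\<^sub>2 regular_solution n m d = 1\<^sub>2" .
  have "regular_solution n m d *\<^sub>2 R'
    = (\<Sum>j<n. \<Sum>i<n. \<Sum>l<n. sc (s i l) (kron (?a j *\<^sub>1 ?a i) (?b j *\<^sub>1 ?b l)))"
    by (simp add: R R'_def mm_sum_left) (simp add: mm_sum_right mm_sc_right mul_kron sc_sum)
  also have "\<dots> = (\<Sum>k<n. \<Sum>p<n. sc (\<Sum>j<n. \<Sum>i<n. \<Sum>l<n. s i l * (d k j i * m j l p)) (kron (?a k) (?b p)))"
    by (simp add: mult_a mult_b kron_lincomb sc_sum sc_sc collect_sc2)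
  also have "\<dots> = 1\<^sub>2" by (simp add: antipode_right one)
  finally have inv2: "regular_solution n m d *\<^sub>2 R' = 1\<^sub>2" .
  have "pentagon_realization n (regular_solution n m d) R' ?a ?b m d"
  proof unfold_locales
    show "pentagon_mat n (regular_solution n m d)"
      by (rule pentagon_from_comult[OF _ _ R mult_a comult]) simp_all
    show "supp2 (regular_solution n m d)" "supp2 R'" by (simp_all add: R R'_def)
    show "regular_solution n m d = (\<Sum>i<n. kron (?a i) (?b i))" by (rule R)
  qed (use pos in \<open>simp_all add: inv1 inv2 indep_a indep_b mult_a mult_b\<close>)
  then show ?thesis unfolding realizes_def by blast
qed

end

section \<open>Change of basis\<close>

text \<open>
The constants \<open>m', d'\<close> belong to the basis \<open>e'\<^sub>i = \<Sum> Q\<^sub>i\<^sub>j e\<^sub>j\<close> if \<open>m, d\<close> belong to \<open>e\<close>. In this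
form the equations avoid the inverse of \<open>Q\<close>.
\<close>

definition basechange :: "nat \<Rightarrow> (nat \<Rightarrow> nat \<Rightarrow> 'k::field) \<Rightarrow> (nat \<Rightarrow> nat \<Rightarrow> nat \<Rightarrow> 'k) \<Rightarrow> (nat \<Rightarrow> nat \<Rightarrow> nat \<Rightarrow> 'k)
    \<Rightarrow> (nat \<Rightarrow> nat \<Rightarrow> nat \<Rightarrow> 'k) \<Rightarrow> (nat \<Rightarrow> nat \<Rightarrow> nat \<Rightarrow> 'k) \<Rightarrow> bool" where
  "basechange n Q m d m' d' \<longleftrightarrow>
     (\<forall>p<n. \<forall>q<n. \<forall>k<n. (\<Sum>i<n. \<Sum>j<n. Q p i * Q q j * m i j k) = (\<Sum>r<n. m' p q r * Q r k)) \<and>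
     (\<forall>k<n. \<forall>i<n. \<forall>j<n. (\<Sum>l<n. Q k l * d l i j) = (\<Sum>p<n. \<Sum>q<n. d' k p q * Q p i * Q q j))"

text \<open>
The \<open>b\<^sub>i\<close> change like a basis and the \<open>a\<^sub>i\<close> like the dual basis, so their canonical element \<open>R\<close> stays the same.
\<close>

lemma (in pentagon_realization) basechange_realization:
  assumes QP: "\<And>i j. i < n \<Longrightarrow> j < n \<Longrightarrow> (\<Sum>l<n. Q i l * P l j) = (if i = j then 1 else 0)"
    and bc: "basechange n Q m d m' d'"
  shows "pentagon_realization n R R' (\<lambda>j. \<Sum>i<n. sc (P i j) (a i)) (\<lambda>i. \<Sum>j<n. sc (Q i j) (b j)) m' d'"
proof -
  note PQ = left_inverse_is_right_inverse[OF QP]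
  let ?a = "\<lambda>j. \<Sum>i<n. sc (P i j) (a i)" and ?b = "\<lambda>i. \<Sum>j<n. sc (Q i j) (b j)"
  have bc1: "(\<Sum>i<n. \<Sum>j<n. Q p i * Q q j * m i j k) = (\<Sum>r<n. m' p q r * Q r k)"
    if "p < n" "q < n" "k < n" for p q k using bc that by (simp add: basechange_def)
  have bc2: "(\<Sum>l<n. Q k l * d l i j) = (\<Sum>p<n. \<Sum>q<n. d' k p q * Q p i * Q q j)"
    if "k < n" "i < n" "j < n" for k i j using bc that by (simp add: basechange_def)
  have mult_b': "?b p *\<^sub>1 ?b q = (\<Sum>r<n. sc (m' p q r) (?b r))" if pq: "p < n" "q < n" for p q
  proof -
    have "?b p *\<^sub>1 ?b q = (\<Sum>i<n. \<Sum>j<n. sc (Q p i * Q q j) (b i *\<^sub>1 b j))"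
      by (simp add: mm_sum_left mm_sc_left) (simp add: mm_sum_right mm_sc_right sc_sum sc_sc)
    also have "\<dots> = (\<Sum>k<n. sc (\<Sum>i<n. \<Sum>j<n. Q p i * Q q j * m i j k) (b k))"
      by (simp add: mult_b sc_sum sc_sc collect_sc1)
    also have "\<dots> = (\<Sum>r<n. sc (m' p q r) (?b r))"
      using pq by (simp add: bc1 sc_sum sc_sc collect_sc1)
    finally show ?thesis .
  qed
  have a_a': "a l = (\<Sum>k<n. sc (Q k l) (?a k))" if "l < n" for l
  proof -
    have "(\<Sum>k<n. sc (Q k l) (?a k)) = (\<Sum>i<n. sc (\<Sum>k<n. P i k * Q k l) (a i))"
      by (simp add: sc_sum sc_sc collect_sc1 mult.commute)
    also have "\<dots> = (\<Sum>i<n. sc (if i = l then 1 else 0) (a i))"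
      using that by (intro sum.cong) (auto simp: PQ)
    finally show ?thesis using that by (simp add: sum_sc_delta)
  qed
  have mult_a': "?a p *\<^sub>1 ?a q = (\<Sum>k<n. sc (d' k p q) (?a k))" if pq: "p < n" "q < n" for p q
  proof -
    have coeff: "(\<Sum>i<n. \<Sum>j<n. \<Sum>l<n. P i p * P j q * d l i j * Q k l) = d' k p q" if k: "k < n" for k
    proof -
      have "(\<Sum>i<n. \<Sum>j<n. \<Sum>l<n. P i p * P j q * d l i j * Q k l)
        = (\<Sum>i<n. \<Sum>j<n. P i p * P j q * (\<Sum>l<n. Q k l * d l i j))"
        by (simp add: sum_distrib_left mult_ac)
      also have "\<dots> = (\<Sum>i<n. \<Sum>j<n. P i p * P j q * (\<Sum>r<n. \<Sum>t<n. d' k r t * Q r i * Q t j))"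
        using k by (simp add: bc2)
      also have "\<dots> = (\<Sum>(i,j)\<in>{..<n}\<times>{..<n}. \<Sum>(r,t)\<in>{..<n}\<times>{..<n}. d' k r t * ((Q r i * P i p) * (Q t j * P j q)))"
        by (simp add: sum_pairs sum_distrib_left mult_ac)
      also have "\<dots> = (\<Sum>(r,t)\<in>{..<n}\<times>{..<n}. \<Sum>(i,j)\<in>{..<n}\<times>{..<n}. d' k r t * ((Q r i * P i p) * (Q t j * P j q)))"
        unfolding case_prod_beta by (rule sum.swap)
      also have "\<dots> = (\<Sum>r<n. \<Sum>t<n. d' k r t * ((\<Sum>i<n. Q r i * P i p) * (\<Sum>j<n. Q t j * P j q)))"
        by (simp only: sum_pairs case_prod_conv sum_product) (simp only: sum_distrib_left)
      also have "\<dots> = (\<Sum>r<n. \<Sum>t<n. d' k r t * ((if r = p then 1 else 0) * (if t = q then 1 else 0)))"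
        using pq by (intro sum.cong) (auto simp: QP)
      also have "\<dots> = (\<Sum>r<n. (if r = p then 1 else 0) * (\<Sum>t<n. d' k r t * (if t = q then 1 else 0)))"
        by (simp add: sum_distrib_left mult_ac)
      also have "\<dots> = d' k p q" using pq by (simp add: sum_single_delta)
      finally show ?thesis .
    qed
    have "?a p *\<^sub>1 ?a q = (\<Sum>i<n. \<Sum>j<n. sc (P i p * P j q) (a i *\<^sub>1 a j))"
      by (simp add: mm_sum_left mm_sc_left) (simp add: mm_sum_right mm_sc_right sc_sum sc_sc)
    also have "\<dots> = (\<Sum>i<n. \<Sum>j<n. \<Sum>l<n. sc (P i p * P j q * d l i j) (a l))"
      by (simp add: mult_a sc_sum sc_sc)
    also have "\<dots> = (\<Sum>i<n. \<Sum>j<n. \<Sum>l<n. sc (P i p * P j q * d l i j) (\<Sum>k<n. sc (Q k l) (?a k)))"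
      by (intro sum.cong refl arg_cong[where f = "sc _"] a_a') simp
    also have "\<dots> = (\<Sum>k<n. sc (\<Sum>i<n. \<Sum>j<n. \<Sum>l<n. P i p * P j q * d l i j * Q k l) (?a k))"
    proof -
      have step: "(\<Sum>l<n. sc (c l) (\<Sum>k<n. sc (Q k l) (?a k))) = (\<Sum>k<n. sc (\<Sum>l<n. c l * Q k l) (?a k))" for c
      proof -
        have "(\<Sum>l<n. sc (c l) (\<Sum>k<n. sc (Q k l) (A k))) = (\<Sum>k<n. sc (\<Sum>l<n. c l * Q k l) (A k))"
          for A :: "nat \<Rightarrow> (nat, 'k) fmat"
          by (simp add: sc_sum[of _ _ "{..<n}"] sc_sc collect_sc1)
        then show ?thesis .
      qed
      have collect: "(\<Sum>j<n. \<Sum>k<n. sc (c j k) (?a k)) = (\<Sum>k<n. sc (\<Sum>j<n. c j k) (?a k))" for c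
        by (rule collect_sc1)
      show ?thesis by (simp only: step collect)
    qed
    also have "\<dots> = (\<Sum>k<n. sc (d' k p q) (?a k))" by (simp add: coeff)
    finally show ?thesis .
  qed
  have R': "R = (\<Sum>j<n. kron (?a j) (?b j))"
  proof -
    have "(\<Sum>k<n. kron (?a k) (?b k)) = (\<Sum>k<n. \<Sum>l<n. kron (?a k) (sc (Q k l) (b l)))"
      by (simp add: kron_sum_right)
    also have "\<dots> = (\<Sum>l<n. kron (\<Sum>k<n. sc (Q k l) (?a k)) (b l))"
      by (subst sum.swap) (simp only: kron_sum_left kron_sc_left kron_sc_right)
    also have "\<dots> = R" by (simp add: R_sum flip: a_a')
    finally show ?thesis ..
  qed
  have "indep n ?a"
  proof (rule indep_basechange[OF indep_a, of "\<lambda>i j. P j i" "\<lambda>i j. Q j i"])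
    show "(\<Sum>l<n. P l i * Q j l) = (if i = j then 1 else 0)" if "i < n" "j < n" for i j
      using QP[of j i] that by (auto simp: mult.commute)
  qed
  moreover have "indep n ?b"
    by (rule indep_basechange[OF indep_b QP])
  ultimately show ?thesis
    by unfold_locales (simp_all add: mult_a' mult_b' R'[symmetric])
qed

text \<open>
A functional dual to \<open>a'\<^sub>j\<close>, applied to the first leg of both expressions.
\<close>

lemma first_leg_functional:
  fixes a b a' b' :: "nat \<Rightarrow> (nat, 'k::field) fmat"
  assumes "indep n a'" and eq: "(\<Sum>i<n. kron (a i) (b i)) = (\<Sum>i<n. kron (a' i) (b' i))"
  shows "\<exists>Q. \<forall>j<n. b' j = (\<Sum>i<n. sc (Q j i) (b i))"
proof -
  let ?K = "{..<n} \<times> {..<n}"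
  obtain \<phi> where \<phi>: "\<And>i j. i < n \<Longrightarrow> j < n \<Longrightarrow>
    (\<Sum>y\<in>?K. \<phi> i (fst y) (snd y) * a' j (fst y) (snd y)) = (if i = j then 1 else 0)"
    using assms(1) by (auto simp: indep_def case_prod_beta)
  have eval: "(\<Sum>y\<in>?K. \<phi> j (fst y) (snd y) * (\<Sum>i<n. kron (c i) (e i)) (fst y, p) (snd y, q))
    = (\<Sum>i<n. (\<Sum>y\<in>?K. \<phi> j (fst y) (snd y) * c i (fst y) (snd y)) * e i p q)"
    for j p q and c e :: "nat \<Rightarrow> (nat, 'k) fmat"
    unfolding sum_fun_apply sum_distrib_left sum_distrib_right
    by (subst sum.swap) (simp add: kron_def mult.assoc)
  have "b' j = (\<Sum>i<n. sc (\<Sum>y\<in>?K. \<phi> j (fst y) (snd y) * a i (fst y) (snd y)) (b i))" if j: "j < n" for j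
  proof (intro ext)
    fix p q
    have "(\<Sum>i<n. (\<Sum>y\<in>?K. \<phi> j (fst y) (snd y) * a i (fst y) (snd y)) * b i p q)
      = (\<Sum>i<n. (\<Sum>y\<in>?K. \<phi> j (fst y) (snd y) * a' i (fst y) (snd y)) * b' i p q)"
      by (simp only: eq flip: eval)
    also have "\<dots> = (\<Sum>i<n. (if j = i then 1 else 0) * b' i p q)"
      using j by (intro sum.cong) (auto simp: \<phi>)
    also have "\<dots> = b' j p q" using j by (simp add: sum_single_delta)
    finally show "b' j p q = (\<Sum>i<n. sc (\<Sum>y\<in>?K. \<phi> j (fst y) (snd y) * a i (fst y) (snd y)) (b i)) p q"
      by (simp add: sum_fun_apply sc_def)
  qed
  then show ?thesis
    by (intro exI[of _ "\<lambda>j i. \<Sum>y\<in>?K. \<phi> j (fst y) (snd y) * a i (fst y) (snd y)"]) simp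
qed

text \<open>
Two expressions of \<open>R\<close> with independent legs differ by an invertible matrix, as two pairs of dual bases do.
\<close>

lemma two_realizations:
  assumes 1: "pentagon_realization n R R1 a b m d" and 2: "pentagon_realization n R R2 a' b' m' d'"
  obtains Q P where "\<And>i j. i < n \<Longrightarrow> j < n \<Longrightarrow> (\<Sum>l<n. Q i l * P l j) = (if i = j then 1 else 0)"
    and "\<And>i. i < n \<Longrightarrow> b' i = (\<Sum>j<n. sc (Q i j) (b j))"
    and "\<And>j. j < n \<Longrightarrow> a' j = (\<Sum>i<n. sc (P i j) (a i))"
proof -
  interpret A: pentagon_realization n R R1 a b m d by fact
  interpret B: pentagon_realization n R R2 a' b' m' d' by fact
  have eq: "(\<Sum>i<n. kron (a i) (b i)) = (\<Sum>i<n. kron (a' i) (b' i))"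
    using trans[OF A.R_sum[symmetric] B.R_sum] .
  obtain Q where Q: "\<And>j. j < n \<Longrightarrow> b' j = (\<Sum>i<n. sc (Q j i) (b i))"
    using first_leg_functional[OF B.indep_a eq] by blast
  obtain P where P: "\<And>j. j < n \<Longrightarrow> b j = (\<Sum>i<n. sc (P j i) (b' i))"
    using first_leg_functional[OF A.indep_a eq[symmetric]] by blast
  show thesis
  proof (rule that)
    fix i j assume ij: "i < n" "j < n"
    show "(\<Sum>l<n. Q i l * P l j) = (if i = j then 1 else 0)"
    proof (rule indep_sc[OF B.indep_b _ ij(2)])
      have "(\<Sum>j<n. sc (\<Sum>l<n. Q i l * P l j) (b' j)) = (\<Sum>l<n. sc (Q i l) (\<Sum>j<n. sc (P l j) (b' j)))"
        by (simp add: sc_sum sc_sc collect_sc1)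
      also have "\<dots> = (\<Sum>l<n. sc (Q i l) (b l))" by (simp flip: P)
      also have "\<dots> = b' i" by (rule Q[OF ij(1), symmetric])
      also have "\<dots> = (\<Sum>j<n. sc (if i = j then 1 else 0) (b' j))" using ij by (simp add: sum_sc_delta)
      finally show "(\<Sum>j<n. sc (\<Sum>l<n. Q i l * P l j) (b' j)) = (\<Sum>j<n. sc (if i = j then 1 else 0) (b' j))" .
    qed
  next
    fix j assume j: "j < n"
    show "a' j = (\<Sum>i<n. sc (P i j) (a i))"
    proof (rule indep_kron_right[where x = a' and y = "\<lambda>j. \<Sum>i<n. sc (P i j) (a i)", OF B.indep_b _ j])
      have "(\<Sum>i<n. kron (a' i) (b' i)) = (\<Sum>i<n. kron (a i) (\<Sum>j<n. sc (P i j) (b' j)))"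
        unfolding eq[symmetric] by (intro sum.cong refl) (simp flip: P)
      also have "\<dots> = (\<Sum>j<n. kron (\<Sum>i<n. sc (P i j) (a i)) (b' j))"
        unfolding kron_sum_right kron_sum_left kron_sc_left kron_sc_right by (rule sum.swap)
      finally show "(\<Sum>i<n. kron (a' i) (b' i)) = (\<Sum>j<n. kron (\<Sum>i<n. sc (P i j) (a i)) (b' j))" .
    qed
  qed (rule Q)
qed

section \<open>Hopf algebras in coordinates\<close>

text \<open>
Only bilinearity and linearity of the structure maps are assumed. In this setting every axiom of a Hopf
algebra becomes an equation between structure constants, which can be read in both directions.
\<close>

locale hopf_coordinates = coordinates H "{..<n}" e \<kappa>
  for H :: "('k::field, 'h) hopf" (structure) and n :: nat and e :: "nat \<Rightarrow> 'h"
    and \<kappa> :: "'h \<Rightarrow> nat \<Rightarrow> 'k" +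
  assumes mult_bilinear: "bilinear_into H H H (mult H)"
    and comult_linear: "comult H \<in> LinearCombinations.module_hom class_ring H (tensor H H)"
    and counit_linear: "counit H \<in> LinearCombinations.module_hom class_ring H base_alg"
begin

sublocale HH: two_coordinates H "{..<n}" e \<kappa> H "{..<n}" e \<kappa> ..
sublocale HHH: two_coordinates "tensor H H" "{..<n} \<times> {..<n}" HH.tbasis HH.tcoord H "{..<n}" e \<kappa> ..
sublocale HHH': two_coordinates H "{..<n}" e \<kappa> "tensor H H" "{..<n} \<times> {..<n}" HH.tbasis HH.tcoord ..

definition m :: "nat \<Rightarrow> nat \<Rightarrow> nat \<Rightarrow> 'k" where "m i j k = \<kappa> (e i \<otimes> e j) k"
definition d :: "nat \<Rightarrow> nat \<Rightarrow> nat \<Rightarrow> 'k" where "d k i j = HH.tcoord (comult H (e k)) (i, j)"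
definition \<eta> :: "nat \<Rightarrow> 'k" where "\<eta> i = \<kappa> \<one> i"
definition \<epsilon> :: "nat \<Rightarrow> 'k" where "\<epsilon> i = counit H (e i)"

lemma comult_in: "h \<in> carrier H \<Longrightarrow> comult H h \<in> carrier (tensor H H)"
  using comult_linear by (auto simp: LinearCombinations.module_hom_def)

lemma mult_in: "x \<in> carrier H \<Longrightarrow> y \<in> carrier H \<Longrightarrow> x \<otimes> y \<in> carrier H"
  using mult_bilinear by (auto simp: bilinear_into_def)

lemma linear_form_expand:
  assumes g: "\<And>x y. x \<in> carrier H \<Longrightarrow> y \<in> carrier H \<Longrightarrow> g (x \<oplus> y) = g x + g y"
    "\<And>c x. x \<in> carrier H \<Longrightarrow> g (c \<odot> x) = c * g x" and h: "h \<in> carrier H"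
  shows "g h = (\<Sum>k<n. \<kappa> h k * g (e k))"
proof -
  interpret abelian_group H by (rule abelian_group)
  have smult_zero: "0 \<odot> \<zero> = \<zero>"
    by (rule coord_eqI) (simp_all add: smult_in zero_in coord_smult coord_zero)
  have g0: "g \<zero> = (0::'k)"
    using g(2)[OF zero_in, of 0] smult_zero by simp
  have "g (\<Oplus>k\<in>F. \<kappa> h k \<odot> e k) = (\<Sum>k\<in>F. \<kappa> h k * g (e k))" if "finite F" "F \<subseteq> {..<n}" for F
    using that
  proof (induction F rule: finite_induct)
    case (insert k F)
    then have "(\<lambda>k. \<kappa> h k \<odot> e k) \<in> F \<rightarrow> carrier H" "\<kappa> h k \<odot> e k \<in> carrier H"
      by (auto intro!: smult_in basis_in)
    then show ?case using insert by (simp add: g basis_in finsum_closed)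
  qed (simp add: g0)
  from this[of "{..<n}"] show ?thesis using expansion[OF h] by simp
qed

lemma mult_coord:
  assumes "x \<in> carrier H" "y \<in> carrier H" "p < n"
  shows "\<kappa> (x \<otimes> y) p = (\<Sum>i<n. \<Sum>j<n. \<kappa> x i * \<kappa> y j * m i j p)"
proof -
  have "bilinear_form H H (\<lambda>x y. \<kappa> (x \<otimes> y) p)"
    using mult_bilinear assms(3) by (auto simp: bilinear_into_def base_alg_def coord_add coord_smult)
  from HH.bilinear_form_apply[OF this assms(1,2)] show ?thesis by (simp add: m_def)
qed

lemma comult_coord:
  assumes "h \<in> carrier H" "i < n" "j < n"
  shows "HH.tcoord (comult H h) (i, j) = (\<Sum>k<n. \<kappa> h k * d k i j)"
  unfolding d_def
  by (rule linear_form_expand[OF _ _ assms(1)])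
    (use assms comult_linear in \<open>auto simp: LinearCombinations.module_hom_def class_ring_simps HH.T.coord_add HH.T.coord_smult Pi_iff\<close>)

lemma counit_coord:
  assumes "h \<in> carrier H"
  shows "counit H h = (\<Sum>k<n. \<kappa> h k * \<epsilon> k)"
  unfolding \<epsilon>_def
  by (rule linear_form_expand[OF _ _ assms])
    (use counit_linear in \<open>auto simp: LinearCombinations.module_hom_def class_ring_simps base_alg_def\<close>)

lemma pure_comult_bilinear:
  "bilinear_into H H HHH.T (\<lambda>a b. pure_tensor (tensor H H) H (comult H a) b)"
  "bilinear_into H H HHH'.T (\<lambda>a b. pure_tensor H (tensor H H) a (comult H b))"
  using HHH.pure_bilinear HHH'.pure_bilinear comult_linear
  by (auto simp: bilinear_into_def LinearCombinations.module_hom_def class_ring_simps Pi_iff)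

lemma sum_coord_basis:
  "j < n \<Longrightarrow> (\<Sum>p<n. x p * \<kappa> (e p) j) = x j"
  by (simp add: coord_basis if_distrib[of "\<lambda>x. _ * x"] cong: if_cong)

lemma coassoc_left_coord:
  assumes "h \<in> carrier H" and ijl: "i < n" "j < n" "l < n"
  shows "tensor_map (tensor H H) H (comult H) id (comult H h) \<in> carrier HHH.T"
    and "HHH.tcoord (tensor_map (tensor H H) H (comult H) id (comult H h)) ((i, j), l)
      = (\<Sum>p<n. HH.tcoord (comult H h) (p, l) * d p i j)"
proof -
  note L = HH.tensor_lift_in_coord[OF HHH.coordinates_tensor pure_comult_bilinear(1) comult_in[OF assms(1)]]
  show "tensor_map (tensor H H) H (comult H) id (comult H h) \<in> carrier HHH.T"
    unfolding tensor_map_def id_def by (rule L(1))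
  have "HHH.tcoord (tensor_map (tensor H H) H (comult H) id (comult H h)) ((i, j), l)
    = (\<Sum>x\<in>{..<n}\<times>{..<n}. HH.tcoord (comult H h) x *
        HHH.tcoord (pure_tensor (tensor H H) H (comult H (e (fst x))) (e (snd x))) ((i, j), l))"
    unfolding tensor_map_def id_def using ijl by (intro L(2)) auto
  also have "\<dots> = (\<Sum>p<n. \<Sum>q<n. HH.tcoord (comult H h) (p, q) * d p i j * \<kappa> (e q) l)"
    unfolding sum_pairs using ijl
    by (intro sum.cong) (auto simp: HHH.tcoord_pure comult_in basis_in d_def)
  finally show "HHH.tcoord (tensor_map (tensor H H) H (comult H) id (comult H h)) ((i, j), l)
      = (\<Sum>p<n. HH.tcoord (comult H h) (p, l) * d p i j)"
    using ijl by (simp add: sum_coord_basis)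
qed

lemma pure3_bilinear:
  assumes "a \<in> carrier H"
  shows "bilinear_into H H HHH.T (\<lambda>b c. pure_tensor3 H H H a b c)"
  using assms HHH.pure_bilinear HH.pure_bilinear
  by (auto simp: bilinear_into_def pure_tensor3_def)

text \<open>
The associator is a lift of a lift; to compute it, the inner lift has to depend bilinearly on its
parameters.
\<close>

lemma assoc_inner_bilinear:
  "bilinear_into H (tensor H H) HHH.T (\<lambda>a. tensor_lift HHH.T (\<lambda>b c. pure_tensor3 H H H a b c))"
proof -
  note L = HH.tensor_lift_in_coord[OF HHH.coordinates_tensor pure3_bilinear]
  note lin = HH.tensor_lift_linear[OF HHH.coordinates_tensor pure3_bilinear]
  have p3: "pure_tensor3 H H H a b c \<in> carrier HHH.T"
    if "a \<in> carrier H" "b \<in> carrier H" "c \<in> carrier H" for a b c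
    using that by (simp add: pure_tensor3_def HHH.pure_in HH.pure_in)
  have p3_add: "pure_tensor3 H H H (a \<oplus> a') b c = pure_tensor3 H H H a b c \<oplus>\<^bsub>HHH.T\<^esub> pure_tensor3 H H H a' b c"
    if "a \<in> carrier H" "a' \<in> carrier H" "b \<in> carrier H" "c \<in> carrier H" for a a' b c
    using that HHH.pure_bilinear HH.pure_bilinear by (auto simp: pure_tensor3_def bilinear_into_def)
  have p3_smult: "pure_tensor3 H H H (x \<odot> a) b c = x \<odot>\<^bsub>HHH.T\<^esub> pure_tensor3 H H H a b c"
    if "a \<in> carrier H" "b \<in> carrier H" "c \<in> carrier H" for x a b c
    using that HHH.pure_bilinear HH.pure_bilinear by (auto simp: pure_tensor3_def bilinear_into_def)
  show ?thesis
    unfolding bilinear_into_def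
  proof (intro conjI ballI allI)
    fix a a' S c assume a: "a \<in> carrier H" "a' \<in> carrier H" and S: "S \<in> carrier (tensor H H)"
    show "tensor_lift HHH.T (\<lambda>b c. pure_tensor3 H H H (a \<oplus> a') b c) S
      = tensor_lift HHH.T (\<lambda>b c. pure_tensor3 H H H a b c) S
        \<oplus>\<^bsub>HHH.T\<^esub> tensor_lift HHH.T (\<lambda>b c. pure_tensor3 H H H a' b c) S"
      by (rule HHH.T.coord_eqI)
        (use a S in \<open>auto simp: L HHH.T.add_in HHH.T.coord_add add_in p3 p3_add basis_in sum_pairs
          distrib_left sum.distrib\<close>)
  next
    fix c a S assume a: "a \<in> carrier H" and S: "S \<in> carrier (tensor H H)"
    show "tensor_lift HHH.T (\<lambda>b c'. pure_tensor3 H H H (c \<odot> a) b c') S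
      = c \<odot>\<^bsub>HHH.T\<^esub> tensor_lift HHH.T (\<lambda>b c. pure_tensor3 H H H a b c) S"
      by (rule HHH.T.coord_eqI)
        (use a S in \<open>auto simp: L HHH.T.smult_in HHH.T.coord_smult smult_in p3 p3_smult basis_in sum_pairs
          sum_distrib_left mult.left_commute\<close>)
  qed (auto simp: L lin)
qed

lemma tensor_assoc_coord:
  assumes S: "S \<in> carrier HHH'.T" and ijl: "i < n" "j < n" "l < n"
  shows "tensor_assoc H H H S \<in> carrier HHH.T"
    and "HHH.tcoord (tensor_assoc H H H S) ((i, j), l) = HHH'.tcoord S (i, (j, l))"
proof -
  note L = HHH'.tensor_lift_in_coord[OF HHH.coordinates_tensor assoc_inner_bilinear S]
  show "tensor_assoc H H H S \<in> carrier HHH.T"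
    unfolding tensor_assoc_def by (rule L(1))
  have "HHH.tcoord (tensor_assoc H H H S) ((i, j), l)
    = (\<Sum>x\<in>{..<n} \<times> ({..<n} \<times> {..<n}). HHH'.tcoord S x *
        HHH.tcoord (tensor_lift HHH.T (\<lambda>b c. pure_tensor3 H H H (e (fst x)) b c) (HH.tbasis (snd x))) ((i, j), l))"
    unfolding tensor_assoc_def using ijl by (intro L(2)) auto
  also have "\<dots> = (\<Sum>x\<in>{..<n} \<times> ({..<n} \<times> {..<n}). HHH'.tcoord S x * (if x = (i, (j, l)) then 1 else 0))"
  proof (rule sum.cong[OF refl])
    fix x assume "x \<in> {..<n} \<times> ({..<n} \<times> {..<n})"
    then obtain p q r where x: "x = (p, (q, r))" "p < n" "q < n" "r < n" by auto
    have "tensor_lift HHH.T (\<lambda>b c. pure_tensor3 H H H (e p) b c) (HH.tbasis (q, r)) = pure_tensor3 H H H (e p) (e q) (e r)"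
      using x by (simp add: HH.tbasis_def HH.tensor_lift_pure[OF HHH.coordinates_tensor pure3_bilinear] basis_in)
    then show "HHH'.tcoord S x *
        HHH.tcoord (tensor_lift HHH.T (\<lambda>b c. pure_tensor3 H H H (e (fst x)) b c) (HH.tbasis (snd x))) ((i, j), l)
      = HHH'.tcoord S x * (if x = (i, (j, l)) then 1 else 0)"
      using x ijl by (auto simp: pure_tensor3_def HHH.tcoord_pure HH.tcoord_pure HH.pure_in basis_in coord_basis
        split: if_splits)
  qed
  also have "\<dots> = HHH'.tcoord S (i, (j, l))"
    using ijl by (subst sum_single_delta) auto
  finally show "HHH.tcoord (tensor_assoc H H H S) ((i, j), l) = HHH'.tcoord S (i, (j, l))" .
qed

lemma coassoc_right_coord:
  assumes "h \<in> carrier H" and ijl: "i < n" "j < n" "l < n"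
  shows "tensor_assoc H H H (tensor_map H (tensor H H) id (comult H) (comult H h)) \<in> carrier HHH.T"
    and "HHH.tcoord (tensor_assoc H H H (tensor_map H (tensor H H) id (comult H) (comult H h))) ((i, j), l)
      = (\<Sum>p<n. HH.tcoord (comult H h) (i, p) * d p j l)"
proof -
  note L = HH.tensor_lift_in_coord[OF HHH'.coordinates_tensor pure_comult_bilinear(2) comult_in[OF assms(1)]]
  have in_T: "tensor_map H (tensor H H) id (comult H) (comult H h) \<in> carrier HHH'.T"
    unfolding tensor_map_def id_def by (rule L(1))
  note A = tensor_assoc_coord[OF in_T ijl]
  show "tensor_assoc H H H (tensor_map H (tensor H H) id (comult H) (comult H h)) \<in> carrier HHH.T"
    by (rule A(1))
  have "HHH'.tcoord (tensor_map H (tensor H H) id (comult H) (comult H h)) (i, (j, l))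
    = (\<Sum>x\<in>{..<n}\<times>{..<n}. HH.tcoord (comult H h) x *
        HHH'.tcoord (pure_tensor H (tensor H H) (e (fst x)) (comult H (e (snd x)))) (i, (j, l)))"
    unfolding tensor_map_def id_def using ijl by (intro L(2)) auto
  also have "\<dots> = (\<Sum>q<n. \<Sum>p<n. HH.tcoord (comult H h) (p, q) * d q j l * \<kappa> (e p) i)"
    unfolding sum_pairs using ijl
    by (subst sum.swap, intro sum.cong) (auto simp: HHH'.tcoord_pure comult_in basis_in d_def)
  also have "\<dots> = (\<Sum>p<n. HH.tcoord (comult H h) (i, p) * d p j l)"
    using ijl by (simp add: sum_coord_basis)
  finally show "HHH.tcoord (tensor_assoc H H H (tensor_map H (tensor H H) id (comult H) (comult H h))) ((i, j), l)
      = (\<Sum>p<n. HH.tcoord (comult H h) (i, p) * d p j l)"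
    by (simp add: A(2))
qed

lemma counit_bilinear:
  "bilinear_into H H H (\<lambda>a b. counit H a \<odot> b)" "bilinear_into H H H (\<lambda>a b. counit H b \<odot> a)"
proof -
  interpret vectorspace class_ring H by (rule vectorspace)
  have c: "counit H (x \<oplus> y) = counit H x + counit H y" "counit H (c \<odot> x) = c * counit H x"
    if "x \<in> carrier H" "y \<in> carrier H" for x y c
    using that counit_linear by (auto simp: LinearCombinations.module_hom_def class_ring_simps base_alg_def)
  have c': "counit H (c \<odot> x) = c * counit H x" if "x \<in> carrier H" for x c
    using that counit_linear by (auto simp: LinearCombinations.module_hom_def class_ring_simps base_alg_def)
  show "bilinear_into H H H (\<lambda>a b. counit H a \<odot> b)" "bilinear_into H H H (\<lambda>a b. counit H b \<odot> a)"
    unfolding bilinear_into_def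
    by (intro conjI ballI allI; (rule coord_eqI)?;
      auto simp: c c' smult_in add_in coord_add coord_smult algebra_simps)+
qed

lemma counit_axiom_coord:
  assumes h: "h \<in> carrier H" and j: "j < n"
  shows "tensor_lift H (\<lambda>a b. counit H a \<odot> b) (comult H h) \<in> carrier H"
    and "tensor_lift H (\<lambda>a b. counit H b \<odot> a) (comult H h) \<in> carrier H"
    and "\<kappa> (tensor_lift H (\<lambda>a b. counit H a \<odot> b) (comult H h)) j
      = (\<Sum>p<n. \<epsilon> p * HH.tcoord (comult H h) (p, j))"
    and "\<kappa> (tensor_lift H (\<lambda>a b. counit H b \<odot> a) (comult H h)) j
      = (\<Sum>p<n. \<epsilon> p * HH.tcoord (comult H h) (j, p))"
proof -
  note L1 = HH.tensor_lift_in_coord[OF coordinates_axioms counit_bilinear(1) comult_in[OF h]]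
  note L2 = HH.tensor_lift_in_coord[OF coordinates_axioms counit_bilinear(2) comult_in[OF h]]
  show "tensor_lift H (\<lambda>a b. counit H a \<odot> b) (comult H h) \<in> carrier H"
    and "tensor_lift H (\<lambda>a b. counit H b \<odot> a) (comult H h) \<in> carrier H"
    by (rule L1 L2)+
  have "\<kappa> (tensor_lift H (\<lambda>a b. counit H a \<odot> b) (comult H h)) j
    = (\<Sum>p<n. \<Sum>q<n. \<epsilon> p * HH.tcoord (comult H h) (p, q) * \<kappa> (e q) j)"
    using j by (simp add: L1 sum_pairs coord_smult basis_in \<epsilon>_def mult_ac)
  then show "\<kappa> (tensor_lift H (\<lambda>a b. counit H a \<odot> b) (comult H h)) j
      = (\<Sum>p<n. \<epsilon> p * HH.tcoord (comult H h) (p, j))"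
    using j by (simp add: sum_coord_basis)
  have "\<kappa> (tensor_lift H (\<lambda>a b. counit H b \<odot> a) (comult H h)) j
    = (\<Sum>q<n. \<Sum>p<n. \<epsilon> q * HH.tcoord (comult H h) (p, q) * \<kappa> (e p) j)"
    using j by (subst sum.swap) (simp add: L2 sum_pairs coord_smult basis_in \<epsilon>_def mult_ac)
  then show "\<kappa> (tensor_lift H (\<lambda>a b. counit H b \<odot> a) (comult H h)) j
      = (\<Sum>p<n. \<epsilon> p * HH.tcoord (comult H h) (j, p))"
    using j by (simp add: sum_coord_basis)
qed

lemma antipode_axiom_coord:
  assumes S: "S \<in> LinearCombinations.module_hom class_ring H H" and h: "h \<in> carrier H" and p: "p < n"
  shows "tensor_lift H (\<lambda>a b. S a \<otimes> b) (comult H h) \<in> carrier H"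
    and "tensor_lift H (\<lambda>a b. a \<otimes> S b) (comult H h) \<in> carrier H"
    and "\<kappa> (tensor_lift H (\<lambda>a b. S a \<otimes> b) (comult H h)) p
      = (\<Sum>i<n. \<Sum>l<n. \<Sum>j<n. \<kappa> (S (e i)) l * (HH.tcoord (comult H h) (i, j) * m l j p))"
    and "\<kappa> (tensor_lift H (\<lambda>a b. a \<otimes> S b) (comult H h)) p
      = (\<Sum>j<n. \<Sum>i<n. \<Sum>l<n. \<kappa> (S (e i)) l * (HH.tcoord (comult H h) (j, i) * m j l p))"
proof -
  have S': "S x \<in> carrier H" if "x \<in> carrier H" for x
    using S that by (auto simp: LinearCombinations.module_hom_def)
  have b1: "bilinear_into H H H (\<lambda>a b. S a \<otimes> b)" and b2: "bilinear_into H H H (\<lambda>a b. a \<otimes> S b)"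
    using mult_bilinear S by (auto simp: bilinear_into_def LinearCombinations.module_hom_def class_ring_simps Pi_iff)
  note L1 = HH.tensor_lift_in_coord[OF coordinates_axioms b1 comult_in[OF h]]
  note L2 = HH.tensor_lift_in_coord[OF coordinates_axioms b2 comult_in[OF h]]
  show "tensor_lift H (\<lambda>a b. S a \<otimes> b) (comult H h) \<in> carrier H"
    and "tensor_lift H (\<lambda>a b. a \<otimes> S b) (comult H h) \<in> carrier H"
    by (rule L1 L2)+
  have delta: "(\<Sum>i<n. \<Sum>j'<n. x i * \<kappa> (e j) j' * y i j') = (\<Sum>i<n. x i * y i j)"
    "(\<Sum>i<n. \<Sum>j'<n. \<kappa> (e j) i * x j' * y i j') = (\<Sum>j'<n. x j' * y j j')" if "j < n" for x y j
  proof -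
    have "(\<Sum>j'<n. x i * \<kappa> (e j) j' * y i j') = (\<Sum>j'<n. (if j = j' then 1 else 0) * (x i * y i j'))" for i
      using that by (intro sum.cong) (auto simp: coord_basis)
    then show "(\<Sum>i<n. \<Sum>j'<n. x i * \<kappa> (e j) j' * y i j') = (\<Sum>i<n. x i * y i j)"
      using that by (simp add: sum_single_delta)
    have "(\<Sum>i<n. \<Sum>j'<n. \<kappa> (e j) i * x j' * y i j')
      = (\<Sum>i<n. (if j = i then 1 else 0) * (\<Sum>j'<n. x j' * y i j'))"
      using that by (intro sum.cong) (auto simp: coord_basis)
    then show "(\<Sum>i<n. \<Sum>j'<n. \<kappa> (e j) i * x j' * y i j') = (\<Sum>j'<n. x j' * y j j')"
      using that by (simp add: sum_single_delta)
  qed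
  have "\<kappa> (tensor_lift H (\<lambda>a b. S a \<otimes> b) (comult H h)) p
    = (\<Sum>i<n. \<Sum>j<n. HH.tcoord (comult H h) (i, j) * (\<Sum>l<n. \<kappa> (S (e i)) l * m l j p))"
    using p by (simp add: L1 sum_pairs mult_coord S' basis_in delta)
  also have "\<dots> = (\<Sum>i<n. \<Sum>j<n. \<Sum>l<n. \<kappa> (S (e i)) l * (HH.tcoord (comult H h) (i, j) * m l j p))"
    by (simp add: sum_distrib_left mult_ac)
  also have "\<dots> = (\<Sum>i<n. \<Sum>l<n. \<Sum>j<n. \<kappa> (S (e i)) l * (HH.tcoord (comult H h) (i, j) * m l j p))"
    by (intro sum.cong refl sum.swap)
  finally show "\<kappa> (tensor_lift H (\<lambda>a b. S a \<otimes> b) (comult H h)) p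
      = (\<Sum>i<n. \<Sum>l<n. \<Sum>j<n. \<kappa> (S (e i)) l * (HH.tcoord (comult H h) (i, j) * m l j p))" .
  have "\<kappa> (tensor_lift H (\<lambda>a b. a \<otimes> S b) (comult H h)) p
    = (\<Sum>j<n. \<Sum>i<n. HH.tcoord (comult H h) (j, i) * (\<Sum>l<n. \<kappa> (S (e i)) l * m j l p))"
    using p by (simp add: L2 sum_pairs mult_coord S' basis_in delta)
  then show "\<kappa> (tensor_lift H (\<lambda>a b. a \<otimes> S b) (comult H h)) p
      = (\<Sum>j<n. \<Sum>i<n. \<Sum>l<n. \<kappa> (S (e i)) l * (HH.tcoord (comult H h) (j, i) * m j l p))"
    by (simp add: sum_distrib_left mult_ac)
qed

end

lemma hopf_coordinatesI:
  assumes H: "bialgebra H" and c: "coordinates H {..<n} e \<kappa>"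
  shows "hopf_coordinates H n e \<kappa>"
proof -
  interpret coordinates H "{..<n}" e \<kappa> by (rule c)
  interpret k_algebra H using H by (simp add: bialgebra_def)
  interpret ring H by (rule ring)
  show ?thesis
  proof
    show "bilinear_into H H H (mult H)"
      by (auto simp: bilinear_into_def l_distr r_distr smult_mult_left smult_mult_right)
    show "comult H \<in> LinearCombinations.module_hom class_ring H (tensor H H)"
      "counit H \<in> LinearCombinations.module_hom class_ring H base_alg"
      using H by (auto simp: bialgebra_def alg_hom_def)
  qed
qed

context hopf_coordinates
begin

lemma linear_ext:
  fixes g g' :: "'h \<Rightarrow> 'k"
  assumes "\<And>x y. x \<in> carrier H \<Longrightarrow> y \<in> carrier H \<Longrightarrow> g (x \<oplus> y) = g x + g y"
    "\<And>c x. x \<in> carrier H \<Longrightarrow> g (c \<odot> x) = c * g x"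
    "\<And>x y. x \<in> carrier H \<Longrightarrow> y \<in> carrier H \<Longrightarrow> g' (x \<oplus> y) = g' x + g' y"
    "\<And>c x. x \<in> carrier H \<Longrightarrow> g' (c \<odot> x) = c * g' x"
    "\<And>k. k < n \<Longrightarrow> g (e k) = g' (e k)" "h \<in> carrier H"
  shows "g h = g' h"
  using linear_form_expand[of g h] linear_form_expand[of g' h] assms by simp

lemma mult_coord_basis:
  assumes "x \<in> carrier H" "i < n" "p < n"
  shows "\<kappa> (x \<otimes> e i) p = (\<Sum>k<n. \<kappa> x k * m k i p)"
    and "\<kappa> (e i \<otimes> x) p = (\<Sum>k<n. \<kappa> x k * m i k p)"
  unfolding m_def
  by (rule linear_form_expand[OF _ _ assms(1)];
      use assms mult_bilinear in \<open>auto simp: bilinear_into_def basis_in coord_add coord_smult\<close>)+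

lemma comult_additive:
  assumes "ij \<in> {..<n} \<times> {..<n}"
  shows "x \<in> carrier H \<Longrightarrow> y \<in> carrier H \<Longrightarrow>
      HH.tcoord (comult H (x \<oplus> y)) ij = HH.tcoord (comult H x) ij + HH.tcoord (comult H y) ij"
    and "x \<in> carrier H \<Longrightarrow> HH.tcoord (comult H (c \<odot> x)) ij = c * HH.tcoord (comult H x) ij"
  using assms comult_linear
  by (auto simp: LinearCombinations.module_hom_def class_ring_simps HH.T.coord_add HH.T.coord_smult Pi_iff)

lemma counit_additive:
  shows "x \<in> carrier H \<Longrightarrow> y \<in> carrier H \<Longrightarrow> counit H (x \<oplus> y) = counit H x + counit H y"
    and "x \<in> carrier H \<Longrightarrow> counit H (c \<odot> x) = c * counit H x"
  using counit_linear by (auto simp: LinearCombinations.module_hom_def class_ring_simps base_alg_def)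

lemma comult_product_coord:
  assumes "i < n" "j < n" "p < n" "q < n"
  shows "HH.tcoord (comult H (e i) \<otimes>\<^bsub>tensor H H\<^esub> comult H (e j)) (p, q)
     = (\<Sum>r<n. \<Sum>t<n. \<Sum>r'<n. \<Sum>t'<n. d i r t * d j r' t' * (m r r' p * m t t' q))"
proof -
  have "comult H (e i) \<in> carrier (tensor H H)" "comult H (e j) \<in> carrier (tensor H H)"
    using assms by (auto intro!: comult_in basis_in)
  from HH.mult_in_tcoord(2)[OF mult_bilinear mult_bilinear this] assms
  show ?thesis by (simp add: sum_pairs d_def m_def sum_distrib_left mult.assoc)
qed

lemma hopf_imp_constants:
  assumes "hopf_algebra H"
  shows "\<exists>s. hopf_constants n m d \<eta> \<epsilon> s"
proof -
  interpret hopf_algebra H by fact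
  interpret k_algebra H by (rule k_algebra)
  interpret ring H by (rule ring)
  obtain S where "is_antipode H S" using antipode by blast
  then have S: "S \<in> LinearCombinations.module_hom class_ring H H"
    and S1: "\<And>h. h \<in> carrier H \<Longrightarrow> tensor_lift H (\<lambda>a b. S a \<otimes> b) (comult H h) = counit H h \<odot> \<one>"
    and S2: "\<And>h. h \<in> carrier H \<Longrightarrow> tensor_lift H (\<lambda>a b. a \<otimes> S b) (comult H h) = counit H h \<odot> \<one>"
    by (auto simp: is_antipode_def)
  have e: "i < n \<Longrightarrow> e i \<in> carrier H" for i by (simp add: basis_in)
  have hom: "comult H (x \<otimes> y) = comult H x \<otimes>\<^bsub>tensor H H\<^esub> comult H y"
    "counit H (x \<otimes> y) = counit H x * counit H y" if "x \<in> carrier H" "y \<in> carrier H" for x y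
    using comult_hom counit_hom that by (auto simp: alg_hom_def Ring.ring_hom_def base_alg_def)
  have hom_one: "comult H \<one> = pure_tensor H H \<one> \<one>" "counit H \<one> = 1"
    using comult_hom counit_hom by (auto simp: alg_hom_def Ring.ring_hom_def base_alg_def tensor_def)
  have "hopf_constants n m d \<eta> \<epsilon> (\<lambda>i j. \<kappa> (S (e i)) j)"
  proof
    fix i j l p assume i: "i < n" and j: "j < n" and l: "l < n" and p: "p < n"
    have "\<kappa> (e i \<otimes> e j \<otimes> e l) p = \<kappa> (e i \<otimes> (e j \<otimes> e l)) p"
      using i j l by (simp add: m_assoc e)
    then show "(\<Sum>k<n. m i j k * m k l p) = (\<Sum>k<n. m j l k * m i k p)"
      using mult_coord_basis(1)[OF mult_in[OF e[OF i] e[OF j]] l p]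
        mult_coord_basis(2)[OF mult_in[OF e[OF j] e[OF l]] i p] by (simp only: m_def)
  next
    fix j p assume j: "j < n" and p: "p < n"
    show "(\<Sum>i<n. \<eta> i * m i j p) = (if j = p then 1 else 0)"
      "(\<Sum>i<n. \<eta> i * m j i p) = (if j = p then 1 else 0)"
      using mult_coord_basis[OF one_closed j p] j p by (simp_all add: e coord_basis \<eta>_def)
  next
    fix k i j l assume k: "k < n" and ijl: "i < n" "j < n" "l < n"
    show "(\<Sum>p<n. d k p l * d p i j) = (\<Sum>p<n. d k i p * d p j l)"
      using arg_cong[OF coassoc[OF e[OF k]], of "\<lambda>x. HHH.tcoord x ((i, j), l)"]
      by (simp add: coassoc_left_coord(2)[OF e[OF k] ijl] coassoc_right_coord(2)[OF e[OF k] ijl])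
        (simp add: d_def)
  next
    fix k j assume k: "k < n" and j: "j < n"
    show "(\<Sum>i<n. \<epsilon> i * d k i j) = (if k = j then 1 else 0)"
      using counit_axiom_coord(3)[OF e[OF k] j] counit_left[OF e[OF k]] k j by (simp add: d_def coord_basis)
    show "(\<Sum>i<n. \<epsilon> i * d k j i) = (if k = j then 1 else 0)"
      using counit_axiom_coord(4)[OF e[OF k] j] counit_right[OF e[OF k]] k j by (simp add: d_def coord_basis)
  next
    fix i j p q assume ij: "i < n" "j < n" and pq: "p < n" "q < n"
    show "(\<Sum>k<n. m i j k * d k p q) =
      (\<Sum>r<n. \<Sum>t<n. \<Sum>r'<n. \<Sum>t'<n. d i r t * d j r' t' * (m r r' p * m t t' q))"
      unfolding comult_product_coord[OF ij pq, symmetric]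
      using ij pq by (simp add: comult_coord mult_in e m_def flip: hom)
  next
    fix p q assume "p < n" "q < n"
    then show "(\<Sum>k<n. \<eta> k * d k p q) = \<eta> p * \<eta> q"
      using comult_coord[of \<one> p q] by (simp add: hom_one HH.tcoord_pure \<eta>_def)
  next
    fix i j assume "i < n" "j < n"
    then show "(\<Sum>k<n. m i j k * \<epsilon> k) = \<epsilon> i * \<epsilon> j"
      using hom(2)[of "e i" "e j"] counit_coord[of "e i \<otimes> e j"] by (simp add: e mult_in m_def \<epsilon>_def)
  next
    show "(\<Sum>k<n. \<eta> k * \<epsilon> k) = 1"
      using counit_coord[of \<one>] by (simp add: hom_one \<eta>_def)
  next
    fix k p assume k: "k < n" and p: "p < n"
    show "(\<Sum>i<n. \<Sum>l<n. \<Sum>j<n. \<kappa> (S (e i)) l * (d k i j * m l j p)) = \<epsilon> k * \<eta> p"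
      using antipode_axiom_coord(3)[OF S e[OF k] p] S1[OF e[OF k]] p
      by (simp add: d_def coord_smult \<epsilon>_def \<eta>_def)
    show "(\<Sum>j<n. \<Sum>i<n. \<Sum>l<n. \<kappa> (S (e i)) l * (d k j i * m j l p)) = \<epsilon> k * \<eta> p"
      using antipode_axiom_coord(4)[OF S e[OF k] p] S2[OF e[OF k]] p
      by (simp add: d_def coord_smult \<epsilon>_def \<eta>_def)
  qed
  then show ?thesis by (intro exI[where x = "\<lambda>i. \<kappa> (S (e i))"])
qed

text \<open>
All axioms state equality of maps that are linear in each argument, so that they need to be checked on basis
vectors and coordinates only.
\<close>

lemma constants_imp_hopf:
  assumes pos: "n > 0" and one: "\<one> \<in> carrier H" and "hopf_constants n m d \<eta> \<epsilon> s"
  shows "hopf_algebra H"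
proof -
  interpret C: hopf_constants n m d \<eta> \<epsilon> s by fact
  interpret vectorspace class_ring H by (rule vectorspace)
  have e: "i < n \<Longrightarrow> e i \<in> carrier H" for i by (simp add: basis_in)
  note bil = mult_bilinear[unfolded bilinear_into_def]
  have mult_add: "(x \<oplus> y) \<otimes> z = x \<otimes> z \<oplus> y \<otimes> z" "z \<otimes> (x \<oplus> y) = z \<otimes> x \<oplus> z \<otimes> y"
    "(c \<odot> x) \<otimes> y = c \<odot> (x \<otimes> y)" "x \<otimes> (c \<odot> y) = c \<odot> (x \<otimes> y)"
    if "x \<in> carrier H" "y \<in> carrier H" "z \<in> carrier H" for x y z c
    using bil that by blast+
  note [simp] = mult_in add_in smult_in coord_add coord_smult mult_add e one
  have bilinear_ext: "g x y = g' x y"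
    if "bilinear_form H H g" "bilinear_form H H g'" "\<And>i j. i < n \<Longrightarrow> j < n \<Longrightarrow> g (e i) (e j) = g' (e i) (e j)"
      "x \<in> carrier H" "y \<in> carrier H" for g g' :: "'h \<Rightarrow> 'h \<Rightarrow> 'k" and x y
    using HH.bilinear_form_apply[OF that(1) that(4,5)] HH.bilinear_form_apply[OF that(2) that(4,5)] that(3)
    by simp
  have bilI: "bilinear_form H H g"
    if "\<And>a a' b. a \<in> carrier H \<Longrightarrow> a' \<in> carrier H \<Longrightarrow> b \<in> carrier H \<Longrightarrow> g (a \<oplus> a') b = g a b + g a' b"
      "\<And>a a' b. a \<in> carrier H \<Longrightarrow> a' \<in> carrier H \<Longrightarrow> b \<in> carrier H \<Longrightarrow> g b (a \<oplus> a') = g b a + g b a'"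
      "\<And>c a b. a \<in> carrier H \<Longrightarrow> b \<in> carrier H \<Longrightarrow> g (c \<odot> a) b = c * g a b"
      "\<And>c a b. a \<in> carrier H \<Longrightarrow> b \<in> carrier H \<Longrightarrow> g a (c \<odot> b) = c * g a b" for g :: "'h \<Rightarrow> 'h \<Rightarrow> 'k"
    using that by (auto simp: bilinear_into_def base_alg_def)
  have assoc: "x \<otimes> y \<otimes> z = x \<otimes> (y \<otimes> z)" if x: "x \<in> carrier H" and y: "y \<in> carrier H" and z: "z \<in> carrier H" for x y z
  proof (rule coord_eqI)
    fix p assume "p \<in> {..<n}"
    then have p: "p < n" by simp
    show "\<kappa> (x \<otimes> y \<otimes> z) p = \<kappa> (x \<otimes> (y \<otimes> z)) p"
    proof (rule bilinear_ext[OF bilI bilI _ x y])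
      fix i j assume ij: "i < n" "j < n"
      show "\<kappa> (e i \<otimes> e j \<otimes> z) p = \<kappa> (e i \<otimes> (e j \<otimes> z)) p"
      proof (rule linear_ext[OF _ _ _ _ _ z])
        fix l assume l: "l < n"
        show "\<kappa> (e i \<otimes> e j \<otimes> e l) p = \<kappa> (e i \<otimes> (e j \<otimes> e l)) p"
          using mult_coord_basis(1)[OF mult_in[OF e[OF ij(1)] e[OF ij(2)]] l p]
            mult_coord_basis(2)[OF mult_in[OF e[OF ij(2)] e[OF l]] ij(1) p] C.assoc[OF ij l p]
          by (simp only: m_def)
      qed (use ij p in simp_all)
    qed (use z p in simp_all)
  qed (use that in simp_all)
  have unit: "\<one> \<otimes> x = x" "x \<otimes> \<one> = x" if x: "x \<in> carrier H" for x
  proof -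
    have "\<kappa> (\<one> \<otimes> x) p = \<kappa> x p" if "p < n" for p
    proof (rule linear_ext[OF _ _ _ _ _ x])
      fix k assume k: "k < n"
      show "\<kappa> (\<one> \<otimes> e k) p = \<kappa> (e k) p"
        using C.unit_left[OF k that] k that by (simp add: mult_coord_basis coord_basis \<eta>_def)
    qed (use that in simp_all)
    then show "\<one> \<otimes> x = x" using x by (intro coord_eqI) simp_all
    have "\<kappa> (x \<otimes> \<one>) p = \<kappa> x p" if "p < n" for p
    proof (rule linear_ext[OF _ _ _ _ _ x])
      fix k assume k: "k < n"
      show "\<kappa> (e k \<otimes> \<one>) p = \<kappa> (e k) p"
        using C.unit_right[OF k that] k that by (simp add: mult_coord_basis coord_basis \<eta>_def)
    qed (use that in simp_all)
    then show "x \<otimes> \<one> = x" using x by (intro coord_eqI) simp_all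
  qed
  have ring: "ring H"
  proof (rule ringI)
    show "abelian_group H" by (rule abelian_group)
    show "Group.monoid H" by (rule monoidI) (simp_all add: assoc unit)
  qed simp_all
  have k_alg: "k_algebra H"
    by (rule k_algebra.intro[OF ring vectorspace]) simp_all
  note TM = HH.tensor_mult_bilinear[OF mult_bilinear mult_bilinear]
  have comult_mult: "comult H (x \<otimes> y) = comult H x \<otimes>\<^bsub>tensor H H\<^esub> comult H y"
    if x: "x \<in> carrier H" and y: "y \<in> carrier H" for x y
  proof (rule HH.T.coord_eqI)
    show "comult H x \<otimes>\<^bsub>tensor H H\<^esub> comult H y \<in> carrier (tensor H H)"
      using TM comult_in x y by (auto simp: bilinear_into_def)
    fix pq assume pq: "pq \<in> {..<n} \<times> {..<n}"
    have in_T: "comult H x \<otimes>\<^bsub>tensor H H\<^esub> comult H y \<in> carrier (tensor H H)"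
      if "x \<in> carrier H" "y \<in> carrier H" for x y
      using TM comult_in that by (auto simp: bilinear_into_def)
    have lin: "comult H (x \<oplus> y) = comult H x \<oplus>\<^bsub>tensor H H\<^esub> comult H y" "comult H (c \<odot> x) = c \<odot>\<^bsub>tensor H H\<^esub> comult H x"
      if "x \<in> carrier H" "y \<in> carrier H" for x y c
      using comult_linear that by (auto simp: LinearCombinations.module_hom_def class_ring_simps)
    have lin': "comult H (c \<odot> x) = c \<odot>\<^bsub>tensor H H\<^esub> comult H x" if "x \<in> carrier H" for x c
      using comult_linear that by (auto simp: LinearCombinations.module_hom_def class_ring_simps)
    show "HH.tcoord (comult H (x \<otimes> y)) pq = HH.tcoord (comult H x \<otimes>\<^bsub>tensor H H\<^esub> comult H y) pq"
    proof (rule bilinear_ext[OF bilI bilI _ x y])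
      fix i j assume ij: "i < n" "j < n"
      obtain p q where p: "p < n" and q: "q < n" and pq': "pq = (p, q)" using pq by auto
      show "HH.tcoord (comult H (e i \<otimes> e j)) pq = HH.tcoord (comult H (e i) \<otimes>\<^bsub>tensor H H\<^esub> comult H (e j)) pq"
        unfolding pq' comult_product_coord[OF ij p q]
        using C.comult_mult[OF ij p q] ij p q by (simp add: comult_coord) (simp add: m_def)
    next
      fix a a' b assume abc: "a \<in> carrier H" "a' \<in> carrier H" "b \<in> carrier H"
      then have "comult H a \<in> carrier (tensor H H)" "comult H a' \<in> carrier (tensor H H)" "comult H b \<in> carrier (tensor H H)"
        by (auto intro: comult_in)
      with TM have "(comult H a \<oplus>\<^bsub>tensor H H\<^esub> comult H a') \<otimes>\<^bsub>tensor H H\<^esub> comult H b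
        = comult H a \<otimes>\<^bsub>tensor H H\<^esub> comult H b \<oplus>\<^bsub>tensor H H\<^esub> comult H a' \<otimes>\<^bsub>tensor H H\<^esub> comult H b"
        "comult H b \<otimes>\<^bsub>tensor H H\<^esub> (comult H a \<oplus>\<^bsub>tensor H H\<^esub> comult H a')
        = comult H b \<otimes>\<^bsub>tensor H H\<^esub> comult H a \<oplus>\<^bsub>tensor H H\<^esub> comult H b \<otimes>\<^bsub>tensor H H\<^esub> comult H a'"
        by (auto simp: bilinear_into_def)
      then show "HH.tcoord (comult H (a \<oplus> a') \<otimes>\<^bsub>tensor H H\<^esub> comult H b) pq
        = HH.tcoord (comult H a \<otimes>\<^bsub>tensor H H\<^esub> comult H b) pq + HH.tcoord (comult H a' \<otimes>\<^bsub>tensor H H\<^esub> comult H b) pq"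
        "HH.tcoord (comult H b \<otimes>\<^bsub>tensor H H\<^esub> comult H (a \<oplus> a')) pq
        = HH.tcoord (comult H b \<otimes>\<^bsub>tensor H H\<^esub> comult H a) pq + HH.tcoord (comult H b \<otimes>\<^bsub>tensor H H\<^esub> comult H a') pq"
        using abc pq by (simp_all add: lin in_T HH.T.coord_add)
    next
      fix c a b assume ab: "a \<in> carrier H" "b \<in> carrier H"
      then have "comult H a \<in> carrier (tensor H H)" "comult H b \<in> carrier (tensor H H)"
        by (auto intro: comult_in)
      with TM have "(c \<odot>\<^bsub>tensor H H\<^esub> comult H a) \<otimes>\<^bsub>tensor H H\<^esub> comult H b
        = c \<odot>\<^bsub>tensor H H\<^esub> (comult H a \<otimes>\<^bsub>tensor H H\<^esub> comult H b)"
        "comult H a \<otimes>\<^bsub>tensor H H\<^esub> (c \<odot>\<^bsub>tensor H H\<^esub> comult H b)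
        = c \<odot>\<^bsub>tensor H H\<^esub> (comult H a \<otimes>\<^bsub>tensor H H\<^esub> comult H b)"
        by (auto simp: bilinear_into_def)
      then show "HH.tcoord (comult H (c \<odot> a) \<otimes>\<^bsub>tensor H H\<^esub> comult H b) pq
        = c * HH.tcoord (comult H a \<otimes>\<^bsub>tensor H H\<^esub> comult H b) pq"
        "HH.tcoord (comult H a \<otimes>\<^bsub>tensor H H\<^esub> comult H (c \<odot> b)) pq
        = c * HH.tcoord (comult H a \<otimes>\<^bsub>tensor H H\<^esub> comult H b) pq"
        using ab pq by (simp_all add: lin' in_T HH.T.coord_smult)
    qed (use pq in \<open>simp_all add: comult_additive\<close>)
  qed (use that comult_in in simp_all)
  have comult_one: "comult H \<one> = \<one>\<^bsub>tensor H H\<^esub>"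
  proof (rule HH.T.coord_eqI)
    fix pq assume "pq \<in> {..<n} \<times> {..<n}"
    then obtain p q where pq: "pq = (p, q)" "p < n" "q < n" by auto
    then show "HH.tcoord (comult H \<one>) pq = HH.tcoord \<one>\<^bsub>tensor H H\<^esub> pq"
      using C.comult_one[of p q] by (simp add: comult_coord HH.one_tensor HH.tcoord_pure \<eta>_def)
  qed (simp_all add: comult_in HH.one_tensor HH.pure_in)
  have counit_mult: "counit H (x \<otimes> y) = counit H x * counit H y" if x: "x \<in> carrier H" and y: "y \<in> carrier H" for x y
  proof (rule bilinear_ext[OF bilI bilI _ x y])
    fix i j assume "i < n" "j < n"
    then show "counit H (e i \<otimes> e j) = counit H (e i) * counit H (e j)"
      using C.counit_mult[of i j] counit_coord[of "e i \<otimes> e j"] by (simp add: m_def \<epsilon>_def)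
  qed (simp_all add: counit_additive algebra_simps)
  have counit_one: "counit H \<one> = 1"
    using C.counit_one counit_coord[of \<one>] by (simp add: \<eta>_def)
  define S where "S h = (\<Oplus>j\<in>{..<n}. (\<Sum>i<n. \<kappa> h i * s i j) \<odot> e j)" for h
  have S_in: "S h \<in> carrier H" for h
    unfolding S_def by (rule finsum_in) auto
  have S_coord: "\<kappa> (S h) j = (\<Sum>i<n. \<kappa> h i * s i j)" if "j < n" for h j
    unfolding S_def using that
    by (subst coord_finsum) (auto simp: coord_basis if_distrib[of "\<lambda>x. _ * x"] cong: if_cong)
  have S_hom: "S \<in> LinearCombinations.module_hom class_ring H H"
    by (auto simp: LinearCombinations.module_hom_def class_ring_simps S_in S_coord sum_distrib_left
        algebra_simps sum.distrib intro!: coord_eqI)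
  have S_basis: "\<kappa> (S (e i)) j = s i j" if "i < n" "j < n" for i j
    using that by (simp add: S_coord coord_basis if_distrib[of "\<lambda>x. x * _"] cong: if_cong)
  have "is_antipode H S"
    unfolding is_antipode_def
  proof (intro conjI ballI S_hom)
    fix h assume h: "h \<in> carrier H"
    show "tensor_lift H (\<lambda>a b. S a \<otimes> b) (comult H h) = counit H h \<odot> \<one>"
    proof (rule coord_eqI)
      fix p assume "p \<in> {..<n}"
      then have p: "p < n" by simp
      show "\<kappa> (tensor_lift H (\<lambda>a b. S a \<otimes> b) (comult H h)) p = \<kappa> (counit H h \<odot> \<one>) p"
        unfolding antipode_axiom_coord(3)[OF S_hom h p]
      proof (rule linear_ext[OF _ _ _ _ _ h])
        fix k assume k: "k < n"
        show "(\<Sum>i<n. \<Sum>l<n. \<Sum>j<n. \<kappa> (S (e i)) l * (HH.tcoord (comult H (e k)) (i, j) * m l j p))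
          = \<kappa> (counit H (e k) \<odot> \<one>) p"
          using C.antipode_left[OF k p] p by (simp add: S_basis d_def \<epsilon>_def \<eta>_def)
      qed (use p in \<open>simp_all add: comult_additive counit_additive distrib_left distrib_right sum.distrib
          sum_distrib_left mult_ac\<close>)
    qed (use h in \<open>simp_all add: antipode_axiom_coord(1)[OF S_hom h pos]\<close>)
    show "tensor_lift H (\<lambda>a b. a \<otimes> S b) (comult H h) = counit H h \<odot> \<one>"
    proof (rule coord_eqI)
      fix p assume "p \<in> {..<n}"
      then have p: "p < n" by simp
      show "\<kappa> (tensor_lift H (\<lambda>a b. a \<otimes> S b) (comult H h)) p = \<kappa> (counit H h \<odot> \<one>) p"
        unfolding antipode_axiom_coord(4)[OF S_hom h p]
      proof (rule linear_ext[OF _ _ _ _ _ h])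
        fix k assume k: "k < n"
        show "(\<Sum>j<n. \<Sum>i<n. \<Sum>l<n. \<kappa> (S (e i)) l * (HH.tcoord (comult H (e k)) (j, i) * m j l p))
          = \<kappa> (counit H (e k) \<odot> \<one>) p"
          using C.antipode_right[OF k p] p by (simp add: S_basis d_def \<epsilon>_def \<eta>_def)
      qed (use p in \<open>simp_all add: comult_additive counit_additive distrib_left distrib_right sum.distrib
          sum_distrib_left mult_ac\<close>)
    qed (use h in \<open>simp_all add: antipode_axiom_coord(2)[OF S_hom h pos]\<close>)
  qed
  show ?thesis
  proof (intro hopf_algebra.intro bialgebra.intro hopf_algebra_axioms.intro)
    show "k_algebra H" by (rule k_alg)
    show "comult H \<in> alg_hom H (tensor H H)"
      using comult_linear comult_mult comult_one comult_in
      by (auto simp: alg_hom_def Ring.ring_hom_def LinearCombinations.module_hom_def)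
    show "counit H \<in> alg_hom H base_alg"
      using counit_linear counit_mult counit_one
      by (auto simp: alg_hom_def Ring.ring_hom_def LinearCombinations.module_hom_def base_alg_def)
    show "\<exists>S. is_antipode H S" using \<open>is_antipode H S\<close> by (intro exI[of _ S])
    fix h assume h: "h \<in> carrier H"
    show "tensor_map (tensor H H) H (comult H) id (comult H h)
      = tensor_assoc H H H (tensor_map H (tensor H H) id (comult H) (comult H h))"
    proof (rule HHH.T.coord_eqI)
      fix x assume "x \<in> ({..<n} \<times> {..<n}) \<times> {..<n}"
      then obtain i j l where x: "x = ((i, j), l)" and ijl: "i < n" "j < n" "l < n" by auto
      show "HHH.tcoord (tensor_map (tensor H H) H (comult H) id (comult H h)) x =
        HHH.tcoord (tensor_assoc H H H (tensor_map H (tensor H H) id (comult H) (comult H h))) x"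
        unfolding x coassoc_left_coord(2)[OF h ijl] coassoc_right_coord(2)[OF h ijl]
      proof (rule linear_ext[OF _ _ _ _ _ h])
        fix k assume "k < n"
        from C.coassoc[OF this ijl]
        show "(\<Sum>p<n. HH.tcoord (comult H (e k)) (p, l) * d p i j) = (\<Sum>p<n. HH.tcoord (comult H (e k)) (i, p) * d p j l)"
          by (simp add: d_def)
      qed (use ijl in \<open>simp_all add: comult_additive distrib_right sum.distrib sum_distrib_left mult.assoc\<close>)
    qed (use coassoc_left_coord(1)[OF h pos pos pos] coassoc_right_coord(1)[OF h pos pos pos] in simp_all)
    show "tensor_lift H (\<lambda>a b. counit H a \<odot> b) (comult H h) = h"
    proof (rule coord_eqI)
      fix j assume "j \<in> {..<n}"
      then have j: "j < n" by simp
      show "\<kappa> (tensor_lift H (\<lambda>a b. counit H a \<odot> b) (comult H h)) j = \<kappa> h j"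
        unfolding counit_axiom_coord(3)[OF h j]
      proof (rule linear_ext[OF _ _ _ _ _ h])
        fix k assume "k < n"
        with C.counit_left[OF this j] j
        show "(\<Sum>p<n. \<epsilon> p * HH.tcoord (comult H (e k)) (p, j)) = \<kappa> (e k) j"
          by (simp add: d_def coord_basis)
      qed (use j in \<open>simp_all add: comult_additive distrib_left sum.distrib sum_distrib_left mult_ac\<close>)
    qed (use h in \<open>simp_all add: counit_axiom_coord(1)[OF _ pos]\<close>)
    show "tensor_lift H (\<lambda>a b. counit H b \<odot> a) (comult H h) = h"
    proof (rule coord_eqI)
      fix j assume "j \<in> {..<n}"
      then have j: "j < n" by simp
      show "\<kappa> (tensor_lift H (\<lambda>a b. counit H b \<odot> a) (comult H h)) j = \<kappa> h j"
        unfolding counit_axiom_coord(4)[OF h j]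
      proof (rule linear_ext[OF _ _ _ _ _ h])
        fix k assume "k < n"
        with C.counit_right[OF this j] j
        show "(\<Sum>p<n. \<epsilon> p * HH.tcoord (comult H (e k)) (j, p)) = \<kappa> (e k) j"
          by (simp add: d_def coord_basis)
      qed (use j in \<open>simp_all add: comult_additive distrib_left sum.distrib sum_distrib_left mult_ac\<close>)
    qed (use h in \<open>simp_all add: counit_axiom_coord(2)[OF _ pos]\<close>)
  qed
qed

end

section \<open>Coordinates and dimension\<close>

lemma (in coordinates) lincomb_coord:
  assumes inj: "inj_on e I" and a: "i \<in> I"
  shows "\<kappa> (LinearCombinations.module.lincomb A a (e ` I)) i = a (e i)"
proof -
  interpret vectorspace class_ring A by (rule vectorspace)
  have "lincomb a (e ` I) = (\<Oplus>v\<in>e ` I. a v \<odot> v)" by (simp add: lincomb_def)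
  moreover have "\<kappa> (\<Oplus>v\<in>e ` I. a v \<odot> v) i = (\<Sum>v\<in>e ` I. \<kappa> (a v \<odot> v) i)"
    using a by (intro coord_finsum) (auto simp: finite_index basis_in smult_in)
  moreover have "\<dots> = (\<Sum>j\<in>I. \<kappa> (a (e j) \<odot> e j) i)"
    by (rule sum.reindex_cong[OF inj]) auto
  moreover have "\<dots> = (\<Sum>j\<in>I. a (e j) * (if j = i then 1 else 0))"
    using a by (intro sum.cong) (auto simp: coord_smult basis_in coord_basis)
  moreover have "\<dots> = a (e i)"
    using a finite_index by (simp add: sum_single_delta)
  ultimately show ?thesis by simp
qed

lemma (in coordinates) inj_basis: "inj_on e I"
proof (rule inj_onI)
  fix i j assume "i \<in> I" "j \<in> I" "e i = e j"
  then show "i = j" using coord_basis[of i j] coord_basis[of j j] by (auto split: if_splits)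
qed

lemma (in coordinates) dimension:
  "vectorspace.fin_dim class_ring A" "vectorspace.dim class_ring A = card I"
proof -
  interpret vectorspace class_ring A by (rule vectorspace)
  have sub: "e ` I \<subseteq> carrier A" using basis_in by auto
  have fin: "finite (e ` I)" using finite_index by simp
  have lin_in: "lincomb a (e ` I) \<in> carrier A" for a
    using sub by (intro lincomb_closed) (auto simp: class_ring_simps)
  have "basis (e ` I)"
    unfolding basis_criterion[OF fin sub]
  proof (intro allI impI)
    fix v assume v: "v \<in> carrier A"
    show "\<exists>!a. a \<in> e ` I \<rightarrow>\<^sub>E carrier class_ring \<and> lincomb a (e ` I) = v"
    proof (rule ex1I)
      let ?a = "\<lambda>x\<in>e ` I. \<kappa> v (inv_into I e x)"
      have "lincomb ?a (e ` I) = v"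
        by (rule coord_eqI) (auto simp: lin_in v lincomb_coord[OF inj_basis] inj_basis)
      then show "?a \<in> e ` I \<rightarrow>\<^sub>E carrier class_ring \<and> lincomb ?a (e ` I) = v"
        by (auto simp: class_ring_simps)
      fix a assume a: "a \<in> e ` I \<rightarrow>\<^sub>E carrier class_ring \<and> lincomb a (e ` I) = v"
      show "a = ?a"
      proof
        fix x show "a x = ?a x"
        proof (cases "x \<in> e ` I")
          case True
          then obtain i where i: "i \<in> I" "x = e i" by auto
          then show ?thesis using lincomb_coord[OF inj_basis i(1), of a] a by (auto simp: inj_basis)
        next
          case False
          then show ?thesis using a by (auto simp: PiE_def extensional_def)
        qed
      qed
    qed
  qed
  then show "dim = card I" using dim_basis[OF fin] card_image[OF inj_basis] by simp
  have "gen_set (e ` I)" using \<open>basis (e ` I)\<close> by (simp add: basis_def)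
  then show fin_dim unfolding fin_dim_def using fin sub by blast
qed

lemma coordinates_exist:
  fixes A :: "('k::field, 'a, 'm) module_scheme" (structure)
  assumes vs: "vectorspace class_ring A" and fd: "vectorspace.fin_dim class_ring A"
    and dim: "vectorspace.dim class_ring A = n"
  shows "\<exists>e \<kappa>. coordinates A {..<n} e \<kappa>"
proof -
  interpret vectorspace class_ring A by (rule vs)
  obtain B where B: "finite B" "basis B" using finite_basis_exists[OF fd] by blast
  then have sub: "B \<subseteq> carrier A" by (simp add: basis_def)
  have "card B = n" using dim_basis[OF B] dim by simp
  then obtain e where e: "bij_betw e {..<n} B"
    using ex_bij_betw_nat_finite[OF B(1)] by (auto simp: atLeast0LessThan)
  have unique: "\<exists>!a. a \<in> B \<rightarrow>\<^sub>E carrier class_ring \<and> lincomb a B = v" if "v \<in> carrier A" for v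
    using B basis_criterion[OF B(1) sub] that by blast
  define c where "c v = (THE a. a \<in> B \<rightarrow>\<^sub>E carrier class_ring \<and> lincomb a B = v)" for v
  have c: "c v \<in> B \<rightarrow>\<^sub>E carrier class_ring" "lincomb (c v) B = v" if "v \<in> carrier A" for v
    using theI'[OF unique[OF that]] by (auto simp: c_def)
  have c_eq: "c v x = a x" if "v \<in> carrier A" "lincomb a B = v" "x \<in> B" for v a x
  proof -
    have "lincomb (restrict a B) B = lincomb a B"
      unfolding lincomb_def using sub by (intro finsum_cong') (auto simp: class_ring_simps)
    then have "restrict a B \<in> B \<rightarrow>\<^sub>E carrier class_ring \<and> lincomb (restrict a B) B = v"
      using that(2) by (auto simp: class_ring_simps)
    then have "restrict a B = c v"
      using unique[OF that(1)] c[OF that(1)] by blast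
    then show ?thesis using that(3) by (metis restrict_apply')
  qed
  have scalar: "(k + l) \<odot> x = k \<odot> x \<oplus> l \<odot> x" "(k * l) \<odot> x = k \<odot> (l \<odot> x)" "0 \<odot> x = \<zero>" "1 \<odot> x = x"
    if "x \<in> carrier A" for x k l
    using that smult_l_distr[of k l x] smult_assoc1[of k l x] smult_l_null[of x] smult_one[of x]
    by (simp_all add: class_ring_simps)
  have smult_in: "k \<odot> x \<in> carrier A" if "x \<in> B" for k x
    using that sub smult_closed[of k x] by (auto simp: class_ring_simps)
  have in_A: "x \<in> carrier A" if "x \<in> B" for x using that sub by blast
  have sum: "lincomb (\<lambda>x. a x + b x) B = lincomb a B \<oplus> lincomb b B" for a b
  proof -
    have "lincomb (\<lambda>x. a x + b x) B = (\<Oplus>x\<in>B. a x \<odot> x \<oplus> b x \<odot> x)"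
      unfolding lincomb_def by (intro finsum_cong') (auto simp: smult_in scalar in_A)
    also have "\<dots> = lincomb a B \<oplus> lincomb b B"
      unfolding lincomb_def by (intro finsum_addf) (auto simp: smult_in)
    finally show ?thesis .
  qed
  have scale: "lincomb (\<lambda>x. k * a x) B = k \<odot> lincomb a B" for k a
  proof -
    have "lincomb (\<lambda>x. k * a x) B = (\<Oplus>x\<in>B. k \<odot> (a x \<odot> x))"
      unfolding lincomb_def using smult_closed[of k "a _ \<odot> _"] smult_in
      by (intro finsum_cong') (auto simp: scalar in_A class_ring_simps)
    also have "\<dots> = k \<odot> lincomb a B"
      unfolding lincomb_def by (rule finsum_smult[symmetric]) (auto simp: smult_in class_ring_simps)
    finally show ?thesis .
  qed
  have zero_lc: "lincomb (\<lambda>x. 0) B = \<zero>"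
  proof -
    have "lincomb (\<lambda>x. 0 * (0::'k)) B = 0 \<odot> lincomb (\<lambda>x. 0) B" by (rule scale)
    moreover have "lincomb (\<lambda>x. 0) B \<in> carrier A"
      using sub by (intro lincomb_closed) (auto simp: class_ring_simps)
    ultimately show ?thesis by (simp add: scalar)
  qed
  have eB: "e i \<in> B" if "i < n" for i using e that by (auto simp: bij_betw_def)
  have single: "lincomb (\<lambda>x. if x = e i then 1 else 0) B = e i" if "i < n" for i
  proof -
    have "lincomb (\<lambda>x. if x = e i then 1 else 0) B = (\<Oplus>x\<in>B. if e i = x then x else \<zero>)"
      unfolding lincomb_def by (intro finsum_cong') (auto simp: scalar in_A)
    also have "\<dots> = e i" using sub eB[OF that] B(1) by (intro finsum_singleton) auto
    finally show ?thesis .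
  qed
  have "coordinates A {..<n} e (\<lambda>v i. c v (e i))"
  proof
    fix i assume "i \<in> {..<n}"
    then have i: "i < n" by simp
    show "e i \<in> carrier A" using eB[OF i] sub by auto
    show "c \<zero> (e i) = 0" by (rule c_eq[OF _ zero_lc eB[OF i]]) simp
    show "c (x \<oplus> y) (e i) = c x (e i) + c y (e i)" if "x \<in> carrier A" "y \<in> carrier A" for x y
      by (rule c_eq[of "x \<oplus> y" "\<lambda>z. c x z + c y z" "e i"]) (use that eB[OF i] in \<open>simp_all add: sum c\<close>)
    show "c (k \<odot> x) (e i) = k * c x (e i)" if "x \<in> carrier A" for x k
      by (rule c_eq[of "k \<odot> x" "\<lambda>z. k * c x z" "e i"])
        (use that eB[OF i] smult_closed[of k x] in \<open>simp_all add: scale c class_ring_simps\<close>)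
    fix j assume "j \<in> {..<n}"
    then have j: "j < n" by simp
    have "c (e i) (e j) = (if e j = e i then 1 else 0)"
      by (rule c_eq[OF _ single[OF i] eB[OF j]]) (use eB[OF i] sub in auto)
    then show "c (e i) (e j) = (if i = j then 1 else 0)"
      using e i j by (auto simp: bij_betw_def inj_on_def)
  next
    fix x y assume xy: "x \<in> carrier A" "y \<in> carrier A" and eq: "\<And>i. i \<in> {..<n} \<Longrightarrow> c x (e i) = c y (e i)"
    have "c x z = c y z" if "z \<in> B" for z
      using e eq that by (auto simp: bij_betw_def)
    then have "lincomb (c x) B = lincomb (c y) B"
      unfolding lincomb_def using sub by (intro finsum_cong') (auto simp: class_ring_simps)
    then show "x = y" using c(2)[OF xy(1)] c(2)[OF xy(2)] by simp
  qed (auto simp: class_ring_simps)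
  then show ?thesis by blast
qed

section \<open>Isomorphisms and changes of basis\<close>

locale two_bases = X: hopf_coordinates H n e \<kappa> + Y: hopf_coordinates H n e' \<kappa>'
  for H :: "('k::field, 'h) hopf" (structure) and n e \<kappa> e' \<kappa>'
begin

lemma coord_change:
  assumes "x \<in> carrier H" "j < n"
  shows "\<kappa> x j = (\<Sum>i<n. \<kappa>' x i * \<kappa> (e' i) j)"
  by (rule Y.linear_form_expand[OF _ _ assms(1)]) (use assms in \<open>auto simp: X.coord_add X.coord_smult\<close>)

lemma inverse_change:
  assumes "i < n" "j < n"
  shows "(\<Sum>l<n. \<kappa>' (e i) l * \<kappa> (e' l) j) = (if i = j then 1 else 0)"
  using coord_change[of "e i" j] assms by (simp add: X.basis_in X.coord_basis)

lemma basechange_constants: "basechange n (\<lambda>i j. \<kappa> (e' i) j) X.m X.d Y.m Y.d"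
  unfolding basechange_def
proof (intro conjI allI impI)
  fix p q k assume pq: "p < n" "q < n" and k: "k < n"
  have "\<kappa> (e' p \<otimes> e' q) k = (\<Sum>r<n. Y.m p q r * \<kappa> (e' r) k)"
    using coord_change[OF Y.mult_in k, of "e' p" "e' q"] pq by (simp add: Y.basis_in Y.m_def)
  then show "(\<Sum>i<n. \<Sum>j<n. \<kappa> (e' p) i * \<kappa> (e' q) j * X.m i j k) = (\<Sum>r<n. Y.m p q r * \<kappa> (e' r) k)"
    using X.mult_coord[of "e' p" "e' q" k] pq k by (simp add: Y.basis_in)
next
  fix k i j assume k: "k < n" and ij: "i < n" "j < n"
  have ek: "e' k \<in> carrier H" using k by (simp add: Y.basis_in)
  have "(\<Sum>l<n. \<kappa> (e' k) l * X.d l i j) = X.HH.tcoord (comult H (e' k)) (i, j)"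
    using X.comult_coord[OF ek ij] by simp
  also have "\<dots> = extend_linearly (\<lambda>(a, b). \<kappa> a i * \<kappa> b j) (tensor_rep (comult H (e' k)))"
    by (simp add: X.HH.tcoord_def)
  also have "\<dots> = (\<Sum>(p,q)\<in>{..<n}\<times>{..<n}.
      extend_linearly (\<lambda>(a, b). \<kappa>' a p * \<kappa>' b q) (tensor_rep (comult H (e' k))) * (\<kappa> (e' p) i * \<kappa> (e' q) j))"
    using ij by (intro Y.HH.bilinear_form_expand X.HH.coord_product_bilinear
        Y.HH.tensor_rep_facts(1)[OF Y.comult_in[OF ek]]) auto
  also have "\<dots> = (\<Sum>p<n. \<Sum>q<n. Y.d k p q * \<kappa> (e' p) i * \<kappa> (e' q) j)"
    by (simp add: sum_pairs Y.d_def Y.HH.tcoord_def mult.assoc)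
  finally show "(\<Sum>l<n. \<kappa> (e' k) l * X.d l i j) = (\<Sum>p<n. \<Sum>q<n. Y.d k p q * \<kappa> (e' p) i * \<kappa> (e' q) j)" .
qed

end

text \<open>
The rows of an invertible matrix \<open>Q\<close> are the coordinates of a new basis.
\<close>

lemma new_basis:
  fixes A :: "('k::field, 'a, 'm) module_scheme" (structure) and n :: nat
  assumes co: "coordinates A {..<n} e \<kappa>"
    and QP: "\<And>i j. i < n \<Longrightarrow> j < n \<Longrightarrow> (\<Sum>l<n. Q i l * P l j) = (if i = j then 1 else 0)"
  shows "\<exists>e' \<kappa>'. coordinates A {..<n} e' \<kappa>' \<and> (\<forall>i<n. \<forall>j<n. \<kappa> (e' i) j = Q i j)"
proof -
  interpret coordinates A "{..<n}" e \<kappa> by (rule co)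
  note PQ = left_inverse_is_right_inverse[OF QP]
  have "\<forall>i. \<exists>x\<in>carrier A. \<forall>j\<in>{..<n}. \<kappa> x j = Q i j" using exists_coords by blast
  then obtain e' where e': "\<And>i. e' i \<in> carrier A" "\<And>i j. j < n \<Longrightarrow> \<kappa> (e' i) j = Q i j"
    by (metis lessThan_iff)
  define \<kappa>' where "\<kappa>' x j = (\<Sum>i<n. \<kappa> x i * P i j)" for x j
  have "coordinates A {..<n} e' \<kappa>'"
  proof
    fix x y assume xy: "x \<in> carrier A" "y \<in> carrier A" and eq: "\<And>i. i \<in> {..<n} \<Longrightarrow> \<kappa>' x i = \<kappa>' y i"
    have recover: "(\<Sum>j<n. \<kappa>' x j * Q j l) = \<kappa> x l" if "l < n" for x l
    proof -
      have "(\<Sum>j<n. \<kappa>' x j * Q j l) = (\<Sum>i<n. \<kappa> x i * (\<Sum>j<n. P i j * Q j l))"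
        unfolding \<kappa>'_def sum_distrib_left sum_distrib_right by (subst sum.swap) (simp add: mult.assoc)
      also have "\<dots> = (\<Sum>i<n. \<kappa> x i * (if i = l then 1 else 0))"
        using that by (intro sum.cong) (auto simp: PQ)
      finally show ?thesis using that by (simp add: sum_single_delta)
    qed
    show "x = y"
    proof (rule coord_eqI[OF xy])
      fix i assume "i \<in> {..<n}"
      then show "\<kappa> x i = \<kappa> y i" using recover[of i x] recover[of i y] eq by simp
    qed
  qed (auto simp: \<kappa>'_def zero_in add_in smult_in e' coord_zero coord_add
      coord_smult distrib_right sum.distrib sum_distrib_left mult.assoc QP)
  then show ?thesis using e' by blast
qed

lemma tensor_map_coord:
  assumes H: "hopf_coordinates H n e \<kappa>" and L: "hopf_coordinates L n e' \<kappa>'"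
    and f: "f \<in> LinearCombinations.module_hom class_ring H L"
    and fe: "\<And>i. i < n \<Longrightarrow> f (e i) = e' i" and S: "S \<in> carrier (tensor H H)"
  shows "tensor_map L L f f S \<in> carrier (tensor L L)"
    and "i < n \<Longrightarrow> j < n \<Longrightarrow> two_coordinates.tcoord \<kappa>' \<kappa>' (tensor_map L L f f S) (i, j) =
      two_coordinates.tcoord \<kappa> \<kappa> S (i, j)"
proof -
  interpret X: hopf_coordinates H n e \<kappa> by (rule H)
  interpret Y: hopf_coordinates L n e' \<kappa>' by (rule L)
  have b: "bilinear_into H H (tensor L L) (\<lambda>a b. pure_tensor L L (f a) (f b))"
    using Y.HH.pure_bilinear f
    by (auto simp: bilinear_into_def LinearCombinations.module_hom_def class_ring_simps Pi_iff)
  note TL = X.HH.tensor_lift_in_coord[OF Y.HH.coordinates_tensor b S]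
  show "tensor_map L L f f S \<in> carrier (tensor L L)"
    unfolding tensor_map_def by (rule TL(1))
  assume ij: "i < n" "j < n"
  have "Y.HH.tcoord (tensor_map L L f f S) (i, j)
    = (\<Sum>x\<in>{..<n}\<times>{..<n}. X.HH.tcoord S x * Y.HH.tcoord (pure_tensor L L (f (e (fst x))) (f (e (snd x)))) (i, j))"
    unfolding tensor_map_def using ij by (intro TL(2)) auto
  also have "\<dots> = (\<Sum>x\<in>{..<n}\<times>{..<n}. X.HH.tcoord S x * (if x = (i, j) then 1 else 0))"
    using ij by (intro sum.cong) (auto simp: fe Y.HH.tcoord_pure Y.basis_in Y.coord_basis split: if_splits)
  also have "\<dots> = X.HH.tcoord S (i, j)"
    using ij by (subst sum_single_delta) auto
  finally show "Y.HH.tcoord (tensor_map L L f f S) (i, j) = X.HH.tcoord S (i, j)" .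
qed

text \<open>
The linear map that matches the two bases. The constants of product and coproduct determine unit and
counit, which are therefore matched as well.
\<close>

lemma iso_of_constants:
  assumes H: "hopf_coordinates H n e \<kappa>" "hopf_algebra H"
    and L: "hopf_coordinates L n e' \<kappa>'" "hopf_algebra L"
    and m: "\<And>i j k. i < n \<Longrightarrow> j < n \<Longrightarrow> k < n \<Longrightarrow> hopf_coordinates.m H e \<kappa> i j k = hopf_coordinates.m L e' \<kappa>' i j k"
    and d: "\<And>i j k. i < n \<Longrightarrow> j < n \<Longrightarrow> k < n \<Longrightarrow> hopf_coordinates.d H e \<kappa> k i j = hopf_coordinates.d L e' \<kappa>' k i j"
  shows "hopf_iso H L \<noteq> {}"
proof -
  interpret X: hopf_coordinates H n e \<kappa> by (rule H)
  interpret Y: hopf_coordinates L n e' \<kappa>' by (rule L)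
  obtain s where "hopf_constants n X.m X.d X.\<eta> X.\<epsilon> s" using X.hopf_imp_constants[OF H(2)] by blast
  then interpret CX: hopf_constants n X.m X.d X.\<eta> X.\<epsilon> s .
  obtain s' where "hopf_constants n Y.m Y.d Y.\<eta> Y.\<epsilon> s'" using Y.hopf_imp_constants[OF L(2)] by blast
  then interpret CY: hopf_constants n Y.m Y.d Y.\<eta> Y.\<epsilon> s' .
  have one_in: "\<one>\<^bsub>H\<^esub> \<in> carrier H" "\<one>\<^bsub>L\<^esub> \<in> carrier L"
    using H(2) L(2) by (auto simp: hopf_algebra_def bialgebra_def k_algebra_def ring_def monoid.one_closed)
  \<comment> \<open>A left unit and a right unit of the same product agree; the same argument applies to counits.\<close>
  have eta: "X.\<eta> p = Y.\<eta> p" if p: "p < n" for p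
  proof -
    have "(\<Sum>i<n. \<Sum>j<n. X.\<eta> i * (Y.\<eta> j * X.m i j p)) = (\<Sum>i<n. X.\<eta> i * (if i = p then 1 else 0))"
      using p by (intro sum.cong) (auto simp: m CY.unit_right simp flip: sum_distrib_left)
    moreover have "(\<Sum>i<n. \<Sum>j<n. X.\<eta> i * (Y.\<eta> j * X.m i j p)) = (\<Sum>j<n. Y.\<eta> j * (\<Sum>i<n. X.\<eta> i * X.m i j p))"
      unfolding sum_distrib_left by (subst sum.swap) (simp add: mult.left_commute)
    moreover have "\<dots> = (\<Sum>j<n. Y.\<eta> j * (if j = p then 1 else 0))"
      using p by (intro sum.cong) (auto simp: CX.unit_left)
    ultimately show ?thesis using p by (simp add: sum_single_delta)
  qed
  have eps: "X.\<epsilon> k = Y.\<epsilon> k" if k: "k < n" for k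
  proof -
    have "(\<Sum>i<n. \<Sum>j<n. X.\<epsilon> i * (Y.\<epsilon> j * X.d k i j)) = (\<Sum>i<n. X.\<epsilon> i * (if k = i then 1 else 0))"
      using k by (intro sum.cong) (auto simp: d CY.counit_right simp flip: sum_distrib_left)
    moreover have "(\<Sum>i<n. \<Sum>j<n. X.\<epsilon> i * (Y.\<epsilon> j * X.d k i j)) = (\<Sum>j<n. Y.\<epsilon> j * (\<Sum>i<n. X.\<epsilon> i * X.d k i j))"
      unfolding sum_distrib_left by (subst sum.swap) (simp add: mult.left_commute)
    moreover have "\<dots> = (\<Sum>j<n. Y.\<epsilon> j * (if k = j then 1 else 0))"
      using k by (intro sum.cong) (auto simp: CX.counit_left)
    ultimately show ?thesis using k by (simp add: sum_single_delta)
  qed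
  define f where "f h = (\<Oplus>\<^bsub>L\<^esub>i\<in>{..<n}. \<kappa> h i \<odot>\<^bsub>L\<^esub> e' i)" for h
  have f_in: "f h \<in> carrier L" for h
    unfolding f_def by (rule Y.finsum_in) (auto intro: Y.smult_in Y.basis_in)
  have f_coord: "\<kappa>' (f h) j = \<kappa> h j" if "j < n" for h j
    unfolding f_def using that
    by (subst Y.coord_finsum) (auto simp: Y.smult_in Y.basis_in Y.coord_smult Y.coord_basis
        if_distrib[of "\<lambda>x. _ * x"] cong: if_cong)
  have f_hom: "f \<in> LinearCombinations.module_hom class_ring H L"
    by (auto simp: LinearCombinations.module_hom_def class_ring_simps f_in f_coord Y.add_in Y.smult_in
        Y.coord_add Y.coord_smult X.coord_add X.coord_smult X.add_in X.smult_in intro!: Y.coord_eqI)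
  have fe: "f (e i) = e' i" if "i < n" for i
    by (rule Y.coord_eqI) (use that in \<open>auto simp: f_in f_coord X.coord_basis Y.coord_basis Y.basis_in\<close>)
  have f_mult: "f (x \<otimes>\<^bsub>H\<^esub> y) = f x \<otimes>\<^bsub>L\<^esub> f y" if "x \<in> carrier H" "y \<in> carrier H" for x y
    by (rule Y.coord_eqI)
      (use that in \<open>auto simp: f_in f_coord Y.mult_in X.mult_coord Y.mult_coord m\<close>)
  have f_one: "f \<one>\<^bsub>H\<^esub> = \<one>\<^bsub>L\<^esub>"
  proof (rule Y.coord_eqI[OF f_in one_in(2)])
    fix i assume "i \<in> {..<n}"
    then show "\<kappa>' (f \<one>\<^bsub>H\<^esub>) i = \<kappa>' \<one>\<^bsub>L\<^esub> i" using eta[of i] by (simp add: f_coord X.\<eta>_def Y.\<eta>_def)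
  qed
  have f_bij: "bij_betw f (carrier H) (carrier L)"
  proof (rule bij_betwI')
    show "f x = f y \<longleftrightarrow> x = y" if "x \<in> carrier H" "y \<in> carrier H" for x y
    proof
      assume "f x = f y"
      then have "\<kappa> x i = \<kappa> y i" if "i < n" for i using f_coord[OF that, of x] f_coord[OF that, of y] by simp
      then show "x = y" using that by (intro X.coord_eqI) auto
    qed simp
    fix y assume y: "y \<in> carrier L"
    obtain x where "x \<in> carrier H" "\<forall>i\<in>{..<n}. \<kappa> x i = \<kappa>' y i" using X.exists_coords by blast
    then have "y = f x" by (intro Y.coord_eqI) (auto simp: y f_in f_coord)
    then show "\<exists>x\<in>carrier H. y = f x" using \<open>x \<in> carrier H\<close> by blast
  qed (rule f_in)
  have f_comult: "comult L (f h) = tensor_map L L f f (comult H h)" if h: "h \<in> carrier H" for h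
  proof (rule Y.HH.T.coord_eqI)
    note T = tensor_map_coord[OF H(1) L(1) f_hom fe X.comult_in[OF h]]
    show "tensor_map L L f f (comult H h) \<in> carrier (tensor L L)" by (rule T(1))
    show "comult L (f h) \<in> carrier (tensor L L)" by (rule Y.comult_in[OF f_in])
    fix ij assume "ij \<in> {..<n} \<times> {..<n}"
    then obtain i j where ij: "ij = (i, j)" "i < n" "j < n" by auto
    then show "Y.HH.tcoord (comult L (f h)) ij = Y.HH.tcoord (tensor_map L L f f (comult H h)) ij"
      using h by (simp add: T(2) Y.comult_coord X.comult_coord f_in f_coord d)
  qed
  have f_counit: "counit L (f h) = counit H h" if "h \<in> carrier H" for h
    using that by (simp add: X.counit_coord Y.counit_coord f_in f_coord eps)
  have "f \<in> hopf_iso H L"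
    using f_hom f_mult f_one f_bij f_comult f_counit f_in
    by (auto simp: hopf_iso_def alg_hom_def Ring.ring_hom_def LinearCombinations.module_hom_def class_ring_simps)
  then show ?thesis by blast
qed

text \<open>
The image of a basis under the isomorphism.
\<close>

lemma constants_of_iso:
  assumes H: "hopf_coordinates H n e \<kappa>" and L: "hopf_algebra L" and f: "f \<in> hopf_iso H L"
  obtains e' \<kappa>' where "hopf_coordinates L n e' \<kappa>'"
    and "\<And>i j k. i < n \<Longrightarrow> j < n \<Longrightarrow> k < n \<Longrightarrow> hopf_coordinates.m L e' \<kappa>' i j k = hopf_coordinates.m H e \<kappa> i j k"
    and "\<And>i j k. i < n \<Longrightarrow> j < n \<Longrightarrow> k < n \<Longrightarrow> hopf_coordinates.d L e' \<kappa>' k i j = hopf_coordinates.d H e \<kappa> k i j"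
proof -
  interpret X: hopf_coordinates H n e \<kappa> by (rule H)
  have hom: "f \<in> LinearCombinations.module_hom class_ring H L" and bij: "bij_betw f (carrier H) (carrier L)"
    and mult: "\<And>x y. x \<in> carrier H \<Longrightarrow> y \<in> carrier H \<Longrightarrow> f (x \<otimes>\<^bsub>H\<^esub> y) = f x \<otimes>\<^bsub>L\<^esub> f y"
    and comult: "\<And>h. h \<in> carrier H \<Longrightarrow> comult L (f h) = tensor_map L L f f (comult H h)"
    using f by (auto simp: hopf_iso_def alg_hom_def Ring.ring_hom_def)
  have lin: "f (x \<oplus>\<^bsub>H\<^esub> y) = f x \<oplus>\<^bsub>L\<^esub> f y" "f (c \<odot>\<^bsub>H\<^esub> x) = c \<odot>\<^bsub>L\<^esub> f x"
    if "x \<in> carrier H" "y \<in> carrier H" for x y c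
    using hom that by (auto simp: LinearCombinations.module_hom_def class_ring_simps)
  have f_in: "f x \<in> carrier L" if "x \<in> carrier H" for x using bij that by (auto simp: bij_betw_def)
  define g where "g = inv_into (carrier H) f"
  have g: "g y \<in> carrier H" "f (g y) = y" if "y \<in> carrier L" for y
    using bij that by (auto simp: g_def bij_betw_def inv_into_into f_inv_into_f)
  have gf: "g (f x) = x" if "x \<in> carrier H" for x
    using bij that by (auto simp: g_def bij_betw_def)
  interpret LB: k_algebra L using L by (simp add: hopf_algebra_def bialgebra_def)
  interpret LV: vectorspace class_ring L by (rule LB.vectorspace)
  have g_add: "g (x \<oplus>\<^bsub>L\<^esub> y) = g x \<oplus>\<^bsub>H\<^esub> g y" if "x \<in> carrier L" "y \<in> carrier L" for x y
    using gf[of "g x \<oplus>\<^bsub>H\<^esub> g y"] that by (simp add: g lin X.add_in)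
  have g_smult: "g (c \<odot>\<^bsub>L\<^esub> x) = c \<odot>\<^bsub>H\<^esub> g x" if "x \<in> carrier L" for x c
    using gf[of "c \<odot>\<^bsub>H\<^esub> g x"] that by (simp add: g lin(2)[of "g x" "g x"] X.smult_in)
  have smult_in: "c \<odot>\<^bsub>L\<^esub> x \<in> carrier L" if "x \<in> carrier L" for c x
    using that LV.smult_closed[of c x] by (simp add: class_ring_simps)
  have co: "coordinates L {..<n} (\<lambda>i. f (e i)) (\<lambda>x. \<kappa> (g x))"
  proof
    have "f \<zero>\<^bsub>H\<^esub> = \<zero>\<^bsub>L\<^esub>"
    proof -
      have z: "0 \<odot>\<^bsub>H\<^esub> \<zero>\<^bsub>H\<^esub> = \<zero>\<^bsub>H\<^esub>"
        by (rule X.coord_eqI) (auto simp: X.zero_in X.smult_in X.coord_smult X.coord_zero)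
      have "f (0 \<odot>\<^bsub>H\<^esub> \<zero>\<^bsub>H\<^esub>) = 0 \<odot>\<^bsub>L\<^esub> f \<zero>\<^bsub>H\<^esub>" by (rule lin(2)[OF X.zero_in X.zero_in])
      then show ?thesis using LV.smult_l_null[of "f \<zero>\<^bsub>H\<^esub>"] f_in[OF X.zero_in] by (simp add: z class_ring_simps)
    qed
    then have "g \<zero>\<^bsub>L\<^esub> = \<zero>\<^bsub>H\<^esub>" using gf[OF X.zero_in] by simp
    then show "\<kappa> (g \<zero>\<^bsub>L\<^esub>) i = 0" if "i \<in> {..<n}" for i using that by (simp add: X.coord_zero)
    show "x = y" if "x \<in> carrier L" "y \<in> carrier L" "\<And>i. i \<in> {..<n} \<Longrightarrow> \<kappa> (g x) i = \<kappa> (g y) i" for x y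
    proof -
      have "g x = g y" using that by (intro X.coord_eqI) (auto simp: g)
      then show ?thesis using that g(2) by metis
    qed
  qed (auto simp: f_in X.basis_in g g_add g_smult X.coord_add X.coord_smult X.coord_basis gf smult_in)
  have hc: "hopf_coordinates L n (\<lambda>i. f (e i)) (\<lambda>x. \<kappa> (g x))"
    by (rule hopf_coordinatesI[OF _ co]) (use L in \<open>simp add: hopf_algebra_def\<close>)
  interpret Y: hopf_coordinates L n "\<lambda>i. f (e i)" "\<lambda>x. \<kappa> (g x)" by (rule hc)
  show thesis
  proof (rule that[OF hc])
    fix i j k assume ijk: "i < n" "j < n" "k < n"
    show "Y.m i j k = X.m i j k"
      unfolding Y.m_def X.m_def using ijk mult[of "e i" "e j"] gf[of "e i \<otimes>\<^bsub>H\<^esub> e j"]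
      by (simp add: X.basis_in X.mult_in)
    have ek: "e k \<in> carrier H" using ijk by (simp add: X.basis_in)
    show "Y.d k i j = X.d k i j"
      unfolding Y.d_def X.d_def comult[OF ek]
      by (rule tensor_map_coord(2)[OF H hc hom refl X.comult_in[OF ek] ijk(1,2)])
  qed
qed

section \<open>Constructing a Hopf algebra from structure constants\<close>

locale hopf_construction = hopf_constants n m d \<eta> \<epsilon> s
  for n and m d :: "nat \<Rightarrow> nat \<Rightarrow> nat \<Rightarrow> 'k::field" and \<eta> \<epsilon> s +
  fixes \<iota> :: "'k vec \<Rightarrow> 'h"
  assumes pos: "n > 0" and inj: "inj_on \<iota> (carrier_vec n)"
begin

definition pt :: "(nat \<Rightarrow> 'k) \<Rightarrow> 'h" where "pt c = \<iota> (vec n c)"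
definition crd :: "'h \<Rightarrow> nat \<Rightarrow> 'k" where "crd h i = the_inv_into (carrier_vec n) \<iota> h $ i"
definition unit_pt :: "nat \<Rightarrow> 'h" where "unit_pt i = pt (\<lambda>j. if i = j then 1 else 0)"

text \<open>
The comultiplication takes values in the tensor square, whose definition needs the algebra structure as a
record; hence the algebra is defined on its own before the Hopf algebra.
\<close>

definition algebra_part :: "('k, 'h) module" where
  "algebra_part = \<lparr>carrier = \<iota> ` carrier_vec n,
     mult = \<lambda>x y. pt (\<lambda>k. \<Sum>i<n. \<Sum>j<n. crd x i * crd y j * m i j k),
     one = pt \<eta>, zero = pt (\<lambda>_. 0), add = \<lambda>x y. pt (\<lambda>k. crd x k + crd y k),
     smult = \<lambda>c x. pt (\<lambda>k. c * crd x k)\<rparr>"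

definition constructed :: "('k, 'h) hopf" where
  "constructed = \<lparr>carrier = \<iota> ` carrier_vec n,
     mult = \<lambda>x y. pt (\<lambda>k. \<Sum>i<n. \<Sum>j<n. crd x i * crd y j * m i j k),
     one = pt \<eta>, zero = pt (\<lambda>_. 0), add = \<lambda>x y. pt (\<lambda>k. crd x k + crd y k),
     smult = \<lambda>c x. pt (\<lambda>k. c * crd x k),
     comult = \<lambda>h. tensor_class algebra_part algebra_part
       (\<Sum>(i,j)\<in>{..<n}\<times>{..<n}. Poly_Mapping.single (unit_pt i, unit_pt j) (\<Sum>k<n. crd h k * d k i j)),
     counit = \<lambda>h. \<Sum>k<n. crd h k * \<epsilon> k\<rparr>"

lemma constructed_simps:
  "carrier constructed = \<iota> ` carrier_vec n" "mult constructed = mult algebra_part"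
  "one constructed = pt \<eta>" "zero constructed = pt (\<lambda>_. 0)"
  "add constructed = add algebra_part"
  "smult constructed = smult algebra_part"
  "counit constructed h = (\<Sum>k<n. crd h k * \<epsilon> k)"
  by (simp_all add: constructed_def algebra_part_def)

lemma tensor_class_constructed:
  "tensor_class algebra_part algebra_part = tensor_class constructed constructed"
proof -
  have "tensor_relators algebra_part algebra_part = tensor_relators constructed constructed"
    unfolding tensor_relators_def constructed_simps by (simp add: algebra_part_def)
  then show ?thesis by (simp add: tensor_class_def[abs_def])
qed

lemma pt_in: "pt c \<in> carrier constructed"
  by (simp add: pt_def constructed_simps)

lemma crd_pt: "i < n \<Longrightarrow> crd (pt c) i = c i"
  by (simp add: crd_def pt_def the_inv_into_f_f[OF inj])

lemma crd_eqI:
  assumes "x \<in> carrier constructed" "y \<in> carrier constructed" "\<And>i. i < n \<Longrightarrow> crd x i = crd y i"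
  shows "x = y"
proof -
  obtain v w where v: "x = \<iota> v" "v \<in> carrier_vec n" and w: "y = \<iota> w" "w \<in> carrier_vec n"
    using assms by (auto simp: constructed_simps)
  have "v $ i = w $ i" if "i < n" for i
    using assms(3)[OF that] v w by (simp add: crd_def the_inv_into_f_f[OF inj])
  then have "v = w" using v w by (intro eq_vecI) auto
  then show ?thesis by (simp add: v w)
qed

lemma coordinates_constructed: "coordinates constructed {..<n} unit_pt crd"
proof
  show "\<zero>\<^bsub>constructed\<^esub> \<in> carrier constructed" using pt_in by (simp add: constructed_simps(4))
qed (auto simp: pt_in crd_pt unit_pt_def constructed_def[THEN arg_cong[where f = add]]
    constructed_def[THEN arg_cong[where f = smult]] constructed_simps(4) intro: crd_eqI)

interpretation C: two_coordinates constructed "{..<n}" unit_pt crd constructed "{..<n}" unit_pt crd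
  by (rule two_coordinates.intro) (rule coordinates_constructed)+

lemma comult_constructed:
  shows "comult constructed h \<in> carrier (tensor constructed constructed)"
    and "i < n \<Longrightarrow> j < n \<Longrightarrow> C.tcoord (comult constructed h) (i, j) = (\<Sum>k<n. crd h k * d k i j)"
proof -
  let ?p = "\<Sum>(i,j)\<in>{..<n}\<times>{..<n}. Poly_Mapping.single (unit_pt i, unit_pt j) (\<Sum>k<n. crd h k * d k i j)"
  have eq: "comult constructed h = tensor_class constructed constructed ?p"
    unfolding tensor_class_constructed[symmetric] by (simp add: constructed_def)
  have formal: "Poly_Mapping.keys ?p \<subseteq> carrier constructed \<times> carrier constructed"
  proof
    fix x assume "x \<in> Poly_Mapping.keys ?p"
    then have "(\<Sum>ij\<in>{..<n}\<times>{..<n}. Poly_Mapping.lookup (Poly_Mapping.single (unit_pt (fst ij), unit_pt (snd ij))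
        (\<Sum>k<n. crd h k * d k (fst ij) (snd ij))) x) \<noteq> 0"
      by (simp add: in_keys_iff lookup_sum case_prod_beta)
    then obtain ij where "Poly_Mapping.lookup (Poly_Mapping.single (unit_pt (fst ij), unit_pt (snd ij))
        (\<Sum>k<n. crd h k * d k (fst ij) (snd ij))) x \<noteq> 0"
      by (rule sum.not_neutral_contains_not_neutral)
    then have "x = (unit_pt (fst ij), unit_pt (snd ij))"
      by (auto simp: lookup_single when_def split: if_splits)
    then show "x \<in> carrier constructed \<times> carrier constructed" by (simp add: unit_pt_def pt_in)
  qed
  then show "comult constructed h \<in> carrier (tensor constructed constructed)"
    unfolding eq by (intro C.tensor_class_in) simp
  assume ij: "i < n" "j < n"
  have "C.tcoord (comult constructed h) (i, j) = extend_linearly (\<lambda>(a, b). crd a i * crd b j) ?p"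
    unfolding eq using formal ij by (intro C.tcoord_class) auto
  also have "\<dots> = (\<Sum>x\<in>{..<n}\<times>{..<n}. (\<Sum>k<n. crd h k * d k (fst x) (snd x)) * (if x = (i, j) then 1 else 0))"
    unfolding extend_linearly_sum case_prod_beta
    using ij by (intro sum.cong) (auto simp: unit_pt_def crd_pt split: if_splits)
  also have "\<dots> = (\<Sum>k<n. crd h k * d k i j)"
    using ij by (subst sum_single_delta) auto
  finally show "C.tcoord (comult constructed h) (i, j) = (\<Sum>k<n. crd h k * d k i j)" .
qed

lemma hopf_coordinates_constructed: "hopf_coordinates constructed n unit_pt crd"
proof (intro hopf_coordinates.intro hopf_coordinates_axioms.intro coordinates_constructed)
  have crd_mult: "crd (x \<otimes>\<^bsub>constructed\<^esub> y) k = (\<Sum>i<n. \<Sum>j<n. crd x i * crd y j * m i j k)" if "k < n" for x y k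
    using that by (simp add: constructed_def crd_pt)
  have mult_in: "x \<otimes>\<^bsub>constructed\<^esub> y \<in> carrier constructed" for x y
    using pt_in by (simp add: constructed_simps(2) algebra_part_def)
  show "bilinear_into constructed constructed constructed (mult constructed)"
    unfolding bilinear_into_def
    by (intro conjI ballI allI; (rule crd_eqI)?)
      (auto simp: mult_in crd_mult C.A.add_in C.A.smult_in C.A.coord_add C.A.coord_smult
        distrib_left distrib_right sum.distrib sum_distrib_left mult_ac)
  have "comult constructed (x \<oplus>\<^bsub>constructed\<^esub> y)
    = comult constructed x \<oplus>\<^bsub>C.T\<^esub> comult constructed y"
    if "x \<in> carrier constructed" "y \<in> carrier constructed" for x y
    by (rule C.T.coord_eqI) (use that in \<open>auto simp: comult_constructed C.T.add_in C.T.coord_add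
        C.A.coord_add distrib_right sum.distrib\<close>)
  moreover have "comult constructed (c \<odot>\<^bsub>constructed\<^esub> x) = c \<odot>\<^bsub>C.T\<^esub> comult constructed x"
    if "x \<in> carrier constructed" for c x
    by (rule C.T.coord_eqI) (use that in \<open>auto simp: comult_constructed C.T.smult_in C.T.coord_smult
        C.A.coord_smult sum_distrib_left mult.assoc\<close>)
  ultimately show "comult constructed
    \<in> LinearCombinations.module_hom class_ring constructed (tensor constructed constructed)"
    unfolding LinearCombinations.module_hom_def class_ring_simps by (simp add: comult_constructed)
  show "counit constructed \<in> LinearCombinations.module_hom class_ring constructed base_alg"
    unfolding LinearCombinations.module_hom_def class_ring_simps
    by (auto simp: constructed_simps(7) base_alg_def C.A.coord_add C.A.coord_smult distrib_right sum.distrib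
        sum_distrib_left mult.assoc)
qed

interpretation X: hopf_coordinates constructed n unit_pt crd
  by (rule hopf_coordinates_constructed)

lemma constants_constructed:
  "i < n \<Longrightarrow> j < n \<Longrightarrow> k < n \<Longrightarrow> X.m i j k = m i j k"
  "i < n \<Longrightarrow> j < n \<Longrightarrow> k < n \<Longrightarrow> X.d k i j = d k i j"
  "i < n \<Longrightarrow> X.\<eta> i = \<eta> i" "i < n \<Longrightarrow> X.\<epsilon> i = \<epsilon> i"
proof -
  have delta: "(\<Sum>k<n. crd (unit_pt i) k * g k) = g i" if "i < n" for i g
    using that X.linear_form_expand[of "\<lambda>h. crd h 0"] by (simp add: unit_pt_def crd_pt sum_single_delta)
  assume i: "i < n"
  show "X.\<eta> i = \<eta> i" using i by (simp add: X.\<eta>_def constructed_simps(3) crd_pt)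
  show "X.\<epsilon> i = \<epsilon> i" using i by (simp add: X.\<epsilon>_def constructed_simps(7) delta)
  assume j: "j < n" and k: "k < n"
  have "X.m i j k = (\<Sum>i'<n. crd (unit_pt i) i' * (\<Sum>j'<n. crd (unit_pt j) j' * m i' j' k))"
    using k unfolding X.m_def
    by (simp add: constructed_simps(2) algebra_part_def crd_pt sum_distrib_left mult.assoc)
  then show "X.m i j k = m i j k" using i j by (simp add: delta)
  show "X.d k i j = d k i j" using i j k by (simp add: X.d_def comult_constructed delta)
qed

lemma hopf_constants_cong: "hopf_constants n X.m X.d X.\<eta> X.\<epsilon> s"
  by unfold_locales
    (simp_all add: constants_constructed assoc unit_left unit_right coassoc counit_left counit_right
      comult_mult comult_one counit_mult counit_one antipode_left antipode_right)

lemma hopf_algebra_constructed: "hopf_algebra constructed"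
  by (rule X.constants_imp_hopf[OF pos _ hopf_constants_cong]) (simp add: constructed_simps(3) pt_in)

lemma exists_hopf:
  "\<exists>(H :: ('k, 'h) hopf) e \<kappa>. hopf_coordinates H n e \<kappa> \<and> hopf_algebra H \<and>
    (\<forall>i<n. \<forall>j<n. \<forall>k<n. hopf_coordinates.m H e \<kappa> i j k = m i j k \<and> hopf_coordinates.d H e \<kappa> k i j = d k i j)"
  using hopf_coordinates_constructed hopf_algebra_constructed constants_constructed(1,2)
  by (intro exI[of _ constructed] exI[of _ unit_pt] exI[of _ crd]) simp

end

section \<open>The tensor powers of the matrix algebra\<close>

definition mat_unit :: "nat \<Rightarrow> nat \<times> nat \<Rightarrow> 'k::field mat" where
  "mat_unit n x = mat n n (\<lambda>ij. if ij = x then 1 else 0)"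

lemma coordinates_mat:
  "coordinates (mat_alg n :: ('k::field, 'k mat) module) ({..<n} \<times> {..<n}) (mat_unit n) (\<lambda>A x. A $$ x)"
proof
  fix x y :: "'k mat"
  assume "x \<in> carrier (mat_alg n)" "y \<in> carrier (mat_alg n)" "\<And>i. i \<in> {..<n} \<times> {..<n} \<Longrightarrow> x $$ i = y $$ i"
  then show "x = y" by (intro eq_matI) (auto simp: module_mat_simps)
qed (auto simp: module_mat_simps mat_unit_def split: if_splits)

text \<open>
The type argument \<open>K\<close> fixes the ground field of the abbreviations.
\<close>

locale matrix_algebra = matrix_size n for n +
  fixes K :: "'k::field itself"
  assumes pos: "n > 0"
begin

abbreviation M :: "('k, 'k mat) module" where "M \<equiv> mat_alg n"
abbreviation MM :: "('k, ('k mat, 'k mat, 'k) tens) module" where "MM \<equiv> tensor M M"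
abbreviation MMM :: "('k, (('k mat, 'k mat, 'k) tens, 'k mat, 'k) tens) module" where "MMM \<equiv> tensor MM M"

sublocale MC: coordinates M "{..<n} \<times> {..<n}" "mat_unit n" "\<lambda>A x. A $$ x"
  by (rule coordinates_mat)
sublocale M2: two_coordinates M "{..<n} \<times> {..<n}" "mat_unit n" "\<lambda>A x. A $$ x"
    M "{..<n} \<times> {..<n}" "mat_unit n" "\<lambda>A x. A $$ x" ..
sublocale M3: two_coordinates MM "({..<n} \<times> {..<n}) \<times> ({..<n} \<times> {..<n})" M2.tbasis M2.tcoord
    M "{..<n} \<times> {..<n}" "mat_unit n" "\<lambda>A x. A $$ x" ..

lemma mat_mult_bilinear: "bilinear_into M M M (mult M)"
  by (auto simp: bilinear_into_def module_mat_simps add_mult_distrib_mat mult_add_distrib_mat)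

lemmas MM_mult_bilinear = M2.tensor_mult_bilinear[OF mat_mult_bilinear mat_mult_bilinear]
lemmas MMM_mult_bilinear = M3.tensor_mult_bilinear[OF MM_mult_bilinear mat_mult_bilinear]

text \<open>
A coordinate of a tensor of matrices lists row and column leg by leg, \<open>((p, q), (r, s))\<close>; the operator has the
row index \<open>(p, r)\<close> and the column index \<open>(q, s)\<close>. With this regrouping, the product of tensors becomes the
product of operators.
\<close>

definition op1 :: "'k mat \<Rightarrow> (nat, 'k) fmat" where
  "op1 A = (\<lambda>p q. if p < n \<and> q < n then A $$ (p, q) else 0)"
definition op2 :: "('k mat, 'k mat, 'k) tens \<Rightarrow> (nat \<times> nat, 'k) fmat" where
  "op2 S = (\<lambda>x y. if x \<in> {..<n} \<times> {..<n} \<and> y \<in> {..<n} \<times> {..<n}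
     then M2.tcoord S ((fst x, fst y), (snd x, snd y)) else 0)"
definition op3 :: "(('k mat, 'k mat, 'k) tens, 'k mat, 'k) tens \<Rightarrow> ((nat \<times> nat) \<times> nat, 'k) fmat" where
  "op3 Z = (\<lambda>x y. if x \<in> ({..<n} \<times> {..<n}) \<times> {..<n} \<and> y \<in> ({..<n} \<times> {..<n}) \<times> {..<n}
     then M3.tcoord Z (((fst (fst x), fst (fst y)), (snd (fst x), snd (fst y))), (snd x, snd y)) else 0)"

lemma supp_op [simp]: "supp1 (op1 A)" "supp2 (op2 S)" "supp3 (op3 Z)"
  by (simp_all add: supported_def op1_def op2_def op3_def)

lemma op2_eqI: "S \<in> carrier MM \<Longrightarrow> T \<in> carrier MM \<Longrightarrow> op2 S = op2 T \<Longrightarrow> S = T"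
proof (rule M2.T.coord_eqI)
  fix i assume eq: "op2 S = op2 T" and "i \<in> ({..<n} \<times> {..<n}) \<times> ({..<n} \<times> {..<n})"
  then obtain p q r s where i: "i = ((p, q), (r, s))" "p < n" "q < n" "r < n" "s < n" by auto
  then show "M2.tcoord S i = M2.tcoord T i"
    using fun_cong[OF fun_cong[OF eq], of "(p, r)" "(q, s)"] by (simp add: op2_def)
qed

lemma op3_eqI: "S \<in> carrier MMM \<Longrightarrow> T \<in> carrier MMM \<Longrightarrow> op3 S = op3 T \<Longrightarrow> S = T"
proof (rule M3.T.coord_eqI)
  fix i assume eq: "op3 S = op3 T" and "i \<in> (({..<n} \<times> {..<n}) \<times> ({..<n} \<times> {..<n})) \<times> ({..<n} \<times> {..<n})"
  then obtain p q r s t w where i: "i = (((p, q), (r, s)), (t, w))" "p < n" "q < n" "r < n" "s < n" "t < n" "w < n"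
    by auto
  then show "M3.tcoord S i = M3.tcoord T i"
    using fun_cong[OF fun_cong[OF eq], of "((p, r), t)" "((q, s), w)"] by (simp add: op3_def)
qed

lemma op2_surj:
  assumes "supp2 X"
  shows "\<exists>S\<in>carrier MM. op2 S = X"
proof -
  obtain S where S: "S \<in> carrier MM"
    and c: "\<forall>i\<in>({..<n} \<times> {..<n}) \<times> ({..<n} \<times> {..<n}). M2.tcoord S i
      = X (fst (fst i), fst (snd i)) (snd (fst i), snd (snd i))"
    using M2.T.exists_coords[of "\<lambda>i. X (fst (fst i), fst (snd i)) (snd (fst i), snd (snd i))"] by blast
  have "op2 S = X"
  proof (intro ext)
    fix x y
    show "op2 S x y = X x y"
    proof (cases "x \<in> {..<n} \<times> {..<n} \<and> y \<in> {..<n} \<times> {..<n}")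
      case True
      then have "((fst x, fst y), (snd x, snd y)) \<in> ({..<n} \<times> {..<n}) \<times> ({..<n} \<times> {..<n})" by auto
      from bspec[OF c this] show ?thesis using True by (simp add: op2_def)
    next
      case False
      then have "X x y = 0" using assms unfolding supported_def by blast
      moreover have "op2 S x y = 0" unfolding op2_def using False by (rule if_not_P)
      ultimately show ?thesis by simp
    qed
  qed
  then show ?thesis using S by blast
qed

definition to_mat :: "(nat, 'k) fmat \<Rightarrow> 'k mat" where "to_mat A = mat n n (\<lambda>(p, q). A p q)"

lemma op1_to_mat: "supp1 A \<Longrightarrow> op1 (to_mat A) = A"
  by (intro ext) (auto simp: op1_def to_mat_def supported_def)

lemma to_mat_in: "to_mat A \<in> carrier M"
  by (simp add: to_mat_def module_mat_simps)

lemma op1_eqI: "A \<in> carrier M \<Longrightarrow> B \<in> carrier M \<Longrightarrow> op1 A = op1 B \<Longrightarrow> A = B"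
proof (rule MC.coord_eqI)
  fix i assume eq: "op1 A = op1 B" and "i \<in> {..<n} \<times> {..<n}"
  then obtain p q where i: "i = (p, q)" "p < n" "q < n" by auto
  then show "A $$ i = B $$ i" using fun_cong[OF fun_cong[OF eq], of p q] by (simp add: op1_def)
qed

lemma op1_mult: "A \<in> carrier M \<Longrightarrow> B \<in> carrier M \<Longrightarrow> op1 (A \<otimes>\<^bsub>M\<^esub> B) = op1 A *\<^sub>1 op1 B"
  by (intro ext) (auto simp: op1_def mm_def module_mat_simps scalar_prod_def atLeast0LessThan)

lemma op1_one: "op1 \<one>\<^bsub>M\<^esub> = 1\<^sub>1"
  by (intro ext) (auto simp: op1_def idm_def module_mat_simps)

lemma op2_pure: "A \<in> carrier M \<Longrightarrow> B \<in> carrier M \<Longrightarrow> op2 (pure_tensor M M A B) = kron (op1 A) (op1 B)"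
  by (intro ext) (auto simp: op2_def op1_def kron_def M2.tcoord_pure)

lemma op3_pure: "S \<in> carrier MM \<Longrightarrow> B \<in> carrier M \<Longrightarrow> op3 (pure_tensor MM M S B) = kron (op2 S) (op1 B)"
  by (intro ext) (auto simp: op3_def op2_def op1_def kron_def M3.tcoord_pure)

lemma op2_add: "S \<in> carrier MM \<Longrightarrow> T \<in> carrier MM \<Longrightarrow> op2 (S \<oplus>\<^bsub>MM\<^esub> T) = op2 S + op2 T"
  by (intro ext) (auto simp: op2_def M2.T.coord_add)

lemma op3_add: "S \<in> carrier MMM \<Longrightarrow> T \<in> carrier MMM \<Longrightarrow> op3 (S \<oplus>\<^bsub>MMM\<^esub> T) = op3 S + op3 T"
  by (intro ext) (auto simp: op3_def M3.T.coord_add)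

lemma MM_mult_in: "S \<in> carrier MM \<Longrightarrow> T \<in> carrier MM \<Longrightarrow> S \<otimes>\<^bsub>MM\<^esub> T \<in> carrier MM"
  using MM_mult_bilinear by (auto simp: bilinear_into_def)

lemma MMM_mult_in: "S \<in> carrier MMM \<Longrightarrow> T \<in> carrier MMM \<Longrightarrow> S \<otimes>\<^bsub>MMM\<^esub> T \<in> carrier MMM"
  using MMM_mult_bilinear by (auto simp: bilinear_into_def)

lemma M_mult_in: "A \<in> carrier M \<Longrightarrow> B \<in> carrier M \<Longrightarrow> A \<otimes>\<^bsub>M\<^esub> B \<in> carrier M"
  using mat_mult_bilinear by (auto simp: bilinear_into_def)

lemma one_in: "\<one>\<^bsub>M\<^esub> \<in> carrier M"
  by (simp add: module_mat_simps)

lemma MM_distrib: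
  assumes "S \<in> carrier MM" "U \<in> carrier MM" "V \<in> carrier MM"
  shows "(S \<oplus>\<^bsub>MM\<^esub> U) \<otimes>\<^bsub>MM\<^esub> V = S \<otimes>\<^bsub>MM\<^esub> V \<oplus>\<^bsub>MM\<^esub> U \<otimes>\<^bsub>MM\<^esub> V"
    "V \<otimes>\<^bsub>MM\<^esub> (S \<oplus>\<^bsub>MM\<^esub> U) = V \<otimes>\<^bsub>MM\<^esub> S \<oplus>\<^bsub>MM\<^esub> V \<otimes>\<^bsub>MM\<^esub> U"
  using assms MM_mult_bilinear by (auto simp: bilinear_into_def)

lemma MMM_distrib:
  assumes "S \<in> carrier MMM" "U \<in> carrier MMM" "V \<in> carrier MMM"
  shows "(S \<oplus>\<^bsub>MMM\<^esub> U) \<otimes>\<^bsub>MMM\<^esub> V = S \<otimes>\<^bsub>MMM\<^esub> V \<oplus>\<^bsub>MMM\<^esub> U \<otimes>\<^bsub>MMM\<^esub> V"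
    "V \<otimes>\<^bsub>MMM\<^esub> (S \<oplus>\<^bsub>MMM\<^esub> U) = V \<otimes>\<^bsub>MMM\<^esub> S \<oplus>\<^bsub>MMM\<^esub> V \<otimes>\<^bsub>MMM\<^esub> U"
  using assms MMM_mult_bilinear by (auto simp: bilinear_into_def)

lemma op2_mult:
  assumes S: "S \<in> carrier MM" and T: "T \<in> carrier MM"
  shows "op2 (S \<otimes>\<^bsub>MM\<^esub> T) = op2 S *\<^sub>2 op2 T"
  using S
proof (induction rule: M2.tensor_induct)
  case (pure a b)
  show ?case using T
  proof (induction rule: M2.tensor_induct)
    case (pure a' b')
    then show ?case using \<open>a \<in> carrier M\<close> \<open>b \<in> carrier M\<close>
      by (simp add: M2.tensor_mult_pure[OF mat_mult_bilinear mat_mult_bilinear] op2_pure M_mult_in op1_mult mul_kron)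
  next
    case (add S U)
    have "pure_tensor M M a b \<in> carrier MM" using pure by (rule M2.pure_in)
    then show ?case using add
      by (simp only: MM_distrib op2_add MM_mult_in mm_add)
  qed
next
  case (add S U)
  then show ?case using T
    by (simp only: MM_distrib op2_add MM_mult_in mm_add)
qed

lemma op3_mult:
  assumes S: "S \<in> carrier MMM" and T: "T \<in> carrier MMM"
  shows "op3 (S \<otimes>\<^bsub>MMM\<^esub> T) = op3 S *\<^sub>3 op3 T"
  using S
proof (induction rule: M3.tensor_induct)
  case (pure a b)
  show ?case using T
  proof (induction rule: M3.tensor_induct)
    case (pure a' b')
    then show ?case using \<open>a \<in> carrier MM\<close> \<open>b \<in> carrier M\<close>
      by (simp add: M3.tensor_mult_pure[OF MM_mult_bilinear mat_mult_bilinear] op3_pure M_mult_in MM_mult_in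
          op1_mult op2_mult mul_kron)
  next
    case (add S U)
    have "pure_tensor MM M a b \<in> carrier MMM" using pure by (rule M3.pure_in)
    then show ?case using add
      by (simp only: MMM_distrib op3_add MMM_mult_in mm_add)
  qed
next
  case (add S U)
  then show ?case using T
    by (simp only: MMM_distrib op3_add MMM_mult_in mm_add)
qed

lemma op2_one: "op2 \<one>\<^bsub>MM\<^esub> = 1\<^sub>2"
  by (simp add: M2.one_tensor op2_pure one_in op1_one kron_idm)

lemma MM_one_in: "\<one>\<^bsub>MM\<^esub> \<in> carrier MM"
  by (simp add: M2.one_tensor M2.pure_in one_in)

lemma leg_bilinear:
  "bilinear_into M M MMM (\<lambda>x y. pure_tensor3 M M M x y \<one>\<^bsub>M\<^esub>)"
  "bilinear_into M M MMM (\<lambda>x y. pure_tensor3 M M M x \<one>\<^bsub>M\<^esub> y)"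
  "bilinear_into M M MMM (\<lambda>x y. pure_tensor3 M M M \<one>\<^bsub>M\<^esub> x y)"
  unfolding bilinear_into_def pure_tensor3_def
  by (intro conjI ballI allI,
      simp_all only: bilinear_intoD[OF M2.pure_bilinear] bilinear_intoD[OF M3.pure_bilinear] one_in)+

lemma legs_in:
  assumes "R \<in> carrier MM"
  shows "leg12 M R \<in> carrier MMM" "leg13 M R \<in> carrier MMM" "leg23 M R \<in> carrier MMM"
  unfolding leg12_def leg13_def leg23_def
  by (rule M2.tensor_lift_in_coord(1)[OF M3.coordinates_tensor leg_bilinear(1) assms]
      M2.tensor_lift_in_coord(1)[OF M3.coordinates_tensor leg_bilinear(2) assms]
      M2.tensor_lift_in_coord(1)[OF M3.coordinates_tensor leg_bilinear(3) assms])+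

lemma legs_pure:
  assumes "a \<in> carrier M" "b \<in> carrier M"
  shows "leg12 M (pure_tensor M M a b) = pure_tensor3 M M M a b \<one>\<^bsub>M\<^esub>"
    "leg13 M (pure_tensor M M a b) = pure_tensor3 M M M a \<one>\<^bsub>M\<^esub> b"
    "leg23 M (pure_tensor M M a b) = pure_tensor3 M M M \<one>\<^bsub>M\<^esub> a b"
  unfolding leg12_def leg13_def leg23_def
  by (rule M2.tensor_lift_pure[OF M3.coordinates_tensor leg_bilinear(1) assms]
      M2.tensor_lift_pure[OF M3.coordinates_tensor leg_bilinear(2) assms]
      M2.tensor_lift_pure[OF M3.coordinates_tensor leg_bilinear(3) assms])+

lemma legs_add:
  assumes "R \<in> carrier MM" "S \<in> carrier MM"
  shows "leg12 M (R \<oplus>\<^bsub>MM\<^esub> S) = leg12 M R \<oplus>\<^bsub>MMM\<^esub> leg12 M S"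
    "leg13 M (R \<oplus>\<^bsub>MM\<^esub> S) = leg13 M R \<oplus>\<^bsub>MMM\<^esub> leg13 M S"
    "leg23 M (R \<oplus>\<^bsub>MM\<^esub> S) = leg23 M R \<oplus>\<^bsub>MMM\<^esub> leg23 M S"
  unfolding leg12_def leg13_def leg23_def
  by (rule M2.tensor_lift_linear(1)[OF M3.coordinates_tensor leg_bilinear(1) assms]
      M2.tensor_lift_linear(1)[OF M3.coordinates_tensor leg_bilinear(2) assms]
      M2.tensor_lift_linear(1)[OF M3.coordinates_tensor leg_bilinear(3) assms])+

lemma leg_mat_add: "L12 (X + Y) = L12 X + L12 Y" "L13 (X + Y) = L13 X + L13 Y" "L23 (X + Y) = L23 X + L23 Y"
  for X Y :: "(nat \<times> nat, 'k) fmat"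
  by (intro ext, simp add: leg12_mat_def leg13_mat_def leg23_mat_def kron_def algebra_simps)+

lemma op3_legs:
  assumes "R \<in> carrier MM"
  shows "op3 (leg12 M R) = L12 (op2 R)" "op3 (leg13 M R) = L13 (op2 R)" "op3 (leg23 M R) = L23 (op2 R)"
  using assms
proof (induction rule: M2.tensor_induct)
  case (pure a b)
  { case 1 show ?case using pure
      by (simp add: legs_pure pure_tensor3_def op3_pure op2_pure M2.pure_in one_in op1_one legs_kron) }
  { case 2 show ?case using pure
      by (simp add: legs_pure pure_tensor3_def op3_pure op2_pure M2.pure_in one_in op1_one legs_kron) }
  { case 3 show ?case using pure
      by (simp add: legs_pure pure_tensor3_def op3_pure op2_pure M2.pure_in one_in op1_one legs_kron) }
next
  case (add S U)
  { case 1 show ?case using add by (simp only: legs_add op3_add op2_add legs_in leg_mat_add) }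
  { case 2 show ?case using add by (simp only: legs_add op3_add op2_add legs_in leg_mat_add) }
  { case 3 show ?case using add by (simp only: legs_add op3_add op2_add legs_in leg_mat_add) }
qed

lemma pentagon_iff:
  assumes "R \<in> carrier MM"
  shows "pentagon M R \<longleftrightarrow> pentagon_mat n (op2 R)"
proof -
  note L = legs_in[OF assms]
  have "pentagon M R \<longleftrightarrow> op3 (leg12 M R \<otimes>\<^bsub>MMM\<^esub> leg13 M R \<otimes>\<^bsub>MMM\<^esub> leg23 M R) = op3 (leg23 M R \<otimes>\<^bsub>MMM\<^esub> leg12 M R)"
    unfolding pentagon_def using op3_eqI L by (auto intro!: MMM_mult_in)
  also have "\<dots> \<longleftrightarrow> pentagon_mat n (op2 R)"
    using L assms by (simp add: op3_mult MMM_mult_in op3_legs pentagon_mat_def Let_def)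
  finally show ?thesis .
qed

lemma MM_monoid: "Group.monoid MM"
proof (rule monoidI)
  fix x y z assume "x \<in> carrier MM" "y \<in> carrier MM" "z \<in> carrier MM"
  then show "x \<otimes>\<^bsub>MM\<^esub> y \<otimes>\<^bsub>MM\<^esub> z = x \<otimes>\<^bsub>MM\<^esub> (y \<otimes>\<^bsub>MM\<^esub> z)"
    by (intro op2_eqI MM_mult_in) (simp_all add: op2_mult MM_mult_in mm_assoc)
next
  fix x assume "x \<in> carrier MM"
  then show "\<one>\<^bsub>MM\<^esub> \<otimes>\<^bsub>MM\<^esub> x = x" "x \<otimes>\<^bsub>MM\<^esub> \<one>\<^bsub>MM\<^esub> = x"
    by (intro op2_eqI MM_mult_in MM_one_in; simp add: op2_mult op2_one MM_one_in)+
qed (simp_all add: MM_mult_in MM_one_in)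

lemma M_monoid: "Group.monoid M"
proof (rule monoidI)
  fix x y z assume "x \<in> carrier M" "y \<in> carrier M" "z \<in> carrier M"
  then show "x \<otimes>\<^bsub>M\<^esub> y \<otimes>\<^bsub>M\<^esub> z = x \<otimes>\<^bsub>M\<^esub> (y \<otimes>\<^bsub>M\<^esub> z)"
    by (intro op1_eqI M_mult_in) (simp_all add: op1_mult M_mult_in mm_assoc)
next
  fix x assume "x \<in> carrier M"
  then show "\<one>\<^bsub>M\<^esub> \<otimes>\<^bsub>M\<^esub> x = x" "x \<otimes>\<^bsub>M\<^esub> \<one>\<^bsub>M\<^esub> = x"
    by (intro op1_eqI M_mult_in one_in; simp add: op1_mult op1_one one_in)+
qed (simp_all add: M_mult_in one_in)

lemma Units_MM_iff:
  "R \<in> Units MM \<longleftrightarrow> R \<in> carrier MM \<and> (\<exists>X. supp2 X \<and> op2 R *\<^sub>2 X = 1\<^sub>2 \<and> X *\<^sub>2 op2 R = 1\<^sub>2)"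
proof
  assume "R \<in> Units MM"
  then obtain S where "R \<in> carrier MM" "S \<in> carrier MM" "S \<otimes>\<^bsub>MM\<^esub> R = \<one>\<^bsub>MM\<^esub>" "R \<otimes>\<^bsub>MM\<^esub> S = \<one>\<^bsub>MM\<^esub>"
    by (auto simp: Units_def)
  then show "R \<in> carrier MM \<and> (\<exists>X. supp2 X \<and> op2 R *\<^sub>2 X = 1\<^sub>2 \<and> X *\<^sub>2 op2 R = 1\<^sub>2)"
    by (intro conjI exI[of _ "op2 S"]) (simp_all add: op2_one flip: op2_mult)
next
  assume *: "R \<in> carrier MM \<and> (\<exists>X. supp2 X \<and> op2 R *\<^sub>2 X = 1\<^sub>2 \<and> X *\<^sub>2 op2 R = 1\<^sub>2)"
  then obtain X where X: "supp2 X" "op2 R *\<^sub>2 X = 1\<^sub>2" "X *\<^sub>2 op2 R = 1\<^sub>2" by blast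
  obtain S where S: "S \<in> carrier MM" "op2 S = X" using op2_surj[OF X(1)] by blast
  have "S \<otimes>\<^bsub>MM\<^esub> R = \<one>\<^bsub>MM\<^esub>" "R \<otimes>\<^bsub>MM\<^esub> S = \<one>\<^bsub>MM\<^esub>"
    by (rule op2_eqI; use * S X in \<open>simp add: MM_mult_in MM_one_in op2_mult op2_one\<close>)+
  then show "R \<in> Units MM" using * S by (auto simp: Units_def)
qed

lemma op2_finsum:
  assumes "finite F" "\<And>i. i \<in> F \<Longrightarrow> a i \<in> carrier M" "\<And>i. i \<in> F \<Longrightarrow> b i \<in> carrier M"
  shows "op2 (\<Oplus>\<^bsub>MM\<^esub>i\<in>F. pure_tensor M M (a i) (b i)) = (\<Sum>i\<in>F. kron (op1 (a i)) (op1 (b i)))"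
proof -
  interpret abelian_group MM by (rule M2.T.abelian_group)
  have zero: "op2 \<zero>\<^bsub>MM\<^esub> = 0"
    by (intro ext) (auto simp: op2_def M2.T.coord_zero)
  show ?thesis using assms
  proof (induction F rule: finite_induct)
    case (insert i F)
    then have "(\<lambda>i. pure_tensor M M (a i) (b i)) \<in> F \<rightarrow> carrier MM" "pure_tensor M M (a i) (b i) \<in> carrier MM"
      by (auto intro!: M2.pure_in)
    then show ?case using insert by (simp add: op2_add op2_pure finsum_closed)
  qed (simp add: zero)
qed

lemma length_iff:
  fixes l :: nat
  assumes R: "R \<in> carrier MM"
  shows "(\<exists>a b. (\<forall>i<l. a i \<in> carrier M \<and> b i \<in> carrier M) \<and>
      R = (\<Oplus>\<^bsub>MM\<^esub>i\<in>{..<l}. pure_tensor M M (a i) (b i)))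
    \<longleftrightarrow> (\<exists>c e. (\<forall>i<l. supp1 (c i) \<and> supp1 (e i)) \<and> op2 R = (\<Sum>i<l. kron (c i) (e i)))"
    (is "?A \<longleftrightarrow> ?B")
proof
  assume ?A
  then obtain a b where ab: "\<forall>i<l. a i \<in> carrier M \<and> b i \<in> carrier M"
    and "R = (\<Oplus>\<^bsub>MM\<^esub>i\<in>{..<l}. pure_tensor M M (a i) (b i))" by blast
  then have "op2 R = (\<Sum>i<l. kron (op1 (a i)) (op1 (b i)))"
    using op2_finsum[of "{..<l}" a b] by auto
  then show ?B
    by - (rule exI[of _ "\<lambda>i. op1 (a i)"], rule exI[of _ "\<lambda>i. op1 (b i)"], simp)
next
  assume ?B
  then obtain c e where ce: "\<forall>i<l. supp1 (c i) \<and> supp1 (e i)" "op2 R = (\<Sum>i<l. kron (c i) (e i))" by blast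
  have "(\<Sum>i<l. kron (c i) (e i)) = (\<Sum>i<l. kron (op1 (to_mat (c i))) (op1 (to_mat (e i))))"
    by (rule sum.cong) (use ce(1) in \<open>auto simp: op1_to_mat\<close>)
  then have "op2 R = op2 (\<Oplus>\<^bsub>MM\<^esub>i\<in>{..<l}. pure_tensor M M (to_mat (c i)) (to_mat (e i)))"
    unfolding ce(2) by (subst op2_finsum) (simp_all add: to_mat_in)
  then have "R = (\<Oplus>\<^bsub>MM\<^esub>i\<in>{..<l}. pure_tensor M M (to_mat (c i)) (to_mat (e i)))"
    by (rule op2_eqI[OF R M2.T.finsum_in[OF M2.pure_in[OF to_mat_in to_mat_in]]])
  then show ?A
    by - (rule exI[of _ "\<lambda>i. to_mat (c i)"], rule exI[of _ "\<lambda>i. to_mat (e i)"], simp add: to_mat_in)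
qed

lemma some_length: "R \<in> carrier MM \<Longrightarrow> \<exists>l c e. (\<forall>i<(l::nat). supp1 (c i) \<and> supp1 (e i)) \<and> op2 R = (\<Sum>i<l. kron (c i) (e i))"
proof (induction rule: M2.tensor_induct)
  case (pure a b)
  then show ?case
    by - (rule exI[of _ 1], rule exI[of _ "\<lambda>_. op1 a"], rule exI[of _ "\<lambda>_. op1 b"], simp add: op2_pure)
next
  case (add S U)
  obtain l c e where 1: "\<forall>i<(l::nat). supp1 (c i) \<and> supp1 (e i)" "op2 S = (\<Sum>i<l. kron (c i) (e i))"
    using add.IH(1) by blast
  obtain l' c' e' where 2: "\<forall>i<(l'::nat). supp1 (c' i) \<and> supp1 (e' i)" "op2 U = (\<Sum>i<l'. kron (c' i) (e' i))"
    using add.IH(2) by blast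
  have "(\<Sum>i<l + l'. kron (if i < l then c i else c' (i - l)) (if i < l then e i else e' (i - l)))
    = (\<Sum>i<l. kron (c i) (e i)) + (\<Sum>i<l'. kron (c' i) (e' i))"
  proof (induction l')
    case 0
    have "(\<Sum>i<l. kron (if i < l then c i else c' (i - l)) (if i < l then e i else e' (i - l)))
      = (\<Sum>i<l. kron (c i) (e i))"
      by (rule sum.cong) auto
    then show ?case by simp
  next
    case (Suc l') then show ?case by (simp add: add.assoc)
  qed
  then show ?case using 1 2 add
    by - (rule exI[of _ "l + l'"], rule exI[of _ "\<lambda>i. if i < l then c i else c' (i - l)"],
        rule exI[of _ "\<lambda>i. if i < l then e i else e' (i - l)"], auto simp: op2_add)
qed

text \<open>
In an expression of minimal length \<open>n\<close> the legs are independent, so the multiplication rules exist. Conversely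
the independent legs of a realization cannot be replaced by fewer.
\<close>

lemma Pent_iff: "R \<in> Pent n \<longleftrightarrow> R \<in> carrier MM \<and> (\<exists>m d. realizes n (op2 R) m d)"
proof
  assume "R \<in> Pent n"
  then have U: "R \<in> Units MM" and pent: "pentagon M R" and len: "tensor_length M R = n"
    by (auto simp: Pent_def)
  have R: "R \<in> carrier MM" using U by (simp add: Units_def)
  obtain X where X: "supp2 X" "op2 R *\<^sub>2 X = 1\<^sub>2" "X *\<^sub>2 op2 R = 1\<^sub>2" using U Units_MM_iff by blast
  interpret P: pentagon_solution n "op2 R" X
    by unfold_locales (use pos X pent in \<open>simp_all add: pentagon_iff[OF R]\<close>)
  define Q where "Q l \<longleftrightarrow> (\<exists>c e. (\<forall>i<(l::nat). supp1 (c i) \<and> supp1 (e i)) \<and> op2 R = (\<Sum>i<l. kron (c i) (e i)))" for l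
  have len': "(LEAST l. Q l) = n"
    using len unfolding tensor_length_def Q_def length_iff[OF R] .
  have "\<exists>l. Q l" using some_length[OF R] by (simp add: Q_def)
  then have "Q n" using len' LeastI_ex by metis
  then obtain c e where supp: "\<And>i. i < n \<Longrightarrow> supp1 (c i)" "\<And>i. i < n \<Longrightarrow> supp1 (e i)"
    and sum: "op2 R = (\<Sum>i<n. kron (c i) (e i))" by (auto simp: Q_def)
  have min: "n \<le> card F"
    if F: "finite F" and s: "\<And>i. i \<in> F \<Longrightarrow> supp1 (c' i)" "\<And>i. i \<in> F \<Longrightarrow> supp1 (e' i)"
      and eq: "(\<Sum>i<n. kron (c i) (e i)) = (\<Sum>i\<in>F. kron (c' i) (e' i))"
    for F :: "nat set" and c' e' :: "nat \<Rightarrow> (nat, 'k) fmat"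
  proof -
    obtain h where h: "bij_betw h {..<card F} F"
      using ex_bij_betw_nat_finite[OF F] by (auto simp: atLeast0LessThan)
    have "op2 R = (\<Sum>i<card F. kron (c' (h i)) (e' (h i)))"
      unfolding sum eq by (rule sum.reindex_bij_betw[OF h, symmetric])
    moreover have "\<forall>i<card F. supp1 (c' (h i)) \<and> supp1 (e' (h i))"
      using s h by (auto simp: bij_betw_def)
    ultimately have "Q (card F)" unfolding Q_def by (intro exI conjI)
    then have "(LEAST l. Q l) \<le> card F" by (rule Least_le)
    then show ?thesis by (simp add: len')
  qed
  have "indep n c" "indep n e"
    by (rule minimal_length_indep[OF supp min]; assumption)+
  then show "R \<in> carrier MM \<and> (\<exists>m d. realizes n (op2 R) m d)"
    using R P.realizes_exists[OF sum supp] by blast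
next
  assume *: "R \<in> carrier MM \<and> (\<exists>m d. realizes n (op2 R) m d)"
  then have R: "R \<in> carrier MM" by simp
  from * obtain m d X a b where "pentagon_realization n (op2 R) X a b m d"
    unfolding realizes_def by blast
  then interpret P: pentagon_realization n "op2 R" X a b m d .
  have "(LEAST l :: nat. \<exists>c e. (\<forall>i<l. supp1 (c i) \<and> supp1 (e i)) \<and> op2 R = (\<Sum>i<l. kron (c i) (e i))) = n"
  proof (rule Least_equality)
    show "\<exists>c e. (\<forall>i<n. supp1 (c i) \<and> supp1 (e i)) \<and> op2 R = (\<Sum>i<n. kron (c i) (e i))"
      using P.R_sum by - (rule exI[of _ a], rule exI[of _ b], simp)
    fix l :: nat assume "\<exists>c e. (\<forall>i<l. supp1 (c i) \<and> supp1 (e i)) \<and> op2 R = (\<Sum>i<l. kron (c i) (e i))"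
    then obtain c e where "op2 R = (\<Sum>i<l. kron (c i) (e i))" by blast
    then have "(\<Sum>i<n. kron (a i) (b i)) = (\<Sum>i<l. kron (c i) (e i))"
      using P.R_sum by simp
    from indep_length_bound[OF P.indep_a P.indep_b finite_lessThan this] show "n \<le> l" by simp
  qed
  then have "tensor_length M R = n" unfolding tensor_length_def length_iff[OF R] .
  moreover have "R \<in> Units MM"
    using R Units_MM_iff P.supp_R' P.R_R' P.R'_R by blast
  ultimately show "R \<in> Pent n"
    using P.pentagon by (simp add: Pent_def pentagon_iff[OF R])
qed

section \<open>The conjugation action\<close>

definition conj_tensor :: "'k mat \<Rightarrow> ('k mat, 'k mat, 'k) tens \<Rightarrow> ('k mat, 'k mat, 'k) tens" where
  "conj_tensor u R = pure_tensor M M u u \<otimes>\<^bsub>MM\<^esub> R \<otimes>\<^bsub>MM\<^esub> inv\<^bsub>MM\<^esub> (pure_tensor M M u u)"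

lemma conj_action_eq: "R \<in> Pent n \<Longrightarrow> conj_action n u R = conj_tensor u R"
  by (simp add: conj_action_def conj_tensor_def Let_def)

lemma GL_iff: "u \<in> carrier (GL n) \<longleftrightarrow> u \<in> carrier M \<and>
    (\<exists>v\<in>carrier M. op1 u *\<^sub>1 op1 v = 1\<^sub>1 \<and> op1 v *\<^sub>1 op1 u = 1\<^sub>1)"
proof -
  have "u \<otimes>\<^bsub>M\<^esub> v = \<one>\<^bsub>M\<^esub> \<longleftrightarrow> op1 u *\<^sub>1 op1 v = 1\<^sub>1" if "u \<in> carrier M" "v \<in> carrier M" for u v
    using op1_eqI[OF M_mult_in[OF that] one_in] op1_mult[OF that] op1_one by metis
  then show ?thesis unfolding units_of_def Units_def by auto
qed

lemma op2_conj:
  assumes u: "u \<in> carrier M" "v \<in> carrier M" and uv: "op1 u *\<^sub>1 op1 v = 1\<^sub>1" "op1 v *\<^sub>1 op1 u = 1\<^sub>1"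
    and R: "R \<in> carrier MM"
  shows "conj_tensor u R \<in> carrier MM"
    and "op2 (conj_tensor u R) = kron (op1 u) (op1 u) *\<^sub>2 op2 R *\<^sub>2 kron (op1 v) (op1 v)"
proof -
  let ?U = "pure_tensor M M u u" and ?V = "pure_tensor M M v v"
  have UV: "?U \<in> carrier MM" "?V \<in> carrier MM" using u by (auto intro: M2.pure_in)
  have "?U \<otimes>\<^bsub>MM\<^esub> ?V = \<one>\<^bsub>MM\<^esub>" "?V \<otimes>\<^bsub>MM\<^esub> ?U = \<one>\<^bsub>MM\<^esub>"
    by (intro op2_eqI MM_mult_in MM_one_in UV; simp add: op2_mult UV op2_pure u mul_kron uv op2_one kron_idm)+
  then have inv: "inv\<^bsub>MM\<^esub> ?U = ?V" using monoid.inv_char[OF MM_monoid UV] by simp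
  show "conj_tensor u R \<in> carrier MM"
    unfolding conj_tensor_def inv using UV R by (intro MM_mult_in)
  show "op2 (conj_tensor u R) = kron (op1 u) (op1 u) *\<^sub>2 op2 R *\<^sub>2 kron (op1 v) (op1 v)"
    unfolding conj_tensor_def inv using UV R u by (simp add: op2_mult MM_mult_in op2_pure)
qed

lemma conj_in_Pent:
  assumes "u \<in> carrier (GL n)" "R \<in> Pent n"
  shows "conj_tensor u R \<in> Pent n"
    and "realizes n (op2 R) m d \<Longrightarrow> realizes n (op2 (conj_tensor u R)) m d"
proof -
  obtain v where uv: "u \<in> carrier M" "v \<in> carrier M" "op1 u *\<^sub>1 op1 v = 1\<^sub>1" "op1 v *\<^sub>1 op1 u = 1\<^sub>1"
    using assms(1) GL_iff by blast
  have R: "R \<in> carrier MM" using assms(2) Pent_iff by blast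
  note C = op2_conj[OF uv R]
  have real: "realizes n (op2 (conj_tensor u R)) m d" if "realizes n (op2 R) m d" for m d
    unfolding C(2) by (rule realizes_conj_invariant[OF that]) (use uv in simp_all)
  then show "conj_tensor u R \<in> Pent n" using assms(2) C(1) by (auto simp: Pent_iff)
  show "realizes n (op2 R) m d \<Longrightarrow> realizes n (op2 (conj_tensor u R)) m d" by (rule real)
qed

lemma conj_mult:
  assumes "u \<in> carrier (GL n)" "u' \<in> carrier (GL n)" and R: "R \<in> carrier MM"
  shows "conj_tensor (u \<otimes>\<^bsub>M\<^esub> u') R = conj_tensor u (conj_tensor u' R)"
proof -
  obtain v where v: "u \<in> carrier M" "v \<in> carrier M" "op1 u *\<^sub>1 op1 v = 1\<^sub>1" "op1 v *\<^sub>1 op1 u = 1\<^sub>1"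
    using assms(1) GL_iff by blast
  obtain v' where v': "u' \<in> carrier M" "v' \<in> carrier M" "op1 u' *\<^sub>1 op1 v' = 1\<^sub>1" "op1 v' *\<^sub>1 op1 u' = 1\<^sub>1"
    using assms(2) GL_iff by blast
  have cancel: "op1 u' *\<^sub>1 (op1 v' *\<^sub>1 Z) = Z" "op1 v *\<^sub>1 (op1 u *\<^sub>1 Z) = Z" if "supp1 Z" for Z
    using that v v' by (simp_all flip: mm_assoc)
  have uu: "u \<otimes>\<^bsub>M\<^esub> u' \<in> carrier M" "v' \<otimes>\<^bsub>M\<^esub> v \<in> carrier M" using v v' by (auto intro: M_mult_in)
  have "op1 (u \<otimes>\<^bsub>M\<^esub> u') *\<^sub>1 op1 (v' \<otimes>\<^bsub>M\<^esub> v) = 1\<^sub>1" "op1 (v' \<otimes>\<^bsub>M\<^esub> v) *\<^sub>1 op1 (u \<otimes>\<^bsub>M\<^esub> u') = 1\<^sub>1"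
    using v v' by (simp_all add: op1_mult mm_assoc cancel)
  note C = op2_conj[OF uu this R]
  note C' = op2_conj[OF v' R]
  note C'' = op2_conj[OF v C'(1)]
  show ?thesis
    by (rule op2_eqI[OF C(1) C''(1)])
      (use v v' in \<open>simp add: C(2) C'(2) C''(2) op1_mult mm_assoc flip: mul_kron(1)\<close>)
qed

lemma conj_one:
  assumes R: "R \<in> carrier MM"
  shows "conj_tensor \<one>\<^bsub>M\<^esub> R = R"
proof -
  have "op1 \<one>\<^bsub>M\<^esub> *\<^sub>1 op1 \<one>\<^bsub>M\<^esub> = 1\<^sub>1" by (simp add: op1_one)
  note C = op2_conj[OF one_in one_in this this R]
  show ?thesis by (rule op2_eqI[OF C(1) R]) (simp add: C(2) op1_one kron_idm)
qed

lemma GL_group: "group (GL n :: 'k mat monoid)"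
  by (rule monoid.units_group[OF M_monoid])

lemma GL_simps: "mult (GL n) = mult M" "one (GL n) = \<one>\<^bsub>M\<^esub>"
  by (simp_all add: units_of_def)

lemma conj_group_action: "group_action (GL n) (Pent n :: ('k mat, 'k mat, 'k) tens set) (conj_action n)"
proof -
  interpret G: group "GL n :: 'k mat monoid" by (rule GL_group)
  have in_MM: "R \<in> carrier MM" if "R \<in> Pent n" for R using that Pent_iff by blast
  have inverse: "conj_tensor (inv\<^bsub>GL n\<^esub> u) (conj_tensor u R) = R" "conj_tensor u (conj_tensor (inv\<^bsub>GL n\<^esub> u) R) = R"
    if "u \<in> carrier (GL n)" "R \<in> Pent n" for u R
    using that conj_mult[OF G.inv_closed[OF that(1)] that(1) in_MM[OF that(2)]]
      conj_mult[OF that(1) G.inv_closed[OF that(1)] in_MM[OF that(2)]] conj_one[OF in_MM[OF that(2)]]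
      G.l_inv[OF that(1)] G.r_inv[OF that(1)]
    by (simp_all add: GL_simps)
  have bij: "conj_action n u \<in> Bij (Pent n)" if u: "u \<in> carrier (GL n)" for u :: "'k mat"
    unfolding Bij_def
  proof
    show "conj_action n u \<in> extensional (Pent n)" by (simp add: conj_action_def)
    have "bij_betw (conj_action n u) (Pent n) (Pent n)"
      by (rule bij_betw_byWitness[where f' = "conj_tensor (inv\<^bsub>GL n\<^esub> u)"])
        (use u in \<open>auto simp: conj_action_eq inverse conj_in_Pent\<close>)
    then show "conj_action n u \<in> {f. bij_betw f (Pent n) (Pent n)}" by simp
  qed
  have hom: "conj_action n (u \<otimes>\<^bsub>M\<^esub> v) = compose (Pent n) (conj_action n u) (conj_action n v)"
    if "u \<in> carrier (GL n)" "v \<in> carrier (GL n)" for u v :: "'k mat"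
  proof
    fix R :: "('k mat, 'k mat, 'k) tens"
    show "conj_action n (u \<otimes>\<^bsub>M\<^esub> v) R = compose (Pent n) (conj_action n u) (conj_action n v) R"
    proof (cases "R \<in> Pent n")
      case True
      then show ?thesis using that
        by (simp add: compose_def conj_action_eq conj_in_Pent conj_mult in_MM)
    qed (simp add: compose_def conj_action_def)
  qed
  show ?thesis
  proof (rule group_action.intro, rule group_hom.intro)
    show "group (BijGroup (Pent n :: ('k mat, 'k mat, 'k) tens set))" by (rule group_BijGroup)
    show "group_hom_axioms (GL n) (BijGroup (Pent n)) (conj_action n :: 'k mat \<Rightarrow> _)"
      by (rule group_hom_axioms.intro)
        (use bij hom in \<open>auto simp: hom_def BijGroup_def GL_simps\<close>)
  qed (rule GL_group)
qed

lemma orbit_eq: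
  assumes "R \<in> Pent n"
  shows "orbit (GL n) (conj_action n) R = {conj_tensor u R | u. u \<in> carrier (GL n)}"
  using assms by (simp add: orbit_def conj_action_eq)

text \<open>
The matrices that conjugate two realizations of the same constants form an element of the general linear
group.
\<close>

lemma same_constants_same_orbit:
  assumes R: "R \<in> Pent n" and S: "S \<in> Pent n"
    and "realizes n (op2 R) m d" "realizes n (op2 S) m d"
  shows "S \<in> orbit (GL n) (conj_action n) R"
proof -
  have in_MM: "R \<in> carrier MM" "S \<in> carrier MM" using R S Pent_iff by blast+
  obtain u v where uv: "supp1 u" "supp1 v" "u *\<^sub>1 v = 1\<^sub>1" "v *\<^sub>1 u = 1\<^sub>1"
    and eq: "op2 S = kron u u *\<^sub>2 op2 R *\<^sub>2 kron v v"
    using common_constants_conjugate[OF assms(3,4)] by blast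
  have m: "to_mat u \<in> carrier M" "to_mat v \<in> carrier M"
    "op1 (to_mat u) *\<^sub>1 op1 (to_mat v) = 1\<^sub>1" "op1 (to_mat v) *\<^sub>1 op1 (to_mat u) = 1\<^sub>1"
    using uv by (simp_all add: to_mat_in op1_to_mat)
  note C = op2_conj[OF m in_MM(1)]
  have "S = conj_tensor (to_mat u) R"
    by (rule op2_eqI[OF in_MM(2) C(1)]) (simp add: C(2) op1_to_mat uv eq)
  moreover have "to_mat u \<in> carrier (GL n)" using m GL_iff by blast
  ultimately show ?thesis unfolding orbit_eq[OF R] by blast
qed

end

section \<open>Isomorphism types and orbits\<close>

lemma realizes_cong:
  assumes "realizes n R m d"
    and eq: "\<And>i j k. i < n \<Longrightarrow> j < n \<Longrightarrow> k < n \<Longrightarrow> m' i j k = m i j k \<and> d' k i j = d k i j"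
  shows "realizes n R m' d'"
proof -
  obtain R' a b where r: "pentagon_realization n R R' a b m d" using assms(1) by (auto simp: realizes_def)
  interpret pentagon_realization n R R' a b m d by (rule r)
  have "pentagon_realization n R R' a b m' d'"
  proof
    fix i j :: nat assume ij: "i < n" "j < n"
    have "(\<Sum>k<n. sc (d' k i j) (a k)) = (\<Sum>k<n. sc (d k i j) (a k))"
      by (rule sum.cong) (use eq ij in auto)
    then show "mm {..<n} (a i) (a j) = (\<Sum>k<n. sc (d' k i j) (a k))" using mult_a ij by simp
    have "(\<Sum>k<n. sc (m' i j k) (b k)) = (\<Sum>k<n. sc (m i j k) (b k))"
      by (rule sum.cong) (use eq ij in auto)
    then show "mm {..<n} (b i) (b j) = (\<Sum>k<n. sc (m' i j k) (b k))" using mult_b ij by simp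
  qed (simp_all add: indep_a indep_b R_sum[symmetric])
  then show ?thesis by (auto simp: realizes_def)
qed

text \<open>
For a fixed Hopf algebra, the solutions that realize its constants are the same for all bases.
\<close>

lemma realizes_any_basis:
  assumes 1: "hopf_coordinates H n e \<kappa>" and 2: "hopf_coordinates H n e' \<kappa>'"
    and r: "realizes n R (hopf_coordinates.m H e \<kappa>) (hopf_coordinates.d H e \<kappa>)"
  shows "realizes n R (hopf_coordinates.m H e' \<kappa>') (hopf_coordinates.d H e' \<kappa>')"
proof -
  have t: "two_bases H n e \<kappa> e' \<kappa>'" "two_bases H n e' \<kappa>' e \<kappa>"
    using 1 2 by (simp_all add: two_bases_def)
  obtain R' a b where "pentagon_realization n R R' a b (hopf_coordinates.m H e \<kappa>) (hopf_coordinates.d H e \<kappa>)"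
    using r by (auto simp: realizes_def)
  from pentagon_realization.basechange_realization[OF this two_bases.inverse_change[OF t(2)]
      two_bases.basechange_constants[OF t(1)]]
  show ?thesis unfolding realizes_def by blast
qed

text \<open>
The matrix that relates the two realizations of \<open>R\<close> defines a new basis of \<open>H\<close>. With respect to it \<open>H\<close> has the
structure constants of \<open>L\<close>, because in both algebras they are the coefficients of the products of the
same independent matrices.
\<close>

lemma isomorphic_of_common_realization:
  assumes H: "hopf_algebra H" "hopf_coordinates H n e \<kappa>"
    and L: "hopf_algebra L" "hopf_coordinates L n f \<mu>"
    and "realizes n R (hopf_coordinates.m H e \<kappa>) (hopf_coordinates.d H e \<kappa>)"
    and "realizes n R (hopf_coordinates.m L f \<mu>) (hopf_coordinates.d L f \<mu>)"
  shows "hopf_iso H L \<noteq> {}"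
proof -
  let ?m = "hopf_coordinates.m L f \<mu>" and ?d = "hopf_coordinates.d L f \<mu>"
  obtain R1 a b where 1: "pentagon_realization n R R1 a b (hopf_coordinates.m H e \<kappa>) (hopf_coordinates.d H e \<kappa>)"
    using assms(5) unfolding realizes_def by blast
  obtain R2 a' b' where 2: "pentagon_realization n R R2 a' b' ?m ?d"
    using assms(6) unfolding realizes_def by blast
  obtain Q P where QP: "\<And>i j. i < n \<Longrightarrow> j < n \<Longrightarrow> (\<Sum>l<n. Q i l * P l j) = (if i = j then 1 else 0)"
    and b': "\<And>i. i < n \<Longrightarrow> b' i = (\<Sum>j<n. sc (Q i j) (b j))"
    and a': "\<And>j. j < n \<Longrightarrow> a' j = (\<Sum>i<n. sc (P i j) (a i))"
    by (rule two_realizations[OF 1 2]) blast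
  have "coordinates H {..<n} e \<kappa>" using H(2) by (rule hopf_coordinates.axioms)
  from new_basis[OF this QP] obtain e' \<kappa>' where c: "coordinates H {..<n} e' \<kappa>'"
    and Q: "\<And>i j. i < n \<Longrightarrow> j < n \<Longrightarrow> \<kappa> (e' i) j = Q i j" by blast
  have H': "hopf_coordinates H n e' \<kappa>'"
    by (rule hopf_coordinatesI[OF hopf_algebra.axioms(1)[OF H(1)] c])
  let ?m' = "hopf_coordinates.m H e' \<kappa>'" and ?d' = "hopf_coordinates.d H e' \<kappa>'"
  have "two_bases H n e \<kappa> e' \<kappa>'" using H(2) H' by (simp add: two_bases_def)
  then have bc: "basechange n (\<lambda>i j. \<kappa> (e' i) j) (hopf_coordinates.m H e \<kappa>) (hopf_coordinates.d H e \<kappa>) ?m' ?d'"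
    by (rule two_bases.basechange_constants)
  have QP': "(\<Sum>l<n. \<kappa> (e' i) l * P l j) = (if i = j then 1 else 0)" if "i < n" "j < n" for i j
    using QP[OF that] that by (simp add: Q)
  let ?a = "\<lambda>j. \<Sum>i<n. sc (P i j) (a i)" and ?b = "\<lambda>i. \<Sum>j<n. sc (\<kappa> (e' i) j) (b j)"
  have 3: "pentagon_realization n R R1 ?a ?b ?m' ?d'"
    by (rule pentagon_realization.basechange_realization[OF 1 QP' bc])
  have a: "?a i = a' i" if "i < n" for i using a'[OF that] by simp
  have b: "?b i = b' i" if "i < n" for i using b'[OF that] that by (simp add: Q)
  have m: "?m' i j k = ?m i j k" if "i < n" "j < n" "k < n" for i j k
  proof (rule indep_sc[OF pentagon_realization.indep_b[OF 2] _ that(3)])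
    have "(\<Sum>k<n. sc (?m' i j k) (b' k)) = (\<Sum>k<n. sc (?m' i j k) (?b k))"
      by (rule sum.cong) (use b in auto)
    also have "\<dots> = mm {..<n} (b' i) (b' j)"
      unfolding b[OF that(1), symmetric] b[OF that(2), symmetric]
      by (rule pentagon_realization.mult_b[OF 3 that(1,2), symmetric])
    also have "\<dots> = (\<Sum>k<n. sc (?m i j k) (b' k))" by (rule pentagon_realization.mult_b[OF 2 that(1,2)])
    finally show "(\<Sum>k<n. sc (?m' i j k) (b' k)) = (\<Sum>k<n. sc (?m i j k) (b' k))" .
  qed
  have d: "?d' k i j = ?d k i j" if "i < n" "j < n" "k < n" for i j k
  proof (rule indep_sc[OF pentagon_realization.indep_a[OF 2] _ that(3)])
    have "(\<Sum>k<n. sc (?d' k i j) (a' k)) = (\<Sum>k<n. sc (?d' k i j) (?a k))"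
      by (rule sum.cong) (use a in auto)
    also have "\<dots> = mm {..<n} (a' i) (a' j)"
      unfolding a[OF that(1), symmetric] a[OF that(2), symmetric]
      by (rule pentagon_realization.mult_a[OF 3 that(1,2), symmetric])
    also have "\<dots> = (\<Sum>k<n. sc (?d k i j) (a' k))" by (rule pentagon_realization.mult_a[OF 2 that(1,2)])
    finally show "(\<Sum>k<n. sc (?d' k i j) (a' k)) = (\<Sum>k<n. sc (?d k i j) (a' k))" .
  qed
  show ?thesis by (rule iso_of_constants[OF H' H(1) L(2,1) m d])
qed

text \<open>
A relation whose fibres on one side are the classes of \<open>r\<close> and on the other side the sets \<open>orb y\<close> induces a
bijection between them. The function is \<open>C \<mapsto> {y. \<exists>x\<in>C. R x y}\<close>, so that no representatives have to be chosen.
\<close>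

lemma quotient_correspondence:
  assumes r: "r \<subseteq> X \<times> X"
    and total: "\<And>x. x \<in> X \<Longrightarrow> \<exists>y\<in>Y. R x y" and onto: "\<And>y. y \<in> Y \<Longrightarrow> \<exists>x\<in>X. R x y"
    and left: "\<And>x x' y. x \<in> X \<Longrightarrow> x' \<in> X \<Longrightarrow> y \<in> Y \<Longrightarrow> R x y \<Longrightarrow> (R x' y \<longleftrightarrow> (x, x') \<in> r)"
    and right: "\<And>x y. x \<in> X \<Longrightarrow> y \<in> Y \<Longrightarrow> R x y \<Longrightarrow> {y'\<in>Y. R x y'} = orb y"
  shows "\<exists>\<Phi>. bij_betw \<Phi> (X // r) {orb y | y. y \<in> Y}"
proof -
  define F where "F x = {y\<in>Y. R x y}" for x
  define \<Phi> where "\<Phi> C = \<Union> (F ` C)" for C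
  have cls: "r `` {x} = {x'\<in>X. R x' y}" if "x \<in> X" "y \<in> F x" for x y
    using r left[of x _ y] that by (auto simp: F_def)
  have F: "F x = orb y" if "x \<in> X" "y \<in> F x" for x y
    using right[of x y] that by (auto simp: F_def)
  have \<Phi>: "\<Phi> (r `` {x}) = F x" if x: "x \<in> X" for x
  proof -
    obtain y where y: "y \<in> F x" using total[OF x] by (auto simp: F_def)
    have "F x' = F x" if "x' \<in> r `` {x}" for x'
    proof -
      have x': "x' \<in> X" "y \<in> F x'" using that y unfolding cls[OF x y] by (auto simp: F_def)
      show ?thesis using F[OF x y] F[OF x'] by simp
    qed
    moreover have "x \<in> r `` {x}" using x y unfolding cls[OF x y] by (simp add: F_def)
    ultimately show ?thesis unfolding \<Phi>_def by blast
  qed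
  have "inj_on \<Phi> (X // r)"
  proof (rule inj_onI)
    fix C D assume "C \<in> X // r" "D \<in> X // r" and eq: "\<Phi> C = \<Phi> D"
    then obtain x x' where x: "x \<in> X" "C = r `` {x}" and x': "x' \<in> X" "D = r `` {x'}"
      by (auto elim!: quotientE)
    have FF: "F x = F x'" using eq \<Phi> x x' by simp
    obtain y where y: "y \<in> F x" using total[OF x(1)] by (auto simp: F_def)
    then show "C = D" using cls[OF x(1) y] cls[OF x'(1), of y] FF x x' by simp
  qed
  moreover have "\<Phi> ` (X // r) = {orb y | y. y \<in> Y}"
  proof (intro equalityI subsetI)
    fix Z assume "Z \<in> \<Phi> ` (X // r)"
    then obtain x where x: "x \<in> X" "Z = F x" using \<Phi> by (auto elim!: quotientE)
    obtain y where "y \<in> Y" "y \<in> F x" using total[OF x(1)] by (auto simp: F_def)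
    then show "Z \<in> {orb y | y. y \<in> Y}" using F[OF x(1)] x(2) by blast
  next
    fix Z assume "Z \<in> {orb y | y. y \<in> Y}"
    then obtain y where y: "y \<in> Y" "Z = orb y" by blast
    obtain x where x: "x \<in> X" "R x y" using onto[OF y(1)] by blast
    then have "Z = \<Phi> (r `` {x})" using \<Phi>[OF x(1)] F[OF x(1), of y] y by (simp add: F_def)
    then show "Z \<in> \<Phi> ` (X // r)" using x(1) by (auto intro: quotientI)
  qed
  ultimately show ?thesis unfolding bij_betw_def by blast
qed

context matrix_algebra
begin

definition encodes :: "('k, 'h) hopf \<Rightarrow> ('k mat, 'k mat, 'k) tens \<Rightarrow> bool" where
  "encodes H R \<longleftrightarrow> (\<exists>e \<kappa>. hopf_coordinates H n e \<kappa> \<and>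
     realizes n (op2 R) (hopf_coordinates.m H e \<kappa>) (hopf_coordinates.d H e \<kappa>))"

lemma every_hopf_encoded:
  assumes "H \<in> hopf_algs n"
  shows "\<exists>R\<in>Pent n. encodes (H :: ('k, 'h) hopf) R"
proof -
  have H: "hopf_algebra H" and dim: "vectorspace.fin_dim class_ring H" "vectorspace.dim class_ring H = n"
    using assms by (auto simp: hopf_algs_def)
  interpret hopf_algebra H by (rule H)
  interpret A: k_algebra H by (rule k_algebra)
  obtain e \<kappa> where "coordinates H {..<n} e \<kappa>" using coordinates_exist[OF A.vectorspace dim] by blast
  then have c: "hopf_coordinates H n e \<kappa>" by (rule hopf_coordinatesI[OF bialgebra_axioms])
  obtain s where s: "hopf_constants n (hopf_coordinates.m H e \<kappa>) (hopf_coordinates.d H e \<kappa>)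
      (hopf_coordinates.\<eta> H \<kappa>) (hopf_coordinates.\<epsilon> H e) s"
    using hopf_coordinates.hopf_imp_constants[OF c H] by blast
  have r: "realizes n (regular_solution n (hopf_coordinates.m H e \<kappa>) (hopf_coordinates.d H e \<kappa>))
      (hopf_coordinates.m H e \<kappa>) (hopf_coordinates.d H e \<kappa>)"
    by (rule hopf_constants.regular_realization[OF s pos])
  have "supp2 (regular_solution n (hopf_coordinates.m H e \<kappa>) (hopf_coordinates.d H e \<kappa>))"
    using r pentagon_solution.supp_R[OF pentagon_realization.axioms(1)] unfolding realizes_def by blast
  from op2_surj[OF this] obtain R where "R \<in> carrier MM"
    "op2 R = regular_solution n (hopf_coordinates.m H e \<kappa>) (hopf_coordinates.d H e \<kappa>)" by blast
  then have "R \<in> Pent n" "encodes H R" using r c unfolding Pent_iff encodes_def by metis+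
  then show ?thesis by blast
qed

text \<open>
This is where the type of the elements of Hopf algebras has to be large enough: the Hopf algebra with the
constants of \<open>R\<close> is built on the image of \<open>k\<^sup>n\<close>.
\<close>

lemma every_solution_encoded:
  assumes "inj_on (\<iota> :: 'k vec \<Rightarrow> 'h) (carrier_vec n)" and R: "R \<in> Pent n"
  shows "\<exists>H\<in>hopf_algs n. encodes (H :: ('k, 'h) hopf) R"
proof -
  obtain m d where r: "realizes n (op2 R) m d" using R Pent_iff by blast
  then obtain R' a b where "pentagon_realization n (op2 R) R' a b m d" by (auto simp: realizes_def)
  then obtain \<eta> \<epsilon> s where "hopf_constants n m d \<eta> \<epsilon> s"
    using pentagon_realization.hopf_constants_exist by blast
  then interpret hopf_construction n m d \<eta> \<epsilon> s \<iota>
    using assms(1) pos by (simp add: hopf_construction_def hopf_construction_axioms_def)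
  obtain H :: "('k, 'h) hopf" and e \<kappa> where c: "hopf_coordinates H n e \<kappa>" and H: "hopf_algebra H"
    and eq: "\<And>i j k. i < n \<Longrightarrow> j < n \<Longrightarrow> k < n \<Longrightarrow>
      hopf_coordinates.m H e \<kappa> i j k = m i j k \<and> hopf_coordinates.d H e \<kappa> k i j = d k i j"
    using exists_hopf by blast
  have "H \<in> hopf_algs n"
    using H coordinates.dimension[OF hopf_coordinates.axioms(1)[OF c]] by (simp add: hopf_algs_def)
  moreover have "encodes H R" unfolding encodes_def using c realizes_cong[OF r eq] by blast
  ultimately show ?thesis by blast
qed

lemma encoded_solutions_conjugate:
  assumes R: "R \<in> Pent n" and S: "S \<in> Pent n" and "encodes H R" "encodes H S"
  shows "S \<in> orbit (GL n) (conj_action n) R"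
proof -
  obtain e \<kappa> where c: "hopf_coordinates H n e \<kappa>"
    and r: "realizes n (op2 R) (hopf_coordinates.m H e \<kappa>) (hopf_coordinates.d H e \<kappa>)"
    using assms(3) unfolding encodes_def by blast
  obtain e' \<kappa>' where c': "hopf_coordinates H n e' \<kappa>'"
    and "realizes n (op2 S) (hopf_coordinates.m H e' \<kappa>') (hopf_coordinates.d H e' \<kappa>')"
    using assms(4) unfolding encodes_def by blast
  from realizes_any_basis[OF c' c this(2)] show ?thesis
    by (rule same_constants_same_orbit[OF R S r])
qed

lemma encodes_conj:
  assumes "encodes H R" "R \<in> Pent n" "S \<in> orbit (GL n) (conj_action n) R"
  shows "S \<in> Pent n" "encodes H S"
  using assms conj_in_Pent unfolding orbit_eq[OF assms(2)] encodes_def by blast+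

lemma encodes_iso_iff:
  assumes H: "H \<in> hopf_algs n" and L: "L \<in> hopf_algs n" and enc: "encodes H R"
  shows "encodes L R \<longleftrightarrow> hopf_iso H L \<noteq> {}"
proof -
  have hopf: "hopf_algebra H" "hopf_algebra L" using H L by (auto simp: hopf_algs_def)
  obtain e \<kappa> where c: "hopf_coordinates H n e \<kappa>"
    and r: "realizes n (op2 R) (hopf_coordinates.m H e \<kappa>) (hopf_coordinates.d H e \<kappa>)"
    using enc unfolding encodes_def by blast
  show ?thesis
  proof
    assume "encodes L R"
    then show "hopf_iso H L \<noteq> {}"
      using isomorphic_of_common_realization[OF hopf(1) c hopf(2) _ r] unfolding encodes_def by blast
  next
    assume "hopf_iso H L \<noteq> {}"
    then obtain f where "f \<in> hopf_iso H L" by blast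
    from constants_of_iso[OF c hopf(2) this] obtain e' \<kappa>' where c': "hopf_coordinates L n e' \<kappa>'"
      and eq: "\<And>i j k. i < n \<Longrightarrow> j < n \<Longrightarrow> k < n \<Longrightarrow>
          hopf_coordinates.m L e' \<kappa>' i j k = hopf_coordinates.m H e \<kappa> i j k"
        "\<And>i j k. i < n \<Longrightarrow> j < n \<Longrightarrow> k < n \<Longrightarrow>
          hopf_coordinates.d L e' \<kappa>' k i j = hopf_coordinates.d H e \<kappa> k i j"
      by metis
    have "realizes n (op2 R) (hopf_coordinates.m L e' \<kappa>') (hopf_coordinates.d L e' \<kappa>')"
      by (rule realizes_cong[OF r]) (simp add: eq)
    then show "encodes L R" unfolding encodes_def using c' by blast
  qed
qed

lemma hopf_types_orbits_bijection:
  assumes "inj_on (\<iota> :: 'k vec \<Rightarrow> 'h) (carrier_vec n)"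
  shows "\<exists>\<Phi> :: ('k, 'h) hopf set \<Rightarrow> ('k mat, 'k mat, 'k) tens set.
    bij_betw \<Phi> (hopf_types n) (orbits (GL n) (Pent n) (conj_action n))"
proof -
  have orbits: "orbits (GL n) (Pent n) (conj_action n)
    = {orbit (GL n) (conj_action n) (R :: ('k mat, 'k mat, 'k) tens) | R. R \<in> Pent n}"
    by (auto simp: orbits_def)
  show ?thesis
    unfolding hopf_types_def orbits
  proof (rule quotient_correspondence[where R = encodes])
    fix H :: "('k, 'h) hopf" and R
    assume "H \<in> hopf_algs n" "R \<in> Pent n" "encodes H R"
    then show "{S \<in> Pent n. encodes H S} = orbit (GL n) (conj_action n) R"
      using encoded_solutions_conjugate encodes_conj by blast
  next
    fix H L :: "('k, 'h) hopf" and R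
    assume "H \<in> hopf_algs n" "L \<in> hopf_algs n" "encodes H R"
    then show "encodes L R \<longleftrightarrow> (H, L) \<in> {(H, L). H \<in> hopf_algs n \<and> L \<in> hopf_algs n \<and> hopf_iso H L \<noteq> {}}"
      using encodes_iso_iff by simp
  qed (use every_hopf_encoded every_solution_encoded[OF assms] in auto)
qed

end

theorem theorem3p3:
  fixes n :: nat
  assumes "n > 0"
    and "\<exists>\<iota> :: 'k::field vec \<Rightarrow> 'h. inj_on \<iota> (carrier_vec n)"
  shows "group_action (GL n) (Pent n :: ('k mat, 'k mat, 'k) tens set) (conj_action n) \<and>
    (\<exists>\<Phi> :: ('k, 'h) hopf set \<Rightarrow> ('k mat, 'k mat, 'k) tens set.
       bij_betw \<Phi> (hopf_types n) (orbits (GL n) (Pent n) (conj_action n)))"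
proof -
  interpret matrix_algebra n "TYPE('k)" by unfold_locales (rule assms(1))
  obtain \<iota> :: "'k vec \<Rightarrow> 'h" where "inj_on \<iota> (carrier_vec n)" using assms(2) by blast
  then show ?thesis using conj_group_action hopf_types_orbits_bijection by blast
qed

end
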